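(* Let $d\ge2$, $1\le q\le p\le\infty$, $1\le\theta\le\infty$, and let $\boldsymbol r\in\mathbb R^d$ satisfy $0<r_1=\dots=r_\nu<r_{\nu+1}\le\dots\le r_d$ for some $1\le\nu\le d$. Then, for integers $M\ge2$, $$\varepsilon_M(B^{\boldsymbol r}_{p,\theta},B_{q,1})\asymp d_M(B^{\boldsymbol r}_{p,\theta},B_{q,1})\asymp\lambda_M(B^{\boldsymbol r}_{p,\theta},B_{q,1})\asymp M^{-r_1}(\log^{\nu-1}M)^{r_1+1-\frac1\theta}.$$
   Context: Functions are complex-valued, $2\pi$-periodic in each of $d$ variables; $\|\cdot\|_p$ is the $L_p(\mathbb T^d)$ norm with respect to $(2\pi)^{-d}d\boldsymbol x$ on $\mathbb T^d=[0,2\pi)^d$ (essential supremum for $p=\infty$). $L_p^0=\{f\in L_p(\mathbb T^d):\int_0^{2\pi}f(\boldsymbol x)\,dx_j=0\text{ a.e.},\ j=1,\dots,d\}$. $(\boldsymbol x,\boldsymbol y)=\sum_j x_jy_j$. $1/\theta:=0$ for $\theta=\infty$. $\log=\log_2$, and $\log^{\nu-1}M=(\log M)^{\nu-1}$ (equal to $1$ if $\nu=1$). Blocks. For $\boldsymbol s\in\mathbb N^d$ ($\mathbb N=\{1,2,\dots\}$), $\rho(\boldsymbol s)=\{\boldsymbol k\in\mathbb Z^d:2^{s_j-1}\le|k_j|<2^{s_j},\ j=1,\dots,d\}$ and $\delta_{\boldsymbol s}(f)=\sum_{\boldsymbol k\in\rho(\boldsymbol s)}\widehat f(\boldsymbol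 k)e^{i(\boldsymbol k,\boldsymbol x)}$, with $\widehat f(\boldsymbol k)=(2\pi)^{-d}\int_{\mathbb T^d}f(\boldsymbol t)e^{-i(\boldsymbol k,\boldsymbol t)}d\boldsymbol t$. De la Vallée-Poussin kernel: $V_l(t)=1+2\sum_{k=1}^l\cos kt+2\sum_{k=l+1}^{2l-1}\left(1-\frac{k-l}{l}\right)\cos kt$ (last sum is zero for $l=1$). Put $a_1=V_2-1$, $a_s=V_{2^s}-V_{2^{s-1}}$ for $s\ge2$, $A_{\boldsymbol s}(\boldsymbol x)=\prod_{j=1}^d a_{s_j}(x_j)$, and $A_{\boldsymbol s}(f)=f*A_{\boldsymbol s}$ (convolution with respect to $(2\pi)^{-d}d\boldsymbol x$). Class $B^{\boldsymbol r}_{p,\theta}$: the set of $f\in L_p^0$ with $\|f\|_{B^{\boldsymbol r}_{p,\theta}}\le1$, where $\|f\|_{B^{\boldsymbol r}_{p,\theta}}=\left(\sum_{\boldsymbol s\in\mathbb N^d}2^{(\boldsymbol s,\boldsymbol r)\theta}\|\beta_{\boldsymbol s}(f)\|_p^\theta\right)^{1/\theta}$ for $\theta<\infty$ and $\sup_{\boldsymbol s}2^{(\boldsymbol s,\boldsymbol r)}\|\beta_{\boldsymbol s}(f)\|_p$ for $\theta=\infty$, with $\beta_{\boldsymbol s}=\delta_{\boldsymbol s}$ if $1<p<\infty$ and $\beta_{\boldsymbol s}=A_{\boldsymbol s}$ if $p\in\{1,\infty\}$. Space $B_{q,1}$ ($1\le q\le\infty$): all $f\in L_q^0$ with $\|f\|_{B_{q,1}}:=\sum_{\boldsymbol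 s\in\mathbb N^d}\|A_{\boldsymbol s}(f)\|_q<\infty$. Widths and entropy numbers. For a set $W$ in a normed space $\mathscr Y$, with $L_M$ ranging over linear subspaces of $\mathscr Y$ of dimension at most $M$: Kolmogorov width $d_M(W,\mathscr Y)=\inf_{L_M}\sup_{w\in W}\inf_{u\in L_M}\|w-u\|_{\mathscr Y}$; linear width $\lambda_M(W,\mathscr Y)=\inf_{L_M,\Lambda}\sup_{w\in W}\|w-\Lambda w\|_{\mathscr Y}$, the infimum also being over all continuous linear $\Lambda:\mathscr Y\to L_M$; entropy number $\varepsilon_M(W,\mathscr Y)=\inf\{\varepsilon:\exists\,y^1,\dots,y^{2^M}\in\mathscr Y,\ W\subseteq\bigcup_{j=1}^{2^M}\{x\in\mathscr Y:\|x-y^j\|_{\mathscr Y}\le\varepsilon\}\}$. $a(M)\asymp b(M)$ means that there are constants $C_1,C_2>0$ independent of $M$ with $C_1a(M)\le b(M)\le C_2a(M)$ (the constants may depend on $d$ and all other fixed parameters). *)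

theory Defs
  imports "HOL-Probability.Probability" "HOL-Library.Function_Algebras"
begin

text \<open>
  A space of complex-valued functions is given by a carrier \<open>Y\<close> and a functional \<open>N\<close>
  on functions with values in \<open>[0, \<infinity>]\<close>, finite on \<open>Y\<close>. As usual for \<open>L\<^sub>p\<close>-type spaces, \<open>N\<close> is
  a norm only after identifying functions that agree almost everywhere. We work with
  representatives: subspaces of dimension at most \<open>M\<close> and continuous linear maps of the normed
  space of classes lift to representatives, and those of representatives induce such on classes, so
  that the quantities below are those of the normed space.
\<close>

definition cscale :: "complex \<Rightarrow> ('a \<Rightarrow> complex) \<Rightarrow> 'a \<Rightarrow> complex" where
  "cscale c f = (\<lambda>x. c * f x)"

interpretation cfun: vector_space "cscale :: complex \<Rightarrow> ('a \<Rightarrow> complex) \<Rightarrow> 'a \<Rightarrow> complex"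
  by unfold_locales (auto simp: cscale_def fun_eq_iff algebra_simps)

text \<open>
  The dimension is bounded through a finite basis, because \<open>cfun.dim\<close> is \<open>0\<close> on
  infinite-dimensional spaces.
\<close>

definition subspaces_upto :: "('a \<Rightarrow> complex) set \<Rightarrow> nat \<Rightarrow> ('a \<Rightarrow> complex) set set" where
  "subspaces_upto Y M =
     {L. L \<subseteq> Y \<and> (\<exists>B. cfun.independent B \<and> finite B \<and> card B \<le> M \<and> cfun.span B = L)}"

definition cont_linear_into ::
    "('a \<Rightarrow> complex) set \<Rightarrow> (('a \<Rightarrow> complex) \<Rightarrow> ennreal) \<Rightarrow> ('a \<Rightarrow> complex) set
       \<Rightarrow> (('a \<Rightarrow> complex) \<Rightarrow> 'a \<Rightarrow> complex) \<Rightarrow> bool" where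
  "cont_linear_into Y N L T \<longleftrightarrow>
     (\<forall>f\<in>Y. T f \<in> L) \<and>
     (\<forall>f\<in>Y. \<forall>g\<in>Y. T (f + g) = T f + T g) \<and>
     (\<forall>c. \<forall>f\<in>Y. T (cscale c f) = cscale c (T f)) \<and>
     (\<forall>f\<in>Y. \<forall>e>0. \<exists>\<delta>>0. \<forall>g\<in>Y. N (g - f) < \<delta> \<longrightarrow> N (T g - T f) < e)"

definition kolmogorov_width ::
    "nat \<Rightarrow> ('a \<Rightarrow> complex) set \<Rightarrow> ('a \<Rightarrow> complex) set \<Rightarrow> (('a \<Rightarrow> complex) \<Rightarrow> ennreal) \<Rightarrow> ennreal"
  where
  "kolmogorov_width M W Y N = (INF L\<in>subspaces_upto Y M. SUP w\<in>W. INF u\<in>L. N (w - u))"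

definition linear_width ::
    "nat \<Rightarrow> ('a \<Rightarrow> complex) set \<Rightarrow> ('a \<Rightarrow> complex) set \<Rightarrow> (('a \<Rightarrow> complex) \<Rightarrow> ennreal) \<Rightarrow> ennreal"
  where
  "linear_width M W Y N =
     (INF L\<in>subspaces_upto Y M. INF T\<in>{T. cont_linear_into Y N L T}. SUP w\<in>W. N (w - T w))"

definition entropy_number ::
    "nat \<Rightarrow> ('a \<Rightarrow> complex) set \<Rightarrow> ('a \<Rightarrow> complex) set \<Rightarrow> (('a \<Rightarrow> complex) \<Rightarrow> ennreal) \<Rightarrow> ennreal"
  where
  "entropy_number M W Y N =
     Inf {e. \<exists>y :: nat \<Rightarrow> 'a \<Rightarrow> complex. (\<forall>j\<in>{1..2 ^ M}. y j \<in> Y) \<and>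
               W \<subseteq> (\<Union>j\<in>{1..2 ^ M}. {f \<in> Y. N (f - y j) \<le> e})}"

text \<open>
  Points of \<open>\<real>\<^sup>d\<close> are functions on \<open>{1..d}\<close>, extended by \<open>undefined\<close>. The measure below is
  \<open>(2\<pi>)\<^sup>-\<^sup>d dx\<close> on \<open>[0, 2\<pi>)\<^sup>d\<close>, and all of its complement is a null set.
\<close>

definition torus :: "nat \<Rightarrow> (nat \<Rightarrow> real) measure" where
  "torus d = (\<Pi>\<^sub>M j\<in>{1..d}. uniform_measure lborel {0..<2 * pi})"

definition periodic :: "nat \<Rightarrow> ((nat \<Rightarrow> real) \<Rightarrow> complex) \<Rightarrow> bool" where
  "periodic d f \<longleftrightarrow> (\<forall>x. \<forall>j\<in>{1..d}. f (x(j := x j + 2 * pi)) = f x)"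

text \<open>Powers with positive exponent on \<open>[0, \<infinity>]\<close>.\<close>

definition enn_powr :: "ennreal \<Rightarrow> real \<Rightarrow> ennreal" where
  "enn_powr x a = (if x = \<infinity> then \<infinity> else ennreal (enn2real x powr a))"

definition Lp_norm :: "nat \<Rightarrow> ennreal \<Rightarrow> ((nat \<Rightarrow> real) \<Rightarrow> complex) \<Rightarrow> ennreal" where
  "Lp_norm d p f =
     (if p = \<infinity> then esssup (torus d) (\<lambda>x. ennreal (cmod (f x)))
      else enn_powr (\<integral>\<^sup>+ x. ennreal (cmod (f x) powr enn2real p) \<partial>torus d) (1 / enn2real p))"

definition Lp :: "nat \<Rightarrow> ennreal \<Rightarrow> ((nat \<Rightarrow> real) \<Rightarrow> complex) set" where
  "Lp d p = {f \<in> borel_measurable (torus d). periodic d f \<and> Lp_norm d p f < \<infinity>}"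

definition Lp0 :: "nat \<Rightarrow> ennreal \<Rightarrow> ((nat \<Rightarrow> real) \<Rightarrow> complex) set" where
  "Lp0 d p = {f \<in> Lp d p. \<forall>j\<in>{1..d}.
     AE x in torus d. set_lebesgue_integral lborel {0..<2 * pi} (\<lambda>t. f (x(j := t))) = 0}"

definition indices :: "nat \<Rightarrow> (nat \<Rightarrow> nat) set" where
  "indices d = {1..d} \<rightarrow>\<^sub>E {1..}"

definition rho :: "nat \<Rightarrow> (nat \<Rightarrow> nat) \<Rightarrow> (nat \<Rightarrow> int) set" where
  "rho d s = (\<Pi>\<^sub>E j\<in>{1..d}. {k. 2 ^ (s j - 1) \<le> \<bar>k\<bar> \<and> \<bar>k\<bar> < 2 ^ s j})"

definition character :: "nat \<Rightarrow> (nat \<Rightarrow> int) \<Rightarrow> (nat \<Rightarrow> real) \<Rightarrow> complex" where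
  "character d k x = exp (\<i> * complex_of_real (\<Sum>j=1..d. real_of_int (k j) * x j))"

definition fourier_coeff :: "nat \<Rightarrow> ((nat \<Rightarrow> real) \<Rightarrow> complex) \<Rightarrow> (nat \<Rightarrow> int) \<Rightarrow> complex" where
  "fourier_coeff d f k = (\<integral>t. f t * character d (\<lambda>j. - k j) t \<partial>torus d)"

definition delta_block ::
    "nat \<Rightarrow> (nat \<Rightarrow> nat) \<Rightarrow> ((nat \<Rightarrow> real) \<Rightarrow> complex) \<Rightarrow> (nat \<Rightarrow> real) \<Rightarrow> complex" where
  "delta_block d s f = (\<lambda>x. \<Sum>k\<in>rho d s. fourier_coeff d f k * character d k x)"

definition vallee_poussin :: "nat \<Rightarrow> real \<Rightarrow> real" where
  "vallee_poussin l t =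
     1 + 2 * (\<Sum>k=1..l. cos (real k * t))
       + 2 * (\<Sum>k=l+1..2*l-1. (1 - (real k - real l) / real l) * cos (real k * t))"

definition a_kernel :: "nat \<Rightarrow> real \<Rightarrow> real" where
  "a_kernel s t =
     (if s = 1 then vallee_poussin 2 t - 1
      else vallee_poussin (2 ^ s) t - vallee_poussin (2 ^ (s - 1)) t)"

definition A_kernel :: "nat \<Rightarrow> (nat \<Rightarrow> nat) \<Rightarrow> (nat \<Rightarrow> real) \<Rightarrow> real" where
  "A_kernel d s x = (\<Prod>j=1..d. a_kernel (s j) (x j))"

definition A_block ::
    "nat \<Rightarrow> (nat \<Rightarrow> nat) \<Rightarrow> ((nat \<Rightarrow> real) \<Rightarrow> complex) \<Rightarrow> (nat \<Rightarrow> real) \<Rightarrow> complex" where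
  "A_block d s f =
     (\<lambda>x. \<integral>y. f y * complex_of_real (A_kernel d s (\<lambda>j. x j - y j)) \<partial>torus d)"

definition beta_block ::
    "nat \<Rightarrow> ennreal \<Rightarrow> (nat \<Rightarrow> nat) \<Rightarrow> ((nat \<Rightarrow> real) \<Rightarrow> complex) \<Rightarrow> (nat \<Rightarrow> real) \<Rightarrow> complex" where
  "beta_block d p s f = (if 1 < p \<and> p < \<infinity> then delta_block d s f else A_block d s f)"

definition besov_norm ::
    "nat \<Rightarrow> (nat \<Rightarrow> real) \<Rightarrow> ennreal \<Rightarrow> ennreal \<Rightarrow> ((nat \<Rightarrow> real) \<Rightarrow> complex) \<Rightarrow> ennreal" where
  "besov_norm d r p \<theta> f =
     (if \<theta> = \<infinity> then
        (SUP s\<in>indices d. ennreal (2 powr (\<Sum>j=1..d. real (s j) * r j)) * Lp_norm d p (beta_block d p s f))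
      else
        enn_powr
          (\<Sum>\<^sub>\<infinity>s\<in>indices d.
             ennreal (2 powr ((\<Sum>j=1..d. real (s j) * r j) * enn2real \<theta>))
               * enn_powr (Lp_norm d p (beta_block d p s f)) (enn2real \<theta>))
          (1 / enn2real \<theta>))"

definition besov_class ::
    "nat \<Rightarrow> (nat \<Rightarrow> real) \<Rightarrow> ennreal \<Rightarrow> ennreal \<Rightarrow> ((nat \<Rightarrow> real) \<Rightarrow> complex) set" where
  "besov_class d r p \<theta> = {f \<in> Lp0 d p. besov_norm d r p \<theta> f \<le> 1}"

definition Bq1_norm :: "nat \<Rightarrow> ennreal \<Rightarrow> ((nat \<Rightarrow> real) \<Rightarrow> complex) \<Rightarrow> ennreal" where
  "Bq1_norm d q f = (\<Sum>\<^sub>\<infinity>s\<in>indices d. Lp_norm d q (A_block d s f))"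

definition Bq1 :: "nat \<Rightarrow> ennreal \<Rightarrow> ((nat \<Rightarrow> real) \<Rightarrow> complex) set" where
  "Bq1 d q = {f \<in> Lp0 d q. Bq1_norm d q f < \<infinity>}"

definition weakly_equiv :: "(nat \<Rightarrow> ennreal) \<Rightarrow> (nat \<Rightarrow> ennreal) \<Rightarrow> bool"  (infix "\<asymp>" 50) where
  "a \<asymp> b \<longleftrightarrow>
     (\<exists>C1>0. \<exists>C2>0. \<forall>M\<ge>2. ennreal C1 * a M \<le> b M \<and> b M \<le> ennreal C2 * a M)"

end

theory Submission
  imports Defs
begin

text \<open>
  Upper bounds: projecting onto the blocks of a hyperbolic cross whose weight function is slightly
  flattened in the directions \<open>j > \<nu>\<close> leaves a remainder whose block norms sum, by Hoelder's
  inequality over the layers of the cross, to the claimed rate. This bounds the linear widths, hence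
  the Kolmogorov widths, and Carl's inequality passes from these to the entropy numbers.

  Lower bounds: on a family of blocks \<open>s\<close> with even entries and fixed weight in the first \<open>\<nu>\<close>
  directions, the polynomials that interpolate unimodular data at dyadic nodes have uniformly bounded
  norm in each block. Evenness keeps the blocks from interacting, so the norm of the target space
  is bounded below by a sum over blocks, tested by duality against kernels with bounded convolution
  norm. Among \<open>n\<close> coordinates, any \<open>n / 2\<close> linear conditions admit a solution in the unit cube
  with half of its coordinates unimodular, which bounds the Kolmogorov widths, and a Hamming ball
  count of sign vectors bounds the entropy numbers.
\<close>

text \<open>Constants are immaterial, and the roles of Hoelder's and Young's inequalities are taken
  by one truncation, \<open>t \<le> l + t powr Q * l powr (1 - Q)\<close>, with the level
  \<open>l\<close> adapted to the data. The class uses sharp dyadic blocks for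
  \<open>1 < p < \<infinity>\<close>, the target always smooth ones. Smooth blocks overlap, so their
  sums are not projections; but neighbouring multipliers form a partition of unity, and
  \<open>A_s f\<close> is the sum of \<open>A_s (A_t f)\<close>, or of
  \<open>A_s (delta_t f)\<close>, over the neighbours \<open>t\<close> of \<open>s\<close>. Overlap
  costs powers of \<open>3 ^ d\<close>, and bounds for smooth blocks serve both kinds. In the lower
  bounds \<open>p\<close> and \<open>q\<close> disappear because the test functions are bounded in
  the supremum norm and the target is tested through L_1 norms. The target norm adds up the blocks,
  so its dual test objects form a cube over all blocks at once: with \<open>N\<close> blocks of
  equal size the class norm costs \<open>N powr (1 / \<theta>)\<close> and the pairing gains
  \<open>N\<close>, which is the origin of the exponent \<open>1 - 1 / \<theta>\<close>.\<close>

lemma enn_powr_le_iff: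
  assumes "0 < c" "0 \<le> a"
  shows "enn_powr x (1 / c) \<le> ennreal a \<longleftrightarrow> x \<le> ennreal (a powr c)"
proof (cases x)
  case (real t)
  have "t powr (1/c) \<le> a \<longleftrightarrow> t \<le> a powr c"
  proof
    assume "t powr (1/c) \<le> a"
    then have "(t powr (1/c)) powr c \<le> a powr c" using assms by (intro powr_mono2) auto
    then show "t \<le> a powr c" using assms real by (auto simp: powr_powr)
  next
    assume "t \<le> a powr c"
    then have "t powr (1/c) \<le> (a powr c) powr (1/c)" using assms real by (intro powr_mono2) auto
    then show "t powr (1/c) \<le> a" using assms real by (auto simp: powr_powr)
  qed
  then show ?thesis using real assms by (auto simp: enn_powr_def ennreal_le_iff2)
next
  case top
  then show ?thesis by (auto simp: enn_powr_def top_unique)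
qed

lemma enn_powr_ennreal: "0 \<le> t \<Longrightarrow> enn_powr (ennreal t) a = ennreal (t powr a)"
  by (auto simp: enn_powr_def)

text \<open>Only positive real majorants \<open>a\<close> of \<open>x\<close> have to be tested, so
  later proofs may divide by \<open>a\<close>. The slack \<open>e / C\<close> covers
  \<open>x = 0\<close>, and \<open>x = \<infinity>\<close> is trivial because \<open>C\<close> is
  positive.\<close>

lemma ennreal_le_multI:
  assumes "0 < C" and "\<And>a. 0 < a \<Longrightarrow> x \<le> ennreal a \<Longrightarrow> y \<le> ennreal (C * a)"
  shows "y \<le> ennreal C * x"
proof (cases x)
  case (real t)
  have "y \<le> ennreal (C * t) + ennreal e" if "0 < e" for e
  proof -
    have e: "0 < e / C" using assms(1) that by simp
    have "y \<le> ennreal (C * (t + e / C))"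
      unfolding real(2) by (intro assms(2)) (use e real in \<open>auto intro: ennreal_leI\<close>)
    also have "C * (t + e / C) = C * t + e" using assms(1) by (simp add: field_simps)
    finally show ?thesis using real assms(1) that by (subst ennreal_plus[symmetric]) auto
  qed
  then have "y \<le> ennreal (C * t)" by (rule ennreal_le_epsilon)
  then show ?thesis using real assms(1) by (simp add: ennreal_mult)
next
  case top
  then show ?thesis using assms(1) by (simp add: ennreal_mult_top)
qed

text \<open>The analogue for sums: both summands are replaced by positive real majorants, which then
  serve as normalising factors.\<close>

lemma ennreal_le_addI:
  assumes "\<And>a b. 0 < a \<Longrightarrow> 0 < b \<Longrightarrow> x \<le> ennreal a \<Longrightarrow> y \<le> ennreal b \<Longrightarrow> z \<le> ennreal (a + b)"
  shows "z \<le> x + y"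
proof (cases x; cases y)
  fix s t assume st: "x = ennreal s" "0 \<le> s" "y = ennreal t" "0 \<le> t"
  have "z \<le> ennreal (s + t) + ennreal e" if "0 < e" for e
  proof -
    have "z \<le> ennreal ((s + e/2) + (t + e/2))"
      using st that by (intro assms) (auto intro: ennreal_leI)
    also have "(s + e/2) + (t + e/2) = (s + t) + e" by simp
    finally show ?thesis using st that by (subst ennreal_plus[symmetric]) auto
  qed
  then have "z \<le> ennreal (s + t)" by (rule ennreal_le_epsilon)
  then show ?thesis using st by simp
qed auto

lemma ennreal_exponent_cases:
  assumes "1 \<le> (q::ennreal)"
  obtains "q = \<infinity>" | Q where "1 \<le> Q" "q = ennreal Q"
proof (cases q)
  case (real Q)
  then have "1 \<le> Q" using assms by (metis ennreal_1 ennreal_le_iff)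
  then show ?thesis using real that by blast
qed (use that in auto)

section \<open>Inequalities for the L_p norms on the torus\<close>

lemma Lp_norm_le_iff:
  assumes "1 \<le> Q" "0 \<le> a"
  shows "Lp_norm d (ennreal Q) f \<le> ennreal a \<longleftrightarrow>
     (\<integral>\<^sup>+ x. ennreal (cmod (f x) powr Q) \<partial>torus d) \<le> ennreal (a powr Q)"
  using assms enn_powr_le_iff[of Q a] by (simp add: Lp_norm_def)

lemma Lp_norm_inf_le_iff:
  assumes "f \<in> borel_measurable (torus d)" "0 \<le> a"
  shows "Lp_norm d \<infinity> f \<le> ennreal a \<longleftrightarrow> (AE x in torus d. cmod (f x) \<le> a)"
proof
  assume "Lp_norm d \<infinity> f \<le> ennreal a"
  then have *: "esssup (torus d) (\<lambda>x. ennreal (cmod (f x))) \<le> ennreal a" by (simp add: Lp_norm_def)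
  have "AE x in torus d. ennreal (cmod (f x)) \<le> esssup (torus d) (\<lambda>x. ennreal (cmod (f x)))"
    by (rule esssup_AE)
  then show "AE x in torus d. cmod (f x) \<le> a"
    by eventually_elim (use * assms in \<open>auto dest!: order_trans[OF _ *] simp: ennreal_le_iff\<close>)
next
  assume *: "AE x in torus d. cmod (f x) \<le> a"
  show "Lp_norm d \<infinity> f \<le> ennreal a"
    using assms * by (auto simp: Lp_norm_def intro!: esssup_I ennreal_leI elim!: eventually_mono)
qed

text \<open>Convexity of the power is applied on the open half-line, so a zero argument is
  separated. There the claim reduces to \<open>l powr Q \<le> l\<close> for
  \<open>l \<le> 1\<close>.\<close>

lemma powr_convex_combination:
  fixes u v l m Q :: real
  assumes "1 \<le> Q" "0 \<le> u" "0 \<le> v" "0 < l" "0 < m" "l + m = 1"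
  shows "(l * u + m * v) powr Q \<le> l * u powr Q + m * v powr Q"
proof -
  have contract: "(l * u) powr Q \<le> l * u powr Q" if "0 < l" "l \<le> 1" "0 \<le> u" for l u :: real
  proof -
    have "l powr Q \<le> l powr 1" using that assms(1) by (intro powr_mono') auto
    then have "l powr Q * u powr Q \<le> l * u powr Q" using that by (intro mult_right_mono) auto
    then show ?thesis using that by (simp only: powr_mult)
  qed
  show ?thesis
  proof (cases "u = 0 \<or> v = 0")
    case True
    moreover have "(l * u) powr Q \<le> l * u powr Q" "(m * v) powr Q \<le> m * v powr Q"
      using assms by (intro contract; simp)+
    moreover have "0 powr Q = 0" using assms by simp
    ultimately show ?thesis by (elim disjE) (simp_all)
  next
    case False
    then have uv: "u \<in> {0<..}" "v \<in> {0<..}" using assms by auto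
    have "((1 - m) *\<^sub>R u + m *\<^sub>R v) powr Q \<le> (1 - m) * u powr Q + m * v powr Q"
      using assms by (intro convex_onD[OF powr_convex[OF assms(1)] _ _ uv]) auto
    moreover have "1 - m = l" using assms by simp
    ultimately show ?thesis by simp
  qed
qed

text \<open>Minkowski's inequality by normalisation. If \<open>a\<close> and \<open>b\<close> bound
  the two norms, \<open>f + g\<close> is \<open>a + b\<close> times the convex combination of
  \<open>f / a\<close> and \<open>g / b\<close> with weights \<open>a / (a + b)\<close> and
  \<open>b / (a + b)\<close>; convexity of the power is applied pointwise and integrated.\<close>

lemma Lp_norm_triangle:
  assumes q: "1 \<le> q" and [measurable]: "f \<in> borel_measurable (torus d)" "g \<in> borel_measurable (torus d)"
  shows "Lp_norm d q (\<lambda>x. f x + g x) \<le> Lp_norm d q f + Lp_norm d q g"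
proof (rule ennreal_le_addI)
  fix a b :: real assume ab: "0 < a" "0 < b"
    and f: "Lp_norm d q f \<le> ennreal a" and g: "Lp_norm d q g \<le> ennreal b"
  from q show "Lp_norm d q (\<lambda>x. f x + g x) \<le> ennreal (a + b)"
  proof (cases rule: ennreal_exponent_cases)
    case 1
    have "AE x in torus d. cmod (f x) \<le> a" "AE x in torus d. cmod (g x) \<le> b"
      using f g ab 1 Lp_norm_inf_le_iff[of _ d] by auto
    then have "AE x in torus d. cmod (f x + g x) \<le> a + b"
      by eventually_elim (meson add_mono norm_triangle_ineq order_trans)
    then show ?thesis unfolding 1 using ab by (subst Lp_norm_inf_le_iff) auto
  next
    case (2 Q)
    let ?l = "a / (a + b)" and ?m = "b / (a + b)"
    have lm: "0 < ?l" "0 < ?m" "?l + ?m = 1"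
      using ab by (auto simp flip: add_divide_distrib)
    have "cmod (f x + g x) powr Q
        \<le> (a + b) powr Q * (?l / a powr Q) * cmod (f x) powr Q + (a + b) powr Q * (?m / b powr Q) * cmod (g x) powr Q" for x
    proof -
      have "cmod (f x + g x) powr Q \<le> (cmod (f x) + cmod (g x)) powr Q"
        using 2 by (intro powr_mono2 norm_triangle_ineq) auto
      also have "cmod (f x) + cmod (g x) = (a + b) * (?l * (cmod (f x) / a) + ?m * (cmod (g x) / b))"
      proof -
        have "(a + b) * (?l * u + ?m * v) = a * u + b * v" for u v
          using ab by (simp add: distrib_left)
        then have "(a + b) * (?l * (cmod (f x) / a) + ?m * (cmod (g x) / b)) = a * (cmod (f x) / a) + b * (cmod (g x) / b)" .
        also have "\<dots> = cmod (f x) + cmod (g x)" using ab by simp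
        finally show ?thesis by simp
      qed
      also have "\<dots> powr Q = (a + b) powr Q * (?l * (cmod (f x) / a) + ?m * (cmod (g x) / b)) powr Q"
        using ab by (subst powr_mult) auto
      also have "\<dots> \<le> (a + b) powr Q * (?l * (cmod (f x) / a) powr Q + ?m * (cmod (g x) / b) powr Q)"
        using ab lm 2 by (intro mult_left_mono powr_convex_combination) auto
      finally show ?thesis using ab by (simp add: powr_divide algebra_simps)
    qed
    then have "(\<integral>\<^sup>+ x. ennreal (cmod (f x + g x) powr Q) \<partial>torus d)
      \<le> (\<integral>\<^sup>+ x. ennreal ((a + b) powr Q * (?l / a powr Q)) * ennreal (cmod (f x) powr Q)
           + ennreal ((a + b) powr Q * (?m / b powr Q)) * ennreal (cmod (g x) powr Q) \<partial>torus d)"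
      using ab lm by (intro nn_integral_mono) (auto simp flip: ennreal_mult' ennreal_plus simp del: times_divide_eq_right times_divide_eq_left)
    also have "\<dots> = ennreal ((a + b) powr Q * (?l / a powr Q)) * (\<integral>\<^sup>+ x. ennreal (cmod (f x) powr Q) \<partial>torus d)
           + ennreal ((a + b) powr Q * (?m / b powr Q)) * (\<integral>\<^sup>+ x. ennreal (cmod (g x) powr Q) \<partial>torus d)"
      by (subst nn_integral_add) (auto simp: nn_integral_cmult)
    also have "\<dots> \<le> ennreal ((a + b) powr Q * (?l / a powr Q)) * ennreal (a powr Q)
           + ennreal ((a + b) powr Q * (?m / b powr Q)) * ennreal (b powr Q)"
      using f g ab 2 Lp_norm_le_iff[of Q _ d] by (intro add_mono mult_left_mono) auto
    also have "\<dots> = ennreal ((a + b) powr Q * (?l + ?m))"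
    proof -
      have *: "ennreal (K * (l / A)) * ennreal A + ennreal (K * (m / B)) * ennreal B = ennreal (K * (l + m))"
        if "A > 0" "B > 0" "K > 0" "l > 0" "m > 0" for K l m A B :: real
      proof -
        have "K * (l / A) * A = K * l" "K * (m / B) * B = K * m" using that by auto
        then have "ennreal (K * (l / A)) * ennreal A = ennreal (K * l)" "ennreal (K * (m / B)) * ennreal B = ennreal (K * m)"
          using that by (simp_all flip: ennreal_mult)
        then show ?thesis using that by (simp add: distrib_left)
      qed
      show ?thesis using ab lm by (intro *) auto
    qed
    also have "\<dots> = ennreal ((a + b) powr Q)" using lm by simp
    finally show ?thesis using ab 2 Lp_norm_le_iff[of Q "a + b" d] by auto
  qed
qed

lemma Lp_norm_cmult:
  assumes q: "1 \<le> q" and [measurable]: "f \<in> borel_measurable (torus d)"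
  shows "Lp_norm d q (\<lambda>x. c * f x) \<le> ennreal (cmod c) * Lp_norm d q f"
proof (cases "c = 0")
  case True
  from q have "Lp_norm d q (\<lambda>x. c * f x) \<le> ennreal 0"
  proof (cases rule: ennreal_exponent_cases)
    case 1
    show ?thesis unfolding 1 using True by (subst Lp_norm_inf_le_iff) auto
  next
    case (2 Q)
    show ?thesis unfolding 2 using True 2 by (subst Lp_norm_le_iff) auto
  qed
  then show ?thesis by simp
next
  case False
  show ?thesis
  proof (rule ennreal_le_multI)
    fix a :: real assume a: "0 < a" and f: "Lp_norm d q f \<le> ennreal a"
    from q show "Lp_norm d q (\<lambda>x. c * f x) \<le> ennreal (cmod c * a)"
    proof (cases rule: ennreal_exponent_cases)
      case 1
      have "AE x in torus d. cmod (f x) \<le> a" using f a 1 Lp_norm_inf_le_iff[of f d] by auto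
      then have "AE x in torus d. cmod (c * f x) \<le> cmod c * a"
        by eventually_elim (auto simp: norm_mult intro: mult_left_mono)
      then show ?thesis unfolding 1 using a by (subst Lp_norm_inf_le_iff) auto
    next
      case (2 Q)
      have "(\<integral>\<^sup>+ x. ennreal (cmod (c * f x) powr Q) \<partial>torus d)
          = ennreal (cmod c powr Q) * (\<integral>\<^sup>+ x. ennreal (cmod (f x) powr Q) \<partial>torus d)"
        by (simp add: norm_mult powr_mult ennreal_mult nn_integral_cmult)
      also have "\<dots> \<le> ennreal (cmod c powr Q) * ennreal (a powr Q)"
        using f a 2 Lp_norm_le_iff[of Q _ d] by (intro mult_left_mono) auto
      also have "\<dots> = ennreal ((cmod c * a) powr Q)"
        using a by (simp add: powr_mult ennreal_mult)
      finally show ?thesis using a 2 Lp_norm_le_iff[of Q "cmod c * a" d] by auto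
    qed
  qed (use False in auto)
qed

text \<open>The reverse inequality is the upper bound applied to multiplication by
  \<open>inverse c\<close>.\<close>

lemma Lp_norm_cmult_eq:
  assumes q: "1 \<le> q" and [measurable]: "f \<in> borel_measurable (torus d)"
  shows "Lp_norm d q (\<lambda>x. c * f x) = ennreal (cmod c) * Lp_norm d q f"
proof (cases "c = 0")
  case True
  then show ?thesis using Lp_norm_cmult[OF q assms(2), of c] by simp
next
  case False
  have "Lp_norm d q (\<lambda>x. inverse c * (c * f x)) \<le> ennreal (cmod (inverse c)) * Lp_norm d q (\<lambda>x. c * f x)"
    by (rule Lp_norm_cmult[OF q]) measurable
  then have "ennreal (cmod c) * Lp_norm d q f
      \<le> ennreal (cmod c) * (ennreal (cmod (inverse c)) * Lp_norm d q (\<lambda>x. c * f x))"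
    using False by (intro mult_left_mono) (auto simp flip: mult.assoc)
  also have "\<dots> = Lp_norm d q (\<lambda>x. c * f x)"
    using False by (simp add: norm_inverse flip: mult.assoc ennreal_mult)
  finally show ?thesis using Lp_norm_cmult[OF q assms(2), of c] by (intro antisym)
qed

lemma Lp_norm_zero: "1 \<le> q \<Longrightarrow> Lp_norm d q (\<lambda>x. 0) = 0"
  using Lp_norm_cmult_eq[of q "\<lambda>x. 0" d 0] by simp

lemma Lp_norm_sum:
  assumes q: "1 \<le> q" and "finite A" and m: "\<And>i. i \<in> A \<Longrightarrow> f i \<in> borel_measurable (torus d)"
  shows "Lp_norm d q (\<lambda>x. \<Sum>i\<in>A. f i x) \<le> (\<Sum>i\<in>A. Lp_norm d q (f i))"
  using assms(2) m
proof (induction A rule: finite_induct)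
  case empty
  then show ?case using q by (simp add: Lp_norm_zero)
next
  case (insert i A)
  have "Lp_norm d q (\<lambda>x. \<Sum>i\<in>insert i A. f i x) = Lp_norm d q (\<lambda>x. f i x + (\<Sum>i\<in>A. f i x))"
    using insert by simp
  also have "\<dots> \<le> Lp_norm d q (f i) + Lp_norm d q (\<lambda>x. \<Sum>i\<in>A. f i x)"
    using insert by (intro Lp_norm_triangle q) auto
  also have "\<dots> \<le> Lp_norm d q (f i) + (\<Sum>i\<in>A. Lp_norm d q (f i))"
    using insert by (intro add_mono) auto
  finally show ?case using insert by simp
qed

text \<open>Either \<open>t \<le> l\<close>, or \<open>t powr (1 - Q) \<le> l powr (1 - Q)\<close>
  because the exponent is nonpositive. The free level \<open>l\<close> is set by each application:
  to compare exponents, to bound convolutions and to sum over blocks.\<close>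

lemma le_truncation_plus_powr:
  fixes t l Q :: real
  assumes "1 \<le> Q" "0 \<le> t" "0 < l"
  shows "t \<le> l + t powr Q * l powr (1 - Q)"
proof (cases "t \<le> l")
  case False
  then have "t = t powr Q * t powr (1 - Q)" using assms by (simp flip: powr_add)
  also have "\<dots> \<le> t powr Q * l powr (1 - Q)"
    using False assms by (intro mult_left_mono powr_mono2') auto
  finally show ?thesis using assms by simp
next
  case True
  then show ?thesis by (simp add: add_increasing2)
qed

lemma prob_space_circle: "prob_space (uniform_measure lborel {0..<2 * pi})"
  by (intro prob_space_uniform_measure) auto

lemma product_sigma_finite_circle: "product_sigma_finite (\<lambda>j::nat. uniform_measure lborel {0..<2 * pi})"
  by (simp add: product_sigma_finite_def prob_space_circle prob_space_imp_sigma_finite)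

lemma prob_space_torus: "prob_space (torus d)"
  unfolding torus_def by (intro prob_space_PiM prob_space_circle)

text \<open>For finite \<open>p\<close> the power \<open>|f| powr Q\<close> is truncated at the
  level \<open>a powr Q\<close> with exponent \<open>P / Q\<close>. Both terms integrate to at most
  \<open>a powr Q\<close>, hence the factor 2.\<close>

lemma Lp_norm_mono_exponent:
  assumes q: "1 \<le> q" and qp: "q \<le> p" and [measurable]: "f \<in> borel_measurable (torus d)"
  shows "Lp_norm d q f \<le> 2 * Lp_norm d p f"
proof -
  interpret prob_space "torus d" by (rule prob_space_torus)
  have p: "1 \<le> p" using q qp by order
  have "Lp_norm d q f \<le> ennreal 2 * Lp_norm d p f"
  proof (rule ennreal_le_multI)
    fix a :: real assume a: "0 < a" and f: "Lp_norm d p f \<le> ennreal a"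
    show "Lp_norm d q f \<le> ennreal (2 * a)"
    proof (cases "q = \<infinity>")
      case True
      then have "p = \<infinity>" using qp by (simp add: top_unique)
      then have "Lp_norm d q f \<le> ennreal a" using f True by simp
      also have "\<dots> \<le> ennreal (2 * a)" using a by (intro ennreal_leI) auto
      finally show ?thesis .
    next
      case False
      then obtain Q where Q: "1 \<le> Q" "q = ennreal Q" using ennreal_exponent_cases[OF q] by metis
      have *: "(\<integral>\<^sup>+ x. ennreal (cmod (f x) powr Q) \<partial>torus d) \<le> ennreal (2 * a powr Q)"
        using p
      proof (cases rule: ennreal_exponent_cases)
        case 1
        have "AE x in torus d. cmod (f x) \<le> a" using f a 1 Lp_norm_inf_le_iff[of f d] by auto
        then have "(\<integral>\<^sup>+ x. ennreal (cmod (f x) powr Q) \<partial>torus d) \<le> (\<integral>\<^sup>+ x. ennreal (a powr Q) \<partial>torus d)"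
          using Q by (intro nn_integral_mono_AE) (auto elim!: eventually_mono intro!: ennreal_leI powr_mono2)
        also have "\<dots> = ennreal (a powr Q)" by (simp add: emeasure_space_1)
        also have "\<dots> \<le> ennreal (2 * a powr Q)" by (intro ennreal_leI) auto
        finally show ?thesis .
      next
        case (2 P)
        then have QP: "Q \<le> P" using Q qp by (simp add: ennreal_le_iff)
        have "cmod (f x) powr Q \<le> a powr Q + a powr (Q - P) * cmod (f x) powr P" for x
        proof -
          have "Q * (P / Q) = P" "Q * (1 - P / Q) = Q - P" using Q by (auto simp: field_simps)
          then show ?thesis
            using le_truncation_plus_powr[of "P / Q" "cmod (f x) powr Q" "a powr Q"] Q QP a
            by (simp add: powr_powr mult.commute)
        qed
        then have "(\<integral>\<^sup>+ x. ennreal (cmod (f x) powr Q) \<partial>torus d)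
            \<le> (\<integral>\<^sup>+ x. ennreal (a powr Q) + ennreal (a powr (Q - P)) * ennreal (cmod (f x) powr P) \<partial>torus d)"
          by (intro nn_integral_mono) (auto simp flip: ennreal_mult ennreal_plus)
        also have "\<dots> = ennreal (a powr Q) + ennreal (a powr (Q - P)) * (\<integral>\<^sup>+ x. ennreal (cmod (f x) powr P) \<partial>torus d)"
          by (subst nn_integral_add) (auto simp: nn_integral_cmult emeasure_space_1)
        also have "\<dots> \<le> ennreal (a powr Q) + ennreal (a powr (Q - P)) * ennreal (a powr P)"
          using f a 2 Lp_norm_le_iff[of P _ d] by (intro add_mono mult_left_mono) auto
        also have "\<dots> = ennreal (2 * a powr Q)"
          by (simp flip: ennreal_mult ennreal_plus powr_add)
        finally show ?thesis .
      qed
      also have "\<dots> \<le> ennreal ((2 * a) powr Q)"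
        using Q a powr_mono[of 1 Q 2] by (intro ennreal_leI) (simp add: powr_mult)
      finally show ?thesis using a Q Lp_norm_le_iff[of Q "2 * a" d] by auto
    qed
  qed simp
  then show ?thesis by simp
qed

lemma Lp_norm_1: "Lp_norm d 1 f = (\<integral>\<^sup>+ x. ennreal (cmod (f x)) \<partial>torus d)"
  by (cases "(\<integral>\<^sup>+ x. ennreal (cmod (f x)) \<partial>torus d)") (auto simp: Lp_norm_def enn_powr_def)

lemma Lp_integrable:
  assumes "1 \<le> q" "f \<in> Lp d q"
  shows "integrable (torus d) f"
proof (rule integrableI_bounded)
  show m: "f \<in> borel_measurable (torus d)" using assms by (auto simp: Lp_def)
  have "Lp_norm d 1 f \<le> 2 * Lp_norm d q f" using assms m by (intro Lp_norm_mono_exponent) auto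
  also have "\<dots> < \<infinity>" using assms by (auto simp: Lp_def ennreal_mult_less_top)
  finally show "(\<integral>\<^sup>+ x. ennreal (cmod (f x)) \<partial>torus d) < \<infinity>" by (simp add: Lp_norm_1)
qed

section \<open>Harmonics on the circle\<close>

abbreviation circle :: "real measure" where
  "circle \<equiv> uniform_measure lborel {0..<2 * pi}"

definition harmonic :: "int \<Rightarrow> real \<Rightarrow> complex" where
  "harmonic k t = cis (real_of_int k * t)"

lemma harmonic_0 [simp]: "harmonic 0 t = 1" "harmonic k 0 = 1"
  by (auto simp: harmonic_def)

lemma norm_harmonic [simp]: "cmod (harmonic k t) = 1"
  by (simp add: harmonic_def)

lemma harmonic_add: "harmonic (k + l) t = harmonic k t * harmonic l t"
  by (simp add: harmonic_def cis_mult distrib_right)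

lemma harmonic_diff_arg: "harmonic k (s - t) = harmonic k s * harmonic (- k) t"
  by (simp add: harmonic_def cis_mult algebra_simps)

lemma cnj_harmonic: "cnj (harmonic k t) = harmonic (- k) t"
  by (simp add: harmonic_def cis_cnj)

lemma harmonic_periodic: "harmonic k (t + 2 * pi) = harmonic k t"
proof -
  have "cis (real_of_int k * (t + 2 * pi)) = cis (real_of_int k * t) * cis (2 * pi * real_of_int k)"
    by (simp add: cis_mult algebra_simps)
  also have "cis (2 * pi * real_of_int k) = 1" by (rule cis_multiple_2pi) auto
  finally show ?thesis by (simp add: harmonic_def)
qed

lemma continuous_harmonic [continuous_intros]: "continuous_on A (harmonic k)"
  unfolding harmonic_def by (intro continuous_intros)

lemma measurable_harmonic [measurable]: "harmonic k \<in> borel_measurable borel"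
  by (intro borel_measurable_continuous_onI continuous_harmonic)

lemma set_integral_harmonic:
  assumes "k \<noteq> 0"
  shows "(LINT t:{0..<2 * pi}|lborel. harmonic k t) = 0"
proof -
  \<comment> \<open>The endpoint is a null set; the fundamental theorem of calculus is applied on
    the closed interval.\<close>
  have "(LINT t:{0..<2 * pi}|lborel. harmonic k t) = (LINT t:{0..2 * pi}|lborel. harmonic k t)"
    unfolding set_lebesgue_integral_def
  proof (intro integral_cong_AE)
    show "AE t in lborel. indicat_real {0..<2 * pi} t *\<^sub>R harmonic k t = indicat_real {0..2 * pi} t *\<^sub>R harmonic k t"
      using AE_lborel_singleton[of "2 * pi"] by eventually_elim (auto simp: indicator_def)
  qed auto
  also have "\<dots> = harmonic k (2 * pi) / (\<i> * of_int k) - harmonic k 0 / (\<i> * of_int k)"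
    unfolding set_lebesgue_integral_def
  proof (rule integral_FTC_atLeastAtMost)
    fix x :: real assume "0 \<le> x" "x \<le> 2 * pi"
    have eq: "harmonic k = (\<lambda>x. exp (x *\<^sub>R (\<i> * of_int k)))"
      by (simp add: fun_eq_iff harmonic_def cis_conv_exp scaleR_conv_of_real mult_ac)
    have "((\<lambda>x. exp (x *\<^sub>R (\<i> * of_int k)) / (\<i> * of_int k)) has_vector_derivative
           exp (x *\<^sub>R (\<i> * of_int k)) * (\<i> * of_int k) / (\<i> * of_int k)) (at x within {0..2 * pi})"
      by (intro has_vector_derivative_divide exp_scaleR_has_vector_derivative_right)
    then show "((\<lambda>x. harmonic k x / (\<i> * of_int k)) has_vector_derivative harmonic k x) (at x within {0..2 * pi})"
      unfolding eq using assms by simp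
  qed (auto intro: continuous_intros)
  also have "harmonic k (2 * pi) = 1" using harmonic_periodic[of k 0] by simp
  finally show ?thesis by simp
qed

lemma integral_circle:
  fixes f :: "real \<Rightarrow> complex"
  assumes [measurable]: "f \<in> borel_measurable borel"
  shows "integral\<^sup>L circle f = (LINT t:{0..<2 * pi}|lborel. f t) /\<^sub>R (2 * pi)"
proof -
  have "circle = density lborel (\<lambda>t. ennreal (indicat_real {0..<2 * pi} t / (2 * pi)))"
    unfolding uniform_measure_def
    by (intro density_cong) (auto simp: indicator_def divide_ennreal[symmetric])
  then have "integral\<^sup>L circle f = (\<integral>t. (indicat_real {0..<2 * pi} t / (2 * pi)) *\<^sub>R f t \<partial>lborel)"
    by (simp add: integral_density)
  also have "\<dots> = (\<integral>t. (1 / (2 * pi)) *\<^sub>R (indicat_real {0..<2 * pi} t *\<^sub>R f t) \<partial>lborel)"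
    by simp
  also have "\<dots> = (1 / (2 * pi)) *\<^sub>R (\<integral>t. indicat_real {0..<2 * pi} t *\<^sub>R f t \<partial>lborel)"
    by (rule integral_scaleR_right)
  finally show ?thesis by (simp add: set_lebesgue_integral_def inverse_eq_divide)
qed

lemma integral_circle_harmonic: "(\<integral>t. harmonic k t \<partial>circle) = (if k = 0 then 1 else 0)"
proof (cases "k = 0")
  case True
  interpret prob_space circle by (rule prob_space_circle)
  show ?thesis using True by (simp add: prob_space)
next
  case False
  then show ?thesis by (subst integral_circle) (auto simp: set_integral_harmonic)
qed

lemma integrable_circle_bounded:
  fixes f :: "real \<Rightarrow> complex"
  assumes [measurable]: "f \<in> borel_measurable borel" and "\<And>t. cmod (f t) \<le> B"
  shows "integrable circle f"
proof -
  interpret prob_space circle by (rule prob_space_circle)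
  show ?thesis using assms(2) by (intro integrable_const_bound[of _ B]) auto
qed

lemma integrable_circle_harmonic: "integrable circle (harmonic k)"
  by (rule integrable_circle_bounded[of _ 1]) auto

subsection \<open>Fejer and de la Vallee-Poussin kernels\<close>

text \<open>The normalised square of an exponential sum makes nonnegativity evident; the usual form
  with weights \<open>1 - k / m\<close> is derived in \<open>fejer_eq_cos\<close>.\<close>

definition fejer :: "nat \<Rightarrow> real \<Rightarrow> real" where
  "fejer m t = (cmod (\<Sum>k<m. harmonic (int k) t))\<^sup>2 / real m"

lemma fejer_nonneg: "0 \<le> fejer m t"
  by (simp add: fejer_def)

lemma fejer_1 [simp]: "fejer 1 t = 1" "fejer (Suc 0) t = 1"
  by (simp_all add: fejer_def)

lemma measurable_fejer [measurable]: "fejer m \<in> borel_measurable borel"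
  unfolding fejer_def by measurable

text \<open>Adding the \<open>m\<close>-th exponential contributes 1 and twice the real part of its
  products with the earlier ones, that is, the cosines of \<open>k * t\<close> for
  \<open>k = 1..m\<close>. Every weight \<open>m - k\<close> therefore grows by one.\<close>

lemma norm_sum_harmonic_power2:
  "(cmod (\<Sum>k<m. harmonic (int k) t))\<^sup>2 = real m + 2 * (\<Sum>k=1..m. (real m - real k) * cos (real k * t))"
proof (induction m)
  case (Suc m)
  let ?S = "\<Sum>k<m. harmonic (int k) t"
  have sq: "(cmod (z + w))\<^sup>2 = (cmod z)\<^sup>2 + (cmod w)\<^sup>2 + 2 * Re (z * cnj w)" for z w :: complex
    by (simp only: cmod_power2) (simp add: power2_eq_square algebra_simps)
  have "?S * cnj (harmonic (int m) t) = (\<Sum>k<m. harmonic (- int (m - k)) t)"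
    by (auto simp: sum_distrib_right cnj_harmonic of_nat_diff simp flip: harmonic_add intro!: sum.cong)
  also have "Re \<dots> = (\<Sum>k<m. cos (real (m - k) * t))"
    by (simp only: Re_sum cnj_harmonic[symmetric] complex_cnj_cnj cnj.sel) (simp only: harmonic_def cis.sel of_int_of_nat_eq)
  also have "\<dots> = (\<Sum>k=1..m. cos (real k * t))"
    by (intro sum.reindex_bij_witness[of _ "\<lambda>k. m - k" "\<lambda>k. m - k"]) auto
  finally have "(cmod (\<Sum>k<Suc m. harmonic (int k) t))\<^sup>2 = (cmod ?S)\<^sup>2 + 1 + 2 * (\<Sum>k=1..m. cos (real k * t))"
    by (simp add: sq)
  then show ?case using Suc by (simp add: algebra_simps sum.distrib sum_subtractf sum_distrib_left)
qed simp

lemma sum_symmetric_harmonic: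
  fixes c :: "int \<Rightarrow> real"
  assumes "\<And>k. c (- k) = c k"
  shows "(\<Sum>k\<in>{- int n..int n}. complex_of_real (c k) * harmonic k t)
     = complex_of_real (c 0 + 2 * (\<Sum>k=1..n. c (int k) * cos (real k * t)))"
proof (induction n)
  case (Suc n)
  have "{- int (Suc n)..int (Suc n)} = insert (int (Suc n)) (insert (- int (Suc n)) {- int n..int n})" by auto
  moreover have "harmonic (int (Suc n)) t + harmonic (- int (Suc n)) t = complex_of_real (2 * cos (real (Suc n) * t))"
    by (simp only: cnj_harmonic[symmetric] complex_add_cnj) (simp only: harmonic_def cis.sel of_int_of_nat_eq)
  moreover have "c (- int (Suc n)) = c (int (Suc n))" by (rule assms)
  ultimately have "(\<Sum>k\<in>{- int (Suc n)..int (Suc n)}. complex_of_real (c k) * harmonic k t)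
      = complex_of_real (c (int (Suc n))) * complex_of_real (2 * cos (real (Suc n) * t))
        + (\<Sum>k\<in>{- int n..int n}. complex_of_real (c k) * harmonic k t)"
    by (simp only:) (simp add: distrib_left[symmetric] del: of_nat_Suc)
  then show ?case using Suc by (simp add: distrib_left)
qed simp

lemma fejer_eq_cos:
  assumes "1 \<le> m"
  shows "fejer m t = 1 + 2 * (\<Sum>k=1..m. (1 - real k / real m) * cos (real k * t))"
proof -
  have "(\<Sum>k=1..m. (1 - real k / real m) * cos (real k * t)) = (\<Sum>k=1..m. (real m - real k) * cos (real k * t)) / real m"
    using assms by (auto simp: sum_divide_distrib field_simps intro!: sum.cong)
  then show ?thesis using assms by (simp add: fejer_def norm_sum_harmonic_power2 field_simps)
qed

text \<open>The cut-off at 0 extends the coefficients beyond the degree, so that kernels of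
  different degrees can be expanded over one common frequency range.\<close>

definition fejer_hat :: "nat \<Rightarrow> int \<Rightarrow> real" where
  "fejer_hat m k = max 0 (1 - \<bar>real_of_int k\<bar> / real m)"

lemma fejer_eq_harmonic:
  assumes "1 \<le> m" "m \<le> n"
  shows "complex_of_real (fejer m t) = (\<Sum>k\<in>{- int n..int n}. complex_of_real (fejer_hat m k) * harmonic k t)"
proof -
  have "(\<Sum>k=1..n. fejer_hat m (int k) * cos (real k * t)) = (\<Sum>k=1..m. fejer_hat m (int k) * cos (real k * t))"
    using assms by (intro sum.mono_neutral_right) (auto simp: fejer_hat_def field_simps)
  also have "\<dots> = (\<Sum>k=1..m. (1 - real k / real m) * cos (real k * t))"
    using assms by (intro sum.cong) (auto simp: fejer_hat_def field_simps)
  finally show ?thesis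
    using assms by (subst sum_symmetric_harmonic) (simp_all add: fejer_hat_def fejer_eq_cos)
qed

text \<open>For \<open>k \<le> l\<close> the coefficient on the right is
  \<open>2 * (1 - k / (2 * l)) - (1 - k / l) = 1\<close>, and for larger \<open>k\<close> it is
  \<open>2 - k / l\<close>. The kernel thereby becomes a combination of nonnegative kernels of mean
  one, from which its bounds are drawn.\<close>

lemma vallee_poussin_eq_fejer:
  assumes "1 \<le> l"
  shows "vallee_poussin l t = 2 * fejer (2 * l) t - fejer l t"
proof -
  have "(\<Sum>k=1..2*l. (1 - real k / real (2*l)) * cos (real k * t))
      = (\<Sum>k=1..l. (1 - real k / real (2*l)) * cos (real k * t)) + (\<Sum>k=l+1..2*l. (1 - real k / real (2*l)) * cos (real k * t))"
    unfolding mult_2 by (rule sum.ub_add_nat) (use assms in simp)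
  also have "(\<Sum>k=l+1..2*l. (1 - real k / real (2*l)) * cos (real k * t)) = (\<Sum>k=l+1..2*l-1. (1 - real k / real (2*l)) * cos (real k * t))"
    using assms by (intro sum.mono_neutral_right) auto
  finally have "2 * fejer (2 * l) t - fejer l t = 1 +
      2 * (2 * (\<Sum>k=1..l. (1 - real k / real (2*l)) * cos (real k * t)) - (\<Sum>k=1..l. (1 - real k / real l) * cos (real k * t)))
      + 2 * (2 * (\<Sum>k=l+1..2*l-1. (1 - real k / real (2*l)) * cos (real k * t)))"
    using assms by (simp add: fejer_eq_cos algebra_simps)
  also have "2 * (\<Sum>k=1..l. (1 - real k / real (2*l)) * cos (real k * t)) - (\<Sum>k=1..l. (1 - real k / real l) * cos (real k * t))
      = (\<Sum>k=1..l. cos (real k * t))"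
    using assms by (auto simp: sum_distrib_left algebra_simps simp flip: sum_subtractf intro!: sum.cong)
  also have "2 * (\<Sum>k=l+1..2*l-1. (1 - real k / real (2*l)) * cos (real k * t))
      = (\<Sum>k=l+1..2*l-1. (1 - (real k - real l) / real l) * cos (real k * t))"
    using assms by (auto simp: sum_distrib_left field_simps intro!: sum.cong)
  finally show ?thesis by (simp add: vallee_poussin_def)
qed

text \<open>The trapezoid that is 1 up to \<open>l\<close> and decreases linearly to 0 at
  \<open>2 * l\<close>.\<close>

definition vp_hat :: "nat \<Rightarrow> int \<Rightarrow> real" where
  "vp_hat l k = 2 * fejer_hat (2 * l) k - fejer_hat l k"

lemma vp_hat_eq_1: "1 \<le> l \<Longrightarrow> \<bar>k\<bar> \<le> int l \<Longrightarrow> vp_hat l k = 1"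
  by (auto simp: vp_hat_def fejer_hat_def field_simps max_def)

lemma vp_hat_eq_0: "1 \<le> l \<Longrightarrow> 2 * int l \<le> \<bar>k\<bar> \<Longrightarrow> vp_hat l k = 0"
  by (auto simp: vp_hat_def fejer_hat_def field_simps max_def)

lemma vallee_poussin_eq_harmonic:
  assumes "1 \<le> l" "2 * l \<le> n"
  shows "complex_of_real (vallee_poussin l t) = (\<Sum>k\<in>{- int n..int n}. complex_of_real (vp_hat l k) * harmonic k t)"
  using assms fejer_eq_harmonic[of l n t] fejer_eq_harmonic[of "2 * l" n t]
  by (simp add: vallee_poussin_eq_fejer vp_hat_def algebra_simps sum_subtractf sum_distrib_left)

text \<open>For \<open>s = 1\<close> the constant is subtracted, as in the kernel itself; the
  frequencies 1 and -1 thus belong to the first block.\<close>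

definition a_hat :: "nat \<Rightarrow> int \<Rightarrow> real" where
  "a_hat s k = vp_hat (2 ^ s) k - (if s = 1 then if k = 0 then 1 else 0 else vp_hat (2 ^ (s - 1)) k)"

lemma a_kernel_eq_harmonic:
  assumes "1 \<le> s"
  shows "complex_of_real (a_kernel s t) = (\<Sum>k\<in>{- (2 ^ (s + 1))..2 ^ (s + 1)}. complex_of_real (a_hat s k) * harmonic k t)"
proof (cases "s = 1")
  case True
  have "complex_of_real (vallee_poussin 2 t) = (\<Sum>k\<in>{-4..4}. complex_of_real (vp_hat 2 k) * harmonic k t)"
    using vallee_poussin_eq_harmonic[of 2 4 t] by simp
  moreover have "(\<Sum>k\<in>{-4..4}. (if k = (0::int) then 1 else 0) * harmonic k t) = 1"
    by (simp add: if_distrib[of "\<lambda>x. x * _"] sum.delta cong: if_cong)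
  ultimately show ?thesis using True
    by (simp add: a_kernel_def a_hat_def left_diff_distrib sum_subtractf if_distrib[of complex_of_real] cong: if_cong)
next
  case False
  have le: "2 * (2::nat) ^ (s - 1) \<le> 2 ^ (s + 1)" using assms by (cases s) auto
  have i: "(2::int) ^ (s + 1) = int (2 ^ (s + 1))" by simp
  have "complex_of_real (vallee_poussin (2 ^ s) t) = (\<Sum>k\<in>{- (2 ^ (s + 1))..2 ^ (s + 1)}. complex_of_real (vp_hat (2 ^ s) k) * harmonic k t)"
    "complex_of_real (vallee_poussin (2 ^ (s - 1)) t) = (\<Sum>k\<in>{- (2 ^ (s + 1))..2 ^ (s + 1)}. complex_of_real (vp_hat (2 ^ (s - 1)) k) * harmonic k t)"
    unfolding i by (intro vallee_poussin_eq_harmonic le; simp)+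
  then show ?thesis using False by (simp add: a_kernel_def a_hat_def algebra_simps sum_subtractf)
qed

text \<open>The two trapezoids agree on the inner plateau, and both vanish from
  \<open>2 ^ (s + 1)\<close> on. The lower bound is not strict because of the first block, whose
  multiplier is 1 at frequency 1.\<close>

lemma a_hat_support:
  assumes "1 \<le> s" "a_hat s k \<noteq> 0"
  shows "2 ^ (s - 1) \<le> \<bar>k\<bar>" "\<bar>k\<bar> < 2 ^ (s + 1)"
proof -
  have e: "2 ^ s = 2 * (2::int) ^ (s - 1)" using assms by (cases s) auto
  show "\<bar>k\<bar> < 2 ^ (s + 1)"
  proof (rule ccontr)
    assume "\<not> \<bar>k\<bar> < 2 ^ (s + 1)"
    then have "2 * int (2 ^ s) \<le> \<bar>k\<bar>" "2 * int (2 ^ (s - 1)) \<le> \<bar>k\<bar>" "k \<noteq> 0"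
      using e by auto
    then show False using assms vp_hat_eq_0[of "2 ^ s" k] vp_hat_eq_0[of "2 ^ (s - 1)" k]
      by (auto simp: a_hat_def split: if_splits)
  qed
  show "2 ^ (s - 1) \<le> \<bar>k\<bar>"
  proof (rule ccontr)
    assume "\<not> 2 ^ (s - 1) \<le> \<bar>k\<bar>"
    then have "\<bar>k\<bar> \<le> int (2 ^ s)" "\<bar>k\<bar> \<le> int (2 ^ (s - 1))" "s = 1 \<Longrightarrow> k = 0"
      using e by auto
    then show False using assms vp_hat_eq_1[of "2 ^ s" k] vp_hat_eq_1[of "2 ^ (s - 1)" k]
      by (auto simp: a_hat_def split: if_splits)
  qed
qed

lemma sum_a_hat_telescope:
  assumes "1 \<le> a" "a \<le> b"
  shows "(\<Sum>s=a..b. a_hat s k) = vp_hat (2 ^ b) k - (if a = 1 then if k = 0 then 1 else 0 else vp_hat (2 ^ (a - 1)) k)"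
  using assms(2)
proof (induction b rule: dec_induct)
  case base
  then show ?case by (simp add: a_hat_def)
next
  case (step b)
  then show ?case using assms by (simp add: a_hat_def)
qed

text \<open>The blocks telescope to a difference of two multipliers. On the support of
  \<open>a_hat s\<close> the outer trapezoid, at \<open>2 ^ (s + 1)\<close>, equals 1; the inner
  one, at \<open>2 ^ (s - 2)\<close>, equals 0, as does the constant term that replaces it when the
  range starts at 1.\<close>

lemma sum_a_hat_neighbours:
  assumes "1 \<le> s" "a_hat s k \<noteq> 0"
  shows "(\<Sum>t=max 1 (s - 1)..s + 1. a_hat t k) = 1"
proof -
  have "vp_hat (2 ^ (s + 1)) k = 1" using a_hat_support[OF assms] by (intro vp_hat_eq_1) auto
  moreover have "vp_hat (2 ^ (s - 2)) k = 0" if "3 \<le> s"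
  proof -
    have "2 ^ (s - 1) = 2 * (2::int) ^ (s - 2)" using that by (simp add: numeral_eq_Suc flip: power_Suc Suc_diff_Suc)
    then show ?thesis using a_hat_support[OF assms] by (intro vp_hat_eq_0) auto
  qed
  moreover have "k \<noteq> 0" using a_hat_support[OF assms] by auto
  moreover have "max 1 (s - 1) - 1 = s - 2" by auto
  ultimately show ?thesis using assms by (subst sum_a_hat_telescope) (auto simp: max_def)
qed

section \<open>Integrals and majorants of the kernels\<close>

lemma integral_fejer:
  assumes "1 \<le> m"
  shows "(\<integral>y. complex_of_real (fejer m (x - y)) \<partial>circle) = 1"
proof -
  have "(\<integral>y. complex_of_real (fejer m (x - y)) \<partial>circle)
      = (\<Sum>k\<in>{- int m..int m}. complex_of_real (fejer_hat m k) * harmonic k x * (\<integral>y. harmonic (- k) y \<partial>circle))"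
    using assms integrable_circle_harmonic
    by (simp add: fejer_eq_harmonic[OF _ order_refl] harmonic_diff_arg mult.assoc[symmetric])
  also have "\<dots> = (\<Sum>k\<in>{- int m..int m}. if k = 0 then 1 else 0)"
    by (intro sum.cong) (auto simp: integral_circle_harmonic fejer_hat_def)
  finally show ?thesis by simp
qed

lemma nn_integral_fejer:
  assumes "1 \<le> m"
  shows "(\<integral>\<^sup>+ y. ennreal (fejer m (x - y)) \<partial>circle) = 1"
proof -
  have bd: "fejer m t \<le> real m" for t
  proof -
    have "cmod (\<Sum>k<m. harmonic (int k) t) \<le> real m"
      by (rule order_trans[OF norm_sum]) simp
    then have "(cmod (\<Sum>k<m. harmonic (int k) t))\<^sup>2 \<le> (real m)\<^sup>2" by (intro power_mono) auto
    then show ?thesis using assms by (simp add: fejer_def power2_eq_square field_simps)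
  qed
  interpret prob_space circle by (rule prob_space_circle)
  have "integrable circle (\<lambda>y. fejer m (x - y))"
    using bd fejer_nonneg by (intro integrable_const_bound[of _ "real m"]) auto
  then have "(\<integral>\<^sup>+ y. ennreal (fejer m (x - y)) \<partial>circle) = ennreal (\<integral>y. fejer m (x - y) \<partial>circle)"
    using fejer_nonneg by (intro nn_integral_eq_integral) auto
  moreover have "complex_of_real (\<integral>y. fejer m (x - y) \<partial>circle) = 1"
    using integral_fejer[OF assms, of x] by simp
  ultimately show ?thesis by (simp add: of_real_eq_1_iff)
qed

lemma fejer_minus: "fejer m (- t) = fejer m t"
proof -
  have "harmonic (int k) (- t) = cnj (harmonic (int k) t)" for k
    by (simp add: harmonic_def cis_cnj)
  then have "(\<Sum>k<m. harmonic (int k) (- t)) = cnj (\<Sum>k<m. harmonic (int k) t)" by simp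
  then show ?thesis by (simp only: fejer_def complex_mod_cnj)
qed

text \<open>With F_m the Fejer kernel, the kernel for \<open>s \<ge> 2\<close> is
  \<open>2 F_(2^(s+1)) - 3 F_(2^s) + F_(2^(s-1))\<close>, and the majorant drops the signs. For
  \<open>s = 1\<close> it dominates \<open>2 F_4 - F_2 - 1\<close> because F_1 is 1. Its integral is
  \<open>2 + 3 + 1 = 6\<close>, the origin of the factors \<open>6 ^ d\<close>.\<close>

definition a_majorant :: "nat \<Rightarrow> real \<Rightarrow> real" where
  "a_majorant s t = 2 * fejer (2 * 2 ^ s) t + 3 * fejer (2 ^ s) t + fejer (2 ^ (s - 1)) t"

lemma a_majorant_nonneg: "0 \<le> a_majorant s t"
  by (simp add: a_majorant_def fejer_nonneg)

lemma measurable_a_majorant [measurable]: "a_majorant s \<in> borel_measurable borel"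
  unfolding a_majorant_def by measurable

lemma abs_a_kernel_le:
  assumes "1 \<le> s"
  shows "\<bar>a_kernel s t\<bar> \<le> a_majorant s t"
proof (cases "s = 1")
  case True
  then show ?thesis using fejer_nonneg[of 4 t] fejer_nonneg[of 2 t]
    by (simp add: a_kernel_def a_majorant_def vallee_poussin_eq_fejer)
next
  case False
  have e: "2 * 2 ^ (s - 1) = (2::nat) ^ s" using assms by (cases s) auto
  have "vallee_poussin (2 ^ (s - 1)) t = 2 * fejer (2 ^ s) t - fejer (2 ^ (s - 1)) t"
    by (subst vallee_poussin_eq_fejer) (simp_all only: e one_le_power one_le_numeral)
  then have "a_kernel s t = 2 * fejer (2 * 2 ^ s) t - fejer (2 ^ s) t - (2 * fejer (2 ^ s) t - fejer (2 ^ (s - 1)) t)"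
    using False by (simp add: a_kernel_def vallee_poussin_eq_fejer)
  then show ?thesis
    using fejer_nonneg[of "2 * 2 ^ s" t] fejer_nonneg[of "2 ^ s" t] fejer_nonneg[of "2 ^ (s - 1)" t]
    unfolding a_majorant_def by linarith
qed

lemma nn_integral_a_majorant:
  "(\<integral>\<^sup>+ y. ennreal (a_majorant s (x - y)) \<partial>circle) = 6" "(\<integral>\<^sup>+ x. ennreal (a_majorant s (x - y)) \<partial>circle) = 6"
proof -
  show *: "(\<integral>\<^sup>+ y. ennreal (a_majorant s (x - y)) \<partial>circle) = 6" for x
    by (simp add: a_majorant_def fejer_nonneg ennreal_plus ennreal_mult nn_integral_add nn_integral_cmult nn_integral_fejer)
  have "a_majorant s (x - y) = a_majorant s (y - x)" for x
    using fejer_minus[of _ "y - x"] by (simp add: a_majorant_def)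
  then show "(\<integral>\<^sup>+ x. ennreal (a_majorant s (x - y)) \<partial>circle) = 6" using *[of y] by simp
qed

subsection \<open>Convolution blocks as Fourier multipliers\<close>

abbreviation freqs :: "nat \<Rightarrow> (nat \<Rightarrow> int) set" where
  "freqs d \<equiv> {1..d} \<rightarrow>\<^sub>E UNIV"

lemma measurable_torus_component:
  "j \<in> {1..d} \<Longrightarrow> (\<lambda>x. x j) \<in> borel_measurable (torus d)"
  unfolding torus_def by (subst measurable_cong_sets[OF refl sets_uniform_measure[symmetric]])
    (auto intro: measurable_component_singleton)

lemma nn_integral_torus_prod:
  assumes "\<And>j. j \<in> {1..d} \<Longrightarrow> g j \<in> borel_measurable borel"
  shows "(\<integral>\<^sup>+ x. (\<Prod>j\<in>{1..d}. g j (x j)) \<partial>torus d) = (\<Prod>j\<in>{1..d}. \<integral>\<^sup>+ t. g j t \<partial>circle)"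
proof -
  interpret product_sigma_finite "\<lambda>j::nat. circle" by (rule product_sigma_finite_circle)
  show ?thesis unfolding torus_def
    using assms by (intro product_nn_integral_prod) auto
qed

lemma integral_torus_prod:
  fixes g :: "nat \<Rightarrow> real \<Rightarrow> complex"
  assumes "\<And>j. j \<in> {1..d} \<Longrightarrow> integrable circle (g j)"
  shows "(\<integral>x. (\<Prod>j\<in>{1..d}. g j (x j)) \<partial>torus d) = (\<Prod>j\<in>{1..d}. \<integral>t. g j t \<partial>circle)"
    and "integrable (torus d) (\<lambda>x. \<Prod>j\<in>{1..d}. g j (x j))"
proof -
  interpret product_sigma_finite "\<lambda>j::nat. circle" by (rule product_sigma_finite_circle)
  show "(\<integral>x. (\<Prod>j\<in>{1..d}. g j (x j)) \<partial>torus d) = (\<Prod>j\<in>{1..d}. \<integral>t. g j t \<partial>circle)"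
    unfolding torus_def using assms by (intro product_integral_prod) auto
  show "integrable (torus d) (\<lambda>x. \<Prod>j\<in>{1..d}. g j (x j))"
    unfolding torus_def using assms by (intro product_integrable_prod) auto
qed

lemma character_eq_prod: "character d k x = (\<Prod>j\<in>{1..d}. harmonic (k j) (x j))"
proof -
  have "character d k x = exp (\<Sum>j=1..d. \<i> * of_real (real_of_int (k j) * x j))"
    by (simp add: character_def sum_distrib_left)
  also have "\<dots> = (\<Prod>j\<in>{1..d}. exp (\<i> * of_real (real_of_int (k j) * x j)))"
    by (rule exp_sum) simp
  finally show ?thesis by (simp add: harmonic_def cis_conv_exp)
qed

lemma norm_character [simp]: "cmod (character d k x) = 1"
  by (simp add: character_eq_prod prod_norm[symmetric])

lemma character_mult: "character d k x * character d l x = character d (\<lambda>j. k j + l j) x"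
  by (simp add: character_eq_prod harmonic_add prod.distrib)

lemma cnj_character: "cnj (character d k x) = character d (\<lambda>j. - k j) x"
  by (simp add: character_eq_prod cnj_harmonic)

lemma character_diff_arg:
  "character d k (\<lambda>j. x j - y j) = character d k x * character d (\<lambda>j. - k j) y"
  by (simp add: character_eq_prod harmonic_diff_arg prod.distrib)

lemma measurable_character [measurable]: "character d k \<in> borel_measurable (torus d)"
proof -
  have "(\<lambda>x. harmonic (k j) (x j)) \<in> borel_measurable (torus d)" if "j \<in> {1..d}" for j
    using measurable_compose[OF measurable_torus_component[OF that] measurable_harmonic] .
  then have "(\<lambda>x. \<Prod>j\<in>{1..d}. harmonic (k j) (x j)) \<in> borel_measurable (torus d)"
    by (rule borel_measurable_prod)
  then show ?thesis by (simp add: character_eq_prod[abs_def])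
qed

lemma integral_character:
  "(\<integral>x. character d k x \<partial>torus d) = (if \<forall>j\<in>{1..d}. k j = 0 then 1 else 0)"
proof -
  have "(\<integral>x. character d k x \<partial>torus d) = (\<Prod>j\<in>{1..d}. \<integral>t. harmonic (k j) t \<partial>circle)"
    unfolding character_eq_prod by (intro integral_torus_prod integrable_circle_harmonic)
  then show ?thesis by (auto simp: integral_circle_harmonic)
qed

lemma integrable_mult_character:
  assumes "integrable (torus d) f"
  shows "integrable (torus d) (\<lambda>x. f x * character d k x)"
proof (rule Bochner_Integration.integrable_bound[OF assms])
  show "(\<lambda>x. f x * character d k x) \<in> borel_measurable (torus d)"
    using assms by measurable
qed (simp add: norm_mult)

lemma integrable_character: "integrable (torus d) (character d k)"
proof -
  interpret prob_space "torus d" by (rule prob_space_torus)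
  show ?thesis by (intro integrable_const_bound[of _ 1]) auto
qed

lemma fourier_coeff_add:
  assumes "integrable (torus d) f" "integrable (torus d) g"
  shows "fourier_coeff d (\<lambda>x. f x + g x) k = fourier_coeff d f k + fourier_coeff d g k"
  using assms by (simp add: fourier_coeff_def distrib_right integrable_mult_character)

lemma fourier_coeff_cmult:
  shows "fourier_coeff d (\<lambda>x. c * f x) k = c * fourier_coeff d f k"
  by (simp add: fourier_coeff_def mult.assoc)

lemma fourier_coeff_diff:
  assumes "integrable (torus d) f" "integrable (torus d) g"
  shows "fourier_coeff d (\<lambda>x. f x - g x) k = fourier_coeff d f k - fourier_coeff d g k"
  using assms by (simp add: fourier_coeff_def left_diff_distrib integrable_mult_character)

lemma fourier_coeff_sum:
  assumes "\<And>i. i \<in> A \<Longrightarrow> integrable (torus d) (f i)"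
  shows "fourier_coeff d (\<lambda>x. \<Sum>i\<in>A. f i x) k = (\<Sum>i\<in>A. fourier_coeff d (f i) k)"
  using assms by (simp add: fourier_coeff_def sum_distrib_right integrable_mult_character)

lemma fourier_coeff_character:
  assumes "k \<in> freqs d" "l \<in> freqs d"
  shows "fourier_coeff d (character d l) k = (if l = k then 1 else 0)"
proof -
  have "fourier_coeff d (character d l) k = (if \<forall>j\<in>{1..d}. l j = k j then 1 else 0)"
    by (simp add: fourier_coeff_def character_mult integral_character)
  also have "(\<forall>j\<in>{1..d}. l j = k j) \<longleftrightarrow> l = k" using assms by (auto intro: PiE_ext)
  finally show ?thesis .
qed

definition trig_poly :: "nat \<Rightarrow> (nat \<Rightarrow> int) set \<Rightarrow> ((nat \<Rightarrow> int) \<Rightarrow> complex) \<Rightarrow> (nat \<Rightarrow> real) \<Rightarrow> complex" where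
  "trig_poly d K c x = (\<Sum>k\<in>K. c k * character d k x)"

lemma measurable_trig_poly [measurable]: "trig_poly d K c \<in> borel_measurable (torus d)"
  unfolding trig_poly_def[abs_def] by measurable

lemma integrable_trig_poly: "integrable (torus d) (trig_poly d K c)"
  unfolding trig_poly_def[abs_def]
  by (intro Bochner_Integration.integrable_sum integrable_mult_right integrable_character)

lemma norm_trig_poly_le: "cmod (trig_poly d K c x) \<le> (\<Sum>k\<in>K. cmod (c k))"
  unfolding trig_poly_def by (rule order_trans[OF norm_sum]) (simp add: norm_mult)

lemma fourier_coeff_trig_poly:
  assumes "finite K" "K \<subseteq> freqs d" "k \<in> freqs d"
  shows "fourier_coeff d (trig_poly d K c) k = (if k \<in> K then c k else 0)"
proof -
  have "fourier_coeff d (trig_poly d K c) k = (\<Sum>l\<in>K. fourier_coeff d (\<lambda>x. c l * character d l x) k)"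
    unfolding trig_poly_def[abs_def]
    by (intro fourier_coeff_sum integrable_mult_right integrable_character)
  also have "\<dots> = (\<Sum>l\<in>K. if l = k then c k else 0)"
    using assms by (intro sum.cong) (auto simp: fourier_coeff_cmult fourier_coeff_character subset_iff)
  finally show ?thesis using assms by simp
qed

lemma trig_poly_mono_neutral:
  assumes "finite L" "K \<subseteq> L" "\<And>k. k \<in> L - K \<Longrightarrow> c k = 0"
  shows "trig_poly d K c = trig_poly d L c"
  unfolding trig_poly_def using assms by (intro ext sum.mono_neutral_left) auto

lemma trig_poly_cong: "(\<And>k. k \<in> K \<Longrightarrow> c k = c' k) \<Longrightarrow> trig_poly d K c = trig_poly d K c'"
  unfolding trig_poly_def by (intro ext sum.cong) auto

lemma trig_poly_add: "trig_poly d K c x + trig_poly d K c' x = trig_poly d K (\<lambda>k. c k + c' k) x"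
  by (simp add: trig_poly_def distrib_right sum.distrib)

lemma trig_poly_sum: "(\<Sum>i\<in>A. trig_poly d K (c i) x) = trig_poly d K (\<lambda>k. \<Sum>i\<in>A. c i k) x"
  unfolding trig_poly_def by (simp add: sum_distrib_right) (rule sum.swap)

text \<open>A box containing the support of the multiplier: its product structure lets the tensor
  kernel be expanded into a sum over frequency vectors.\<close>

definition block_freqs :: "nat \<Rightarrow> (nat \<Rightarrow> nat) \<Rightarrow> (nat \<Rightarrow> int) set" where
  "block_freqs d s = (\<Pi>\<^sub>E j\<in>{1..d}. {- (2 ^ (s j + 1))..2 ^ (s j + 1)})"

definition block_hat :: "nat \<Rightarrow> (nat \<Rightarrow> nat) \<Rightarrow> (nat \<Rightarrow> int) \<Rightarrow> real" where
  "block_hat d s k = (\<Prod>j\<in>{1..d}. a_hat (s j) (k j))"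

lemma finite_block_freqs [simp]: "finite (block_freqs d s)"
  unfolding block_freqs_def by (intro finite_PiE) auto

lemma block_freqs_subset: "block_freqs d s \<subseteq> freqs d"
  unfolding block_freqs_def by (intro PiE_mono) auto

lemma indices_ge_1: "s \<in> indices d \<Longrightarrow> j \<in> {1..d} \<Longrightarrow> 1 \<le> s j"
  by (auto simp: indices_def PiE_iff)

lemma block_hat_support:
  assumes s: "s \<in> indices d" and k: "block_hat d s k \<noteq> 0" and j: "j \<in> {1..d}"
  shows "2 ^ (s j - 1) \<le> \<bar>k j\<bar>" "\<bar>k j\<bar> < 2 ^ (s j + 1)"
proof -
  have "a_hat (s j) (k j) \<noteq> 0" using k j by (auto simp: block_hat_def)
  then show "2 ^ (s j - 1) \<le> \<bar>k j\<bar>" "\<bar>k j\<bar> < 2 ^ (s j + 1)"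
    using a_hat_support[of "s j" "k j"] indices_ge_1[OF s j] by auto
qed

lemma block_hat_eq_0: "s \<in> indices d \<Longrightarrow> k \<in> freqs d \<Longrightarrow> k \<notin> block_freqs d s \<Longrightarrow> block_hat d s k = 0"
  using block_hat_support(2)[of s d k] by (force simp: block_freqs_def PiE_iff)

lemma A_kernel_eq:
  assumes "s \<in> indices d"
  shows "complex_of_real (A_kernel d s (\<lambda>j. x j - y j))
    = (\<Sum>k\<in>block_freqs d s. complex_of_real (block_hat d s k) * character d k x * character d (\<lambda>j. - k j) y)"
proof -
  have "complex_of_real (A_kernel d s (\<lambda>j. x j - y j)) = (\<Prod>j\<in>{1..d}. complex_of_real (a_kernel (s j) (x j - y j)))"
    by (simp add: A_kernel_def)
  also have "\<dots> = (\<Prod>j\<in>{1..d}. \<Sum>k\<in>{- (2 ^ (s j + 1))..2 ^ (s j + 1)}. complex_of_real (a_hat (s j) k) * harmonic k (x j - y j))"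
    using indices_ge_1[OF assms] by (intro prod.cong refl a_kernel_eq_harmonic) auto
  also have "\<dots> = (\<Sum>k\<in>block_freqs d s. \<Prod>j\<in>{1..d}. complex_of_real (a_hat (s j) (k j)) * harmonic (k j) (x j - y j))"
    unfolding block_freqs_def by (rule prod_sum_PiE) auto
  also have "\<dots> = (\<Sum>k\<in>block_freqs d s. complex_of_real (block_hat d s k) * character d k (\<lambda>j. x j - y j))"
    by (simp add: block_hat_def character_eq_prod prod.distrib)
  finally show ?thesis by (simp add: character_diff_arg mult.assoc)
qed

text \<open>Convolution with a trigonometric polynomial multiplies Fourier coefficients. From here
  on blocks are mostly handled through their multipliers \<open>block_hat\<close>, and identities
  between blocks become identities between finitely many coefficients.\<close>

lemma A_block_eq_trig_poly:
  assumes s: "s \<in> indices d" and f: "integrable (torus d) f"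
  shows "A_block d s f = trig_poly d (block_freqs d s) (\<lambda>k. complex_of_real (block_hat d s k) * fourier_coeff d f k)"
proof
  fix x
  have "A_block d s f x = (\<integral>y. (\<Sum>k\<in>block_freqs d s. (complex_of_real (block_hat d s k) * character d k x) * (f y * character d (\<lambda>j. - k j) y)) \<partial>torus d)"
    by (simp add: A_block_def A_kernel_eq[OF s] sum_distrib_left mult_ac)
  also have "\<dots> = (\<Sum>k\<in>block_freqs d s. (complex_of_real (block_hat d s k) * character d k x) * fourier_coeff d f k)"
    unfolding fourier_coeff_def
    using f by (subst Bochner_Integration.integral_sum) (auto intro!: integrable_mult_right integrable_mult_character)
  finally show "A_block d s f x = trig_poly d (block_freqs d s) (\<lambda>k. complex_of_real (block_hat d s k) * fourier_coeff d f k) x"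
    by (simp add: trig_poly_def mult_ac)
qed

lemma fourier_coeff_A_block:
  assumes "s \<in> indices d" "integrable (torus d) f" "k \<in> freqs d"
  shows "fourier_coeff d (A_block d s f) k = complex_of_real (block_hat d s k) * fourier_coeff d f k"
  using block_hat_eq_0[OF assms(1,3)]
  by (simp only: A_block_eq_trig_poly[OF assms(1,2)]
      fourier_coeff_trig_poly[OF finite_block_freqs block_freqs_subset assms(3)]) auto

text \<open>A block depends only on the Fourier coefficients in the support of its multiplier.
  Splittings of a function over neighbouring blocks are verified by this criterion.\<close>

lemma A_block_cong_fourier:
  assumes s: "s \<in> indices d" and "integrable (torus d) f" "integrable (torus d) g"
    and "\<And>k. k \<in> freqs d \<Longrightarrow> block_hat d s k \<noteq> 0 \<Longrightarrow> fourier_coeff d f k = fourier_coeff d g k"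
  shows "A_block d s f = A_block d s g"
  unfolding A_block_eq_trig_poly[OF s assms(2)] A_block_eq_trig_poly[OF s assms(3)]
  using assms block_freqs_subset by (intro trig_poly_cong) fastforce

lemma A_block_add:
  assumes "s \<in> indices d" "integrable (torus d) f" "integrable (torus d) g"
  shows "A_block d s (\<lambda>x. f x + g x) = (\<lambda>x. A_block d s f x + A_block d s g x)"
  using assms
  by (simp add: A_block_eq_trig_poly fourier_coeff_add fun_eq_iff trig_poly_add distrib_left)

lemma A_block_cmult:
  shows "A_block d s (\<lambda>x. c * f x) = (\<lambda>x. c * A_block d s f x)"
  by (simp add: A_block_def mult.assoc fun_eq_iff)

lemma A_block_sum:
  assumes "s \<in> indices d" and "\<And>i. i \<in> A \<Longrightarrow> integrable (torus d) (f i)"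
  shows "A_block d s (\<lambda>x. \<Sum>i\<in>A. f i x) = (\<lambda>x. \<Sum>i\<in>A. A_block d s (f i) x)"
proof
  fix x
  have "integrable (torus d) (\<lambda>x. \<Sum>i\<in>A. f i x)" using assms by auto
  then show "A_block d s (\<lambda>x. \<Sum>i\<in>A. f i x) x = (\<Sum>i\<in>A. A_block d s (f i) x)"
    using assms by (simp add: A_block_eq_trig_poly fourier_coeff_sum trig_poly_sum sum_distrib_left)
qed

lemma measurable_A_block:
  assumes "s \<in> indices d" "integrable (torus d) f"
  shows "A_block d s f \<in> borel_measurable (torus d)"
  using assms by (simp add: A_block_eq_trig_poly)

lemma integrable_A_block:
  assumes "s \<in> indices d" "integrable (torus d) f"
  shows "integrable (torus d) (A_block d s f)"
  using assms by (simp add: A_block_eq_trig_poly integrable_trig_poly)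

subsection \<open>Boundedness of the convolution blocks\<close>

definition block_majorant :: "nat \<Rightarrow> (nat \<Rightarrow> nat) \<Rightarrow> (nat \<Rightarrow> real) \<Rightarrow> (nat \<Rightarrow> real) \<Rightarrow> real" where
  "block_majorant d s x y = (\<Prod>j\<in>{1..d}. a_majorant (s j) (x j - y j))"

lemma block_majorant_nonneg: "0 \<le> block_majorant d s x y"
  unfolding block_majorant_def by (intro prod_nonneg a_majorant_nonneg)

lemma measurable_block_majorant [measurable]:
  "(\<lambda>(x, y). block_majorant d s x y) \<in> borel_measurable (torus d \<Otimes>\<^sub>M torus d)"
proof -
  have "(\<lambda>z. a_majorant (s j) (fst z j - snd z j)) \<in> borel_measurable (torus d \<Otimes>\<^sub>M torus d)" if "j \<in> {1..d}" for j
  proof -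
    have "(\<lambda>z. fst z j) \<in> borel_measurable (torus d \<Otimes>\<^sub>M torus d)" "(\<lambda>z. snd z j) \<in> borel_measurable (torus d \<Otimes>\<^sub>M torus d)"
      using measurable_compose[OF measurable_fst measurable_torus_component[OF that]]
        measurable_compose[OF measurable_snd measurable_torus_component[OF that]] by auto
    then show ?thesis by measurable
  qed
  then have "(\<lambda>z. \<Prod>j\<in>{1..d}. a_majorant (s j) (fst z j - snd z j)) \<in> borel_measurable (torus d \<Otimes>\<^sub>M torus d)"
    by (rule borel_measurable_prod)
  then show ?thesis by (simp add: block_majorant_def case_prod_beta)
qed

lemma nn_integral_block_majorant:
  "(\<integral>\<^sup>+ y. ennreal (block_majorant d s x y) \<partial>torus d) = 6 ^ d"
  "(\<integral>\<^sup>+ x. ennreal (block_majorant d s x y) \<partial>torus d) = 6 ^ d"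
proof -
  have "(\<integral>\<^sup>+ y. (\<Prod>j\<in>{1..d}. ennreal (a_majorant (s j) (x j - y j))) \<partial>torus d)
     = (\<Prod>j\<in>{1..d}. \<integral>\<^sup>+ t. ennreal (a_majorant (s j) (x j - t)) \<partial>circle)"
    by (rule nn_integral_torus_prod) auto
  then show "(\<integral>\<^sup>+ y. ennreal (block_majorant d s x y) \<partial>torus d) = 6 ^ d"
    by (simp add: nn_integral_a_majorant block_majorant_def prod_ennreal[symmetric] a_majorant_nonneg)
  have "(\<integral>\<^sup>+ x. (\<Prod>j\<in>{1..d}. ennreal (a_majorant (s j) (x j - y j))) \<partial>torus d)
     = (\<Prod>j\<in>{1..d}. \<integral>\<^sup>+ t. ennreal (a_majorant (s j) (t - y j)) \<partial>circle)"
    by (rule nn_integral_torus_prod) auto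
  then show "(\<integral>\<^sup>+ x. ennreal (block_majorant d s x y) \<partial>torus d) = 6 ^ d"
    by (simp add: nn_integral_a_majorant block_majorant_def prod_ennreal[symmetric] a_majorant_nonneg)
qed

lemma abs_A_kernel_le:
  assumes "s \<in> indices d"
  shows "\<bar>A_kernel d s (\<lambda>j. x j - y j)\<bar> \<le> block_majorant d s x y"
  unfolding A_kernel_def block_majorant_def abs_prod
  using indices_ge_1[OF assms] by (intro prod_mono) (auto intro: abs_a_kernel_le)

lemma norm_A_block_le:
  assumes s: "s \<in> indices d"
  shows "ennreal (cmod (A_block d s f x)) \<le> (\<integral>\<^sup>+ y. ennreal (cmod (f y)) * ennreal (block_majorant d s x y) \<partial>torus d)"
proof (cases "integrable (torus d) (\<lambda>y. f y * complex_of_real (A_kernel d s (\<lambda>j. x j - y j)))")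
  case True
  have "ennreal (cmod (A_block d s f x)) \<le> (\<integral>\<^sup>+ y. ennreal (cmod (f y * complex_of_real (A_kernel d s (\<lambda>j. x j - y j)))) \<partial>torus d)"
    unfolding A_block_def using True by (rule integral_norm_bound_ennreal)
  also have "\<dots> \<le> (\<integral>\<^sup>+ y. ennreal (cmod (f y)) * ennreal (block_majorant d s x y) \<partial>torus d)"
    using abs_A_kernel_le[OF s] block_majorant_nonneg
    by (intro nn_integral_mono) (auto simp: norm_mult intro!: ennreal_leI mult_left_mono simp flip: ennreal_mult)
  finally show ?thesis .
\<comment> \<open>If the integrand is not integrable, its Bochner integral is 0 by
  convention.\<close>
qed (simp add: A_block_def not_integrable_integral_eq)

text \<open>Young's inequality. With \<open>C = 6 ^ d\<close> the mass of the majorant, truncation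
  under the integral bounds the block at \<open>x\<close> by
  \<open>l * C + l powr (1 - Q) * \<Phi> x\<close>. The level
  \<open>l = \<Phi> x powr (1 / Q)\<close> bounds its \<open>Q\<close>-th power by
  \<open>(1 + C) powr Q * \<Phi> x\<close>, and Fubini's theorem bounds the integral of
  \<open>\<Phi>\<close> by \<open>C\<close> times that of \<open>|f| powr Q\<close>.\<close>

lemma Lp_norm_A_block_le:
  assumes q: "1 \<le> q" and s: "s \<in> indices d" and f: "integrable (torus d) f"
  shows "Lp_norm d q (A_block d s f) \<le> ennreal ((1 + 6 ^ d) * 6 ^ d) * Lp_norm d q f"
proof (rule ennreal_le_multI)
  note [measurable] = borel_measurable_integrable[OF f] measurable_A_block[OF s f]
  interpret prob_space "torus d" by (rule prob_space_torus)
  interpret pair_sigma_finite "torus d" "torus d" by unfold_locales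
  define C :: real where "C = 6 ^ d"
  have C: "1 \<le> C" by (simp add: C_def)
  have intC: "(\<integral>\<^sup>+ y. ennreal (block_majorant d s x y) \<partial>torus d) = ennreal C"
    "(\<integral>\<^sup>+ y. ennreal (block_majorant d s y x) \<partial>torus d) = ennreal C" for x
    by (simp_all add: nn_integral_block_majorant C_def ennreal_power[symmetric])
  have mb [measurable]: "(\<lambda>y. block_majorant d s x y) \<in> borel_measurable (torus d)" if "x \<in> space (torus d)" for x
    using measurable_Pair2[OF measurable_block_majorant that] by simp
  fix a :: real assume a: "0 < a" and fa: "Lp_norm d q f \<le> ennreal a"
  from q show "Lp_norm d q (A_block d s f) \<le> ennreal ((1 + 6 ^ d) * 6 ^ d * a)"
  proof (cases rule: ennreal_exponent_cases)
    case 1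
    have ae: "AE x in torus d. cmod (f x) \<le> a" using fa a unfolding 1 by (subst (asm) Lp_norm_inf_le_iff) auto
    have "cmod (A_block d s f x) \<le> (1 + 6 ^ d) * 6 ^ d * a" if x: "x \<in> space (torus d)" for x
    proof -
      note [measurable] = mb[OF x]
      have "ennreal (cmod (A_block d s f x)) \<le> (\<integral>\<^sup>+ y. ennreal (cmod (f y)) * ennreal (block_majorant d s x y) \<partial>torus d)"
        by (rule norm_A_block_le[OF s])
      also have "\<dots> \<le> (\<integral>\<^sup>+ y. ennreal a * ennreal (block_majorant d s x y) \<partial>torus d)"
        using ae by (intro nn_integral_mono_AE) (auto elim!: eventually_mono intro!: mult_right_mono ennreal_leI)
      also have "\<dots> = ennreal (a * C)" using a C by (simp add: nn_integral_cmult intC ennreal_mult)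
      finally have "cmod (A_block d s f x) \<le> a * C" using a C by simp
      also have "\<dots> \<le> (1 + C) * C * a" using a C by (simp add: algebra_simps)
      finally show ?thesis by (simp add: C_def)
    qed
    then show ?thesis unfolding 1 using a by (subst Lp_norm_inf_le_iff) auto
  next
    case (2 Q)
    define \<Phi> where "\<Phi> x = (\<integral>\<^sup>+ y. ennreal (cmod (f y) powr Q) * ennreal (block_majorant d s x y) \<partial>torus d)" for x
    have pt: "ennreal (cmod (A_block d s f x) powr Q) \<le> ennreal ((1 + C) powr Q) * \<Phi> x" if x: "x \<in> space (torus d)" for x
    proof (cases "\<Phi> x")
      case top
      then show ?thesis using C by (simp add: ennreal_mult_top)
    next
      case (real \<phi>)
      note [measurable] = mb[OF x]
      have le: "cmod (A_block d s f x) \<le> l * C + l powr (1 - Q) * \<phi>" if l: "0 < l" for l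
      proof -
        have "ennreal (cmod (A_block d s f x)) \<le> (\<integral>\<^sup>+ y. ennreal (cmod (f y)) * ennreal (block_majorant d s x y) \<partial>torus d)"
          by (rule norm_A_block_le[OF s])
        also have "\<dots> \<le> (\<integral>\<^sup>+ y. ennreal l * ennreal (block_majorant d s x y)
            + ennreal (l powr (1 - Q)) * (ennreal (cmod (f y) powr Q) * ennreal (block_majorant d s x y)) \<partial>torus d)"
        proof (rule nn_integral_mono)
          fix y
          have "cmod (f y) * block_majorant d s x y \<le> (l + cmod (f y) powr Q * l powr (1 - Q)) * block_majorant d s x y"
            using l 2 by (intro mult_right_mono le_truncation_plus_powr block_majorant_nonneg) auto
          also have "\<dots> = l * block_majorant d s x y + l powr (1 - Q) * (cmod (f y) powr Q * block_majorant d s x y)"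
            by (simp add: algebra_simps)
          finally show "ennreal (cmod (f y)) * ennreal (block_majorant d s x y) \<le> ennreal l * ennreal (block_majorant d s x y)
            + ennreal (l powr (1 - Q)) * (ennreal (cmod (f y) powr Q) * ennreal (block_majorant d s x y))"
            using l block_majorant_nonneg[of d s x y] by (simp flip: ennreal_mult ennreal_plus)
        qed
        also have "\<dots> = ennreal l * ennreal C + ennreal (l powr (1 - Q)) * ennreal \<phi>"
          by (subst nn_integral_add) (simp_all add: nn_integral_cmult intC real(2)[symmetric] \<Phi>_def)
        also have "\<dots> = ennreal (l * C + l powr (1 - Q) * \<phi>)"
          using l C real by (simp add: ennreal_mult ennreal_plus)
        finally show ?thesis using l C real by (subst (asm) ennreal_le_iff) auto
      qed
      have "cmod (A_block d s f x) powr Q \<le> (1 + C) powr Q * \<phi>"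
      \<comment> \<open>The level has to be positive, so for \<open>\<phi> = 0\<close> it is sent to
        0 instead.\<close>
      proof (cases "\<phi> = 0")
        case True
        have "cmod (A_block d s f x) \<le> 0"
        proof (rule field_le_epsilon)
          fix e :: real assume "0 < e"
          then show "cmod (A_block d s f x) \<le> 0 + e" using le[of "e / C"] True C by simp
        qed
        then show ?thesis using True 2 by simp
      next
        case False
        then have \<phi>: "0 < \<phi>" using real by simp
        have "(\<phi> powr (1 / Q)) powr (1 - Q) * \<phi> = \<phi> powr (1 / Q)"
        proof -
          have "(\<phi> powr (1 / Q)) powr (1 - Q) * \<phi> = \<phi> powr ((1 / Q) * (1 - Q)) * \<phi> powr 1"
            using \<phi> by (simp add: powr_powr)
          also have "\<dots> = \<phi> powr ((1 / Q) * (1 - Q) + 1)" by (simp only: powr_add)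
          also have "(1 / Q) * (1 - Q) + 1 = 1 / Q" using 2 by (simp add: field_simps)
          finally show ?thesis .
        qed
        then have "cmod (A_block d s f x) \<le> (1 + C) * \<phi> powr (1 / Q)"
          using le[of "\<phi> powr (1 / Q)"] \<phi> by (simp add: algebra_simps)
        then have "cmod (A_block d s f x) powr Q \<le> ((1 + C) * \<phi> powr (1 / Q)) powr Q"
          using 2 by (intro powr_mono2) auto
        also have "\<dots> = (1 + C) powr Q * \<phi>"
          using \<phi> C 2 by (simp add: powr_mult powr_powr)
        finally show ?thesis .
      qed
      then show ?thesis using real C by (simp add: ennreal_leI flip: ennreal_mult)
    qed
    have "(\<integral>\<^sup>+ x. ennreal (cmod (A_block d s f x) powr Q) \<partial>torus d)
        \<le> (\<integral>\<^sup>+ x. ennreal ((1 + C) powr Q) * \<Phi> x \<partial>torus d)"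
      by (intro nn_integral_mono pt)
    also have "\<dots> = ennreal ((1 + C) powr Q) * (\<integral>\<^sup>+ x. \<Phi> x \<partial>torus d)"
      unfolding \<Phi>_def by (rule nn_integral_cmult) measurable
    also have "(\<integral>\<^sup>+ x. \<Phi> x \<partial>torus d) = (\<integral>\<^sup>+ y. (\<integral>\<^sup>+ x. ennreal (cmod (f y) powr Q) * ennreal (block_majorant d s x y) \<partial>torus d) \<partial>torus d)"
      unfolding \<Phi>_def by (rule Fubini'[symmetric]) measurable
    also have "\<dots> = (\<integral>\<^sup>+ y. ennreal C * ennreal (cmod (f y) powr Q) \<partial>torus d)"
    proof (rule nn_integral_cong)
      fix y assume y: "y \<in> space (torus d)"
      have [measurable]: "(\<lambda>x. block_majorant d s x y) \<in> borel_measurable (torus d)"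
        using measurable_Pair1[OF measurable_block_majorant y] by simp
      show "(\<integral>\<^sup>+ x. ennreal (cmod (f y) powr Q) * ennreal (block_majorant d s x y) \<partial>torus d) = ennreal C * ennreal (cmod (f y) powr Q)"
        by (subst nn_integral_cmult) (simp_all add: intC mult.commute)
    qed
    also have "\<dots> = ennreal C * (\<integral>\<^sup>+ y. ennreal (cmod (f y) powr Q) \<partial>torus d)"
      by (rule nn_integral_cmult) measurable
    also have "ennreal ((1 + C) powr Q) * \<dots> \<le> ennreal ((1 + C) powr Q) * (ennreal C * ennreal (a powr Q))"
      using fa a 2 Lp_norm_le_iff[of Q a d f] by (intro mult_left_mono) auto
    also have "\<dots> = ennreal ((1 + C) powr Q * (C * a powr Q))"
      using C by (simp add: ennreal_mult)
    also have "\<dots> \<le> ennreal (((1 + C) * C * a) powr Q)"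
    proof -
      have "C powr 1 \<le> C powr Q" using C 2 by (intro powr_mono) auto
      then have "C * a powr Q \<le> C powr Q * a powr Q" using C by (intro mult_right_mono) auto
      then show ?thesis using a C by (intro ennreal_leI) (simp add: powr_mult mult.assoc)
    qed
    finally show ?thesis unfolding 2 using a 2 by (subst Lp_norm_le_iff) (auto simp: C_def)
  qed
qed (auto intro!: mult_pos_pos add_pos_nonneg)

subsection \<open>The seminorm of the target space\<close>

lemma ennreal_infsum_leI:
  fixes f :: "'a \<Rightarrow> ennreal"
  assumes "\<And>F. finite F \<Longrightarrow> F \<subseteq> A \<Longrightarrow> sum f F \<le> B"
  shows "infsum f A \<le> B"
  using assms by (subst nonneg_infsum_complete) (auto intro!: SUP_least)

lemma ennreal_sum_le_infsum:
  fixes f :: "'a \<Rightarrow> ennreal"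
  assumes "finite F" "F \<subseteq> A"
  shows "sum f F \<le> infsum f A"
  using assms by (subst nonneg_infsum_complete) (auto intro!: SUP_upper)

lemma ennreal_infsum_mono:
  fixes f :: "'a \<Rightarrow> ennreal"
  assumes "\<And>x. x \<in> A \<Longrightarrow> f x \<le> g x"
  shows "infsum f A \<le> infsum g A"
  using assms by (intro infsum_mono nonneg_summable_on_complete) auto

lemma ennreal_infsum_add:
  fixes f g :: "'a \<Rightarrow> ennreal"
  shows "infsum (\<lambda>x. f x + g x) A = infsum f A + infsum g A"
  by (intro infsum_add nonneg_summable_on_complete) auto

lemma ennreal_infsum_cmult:
  fixes f :: "'a \<Rightarrow> ennreal"
  shows "infsum (\<lambda>x. ennreal c * f x) A = ennreal c * infsum f A"
proof (cases "c \<le> 0")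
  case True
  then show ?thesis by (simp add: ennreal_neg)
next
  case False
  have "(SUP F\<in>{F. finite F \<and> F \<subseteq> A}. sum (\<lambda>x. ennreal c * f x) F) = (SUP F\<in>{F. finite F \<and> F \<subseteq> A}. ennreal c * sum f F)"
    by (simp add: sum_distrib_left)
  also have "\<dots> = ennreal c * (SUP F\<in>{F. finite F \<and> F \<subseteq> A}. sum f F)"
    by (rule SUP_mult_left_ennreal[symmetric])
  finally show ?thesis by (simp add: nonneg_infsum_complete)
qed

lemma Bq1_norm_add:
  assumes q: "1 \<le> q" and "integrable (torus d) f" "integrable (torus d) g"
  shows "Bq1_norm d q (f + g) \<le> Bq1_norm d q f + Bq1_norm d q g"
proof -
  have "Bq1_norm d q (f + g) \<le> (\<Sum>\<^sub>\<infinity>s\<in>indices d. Lp_norm d q (A_block d s f) + Lp_norm d q (A_block d s g))"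
    unfolding Bq1_norm_def plus_fun_def
    using assms by (intro ennreal_infsum_mono) (auto simp: A_block_add intro!: Lp_norm_triangle measurable_A_block)
  then show ?thesis by (simp add: ennreal_infsum_add Bq1_norm_def)
qed

lemma Bq1_norm_cscale:
  assumes q: "1 \<le> q" and f: "integrable (torus d) f"
  shows "Bq1_norm d q (cscale c f) = ennreal (cmod c) * Bq1_norm d q f"
proof -
  have "Bq1_norm d q (cscale c f) = (\<Sum>\<^sub>\<infinity>s\<in>indices d. ennreal (cmod c) * Lp_norm d q (A_block d s f))"
    unfolding Bq1_norm_def cscale_def A_block_cmult
    using assms by (intro infsum_cong Lp_norm_cmult_eq measurable_A_block)
  then show ?thesis by (simp only: ennreal_infsum_cmult Bq1_norm_def)
qed

lemma sum_fun_apply: "(\<Sum>i\<in>A. f i) x = (\<Sum>i\<in>A. f i x)"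
  by (induction A rule: infinite_finite_induct) auto

subsection \<open>Interaction of neighbouring blocks\<close>

text \<open>The multipliers of two blocks overlap only if all entries differ by at most one; the cut
  at 1 keeps the entries in the index range.\<close>

definition nbrs :: "nat \<Rightarrow> (nat \<Rightarrow> nat) \<Rightarrow> (nat \<Rightarrow> nat) set" where
  "nbrs d s = (\<Pi>\<^sub>E j\<in>{1..d}. {max 1 (s j - 1)..s j + 1})"

lemma finite_nbrs [simp]: "finite (nbrs d s)"
  unfolding nbrs_def by (intro finite_PiE) auto

lemma nbrs_subset: "nbrs d s \<subseteq> indices d"
  unfolding nbrs_def indices_def by (intro PiE_mono) auto

lemma nbrs_refl: "s \<in> indices d \<Longrightarrow> s \<in> nbrs d s"
  by (fastforce simp: nbrs_def indices_def PiE_iff)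

lemma nbrs_sym:
  assumes "s \<in> indices d" "t \<in> nbrs d s"
  shows "s \<in> nbrs d t"
proof -
  have "max 1 (t j - 1) \<le> s j \<and> s j \<le> t j + 1" if "j \<in> {1..d}" for j
  proof -
    have "1 \<le> s j" "max 1 (s j - 1) \<le> t j" "t j \<le> s j + 1"
      using assms that by (auto simp: nbrs_def indices_def PiE_iff)
    then show ?thesis by auto
  qed
  then show ?thesis using assms by (auto simp: nbrs_def indices_def PiE_iff)
qed

lemma card_nbrs_le: "card (nbrs d s) \<le> 3 ^ d"
proof -
  have "card (nbrs d s) = (\<Prod>j\<in>{1..d}. card {max 1 (s j - 1)..s j + 1})"
    unfolding nbrs_def by (rule card_PiE) simp
  also have "\<dots> \<le> (\<Prod>j\<in>{1..d}. 3)" by (intro prod_mono) (auto simp: max_def)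
  finally show ?thesis by simp
qed

text \<open>Double counting: by symmetry of the neighbour relation each \<open>t\<close> is reached
  from at most \<open>3 ^ d\<close> indices \<open>s\<close>. The set \<open>P\<close> restricts to
  the blocks inside or outside a given set.\<close>

lemma sum_nbrs_le:
  fixes x :: "(nat \<Rightarrow> nat) \<Rightarrow> ennreal"
  assumes "finite F" "F \<subseteq> indices d"
  shows "(\<Sum>s\<in>F. \<Sum>t\<in>nbrs d s \<inter> P. x t) \<le> 3 ^ d * (\<Sum>t\<in>(\<Union>s\<in>F. nbrs d s) \<inter> P. x t)"
proof -
  let ?G = "(\<Union>s\<in>F. nbrs d s) \<inter> P"
  have fin: "finite ?G" using assms by auto
  have "(\<Sum>s\<in>F. \<Sum>t\<in>nbrs d s \<inter> P. x t) = (\<Sum>s\<in>F. \<Sum>t\<in>{t\<in>?G. t \<in> nbrs d s}. x t)"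
    by (intro sum.cong) auto
  also have "\<dots> = (\<Sum>t\<in>?G. \<Sum>s\<in>{s\<in>F. t \<in> nbrs d s}. x t)"
    using assms fin by (intro sum.swap_restrict)
  also have "\<dots> \<le> (\<Sum>t\<in>?G. 3 ^ d * x t)"
  proof (rule sum_mono)
    fix t assume "t \<in> ?G"
    have "{s\<in>F. t \<in> nbrs d s} \<subseteq> nbrs d t" using assms nbrs_sym by blast
    then have "card {s\<in>F. t \<in> nbrs d s} \<le> 3 ^ d"
      using card_mono[OF finite_nbrs] card_nbrs_le[of d t] order_trans by blast
    then have "of_nat (card {s\<in>F. t \<in> nbrs d s}) \<le> (of_nat (3 ^ d) :: ennreal)"
      by (rule of_nat_mono)
    then show "(\<Sum>s\<in>{s\<in>F. t \<in> nbrs d s}. x t) \<le> 3 ^ d * x t"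
      by (simp add: mult_right_mono)
  qed
  finally show ?thesis by (simp add: sum_distrib_left)
qed

lemma block_hat_nz_nbrs:
  assumes s: "s \<in> indices d" "block_hat d s k \<noteq> 0" and t: "t \<in> indices d" "block_hat d t k \<noteq> 0"
  shows "t \<in> nbrs d s"
proof -
  have "max 1 (s j - 1) \<le> t j \<and> t j \<le> s j + 1" if j: "j \<in> {1..d}" for j
  proof -
    have ge: "1 \<le> s j" "1 \<le> t j" using indices_ge_1 s t j by auto
    have pw: "(2::int) ^ (s j - 1) < 2 ^ (t j + 1)" "(2::int) ^ (t j - 1) < 2 ^ (s j + 1)"
      using block_hat_support[OF s j] block_hat_support[OF t j] by linarith+
    have "s j - 1 < t j + 1" "t j - 1 < s j + 1"
      using power_less_imp_less_exp[OF _ pw(1)] power_less_imp_less_exp[OF _ pw(2)] by simp_all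
    then show ?thesis using ge by auto
  qed
  then show ?thesis using t by (auto simp: nbrs_def indices_def PiE_iff)
qed

lemma sum_block_hat_nbrs:
  assumes s: "s \<in> indices d" "block_hat d s k \<noteq> 0"
  shows "(\<Sum>t\<in>nbrs d s. block_hat d t k) = 1"
proof -
  have "(\<Sum>t\<in>nbrs d s. block_hat d t k) = (\<Prod>j\<in>{1..d}. \<Sum>t\<in>{max 1 (s j - 1)..s j + 1}. a_hat t (k j))"
    unfolding nbrs_def block_hat_def by (rule prod_sum_PiE[symmetric]) auto
  also have "\<dots> = (\<Prod>j\<in>{1..d}. 1)"
  proof (rule prod.cong)
    fix j assume j: "j \<in> {1..d}"
    have "a_hat (s j) (k j) \<noteq> 0" using s(2) j by (auto simp: block_hat_def)
    then show "(\<Sum>t\<in>{max 1 (s j - 1)..s j + 1}. a_hat t (k j)) = 1"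
      using indices_ge_1[OF s(1) j] by (intro sum_a_hat_neighbours)
  qed simp
  finally show ?thesis by simp
qed

text \<open>On the support of the multiplier \<open>|k j|\<close> lies in one of the dyadic ranges
  numbered \<open>s j\<close> and \<open>s j + 1\<close>, so the sharp cell containing
  \<open>k\<close> belongs to a neighbour of \<open>s\<close>. The cells are disjoint, hence exactly
  one term is 1.\<close>

lemma sum_rho_nbrs:
  assumes s: "s \<in> indices d" "block_hat d s k \<noteq> 0" and k: "k \<in> freqs d"
  shows "(\<Sum>t\<in>nbrs d s. if k \<in> rho d t then 1 else (0::complex)) = 1"
proof -
  have "(if k \<in> rho d t then 1 else 0) = (\<Prod>j\<in>{1..d}. if 2 ^ (t j - 1) \<le> \<bar>k j\<bar> \<and> \<bar>k j\<bar> < 2 ^ t j then 1 else (0::complex))" for t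
    using k by (auto simp: rho_def PiE_iff)
  then have "(\<Sum>t\<in>nbrs d s. if k \<in> rho d t then 1 else (0::complex))
     = (\<Prod>j\<in>{1..d}. \<Sum>t\<in>{max 1 (s j - 1)..s j + 1}. if 2 ^ (t - 1) \<le> \<bar>k j\<bar> \<and> \<bar>k j\<bar> < 2 ^ t then 1 else 0)"
    unfolding nbrs_def by (simp only:) (rule prod_sum_PiE[symmetric], auto)
  also have "\<dots> = (\<Prod>j\<in>{1..d}. 1)"
  proof (rule prod.cong)
    fix j assume j: "j \<in> {1..d}"
    note b = block_hat_support[OF s j]
    have 1: "1 \<le> s j" using indices_ge_1[OF s(1) j] .
    define t0 where "t0 = (if \<bar>k j\<bar> < 2 ^ s j then s j else s j + 1)"
    have t0: "2 ^ (t0 - 1) \<le> \<bar>k j\<bar>" "\<bar>k j\<bar> < 2 ^ t0" "t0 \<in> {max 1 (s j - 1)..s j + 1}"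
      using b 1 by (auto simp: t0_def)
    have "t = t0" if "1 \<le> t" "2 ^ (t - 1) \<le> \<bar>k j\<bar>" "\<bar>k j\<bar> < 2 ^ t" for t
    proof -
      have "(2::int) ^ (t - 1) < 2 ^ t0" "(2::int) ^ (t0 - 1) < 2 ^ t" using that t0 by linarith+
      then have "t - 1 < t0" "t0 - 1 < t" by (auto dest: power_less_imp_less_exp[rotated])
      then show ?thesis using that(1) t0(3) by auto
    qed
    then have "(\<Sum>t\<in>{max 1 (s j - 1)..s j + 1}. if 2 ^ (t - 1) \<le> \<bar>k j\<bar> \<and> \<bar>k j\<bar> < 2 ^ t then 1 else (0::complex))
       = (\<Sum>t\<in>{max 1 (s j - 1)..s j + 1}. if t = t0 then 1 else 0)"
      using t0 by (intro sum.cong) auto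
    also have "\<dots> = 1" using t0(3) by (subst sum.delta) (simp_all only: finite_atLeastAtMost if_True)
    finally show "(\<Sum>t\<in>{max 1 (s j - 1)..s j + 1}. if 2 ^ (t - 1) \<le> \<bar>k j\<bar> \<and> \<bar>k j\<bar> < 2 ^ t then 1 else (0::complex)) = 1" .
  qed simp
  finally show ?thesis by simp
qed

text \<open>The approximating operator. Its multiplier is 1 at those frequencies without zero
  components for which every block with nonzero multiplier lies in \<open>Q\<close>, and it takes
  intermediate values near the boundary of \<open>Q\<close>.\<close>

definition A_sum :: "nat \<Rightarrow> (nat \<Rightarrow> nat) set \<Rightarrow> ((nat \<Rightarrow> real) \<Rightarrow> complex) \<Rightarrow> (nat \<Rightarrow> real) \<Rightarrow> complex" where
  "A_sum d Q f = (\<lambda>x. \<Sum>s\<in>Q. A_block d s f x)"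

lemma integrable_A_sum:
  assumes "Q \<subseteq> indices d" "integrable (torus d) f"
  shows "integrable (torus d) (A_sum d Q f)"
  unfolding A_sum_def using assms
  by (intro Bochner_Integration.integrable_sum integrable_A_block) auto

lemma fourier_coeff_A_sum:
  assumes "Q \<subseteq> indices d" "integrable (torus d) f" "k \<in> freqs d"
  shows "fourier_coeff d (A_sum d Q f) k = complex_of_real (\<Sum>s\<in>Q. block_hat d s k) * fourier_coeff d f k"
proof -
  have "fourier_coeff d (A_sum d Q f) k = (\<Sum>s\<in>Q. fourier_coeff d (A_block d s f) k)"
    unfolding A_sum_def using assms by (intro fourier_coeff_sum integrable_A_block) auto
  also have "\<dots> = (\<Sum>s\<in>Q. complex_of_real (block_hat d s k) * fourier_coeff d f k)"
    using assms by (intro sum.cong refl fourier_coeff_A_block) auto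
  finally show ?thesis by (simp add: sum_distrib_right)
qed

lemma sum_block_hat_restrict:
  assumes "finite Q" "Q \<subseteq> indices d" "s \<in> indices d" "block_hat d s k \<noteq> 0"
  shows "(\<Sum>t\<in>Q. block_hat d t k) = (\<Sum>t\<in>nbrs d s \<inter> Q. block_hat d t k)"
  using assms block_hat_nz_nbrs[OF assms(3,4)] by (intro sum.mono_neutral_right) auto

text \<open>The multiplier of the operator is examined on the support of block \<open>s\<close>,
  where only neighbours contribute and all neighbours together sum to 1. Seen from \<open>s\<close>,
  the remainder therefore consists of the neighbours missing from \<open>Q\<close>.\<close>

lemma A_block_A_sum:
  assumes Q: "finite Q" "Q \<subseteq> indices d" and s: "s \<in> indices d" and f: "integrable (torus d) f"
  shows "A_block d s (A_sum d Q f) = (\<lambda>x. \<Sum>t\<in>nbrs d s \<inter> Q. A_block d s (A_block d t f) x)"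
    and "A_block d s (\<lambda>x. f x - A_sum d Q f x) = (\<lambda>x. \<Sum>t\<in>nbrs d s \<inter> - Q. A_block d s (A_block d t f) x)"
proof -
  have sub: "nbrs d s \<inter> P \<subseteq> indices d" for P using nbrs_subset by blast
  have int: "integrable (torus d) (A_sum d (nbrs d s \<inter> P) f)" for P
    using f by (intro integrable_A_sum sub)
  have red: "A_block d s (A_sum d (nbrs d s \<inter> P) f) = (\<lambda>x. \<Sum>t\<in>nbrs d s \<inter> P. A_block d s (A_block d t f) x)" for P
    unfolding A_sum_def using sub f by (intro A_block_sum s integrable_A_block) auto
  show "A_block d s (A_sum d Q f) = (\<lambda>x. \<Sum>t\<in>nbrs d s \<inter> Q. A_block d s (A_block d t f) x)"
    unfolding red[symmetric]
  proof (rule A_block_cong_fourier[OF s integrable_A_sum[OF Q(2) f] int])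
    fix k assume k: "k \<in> freqs d" "block_hat d s k \<noteq> 0"
    then show "fourier_coeff d (A_sum d Q f) k = fourier_coeff d (A_sum d (nbrs d s \<inter> Q) f) k"
      by (simp only: fourier_coeff_A_sum[OF _ f] Q sub sum_block_hat_restrict[OF Q s k(2)])
  qed
  show "A_block d s (\<lambda>x. f x - A_sum d Q f x) = (\<lambda>x. \<Sum>t\<in>nbrs d s \<inter> - Q. A_block d s (A_block d t f) x)"
    unfolding red[symmetric]
  proof (rule A_block_cong_fourier[OF s _ int])
    show "integrable (torus d) (\<lambda>x. f x - A_sum d Q f x)"
      using f integrable_A_sum[OF Q(2) f] by simp
    fix k assume k: "k \<in> freqs d" "block_hat d s k \<noteq> 0"
    have "(\<Sum>t\<in>nbrs d s \<inter> Q. block_hat d t k) + (\<Sum>t\<in>nbrs d s \<inter> - Q. block_hat d t k) = 1"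
    proof -
      have "(\<Sum>t\<in>nbrs d s \<inter> Q. block_hat d t k) + (\<Sum>t\<in>nbrs d s \<inter> - Q. block_hat d t k)
          = (\<Sum>t\<in>(nbrs d s \<inter> Q) \<union> (nbrs d s \<inter> - Q). block_hat d t k)"
        by (rule sum.union_disjoint[symmetric]) auto
      also have "(nbrs d s \<inter> Q) \<union> (nbrs d s \<inter> - Q) = nbrs d s" by auto
      finally show ?thesis using sum_block_hat_nbrs[OF s k(2)] by simp
    qed
    then have eq: "(\<Sum>t\<in>nbrs d s \<inter> - Q. block_hat d t k) = 1 - (\<Sum>t\<in>Q. block_hat d t k)"
      using sum_block_hat_restrict[OF Q s k(2)] by simp
    have "fourier_coeff d (A_sum d (nbrs d s \<inter> - Q) f) k = complex_of_real (1 - (\<Sum>t\<in>Q. block_hat d t k)) * fourier_coeff d f k"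
      unfolding eq[symmetric] by (rule fourier_coeff_A_sum[OF sub f k(1)])
    moreover have "fourier_coeff d (\<lambda>x. f x - A_sum d Q f x) k = fourier_coeff d f k - complex_of_real (\<Sum>t\<in>Q. block_hat d t k) * fourier_coeff d f k"
      using fourier_coeff_diff[OF f integrable_A_sum[OF Q(2) f]] fourier_coeff_A_sum[OF Q(2) f k(1)] by simp
    ultimately show "fourier_coeff d (\<lambda>x. f x - A_sum d Q f x) k = fourier_coeff d (A_sum d (nbrs d s \<inter> - Q) f) k"
      by (simp add: left_diff_distrib)
  qed
qed

text \<open>Sharp blocks are met here only after application of a smooth block, for which the
  convolution bound is available in every L_p. This carries the class norm for
  \<open>1 < p < \<infinity>\<close> over to smooth blocks.\<close>

lemma A_block_eq_sum_delta_block: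
  assumes s: "s \<in> indices d" and f: "integrable (torus d) f"
  shows "A_block d s f = (\<lambda>x. \<Sum>t\<in>nbrs d s. A_block d s (delta_block d t f) x)"
proof -
  have fin: "finite (rho d t)" for t
  proof -
    have "{k::int. 2 ^ (t j - 1) \<le> \<bar>k\<bar> \<and> \<bar>k\<bar> < 2 ^ t j} \<subseteq> {- (2 ^ t j)..2 ^ t j}" for j by auto
    then show ?thesis unfolding rho_def by (intro finite_PiE) (auto intro: finite_subset)
  qed
  have sub: "rho d t \<subseteq> freqs d" for t unfolding rho_def by (intro PiE_mono) auto
  have eq: "delta_block d t f = trig_poly d (rho d t) (fourier_coeff d f)" for t
    by (simp add: delta_block_def trig_poly_def fun_eq_iff)
  have int: "integrable (torus d) (delta_block d t f)" for t
    unfolding eq by (rule integrable_trig_poly)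
  have "A_block d s f = A_block d s (\<lambda>x. \<Sum>t\<in>nbrs d s. delta_block d t f x)"
  proof (rule A_block_cong_fourier[OF s f])
    show "integrable (torus d) (\<lambda>x. \<Sum>t\<in>nbrs d s. delta_block d t f x)" using int by simp
    fix k assume k: "k \<in> freqs d" "block_hat d s k \<noteq> 0"
    have "fourier_coeff d (\<lambda>x. \<Sum>t\<in>nbrs d s. delta_block d t f x) k = (\<Sum>t\<in>nbrs d s. fourier_coeff d (delta_block d t f) k)"
      using int by (intro fourier_coeff_sum)
    also have "\<dots> = (\<Sum>t\<in>nbrs d s. (if k \<in> rho d t then 1 else 0) * fourier_coeff d f k)"
      by (intro sum.cong) (auto simp: eq fourier_coeff_trig_poly[OF fin sub k(1)])
    also have "\<dots> = fourier_coeff d f k"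
      using sum_rho_nbrs[OF s k(2,1)] by (simp only: sum_distrib_right[symmetric]) simp
    finally show "fourier_coeff d f k = fourier_coeff d (\<lambda>x. \<Sum>t\<in>nbrs d s. delta_block d t f x) k" ..
  qed
  also have "\<dots> = (\<lambda>x. \<Sum>t\<in>nbrs d s. A_block d s (delta_block d t f) x)"
    using int by (intro A_block_sum s)
  finally show ?thesis .
qed

definition A_const :: "nat \<Rightarrow> real" where
  "A_const d = (1 + 6 ^ d) * 6 ^ d"

lemma A_const_ge_1: "1 \<le> A_const d"
proof -
  have "1 * 1 \<le> (1 + 6 ^ d) * (6 ^ d :: real)" by (intro mult_mono) auto
  then show ?thesis by (simp add: A_const_def)
qed

text \<open>For \<open>1 < p < \<infinity>\<close> the block splits into smooth blocks of
  neighbouring sharp ones; for \<open>p = 1\<close> and \<open>p = \<infinity>\<close> it is itself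
  the \<open>beta_block\<close> with \<open>u = t\<close>. The factor 2 is the passage from exponent
  \<open>p\<close> to \<open>q\<close>.\<close>

lemma Lp_norm_A_block_le_beta:
  assumes q: "1 \<le> q" "q \<le> p" and t: "t \<in> indices d" and f: "f \<in> Lp d p"
  shows "Lp_norm d q (A_block d t f) \<le> ennreal (2 * A_const d) * (\<Sum>u\<in>nbrs d t. Lp_norm d p (beta_block d p u f))"
proof -
  have p: "1 \<le> p" using q by order
  have int: "integrable (torus d) f" using Lp_integrable[OF p f] .
  have "Lp_norm d p (A_block d t f) \<le> ennreal (A_const d) * (\<Sum>u\<in>nbrs d t. Lp_norm d p (beta_block d p u f))"
  proof (cases "1 < p \<and> p < \<infinity>")
    case True
    have d: "integrable (torus d) (delta_block d u f)" for u
      using integrable_trig_poly[of d "rho d u" "fourier_coeff d f"] by (simp add: delta_block_def trig_poly_def[abs_def])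
    have "Lp_norm d p (A_block d t f) \<le> (\<Sum>u\<in>nbrs d t. Lp_norm d p (A_block d t (delta_block d u f)))"
      by (subst A_block_eq_sum_delta_block[OF t int]) (intro Lp_norm_sum p measurable_A_block[OF t d] finite_nbrs)
    also have "\<dots> \<le> (\<Sum>u\<in>nbrs d t. ennreal (A_const d) * Lp_norm d p (delta_block d u f))"
      unfolding A_const_def by (intro sum_mono Lp_norm_A_block_le p t d)
    finally show ?thesis using True by (simp add: beta_block_def sum_distrib_left)
  next
    case False
    have "Lp_norm d p (A_block d t f) = 1 * (\<Sum>u\<in>{t}. Lp_norm d p (beta_block d p u f))"
      unfolding beta_block_def if_not_P[OF False] by simp
    also have "\<dots> \<le> ennreal (A_const d) * (\<Sum>u\<in>nbrs d t. Lp_norm d p (beta_block d p u f))"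
      using A_const_ge_1[of d] nbrs_refl[OF t] by (intro mult_mono sum_mono2) auto
    finally show ?thesis .
  qed
  moreover have "Lp_norm d q (A_block d t f) \<le> 2 * Lp_norm d p (A_block d t f)"
    using q by (intro Lp_norm_mono_exponent measurable_A_block[OF t int])
  ultimately have "Lp_norm d q (A_block d t f) \<le> 2 * (ennreal (A_const d) * (\<Sum>u\<in>nbrs d t. Lp_norm d p (beta_block d p u f)))"
    by (meson mult_left_mono order_trans zero_le)
  then show ?thesis using A_const_ge_1[of d] by (simp add: ennreal_mult mult.assoc)
qed

text \<open>Two passages to neighbours: from \<open>s\<close> to the blocks \<open>t\<close> missing
  from \<open>Q\<close>, then from \<open>t\<close> to the class blocks \<open>u\<close>. Each costs
  an overlap \<open>3 ^ d\<close> and a factor \<open>A_const d\<close>, and only those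
  \<open>u\<close> survive that have a neighbour outside \<open>Q\<close>. The infinite sum is
  bounded through finite partial sums, where the exchange of sums is elementary.\<close>

lemma Bq1_norm_remainder_le:
  assumes q: "1 \<le> q" "q \<le> p" and f: "f \<in> Lp d p" and Q: "finite Q" "Q \<subseteq> indices d"
  shows "Bq1_norm d q (\<lambda>x. f x - A_sum d Q f x) \<le> ennreal (2 * A_const d * A_const d * 9 ^ d) *
     (\<Sum>\<^sub>\<infinity>u\<in>{u\<in>indices d. \<exists>t\<in>nbrs d u. t \<notin> Q}. Lp_norm d p (beta_block d p u f))"
proof -
  let ?C = "A_const d"
  have p: "1 \<le> p" using q by order
  have int: "integrable (torus d) f" using Lp_integrable[OF p f] .
  have C: "0 \<le> ?C" using A_const_ge_1[of d] by simp
  show ?thesis unfolding Bq1_norm_def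
  proof (rule ennreal_infsum_leI)
    fix F assume F: "finite F" "F \<subseteq> indices d"
    define G where "G = (\<Union>s\<in>F. nbrs d s) \<inter> - Q"
    have G: "finite G" "G \<subseteq> indices d" using F nbrs_subset by (auto simp: G_def)
    define H where "H = (\<Union>t\<in>G. nbrs d t)"
    have H: "finite H" "H \<subseteq> {u\<in>indices d. \<exists>t\<in>nbrs d u. t \<notin> Q}"
    proof -
      show "finite H" using G by (simp add: H_def)
      have "\<exists>t\<in>nbrs d u. t \<notin> Q" if "t \<in> G" "u \<in> nbrs d t" for t u
        using nbrs_sym[of t d u] that G by (auto simp: G_def)
      then show "H \<subseteq> {u\<in>indices d. \<exists>t\<in>nbrs d u. t \<notin> Q}"
        using nbrs_subset by (fastforce simp: H_def)
    qed
    have "(\<Sum>s\<in>F. Lp_norm d q (A_block d s (\<lambda>x. f x - A_sum d Q f x)))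
       \<le> (\<Sum>s\<in>F. \<Sum>t\<in>nbrs d s \<inter> - Q. ennreal ?C * Lp_norm d q (A_block d t f))"
    proof (rule sum_mono)
      fix s assume "s \<in> F"
      then have s: "s \<in> indices d" using F by auto
      have t: "t \<in> nbrs d s \<inter> - Q \<Longrightarrow> t \<in> indices d" for t using nbrs_subset by auto
      have "Lp_norm d q (A_block d s (\<lambda>x. f x - A_sum d Q f x)) \<le> (\<Sum>t\<in>nbrs d s \<inter> - Q. Lp_norm d q (A_block d s (A_block d t f)))"
        unfolding A_block_A_sum(2)[OF Q s int]
        by (intro Lp_norm_sum q measurable_A_block s integrable_A_block int t) auto
      also have "\<dots> \<le> (\<Sum>t\<in>nbrs d s \<inter> - Q. ennreal ?C * Lp_norm d q (A_block d t f))"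
        unfolding A_const_def by (intro sum_mono Lp_norm_A_block_le q s integrable_A_block int t)
      finally show "Lp_norm d q (A_block d s (\<lambda>x. f x - A_sum d Q f x)) \<le> \<dots>" .
    qed
    also have "\<dots> \<le> 3 ^ d * (\<Sum>t\<in>G. ennreal ?C * Lp_norm d q (A_block d t f))"
      unfolding G_def by (rule sum_nbrs_le[OF F])
    also have "\<dots> \<le> 3 ^ d * (\<Sum>t\<in>G. ennreal ?C * (ennreal (2 * ?C) * (\<Sum>u\<in>nbrs d t \<inter> UNIV. Lp_norm d p (beta_block d p u f))))"
      unfolding Int_UNIV_right using G by (intro mult_left_mono sum_mono Lp_norm_A_block_le_beta q f) auto
    also have "\<dots> = 3 ^ d * (ennreal ?C * (ennreal (2 * ?C) * (\<Sum>t\<in>G. \<Sum>u\<in>nbrs d t \<inter> UNIV. Lp_norm d p (beta_block d p u f))))"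
      by (simp add: sum_distrib_left)
    also have "\<dots> \<le> 3 ^ d * (ennreal ?C * (ennreal (2 * ?C) * (3 ^ d * (\<Sum>u\<in>H \<inter> UNIV. Lp_norm d p (beta_block d p u f)))))"
      unfolding H_def by (intro mult_left_mono sum_nbrs_le G) auto
    also have "\<dots> \<le> 3 ^ d * (ennreal ?C * (ennreal (2 * ?C) * (3 ^ d * (\<Sum>\<^sub>\<infinity>u\<in>{u\<in>indices d. \<exists>t\<in>nbrs d u. t \<notin> Q}. Lp_norm d p (beta_block d p u f)))))"
      unfolding Int_UNIV_right by (intro mult_left_mono ennreal_sum_le_infsum H) auto
    also have "\<dots> = (ennreal (3 ^ d) * ennreal ?C * ennreal (2 * ?C) * ennreal (3 ^ d)) *
       (\<Sum>\<^sub>\<infinity>u\<in>{u\<in>indices d. \<exists>t\<in>nbrs d u. t \<notin> Q}. Lp_norm d p (beta_block d p u f))"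
      by (simp add: mult.assoc ennreal_power[symmetric])
    also have "ennreal (3 ^ d) * ennreal ?C * ennreal (2 * ?C) * ennreal (3 ^ d) = ennreal (3 ^ d * ?C * (2 * ?C) * 3 ^ d)"
      using C by (simp only: ennreal_mult[symmetric] mult_nonneg_nonneg zero_le_power zero_le_numeral)
    also have "3 ^ d * ?C * (2 * ?C) * 3 ^ d = 2 * ?C * ?C * (3 * 3) ^ d"
      by (simp only: power_mult_distrib) (simp add: mult_ac)
    finally show "(\<Sum>s\<in>F. Lp_norm d q (A_block d s (\<lambda>x. f x - A_sum d Q f x))) \<le> ennreal (2 * ?C * ?C * 9 ^ d) *
       (\<Sum>\<^sub>\<infinity>u\<in>{u\<in>indices d. \<exists>t\<in>nbrs d u. t \<notin> Q}. Lp_norm d p (beta_block d p u f))"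
      by simp
  qed
qed

text \<open>Supplies the continuity of \<open>A_sum d Q\<close> on the target space that the linear
  width asks for.\<close>

lemma Bq1_norm_A_sum_le:
  assumes q: "1 \<le> q" and f: "integrable (torus d) f" and Q: "finite Q" "Q \<subseteq> indices d"
  shows "Bq1_norm d q (A_sum d Q f) \<le> ennreal (A_const d * 3 ^ d) * Bq1_norm d q f"
  unfolding Bq1_norm_def
proof (rule ennreal_infsum_leI)
  fix F assume F: "finite F" "F \<subseteq> indices d"
  let ?G = "(\<Union>s\<in>F. nbrs d s) \<inter> Q"
  have "(\<Sum>s\<in>F. Lp_norm d q (A_block d s (A_sum d Q f))) \<le> (\<Sum>s\<in>F. \<Sum>t\<in>nbrs d s \<inter> Q. ennreal (A_const d) * Lp_norm d q (A_block d t f))"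
  proof (rule sum_mono)
    fix s assume "s \<in> F"
    then have s: "s \<in> indices d" using F by auto
    have t: "t \<in> nbrs d s \<inter> Q \<Longrightarrow> t \<in> indices d" for t using nbrs_subset by auto
    have "Lp_norm d q (A_block d s (A_sum d Q f)) \<le> (\<Sum>t\<in>nbrs d s \<inter> Q. Lp_norm d q (A_block d s (A_block d t f)))"
      unfolding A_block_A_sum(1)[OF Q s f]
      by (intro Lp_norm_sum q measurable_A_block s integrable_A_block f t) auto
    also have "\<dots> \<le> (\<Sum>t\<in>nbrs d s \<inter> Q. ennreal (A_const d) * Lp_norm d q (A_block d t f))"
      unfolding A_const_def by (intro sum_mono Lp_norm_A_block_le q s integrable_A_block f t)
    finally show "Lp_norm d q (A_block d s (A_sum d Q f)) \<le> \<dots>" .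
  qed
  also have "\<dots> \<le> 3 ^ d * (\<Sum>t\<in>?G. ennreal (A_const d) * Lp_norm d q (A_block d t f))"
    by (rule sum_nbrs_le[OF F])
  also have "\<dots> = 3 ^ d * (ennreal (A_const d) * (\<Sum>t\<in>?G. Lp_norm d q (A_block d t f)))"
    by (simp add: sum_distrib_left)
  also have "\<dots> \<le> 3 ^ d * (ennreal (A_const d) * (\<Sum>\<^sub>\<infinity>t\<in>indices d. Lp_norm d q (A_block d t f)))"
    using Q F by (intro mult_left_mono ennreal_sum_le_infsum) auto
  also have "\<dots> = ennreal (A_const d * 3 ^ d) * (\<Sum>\<^sub>\<infinity>t\<in>indices d. Lp_norm d q (A_block d t f))"
    using A_const_ge_1[of d] by (simp add: ennreal_mult mult_ac ennreal_power[symmetric])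
  finally show "(\<Sum>s\<in>F. Lp_norm d q (A_block d s (A_sum d Q f))) \<le> \<dots>" .
qed

subsection \<open>Trigonometric polynomials and the linear width\<close>

lemma Lp_norm_le_bound:
  assumes q: "1 \<le> q" and m: "f \<in> borel_measurable (torus d)" and B: "\<And>x. cmod (f x) \<le> B"
  shows "Lp_norm d q f \<le> ennreal B"
proof -
  interpret prob_space "torus d" by (rule prob_space_torus)
  have B0: "0 \<le> B" using B[of undefined] norm_ge_zero[of "f undefined"] by linarith
  from q show ?thesis
  proof (cases rule: ennreal_exponent_cases)
    case 1
    show ?thesis unfolding 1 using B by (subst Lp_norm_inf_le_iff[OF m B0]) auto
  next
    case (2 Q)
    have "(\<integral>\<^sup>+ x. ennreal (cmod (f x) powr Q) \<partial>torus d) \<le> (\<integral>\<^sup>+ x. ennreal (B powr Q) \<partial>torus d)"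
      using B 2 by (intro nn_integral_mono ennreal_leI powr_mono2) auto
    also have "\<dots> = ennreal (B powr Q)" by (simp add: emeasure_space_1)
    finally show ?thesis unfolding 2 using 2 B0 by (subst Lp_norm_le_iff) auto
  qed
qed

lemma character_upd:
  assumes "j \<in> {1..d}"
  shows "character d k (x(j := t)) = (\<Prod>i\<in>{1..d} - {j}. harmonic (k i) (x i)) * harmonic (k j) t"
  using assms by (simp add: character_eq_prod prod.remove[of _ j] mult.commute)

lemma periodic_trig_poly: "periodic d (trig_poly d K c)"
  unfolding periodic_def trig_poly_def
proof (intro allI ballI sum.cong arg_cong2[where f = "(*)"] refl)
  fix x :: "nat \<Rightarrow> real" and j k assume "j \<in> {1..d}"
  then show "character d k (x(j := x j + 2 * pi)) = character d k x"
    using character_upd[of j d k x "x j + 2 * pi"] character_upd[of j d k x "x j"]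
    by (simp add: harmonic_periodic)
qed

lemma set_integral_trig_poly_slice:
  assumes "j \<in> {1..d}" "\<And>k. k \<in> K \<Longrightarrow> k j \<noteq> 0"
  shows "(LINT t:{0..<2 * pi}|lborel. trig_poly d K c (x(j := t))) = 0"
proof -
  have int: "set_integrable lborel {0..<2 * pi} (harmonic k)" for k
  proof (rule set_integrable_subset)
    show "set_integrable lborel {0..2 * pi} (harmonic k)"
      unfolding set_integrable_def
      by (intro borel_integrable_compact continuous_harmonic) auto
  qed auto
  have "(LINT t:{0..<2 * pi}|lborel. trig_poly d K c (x(j := t)))
      = (\<Sum>k\<in>K. LINT t:{0..<2 * pi}|lborel. (c k * (\<Prod>i\<in>{1..d} - {j}. harmonic (k i) (x i))) * harmonic (k j) t)"
    unfolding trig_poly_def character_upd[OF assms(1)] set_lebesgue_integral_def scaleR_sum_right mult.assoc[symmetric]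
    using int[unfolded set_integrable_def]
    by (intro Bochner_Integration.integral_sum) (simp add: mult_scaleR_right[symmetric] del: mult_scaleR_right)
  also have "\<dots> = (\<Sum>k\<in>K. 0)"
    using assms(2) by (intro sum.cong refl) (simp add: set_integral_harmonic)
  finally show ?thesis by simp
qed

lemma finite_active_blocks:
  assumes "finite K"
  shows "finite {s\<in>indices d. \<exists>k\<in>K. block_hat d s k \<noteq> 0}"
proof -
  define B where "B = (\<Sum>k\<in>K. \<Sum>j\<in>{1..d}. nat \<bar>k j\<bar>)"
  have "{s\<in>indices d. \<exists>k\<in>K. block_hat d s k \<noteq> 0} \<subseteq> ({1..d} \<rightarrow>\<^sub>E {..B + 1})"
  proof clarify
    fix s k assume s: "s \<in> indices d" and k: "k \<in> K" "block_hat d s k \<noteq> 0"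
    have "s j \<le> B + 1" if j: "j \<in> {1..d}" for j
    proof -
      have "int (s j - 1) \<le> 2 ^ (s j - 1)" by (metis less_exp less_imp_le of_nat_le_iff of_nat_numeral of_nat_power)
      also have "\<dots> \<le> \<bar>k j\<bar>" by (rule block_hat_support[OF s k(2) j])
      finally have "s j - 1 \<le> nat \<bar>k j\<bar>" by linarith
      also have "\<dots> \<le> (\<Sum>j\<in>{1..d}. nat \<bar>k j\<bar>)" using j by (intro member_le_sum) auto
      also have "\<dots> \<le> B" unfolding B_def using k assms by (intro member_le_sum[of k]) auto
      finally show ?thesis by linarith
    qed
    then show "s \<in> {1..d} \<rightarrow>\<^sub>E {..B + 1}" using s by (auto simp: indices_def PiE_iff)
  qed
  then show ?thesis by (rule finite_subset) (intro finite_PiE, auto)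
qed

lemma A_block_trig_poly_eq_0:
  assumes K: "finite K" "K \<subseteq> freqs d" and s: "s \<in> indices d" and "\<And>k. k \<in> K \<Longrightarrow> block_hat d s k = 0"
  shows "A_block d s (trig_poly d K c) = (\<lambda>x. 0)"
proof -
  have "complex_of_real (block_hat d s k) * fourier_coeff d (trig_poly d K c) k = 0" if "k \<in> block_freqs d s" for k
  proof -
    have "k \<in> freqs d" using that block_freqs_subset by auto
    then show ?thesis using assms(4)[of k] by (simp only: fourier_coeff_trig_poly[OF K]) auto
  qed
  then have "A_block d s (trig_poly d K c) = trig_poly d (block_freqs d s) (\<lambda>k. 0)"
    unfolding A_block_eq_trig_poly[OF s integrable_trig_poly] by (rule trig_poly_cong)
  then show ?thesis by (simp add: trig_poly_def[of _ _ "\<lambda>k. 0", abs_def])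
qed

text \<open>Frequencies without zero components give mean zero in every variable, and only finitely
  many blocks meet a finite set of frequencies.\<close>

lemma trig_poly_in_Bq1:
  assumes q: "1 \<le> q" and K: "finite K" "K \<subseteq> freqs d" and nz: "\<And>k j. k \<in> K \<Longrightarrow> j \<in> {1..d} \<Longrightarrow> k j \<noteq> 0"
  shows "trig_poly d K c \<in> Bq1 d q"
proof -
  have fin: "Lp_norm d q (trig_poly d L c') < \<infinity>" for L c'
    using Lp_norm_le_bound[OF q measurable_trig_poly norm_trig_poly_le] by (rule le_less_trans) simp
  let ?S = "{s\<in>indices d. \<exists>k\<in>K. block_hat d s k \<noteq> 0}"
  have S: "finite ?S" by (rule finite_active_blocks[OF K(1)])
  have "Bq1_norm d q (trig_poly d K c) \<le> (\<Sum>s\<in>?S. Lp_norm d q (A_block d s (trig_poly d K c)))"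
    unfolding Bq1_norm_def
  proof (rule ennreal_infsum_leI)
    fix F assume F: "finite F" "F \<subseteq> indices d"
    have "(\<Sum>s\<in>F. Lp_norm d q (A_block d s (trig_poly d K c))) = (\<Sum>s\<in>F \<inter> ?S. Lp_norm d q (A_block d s (trig_poly d K c)))"
    proof (rule sum.mono_neutral_right)
      show "\<forall>s\<in>F - F \<inter> ?S. Lp_norm d q (A_block d s (trig_poly d K c)) = 0"
      proof
        fix s assume "s \<in> F - F \<inter> ?S"
        then have "A_block d s (trig_poly d K c) = (\<lambda>x. 0)" using F by (intro A_block_trig_poly_eq_0 K) auto
        then show "Lp_norm d q (A_block d s (trig_poly d K c)) = 0" using Lp_norm_zero[OF q] by simp
      qed
    qed (use F in auto)
    also have "\<dots> \<le> (\<Sum>s\<in>?S. Lp_norm d q (A_block d s (trig_poly d K c)))"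
      using S by (intro sum_mono2) auto
    finally show "(\<Sum>s\<in>F. Lp_norm d q (A_block d s (trig_poly d K c))) \<le> \<dots>" .
  qed
  also have "\<dots> < \<infinity>"
    unfolding infinity_ennreal_def ennreal_sum_less_top[OF S]
  proof
    fix s assume "s \<in> ?S"
    then have "A_block d s (trig_poly d K c) = trig_poly d (block_freqs d s) (\<lambda>k. complex_of_real (block_hat d s k) * fourier_coeff d (trig_poly d K c) k)"
      by (intro A_block_eq_trig_poly integrable_trig_poly) simp
    then show "Lp_norm d q (A_block d s (trig_poly d K c)) < top" using fin by simp
  qed
  finally have "Bq1_norm d q (trig_poly d K c) < \<infinity>" .
  then show ?thesis
    using fin set_integral_trig_poly_slice[of _ d K c] nz
    by (auto simp: Bq1_def Lp0_def Lp_def periodic_trig_poly)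
qed

lemma trig_poly_in_span:
  assumes "finite K"
  shows "trig_poly d K c \<in> cfun.span (character d ` K)"
proof -
  have "trig_poly d K c = (\<Sum>k\<in>K. cscale (c k) (character d k))"
    by (simp add: fun_eq_iff sum_fun_apply trig_poly_def cscale_def)
  then show ?thesis by (simp add: cfun.span_sum cfun.span_scale cfun.span_base)
qed

lemma span_characters:
  assumes "f \<in> cfun.span (character d ` K)" "finite K"
  obtains c where "f = trig_poly d K c"
proof -
  have "\<exists>c. f = trig_poly d K c"
    using assms(1)
  proof (induction rule: cfun.span_induct_alt)
    case base
    show ?case by (rule exI[of _ "\<lambda>_. 0"]) (simp add: trig_poly_def fun_eq_iff)
  next
    case (step a g f)
    then obtain k c where k: "k \<in> K" "g = character d k" "f = trig_poly d K c" by auto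
    have "(\<Sum>l\<in>K. (c l + (if l = k then a else 0)) * character d l x) = (\<Sum>l\<in>K. c l * character d l x) + a * character d k x" for x
      using k(1) assms(2)
      by (simp add: distrib_right sum.distrib if_distrib[of "\<lambda>y. y * _"] cong: if_cong)
    then have "cscale a g + f = trig_poly d K (\<lambda>l. c l + (if l = k then a else 0))"
      by (simp add: fun_eq_iff k cscale_def trig_poly_def)
    then show ?case by blast
  qed
  then show ?thesis using that by blast
qed

text \<open>In direction \<open>j\<close> the box \<open>block_freqs d s\<close> has
  \<open>2 * 2 ^ (s j + 1) + 1\<close> frequencies, at most \<open>2 ^ (s j + 3)\<close>.\<close>

definition rank_bound :: "nat \<Rightarrow> (nat \<Rightarrow> nat) set \<Rightarrow> nat" where
  "rank_bound d Q = (\<Sum>s\<in>Q. 2 ^ (\<Sum>j\<in>{1..d}. s j + 3))"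

lemma card_block_freqs_le: "card (block_freqs d s) \<le> 2 ^ (\<Sum>j\<in>{1..d}. s j + 3)"
proof -
  have "card (block_freqs d s) = (\<Prod>j\<in>{1..d}. card {- (2 ^ (s j + 1))..(2::int) ^ (s j + 1)})"
    unfolding block_freqs_def by (rule card_PiE) simp
  also have "\<dots> \<le> (\<Prod>j\<in>{1..d}. 2 ^ (s j + 3))"
  proof (intro prod_mono conjI)
    fix j
    have "card {- (2 ^ (s j + 1))..(2::int) ^ (s j + 1)} = nat (2 * 2 ^ (s j + 1) + 1)" by simp
    also have "\<dots> \<le> nat (2 ^ (s j + 3))"
    proof (rule nat_mono)
      have "(1::int) \<le> 2 ^ s j" by simp
      moreover have "(2::int) ^ (s j + 1) = 2 * 2 ^ s j" "(2::int) ^ (s j + 3) = 8 * 2 ^ s j" by (simp_all add: power_add)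
      ultimately show "2 * 2 ^ (s j + 1) + 1 \<le> (2::int) ^ (s j + 3)" by linarith
    qed
    also have "\<dots> = 2 ^ (s j + 3)" by (simp add: nat_power_eq)
    finally show "card {- (2 ^ (s j + 1))..(2::int) ^ (s j + 1)} \<le> 2 ^ (s j + 3)" .
  qed simp
  finally show ?thesis by (simp add: power_sum)
qed

lemma linear_width_le_A_sum:
  assumes q: "1 \<le> q" and Q: "finite Q" "Q \<subseteq> indices d" and M: "rank_bound d Q \<le> M"
  shows "linear_width M W (Bq1 d q) (Bq1_norm d q) \<le> (SUP w\<in>W. Bq1_norm d q (\<lambda>x. w x - A_sum d Q w x))"
proof -
  \<comment> \<open>Frequencies with a zero component are removed, because their characters violate
    the mean-zero condition and the subspace must lie in the target space. The multipliers of the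
    blocks vanish there.\<close>
  define K where "K = {k\<in>(\<Union>s\<in>Q. block_freqs d s). \<forall>j\<in>{1..d}. k j \<noteq> 0}"
  define L where "L = cfun.span (character d ` K)"
  have "finite (\<Union>s\<in>Q. block_freqs d s)" using Q by auto
  then have K: "finite K" unfolding K_def by (rule rev_finite_subset) auto
  have K': "K \<subseteq> freqs d" unfolding K_def using block_freqs_subset by blast
  have "card K \<le> card (\<Union>s\<in>Q. block_freqs d s)" using Q by (intro card_mono) (auto simp: K_def)
  also have "\<dots> \<le> (\<Sum>s\<in>Q. card (block_freqs d s))" by (rule card_UN_le[OF Q(1)])
  also have "\<dots> \<le> M" using M unfolding rank_bound_def by (intro order_trans[OF sum_mono[OF card_block_freqs_le]])
  finally have cK: "card K \<le> M" .
  have int: "integrable (torus d) f" if "f \<in> Bq1 d q" for f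
    using that Lp_integrable[OF q, of f] by (auto simp: Bq1_def Lp0_def)
  have LY: "L \<subseteq> Bq1 d q"
  proof
    fix f assume "f \<in> L"
    then obtain c where "f = trig_poly d K c" unfolding L_def using span_characters[OF _ K] by blast
    then show "f \<in> Bq1 d q" using trig_poly_in_Bq1[OF q K K', of c] unfolding K_def by blast
  qed
  \<comment> \<open>The definition of admissible subspaces asks for an independent basis, which is
    extracted from the spanning characters.\<close>
  obtain B where B: "B \<subseteq> character d ` K" "cfun.independent B" "character d ` K \<subseteq> cfun.span B"
    by (rule cfun.maximal_independent_subset)
  have "cfun.span B = L"
    unfolding L_def
  proof
    show "cfun.span B \<subseteq> cfun.span (character d ` K)" by (rule cfun.span_mono[OF B(1)])
    show "cfun.span (character d ` K) \<subseteq> cfun.span B" by (rule cfun.span_minimal[OF B(3) cfun.subspace_span])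
  qed
  moreover have "finite B" using B(1) K by (simp add: finite_subset)
  moreover have "card B \<le> M"
  proof -
    have "card B \<le> card (character d ` K)" using B(1) K by (intro card_mono) auto
    also have "\<dots> \<le> card K" by (rule card_image_le[OF K])
    finally show ?thesis using cK by simp
  qed
  ultimately have L: "L \<in> subspaces_upto (Bq1 d q) M"
    using B(2) LY by (auto simp: subspaces_upto_def)
  have T: "cont_linear_into (Bq1 d q) (Bq1_norm d q) L (A_sum d Q)"
    unfolding cont_linear_into_def
  proof (intro conjI ballI allI impI)
    fix f assume f: "f \<in> Bq1 d q"
    show "A_sum d Q f \<in> L"
    proof -
      have "A_block d s f \<in> L" if s: "s \<in> Q" for s
      proof -
        have si: "s \<in> indices d" using s Q by auto
        define c where "c k = complex_of_real (block_hat d s k) * fourier_coeff d f k" for k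
        have "A_block d s f = trig_poly d (block_freqs d s) c"
          unfolding c_def by (rule A_block_eq_trig_poly[OF si int[OF f]])
        also have "\<dots> = trig_poly d (block_freqs d s \<inter> K) c"
        proof (rule trig_poly_mono_neutral[symmetric])
          fix k assume "k \<in> block_freqs d s - block_freqs d s \<inter> K"
          then obtain j where j: "j \<in> {1..d}" "k j = 0" using s by (auto simp: K_def)
          then have "block_hat d s k = 0" using block_hat_support(1)[OF si _ j(1), of k] by auto
          then show "c k = 0" by (simp add: c_def)
        qed auto
        also have "\<dots> \<in> cfun.span (character d ` (block_freqs d s \<inter> K))"
          by (rule trig_poly_in_span) simp
        also have "\<dots> \<subseteq> L" unfolding L_def by (intro cfun.span_mono) auto
        finally show ?thesis .
      qed
      then have "(\<Sum>s\<in>Q. A_block d s f) \<in> L" unfolding L_def by (rule cfun.span_sum)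
      moreover have "A_sum d Q f = (\<Sum>s\<in>Q. A_block d s f)" by (simp add: A_sum_def fun_eq_iff sum_fun_apply)
      ultimately show ?thesis by simp
    qed
  next
    fix f g assume f: "f \<in> Bq1 d q" and g: "g \<in> Bq1 d q"
    have "A_block d s (f + g) x = A_block d s f x + A_block d s g x" if "s \<in> Q" for s x
      using A_block_add[of s d f g] that Q int[OF f] int[OF g] by (auto simp: plus_fun_def)
    then show "A_sum d Q (f + g) = A_sum d Q f + A_sum d Q g"
      by (simp add: A_sum_def fun_eq_iff sum.distrib)
  next
    fix c f
    show "A_sum d Q (cscale c f) = cscale c (A_sum d Q f)"
      by (simp add: A_sum_def cscale_def fun_eq_iff A_block_cmult sum_distrib_left)
  next
    fix f :: "(nat \<Rightarrow> real) \<Rightarrow> complex" and e :: ennreal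
    assume f: "f \<in> Bq1 d q" and e: "0 < e"
    define C where "C = A_const d * 3 ^ d"
    have C: "0 < C" using A_const_ge_1[of d] by (simp add: C_def)
    \<comment> \<open>The tolerance may be infinite; a finite one below it can be divided by
      \<open>C\<close>.\<close>
    obtain e' where e': "0 < e'" "ennreal e' \<le> e"
    proof (cases e)
      case (real t)
      then show ?thesis using e that[of t] by auto
    next
      case top
      then show ?thesis using that[of 1] by simp
    qed
    have "Bq1_norm d q (A_sum d Q g - A_sum d Q f) < e"
      if g: "g \<in> Bq1 d q" and gf: "Bq1_norm d q (g - f) < ennreal (e' / C)" for g
    proof -
      have gf_int: "integrable (torus d) (\<lambda>x. g x - f x)" "integrable (torus d) (\<lambda>x. - f x)" using int[OF f] int[OF g] by auto
      have "A_block d s (\<lambda>x. g x - f x) x = A_block d s g x - A_block d s f x" if "s \<in> Q" for s x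
        using A_block_add[of s d g "\<lambda>x. - 1 * f x"] A_block_cmult[of d s "-1" f] that Q int[OF g] gf_int by (auto simp: fun_eq_iff)
      then have "A_sum d Q g - A_sum d Q f = A_sum d Q (\<lambda>x. g x - f x)"
        by (simp add: A_sum_def fun_eq_iff sum_subtractf)
      then have "Bq1_norm d q (A_sum d Q g - A_sum d Q f) \<le> ennreal C * Bq1_norm d q (g - f)"
        using Bq1_norm_A_sum_le[OF q gf_int(1) Q] by (simp add: C_def fun_diff_def)
      also have "\<dots> < ennreal C * ennreal (e' / C)"
        using gf C by (intro ennreal_mult_strict_left_mono) auto
      also have "\<dots> = ennreal e'" using C e' by (simp flip: ennreal_mult)
      finally show ?thesis using e'(2) by simp
    qed
    then show "\<exists>\<delta>>0. \<forall>g\<in>Bq1 d q. Bq1_norm d q (g - f) < \<delta> \<longrightarrow> Bq1_norm d q (A_sum d Q g - A_sum d Q f) < e"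
      using C e' by (intro exI[of _ "ennreal (e' / C)"]) auto
  qed
  have "linear_width M W (Bq1 d q) (Bq1_norm d q) \<le> (SUP w\<in>W. Bq1_norm d q (w - A_sum d Q w))"
    unfolding linear_width_def
    by (rule INF_lower2[OF L], rule INF_lower2[of "A_sum d Q"]) (use T in simp_all)
  then show ?thesis by (simp add: fun_diff_def)
qed

subsection \<open>The Besov class\<close>

abbreviation weight :: "nat \<Rightarrow> (nat \<Rightarrow> real) \<Rightarrow> (nat \<Rightarrow> nat) \<Rightarrow> real" where
  "weight d r s \<equiv> (\<Sum>j=1..d. real (s j) * r j)"

text \<open>For finite \<theta> let c_u be the norm of block \<open>u\<close> times
  \<open>2 powr weight d r u\<close>; the \<theta>-th powers of the c_u sum to at most 1. Truncating
  c_u at \<open>X powr - (1 / \<theta>)\<close> splits the sum in two: the constant parts are summed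
  by \<open>S\<close>, and in the parts with the \<theta>-th power the factor
  \<open>2 powr - weight d r u\<close> is bounded by \<open>m\<close>. The two balance when
  \<open>S\<close> is about \<open>X * m\<close>, that is, when about \<open>X\<close> blocks carry
  the largest factor. For \<theta> = \<infinity> the exponent is 0 and the first term is the
  bound.\<close>

lemma besov_sum_le:
  assumes \<theta>: "1 \<le> \<theta>" and f: "besov_norm d r p \<theta> f \<le> 1" and U: "U \<subseteq> indices d" and X: "0 < X"
    and S: "\<And>F. finite F \<Longrightarrow> F \<subseteq> U \<Longrightarrow> (\<Sum>u\<in>F. 2 powr - weight d r u) \<le> S"
    and m: "\<And>u. u \<in> U \<Longrightarrow> 2 powr - weight d r u \<le> m" "0 \<le> m"
  shows "(\<Sum>\<^sub>\<infinity>u\<in>U. Lp_norm d p (beta_block d p u f))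
     \<le> ennreal (X powr - enn2real (1 / \<theta>) * S + X powr (1 - enn2real (1 / \<theta>)) * m)"
proof (rule ennreal_infsum_leI)
  fix F assume F: "finite F" "F \<subseteq> U"
  have S0: "0 \<le> S" using S[of "{}"] by simp
  let ?y = "\<lambda>u. Lp_norm d p (beta_block d p u f)"
  from \<theta> show "sum ?y F \<le> ennreal (X powr - enn2real (1 / \<theta>) * S + X powr (1 - enn2real (1 / \<theta>)) * m)"
  proof (cases rule: ennreal_exponent_cases)
    case 1
    have "?y u \<le> ennreal (2 powr - weight d r u)" if "u \<in> F" for u
    proof -
      have "ennreal (2 powr weight d r u) * ?y u \<le> besov_norm d r p \<theta> f"
        unfolding besov_norm_def 1 using that F U by (auto intro!: SUP_upper2[of u])
      then have "ennreal (2 powr weight d r u) * ?y u \<le> 1" using f by (rule order_trans)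
      then have "ennreal (2 powr - weight d r u) * (ennreal (2 powr weight d r u) * ?y u) \<le> ennreal (2 powr - weight d r u) * 1"
        by (rule mult_left_mono) simp
      then show ?thesis
        by (simp add: mult.assoc[symmetric] ennreal_mult[symmetric] powr_add[symmetric])
    qed
    then have "sum ?y F \<le> (\<Sum>u\<in>F. ennreal (2 powr - weight d r u))" by (intro sum_mono)
    also have "\<dots> = ennreal (\<Sum>u\<in>F. 2 powr - weight d r u)" by (rule sum_ennreal) simp
    also have "\<dots> \<le> ennreal (X powr - enn2real (1 / \<theta>) * S + X powr (1 - enn2real (1 / \<theta>)) * m)"
    proof (rule ennreal_leI)
      have "enn2real (1 / \<theta>) = 0" unfolding 1 by simp
      moreover have "0 \<le> X * m" using X m by simp
      ultimately show "(\<Sum>u\<in>F. 2 powr - weight d r u) \<le> X powr - enn2real (1 / \<theta>) * S + X powr (1 - enn2real (1 / \<theta>)) * m"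
        using S[OF F] X by simp
    qed
    finally show ?thesis .
  next
    case (2 T)
    define \<tau> where "\<tau> = 1 / T"
    have \<tau>: "enn2real (1 / \<theta>) = \<tau>"
      using 2 by (simp add: \<tau>_def divide_ennreal flip: ennreal_1)
    define c where "c u = 2 powr weight d r u * enn2real (?y u)" for u
    have eT: "enn2real \<theta> = T" "\<theta> \<noteq> \<infinity>" using 2 by auto
    have bs: "(\<Sum>\<^sub>\<infinity>s\<in>indices d. ennreal (2 powr (weight d r s * T)) * enn_powr (?y s) T) \<le> 1"
    proof -
      have "enn_powr (\<Sum>\<^sub>\<infinity>s\<in>indices d. ennreal (2 powr (weight d r s * T)) * enn_powr (?y s) T) (1 / T) \<le> ennreal 1"
        using f eT by (simp add: besov_norm_def)
      then show ?thesis using 2(1) by (subst (asm) enn_powr_le_iff) auto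
    qed
    have sumF: "(\<Sum>s\<in>F. ennreal (2 powr (weight d r s * T)) * enn_powr (?y s) T) \<le> 1"
      using ennreal_sum_le_infsum[of F "indices d" "\<lambda>s. ennreal (2 powr (weight d r s * T)) * enn_powr (?y s) T"] bs F U
      by (meson order_trans)
    have yfin: "?y u < \<infinity>" if "u \<in> F" for u
    proof (rule ccontr)
      assume "\<not> ?y u < \<infinity>"
      then have "ennreal (2 powr (weight d r u * T)) * enn_powr (?y u) T = \<infinity>"
        by (simp add: enn_powr_def ennreal_mult_top less_top)
      moreover have "ennreal (2 powr (weight d r u * T)) * enn_powr (?y u) T \<le> (\<Sum>s\<in>F. ennreal (2 powr (weight d r s * T)) * enn_powr (?y s) T)"
        using that F by (intro member_le_sum) auto
      ultimately show False using sumF by (simp add: top_unique)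
    qed
    have y: "?y u = ennreal (enn2real (?y u))" if "u \<in> F" for u
      using yfin[OF that] by (simp add: less_top)
    have "(\<Sum>u\<in>F. ennreal (c u powr T)) = (\<Sum>s\<in>F. ennreal (2 powr (weight d r s * T)) * enn_powr (?y s) T)"
    proof (rule sum.cong)
      fix u assume u: "u \<in> F"
      have "enn_powr (?y u) T = ennreal (enn2real (?y u) powr T)"
        by (subst y[OF u]) (simp add: enn_powr_ennreal)
      then show "ennreal (c u powr T) = ennreal (2 powr (weight d r u * T)) * enn_powr (?y u) T"
        by (simp add: c_def powr_mult powr_powr ennreal_mult)
    qed simp
    then have "ennreal (\<Sum>u\<in>F. c u powr T) \<le> ennreal 1" using sumF by (simp add: sum_ennreal)
    then have cT: "(\<Sum>u\<in>F. c u powr T) \<le> 1" by (subst (asm) ennreal_le_iff) auto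
    have X1: "(X powr - \<tau>) powr (1 - T) = X powr (1 - \<tau>)"
    proof -
      have "- \<tau> * (1 - T) = 1 - \<tau>" using 2 by (simp add: \<tau>_def field_simps)
      then show ?thesis by (simp add: powr_powr)
    qed
    have "enn2real (?y u) \<le> X powr - \<tau> * 2 powr - weight d r u + X powr (1 - \<tau>) * m * c u powr T" if u: "u \<in> F" for u
    proof -
      have c0: "0 \<le> c u" by (simp add: c_def)
      have "enn2real (?y u) = 2 powr - weight d r u * c u"
        by (simp add: c_def mult.assoc[symmetric] powr_add[symmetric])
      also have "\<dots> \<le> 2 powr - weight d r u * (X powr - \<tau> + c u powr T * X powr (1 - \<tau>))"
        using le_truncation_plus_powr[OF 2(1) c0, of "X powr - \<tau>"] X X1 by (intro mult_left_mono) auto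
      also have "\<dots> = X powr - \<tau> * 2 powr - weight d r u + 2 powr - weight d r u * (X powr (1 - \<tau>) * c u powr T)"
        by (simp add: algebra_simps)
      also have "2 powr - weight d r u * (X powr (1 - \<tau>) * c u powr T) \<le> m * (X powr (1 - \<tau>) * c u powr T)"
        using m(1)[of u] u F by (intro mult_right_mono) auto
      finally show ?thesis by (simp add: algebra_simps)
    qed
    then have "(\<Sum>u\<in>F. enn2real (?y u)) \<le> (\<Sum>u\<in>F. X powr - \<tau> * 2 powr - weight d r u + X powr (1 - \<tau>) * m * c u powr T)"
      by (rule sum_mono)
    also have "\<dots> = X powr - \<tau> * (\<Sum>u\<in>F. 2 powr - weight d r u) + X powr (1 - \<tau>) * m * (\<Sum>u\<in>F. c u powr T)"
      by (simp only: sum.distrib sum_distrib_left)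
    also have "\<dots> \<le> X powr - \<tau> * S + X powr (1 - \<tau>) * m * 1"
      using S[OF F] cT m by (intro add_mono mult_left_mono) auto
    finally have "ennreal (\<Sum>u\<in>F. enn2real (?y u)) \<le> ennreal (X powr - \<tau> * S + X powr (1 - \<tau>) * m)"
      by (intro ennreal_leI) simp
    moreover have "sum ?y F = ennreal (\<Sum>u\<in>F. enn2real (?y u))"
      using y by (subst sum_ennreal[symmetric]) (auto intro!: sum.cong)
    ultimately show ?thesis unfolding \<tau> by simp
  qed
qed

subsection \<open>Layers of the weighted hyperbolic cross\<close>

text \<open>In direction \<nu> the weight is exactly 1, so within a layer of unit width the entry
  \<open>s \<nu>\<close> is determined by the others and can be forgotten. The other leading entries
  take at most \<open>l\<close> values each, and the entries beyond \<nu> contribute geometric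
  series.\<close>

lemma layer_sum_le:
  fixes b :: real
  assumes \<nu>: "1 \<le> \<nu>" "\<nu> \<le> d" and g: "g \<nu> = 1" "\<And>j. j \<in> {1..d} \<Longrightarrow> 1 \<le> g j" and b: "0 \<le> b" "b < 1"
    and F: "finite F" "F \<subseteq> {s\<in>indices d. real l \<le> weight d g s \<and> weight d g s < real l + 1}"
  shows "(\<Sum>s\<in>F. \<Prod>j\<in>{\<nu>+1..d}. b ^ s j) \<le> (1 / (1 - b)) ^ (d - \<nu>) * real l ^ (\<nu> - 1)"
proof -
  define R where "R = (\<lambda>s::nat \<Rightarrow> nat. restrict s ({1..d} - {\<nu>}))"
  define h where "h s = (\<Prod>j\<in>{1..d} - {\<nu>}. if j < \<nu> then 1 else b ^ s j)" for s :: "nat \<Rightarrow> nat"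
  have split: "weight d g s = real (s \<nu>) + (\<Sum>j\<in>{1..d} - {\<nu>}. real (s j) * g j)" for s
    using \<nu> g by (subst sum.remove[of _ \<nu>]) auto
  have hR: "(\<Prod>j\<in>{\<nu>+1..d}. b ^ s j) = h (R s)" for s
  proof -
    have "h (R s) = (\<Prod>j\<in>{1..d} - {\<nu>}. if j < \<nu> then 1 else b ^ s j)"
      unfolding h_def R_def by (intro prod.cong) auto
    also have "\<dots> = (\<Prod>j\<in>{\<nu>+1..d}. if j < \<nu> then 1 else b ^ s j)"
      by (rule prod.mono_neutral_right) auto
    also have "\<dots> = (\<Prod>j\<in>{\<nu>+1..d}. b ^ s j)" by (rule prod.cong) auto
    finally show ?thesis ..
  qed
  have inj: "inj_on R F"
  proof (rule inj_onI)
    fix s t assume st: "s \<in> F" "t \<in> F" and eq: "R s = R t"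
    have off: "s j = t j" if "j \<in> {1..d} - {\<nu>}" for j
      using fun_cong[OF eq, of j] that by (simp add: R_def)
    then have "(\<Sum>j\<in>{1..d} - {\<nu>}. real (s j) * g j) = (\<Sum>j\<in>{1..d} - {\<nu>}. real (t j) * g j)"
      by (intro sum.cong) auto
    moreover have "real l \<le> weight d g s" "weight d g s < real l + 1" "real l \<le> weight d g t" "weight d g t < real l + 1"
      using st F by auto
    \<comment> \<open>Two integers, shifted by the same amount, lie in one half-open interval of
      length 1.\<close>
    ultimately have "s \<nu> = t \<nu>" unfolding split by linarith
    then have "s j = t j" if "j \<in> {1..d}" for j using off that by (cases "j = \<nu>") auto
    moreover have "s \<in> indices d" "t \<in> indices d" using st F by auto
    ultimately show "s = t" unfolding indices_def by (intro PiE_ext[of s _ _ t]) auto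
  qed
  have img: "R ` F \<subseteq> (\<Pi>\<^sub>E j\<in>{1..d} - {\<nu>}. {1..l})"
  proof
    fix \<sigma> assume "\<sigma> \<in> R ` F"
    then obtain s where s: "s \<in> F" "\<sigma> = R s" by auto
    have si: "s \<in> indices d" and w: "weight d g s < real l + 1" using s F by auto
    have "s j \<in> {1..l}" if j: "j \<in> {1..d} - {\<nu>}" for j
    proof -
      have "real (s j) * 1 \<le> real (s j) * g j" using g(2)[of j] j by (intro mult_left_mono) auto
      also have "\<dots> \<le> weight d g s"
        using j by (intro member_le_sum mult_nonneg_nonneg) (auto intro: order_trans[OF zero_le_one g(2)])
      finally have "s j \<le> l" using w by linarith
      moreover have "1 \<le> s j" using indices_ge_1[OF si] j by auto
      ultimately show ?thesis by simp
    qed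
    then show "\<sigma> \<in> (\<Pi>\<^sub>E j\<in>{1..d} - {\<nu>}. {1..l})" unfolding s(2) R_def by auto
  qed
  have geo: "(\<Sum>i\<in>{1..l}. b ^ i) \<le> 1 / (1 - b)"
  proof -
    have "(\<Sum>i\<in>{1..l}. b ^ i) \<le> (\<Sum>i. b ^ i)"
      using b by (intro sum_le_suminf summable_geometric) auto
    then show ?thesis using b by (simp add: suminf_geometric)
  qed
  have "(\<Sum>s\<in>F. \<Prod>j\<in>{\<nu>+1..d}. b ^ s j) = (\<Sum>\<sigma>\<in>R ` F. h \<sigma>)"
    by (simp only: hR sum.reindex[OF inj] o_def)
  also have "\<dots> \<le> (\<Sum>\<sigma>\<in>(\<Pi>\<^sub>E j\<in>{1..d} - {\<nu>}. {1..l}). h \<sigma>)"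
    unfolding h_def using b by (intro sum_mono2 img finite_PiE prod_nonneg) auto
  also have "\<dots> = (\<Prod>j\<in>{1..d} - {\<nu>}. \<Sum>i\<in>{1..l}. if j < \<nu> then 1 else b ^ i)"
    unfolding h_def by (rule prod_sum_PiE[symmetric]) auto
  also have "\<dots> = (\<Prod>j\<in>{1..<\<nu>} \<union> {\<nu>+1..d}. \<Sum>i\<in>{1..l}. if j < \<nu> then 1 else b ^ i)"
    using \<nu> by (intro prod.cong) auto
  also have "\<dots> = (\<Prod>j\<in>{1..<\<nu>}. \<Sum>i\<in>{1..l}. if j < \<nu> then 1 else b ^ i) * (\<Prod>j\<in>{\<nu>+1..d}. \<Sum>i\<in>{1..l}. if j < \<nu> then 1 else b ^ i)"
    by (rule prod.union_disjoint) auto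
  also have "(\<Prod>j\<in>{1..<\<nu>}. \<Sum>i\<in>{1..l}. if j < \<nu> then 1 else b ^ i) = (\<Prod>j\<in>{1..<\<nu>}. real l)"
    by (rule prod.cong) auto
  also have "(\<Prod>j\<in>{\<nu>+1..d}. \<Sum>i\<in>{1..l}. if j < \<nu> then 1 else b ^ i) = (\<Prod>j\<in>{\<nu>+1..d}. \<Sum>i\<in>{1..l}. b ^ i)"
    by (rule prod.cong) auto
  also have "(\<Prod>j\<in>{1..<\<nu>}. real l) * (\<Prod>j\<in>{\<nu>+1..d}. \<Sum>i\<in>{1..l}. b ^ i) \<le> real l ^ (\<nu> - 1) * (1 / (1 - b)) ^ (d - \<nu>)"
  proof -
    have "(\<Sum>i\<in>{1..l}. b ^ i) ^ (d - \<nu>) \<le> (1 / (1 - b)) ^ (d - \<nu>)"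
      using geo b by (intro power_mono sum_nonneg) auto
    then show ?thesis by (simp add: mult_left_mono)
  qed
  finally show ?thesis by (simp add: mult.commute)
qed

lemma summable_power_geometric:
  fixes c :: real
  assumes "0 < c" "c < 1"
  shows "summable (\<lambda>i. c ^ i * real (1 + i) ^ k)"
proof -
  have "(\<lambda>i. (1 + inverse (real (Suc i))) ^ k * c) \<longlonglongrightarrow> (1 + 0) ^ k * c"
    by (intro tendsto_intros LIMSEQ_inverse_real_of_nat)
  then have "(\<lambda>i. (1 + inverse (real (Suc i))) ^ k * c) \<longlonglongrightarrow> c" by simp
  then have "\<forall>\<^sub>F i in sequentially. (1 + inverse (real (Suc i))) ^ k * c < (1 + c) / 2"
    using assms by (intro order_tendstoD) auto
  then obtain N where N: "\<And>i. N \<le> i \<Longrightarrow> (1 + inverse (real (Suc i))) ^ k * c < (1 + c) / 2"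
    unfolding eventually_sequentially by blast
  show ?thesis
  proof (rule summable_ratio_test[of "(1 + c) / 2" N])
    show "(1 + c) / 2 < 1" using assms by simp
    fix i assume i: "N \<le> i"
    have "real (1 + Suc i) = (1 + inverse (real (Suc i))) * real (1 + i)" by (simp add: field_simps)
    then have "c ^ Suc i * real (1 + Suc i) ^ k = ((1 + inverse (real (Suc i))) ^ k * c) * (c ^ i * real (1 + i) ^ k)"
      by (simp only: power_mult_distrib power_Suc) (simp add: mult_ac)
    also have "\<dots> \<le> (1 + c) / 2 * (c ^ i * real (1 + i) ^ k)"
      using N[OF i] assms by (intro mult_right_mono) auto
    finally show "norm (c ^ Suc i * real (1 + Suc i) ^ k) \<le> (1 + c) / 2 * norm (c ^ i * real (1 + i) ^ k)"
      using assms by (simp add: abs_mult)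
  qed
qed

text \<open>The gap between \<open>r 1\<close> and the exponents beyond \<nu> is used twice. The
  weight \<open>g\<close> takes one share \<kappa>, so that the number of frequencies in a layer
  decays geometrically in these directions; the other share leaves a geometric decay of the block
  norms. Hence neither the rank nor the tail picks up logarithms from there.\<close>

locale anisotropic =
  fixes d \<nu> :: nat and r :: "nat \<Rightarrow> real" and \<kappa> :: real
  assumes nu: "1 \<le> \<nu>" "\<nu> \<le> d" and r1: "0 < r 1" and kappa: "0 < \<kappa>"
    and r_eq: "\<And>j. j \<in> {1..\<nu>} \<Longrightarrow> r j = r 1"
    and r_ge: "\<And>j. j \<in> {\<nu>+1..d} \<Longrightarrow> r 1 * (1 + 2 * \<kappa>) \<le> r j"
begin

definition g :: "nat \<Rightarrow> real" where
  "g j = (if j \<le> \<nu> then 1 else 1 + \<kappa>)"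

definition cross :: "nat \<Rightarrow> (nat \<Rightarrow> nat) set" where
  "cross n = {s\<in>indices d. weight d g s < real n}"

lemma g_ge_1: "1 \<le> g j" using kappa by (simp add: g_def)

lemma le_weight: "s \<in> indices d \<Longrightarrow> j \<in> {1..d} \<Longrightarrow> real (s j) \<le> weight d g s"
proof -
  assume j: "j \<in> {1..d}"
  have "real (s j) * 1 \<le> real (s j) * g j" using g_ge_1 by (intro mult_left_mono) auto
  also have "\<dots> \<le> weight d g s"
    using j by (intro member_le_sum mult_nonneg_nonneg) (auto intro: order_trans[OF zero_le_one g_ge_1])
  finally show ?thesis by simp
qed

lemma weight_ge_1: "s \<in> indices d \<Longrightarrow> 1 \<le> weight d g s"
  using le_weight[of s 1] indices_ge_1[of s d 1] nu by fastforce

lemma finite_cross: "finite (cross n)"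
proof (rule finite_subset)
  show "cross n \<subseteq> {1..d} \<rightarrow>\<^sub>E {..n}"
  proof
    fix s assume s: "s \<in> cross n"
    have "s j \<le> n" if "j \<in> {1..d}" for j
      using le_weight[of s j] s that by (auto simp: cross_def)
    then show "s \<in> {1..d} \<rightarrow>\<^sub>E {..n}" using s by (auto simp: cross_def indices_def PiE_iff)
  qed
qed (intro finite_PiE, auto)

lemma cross_subset: "cross n \<subseteq> indices d" by (auto simp: cross_def)

definition layer :: "nat \<Rightarrow> (nat \<Rightarrow> nat) set" where
  "layer l = {s\<in>indices d. real l \<le> weight d g s \<and> weight d g s < real l + 1}"

lemma finite_layer: "finite (layer l)"
  by (rule finite_subset[OF _ finite_cross[of "l + 1"]]) (auto simp: layer_def cross_def)

lemma layer_floor: "s \<in> indices d \<Longrightarrow> s \<in> layer (nat \<lfloor>weight d g s\<rfloor>)"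
  using weight_ge_1[of s] by (auto simp: layer_def)

lemma layer_disjoint: "l \<noteq> l' \<Longrightarrow> layer l \<inter> layer l' = {}"
  by (auto simp: layer_def)

lemma layer_prod_sum_le:
  assumes "0 < a" "F \<subseteq> layer l"
  shows "(\<Sum>s\<in>F. 2 powr - (a * real (\<Sum>j\<in>{\<nu>+1..d}. s j))) \<le> (1 / (1 - 2 powr - a)) ^ (d - \<nu>) * real l ^ (\<nu> - 1)"
proof -
  have "2 powr - (a * real (\<Sum>j\<in>{\<nu>+1..d}. s j)) = (\<Prod>j\<in>{\<nu>+1..d}. (2 powr - a) ^ s j)" for s :: "nat \<Rightarrow> nat"
  proof -
    have "(\<Prod>j\<in>{\<nu>+1..d}. (2 powr - a) ^ s j) = ((2::real) powr - a) ^ (\<Sum>j\<in>{\<nu>+1..d}. s j)"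
      by (rule power_sum[symmetric])
    also have "\<dots> = 2 powr (- a * real (\<Sum>j\<in>{\<nu>+1..d}. s j))"
      by (subst powr_realpow[symmetric]) (simp_all add: powr_powr del: of_nat_sum)
    finally show ?thesis by (simp only: minus_mult_left)
  qed
  moreover have "(2::real) powr - a < 1" using assms powr_less_mono[of "- a" 0 2] by simp
  moreover have "g \<nu> = 1" by (simp add: g_def)
  ultimately show ?thesis
    using layer_sum_le[OF nu, of g "2 powr - a" F l] assms g_ge_1 finite_subset[OF assms(2) finite_layer]
    by (simp add: layer_def)
qed

lemma weight_g: "weight d g s = real (\<Sum>j=1..d. s j) + \<kappa> * real (\<Sum>j\<in>{\<nu>+1..d}. s j)"
proof -
  have "weight d g s = (\<Sum>j=1..d. real (s j)) + (\<Sum>j=1..d. if j \<le> \<nu> then 0 else \<kappa> * real (s j))"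
    unfolding sum.distrib[symmetric] by (rule sum.cong) (auto simp: g_def algebra_simps)
  also have "(\<Sum>j=1..d. if j \<le> \<nu> then 0 else \<kappa> * real (s j)) = (\<Sum>j\<in>{\<nu>+1..d}. if j \<le> \<nu> then 0 else \<kappa> * real (s j))"
    by (rule sum.mono_neutral_right) auto
  also have "\<dots> = (\<Sum>j\<in>{\<nu>+1..d}. \<kappa> * real (s j))" by (rule sum.cong) auto
  finally show ?thesis by (simp add: sum_distrib_left)
qed

text \<open>The term with \<kappa> is the share of the smoothness that \<open>g\<close> leaves over;
  it makes the tail sums converge in the directions beyond \<nu>.\<close>

lemma weight_r_ge: "r 1 * (weight d g s + \<kappa> * real (\<Sum>j\<in>{\<nu>+1..d}. s j)) \<le> weight d r s"
proof -
  have "r 1 * (weight d g s + \<kappa> * real (\<Sum>j\<in>{\<nu>+1..d}. s j)) = (\<Sum>j=1..d. real (s j) * (r 1 * (if j \<le> \<nu> then 1 else 1 + 2 * \<kappa>)))"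
  proof -
    have "(\<Sum>j\<in>{\<nu>+1..d}. \<kappa> * real (s j)) = (\<Sum>j=1..d. if j \<le> \<nu> then 0 else \<kappa> * real (s j))"
    proof -
      have "(\<Sum>j=1..d. if j \<le> \<nu> then 0 else \<kappa> * real (s j)) = (\<Sum>j\<in>{\<nu>+1..d}. if j \<le> \<nu> then 0 else \<kappa> * real (s j))"
        by (rule sum.mono_neutral_right) auto
      also have "\<dots> = (\<Sum>j\<in>{\<nu>+1..d}. \<kappa> * real (s j))" by (rule sum.cong) auto
      finally show ?thesis ..
    qed
    then have "weight d g s + \<kappa> * real (\<Sum>j\<in>{\<nu>+1..d}. s j) = (\<Sum>j=1..d. real (s j) * g j + (if j \<le> \<nu> then 0 else \<kappa> * real (s j)))"
      by (simp only: sum.distrib of_nat_sum sum_distrib_left)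
    then show ?thesis
      unfolding sum_distrib_left by (simp only: sum_distrib_left) (rule sum.cong, auto simp: g_def algebra_simps)
  qed
  also have "\<dots> \<le> weight d r s"
  proof (intro sum_mono mult_left_mono)
    fix j assume j: "j \<in> {1..d}"
    show "r 1 * (if j \<le> \<nu> then 1 else 1 + 2 * \<kappa>) \<le> r j"
    proof (cases "j \<le> \<nu>")
      case True
      then show ?thesis using r_eq[of j] j by simp
    next
      case False
      then show ?thesis using r_ge[of j] j by simp
    qed
  qed auto
  finally show ?thesis .
qed

text \<open>Summation over unit layers. In layer \<open>l\<close> the number 2 to the sum of the
  entries is at most \<open>2 ^ (l + 1)\<close> times a geometric factor in the entries beyond
  \<nu>, so the layer contributes at most a constant times \<open>2 ^ l * l ^ (\<nu> - 1)\<close>,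
  and the geometric sum over \<open>l < n\<close> is of the order of its last term.\<close>

lemma rank_cross:
  obtains C where "0 < C" "\<And>n. real (rank_bound d (cross n)) \<le> C * 2 ^ n * real n ^ (\<nu> - 1)"
proof -
  define B where "B = (1 / (1 - 2 powr - \<kappa>)) ^ (d - \<nu>)"
  have B: "0 < B"
  proof -
    have "(2::real) powr - \<kappa> < 1" using kappa powr_less_mono[of "- \<kappa>" 0 2] by simp
    then show ?thesis by (simp add: B_def)
  qed
  have "real (rank_bound d (cross n)) \<le> (2 ^ (3 * d) * 2 * B) * 2 ^ n * real n ^ (\<nu> - 1)" for n
  proof -
    have cr: "cross n = (\<Union>l\<in>{..<n}. layer l \<inter> cross n)"
    proof -
      have "s \<in> (\<Union>l\<in>{..<n}. layer l \<inter> cross n)" if "s \<in> cross n" for s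
      proof -
        have "s \<in> layer (nat \<lfloor>weight d g s\<rfloor>)" using that layer_floor by (auto simp: cross_def)
        moreover have "nat \<lfloor>weight d g s\<rfloor> < n" using that weight_ge_1[of s] by (auto simp: cross_def) linarith
        ultimately show ?thesis using that by auto
      qed
      then show ?thesis by auto
    qed
    have "real (rank_bound d (cross n)) = 2 ^ (3 * d) * (\<Sum>s\<in>cross n. 2 ^ (\<Sum>j=1..d. s j))"
      by (simp add: rank_bound_def sum.distrib power_add sum_distrib_left mult.commute)
    also have "(\<Sum>s\<in>cross n. (2::real) ^ (\<Sum>j=1..d. s j)) = (\<Sum>l<n. \<Sum>s\<in>layer l \<inter> cross n. 2 ^ (\<Sum>j=1..d. s j))"
      by (subst cr, subst sum.UNION_disjoint) (use finite_layer layer_disjoint in auto)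
    also have "\<dots> \<le> (\<Sum>l<n. 2 * 2 ^ l * (B * real n ^ (\<nu> - 1)))"
    proof (rule sum_mono)
      fix l assume l: "l \<in> {..<n}"
      have "(\<Sum>s\<in>layer l \<inter> cross n. (2::real) ^ (\<Sum>j=1..d. s j))
          \<le> (\<Sum>s\<in>layer l \<inter> cross n. 2 * 2 ^ l * 2 powr - (\<kappa> * real (\<Sum>j\<in>{\<nu>+1..d}. s j)))"
      proof (rule sum_mono)
        fix s assume s: "s \<in> layer l \<inter> cross n"
        have "(2::real) ^ (\<Sum>j=1..d. s j) = 2 powr (weight d g s - \<kappa> * real (\<Sum>j\<in>{\<nu>+1..d}. s j))"
          unfolding weight_g by (simp add: powr_realpow del: of_nat_sum)
        also have "\<dots> \<le> 2 powr (real (l + 1) - \<kappa> * real (\<Sum>j\<in>{\<nu>+1..d}. s j))"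
          using s by (intro powr_mono) (auto simp: layer_def)
        also have "\<dots> = 2 powr real (l + 1) * 2 powr - (\<kappa> * real (\<Sum>j\<in>{\<nu>+1..d}. s j))"
          by (simp only: powr_add[symmetric]) simp
        also have "2 powr real (l + 1) = 2 * (2::real) ^ l" by (subst powr_realpow) auto
        finally show "(2::real) ^ (\<Sum>j=1..d. s j) \<le> 2 * 2 ^ l * 2 powr - (\<kappa> * real (\<Sum>j\<in>{\<nu>+1..d}. s j))" .
      qed
      also have "\<dots> = 2 * 2 ^ l * (\<Sum>s\<in>layer l \<inter> cross n. 2 powr - (\<kappa> * real (\<Sum>j\<in>{\<nu>+1..d}. s j)))"
        by (simp only: sum_distrib_left)
      also have "\<dots> \<le> 2 * 2 ^ l * (B * real l ^ (\<nu> - 1))"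
        unfolding B_def by (intro mult_left_mono layer_prod_sum_le kappa) auto
      also have "\<dots> \<le> 2 * 2 ^ l * (B * real n ^ (\<nu> - 1))"
        using l B by (intro mult_left_mono power_mono) auto
      finally show "(\<Sum>s\<in>layer l \<inter> cross n. (2::real) ^ (\<Sum>j=1..d. s j)) \<le> 2 * 2 ^ l * (B * real n ^ (\<nu> - 1))" .
    qed
    also have "\<dots> = 2 * (\<Sum>l<n. 2 ^ l) * (B * real n ^ (\<nu> - 1))"
      by (simp only: sum_distrib_left sum_distrib_right)
    also have "(\<Sum>l<n. (2::real) ^ l) = 2 ^ n - 1" by (induction n) auto
    also have "2 * (2 ^ n - 1) * (B * real n ^ (\<nu> - 1)) \<le> 2 * 2 ^ n * (B * real n ^ (\<nu> - 1))"
      using B by (intro mult_right_mono) auto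
    finally show ?thesis by (simp add: mult_ac)
  qed
  then show ?thesis using that[of "2 ^ (3 * d) * 2 * B"] B by simp
qed

text \<open>The tolerance \<open>G\<close> allows for the shift in weight when passing to
  neighbouring blocks. Layers decay like powers of \<open>2 powr - r 1\<close>, against which the
  polynomial number of blocks in a layer is harmless.\<close>

lemma tail_sum:
  obtains C where "0 < C"
    "\<And>n m F. n \<le> m + G \<Longrightarrow> finite F \<Longrightarrow> F \<subseteq> {u\<in>indices d. real m \<le> weight d g u} \<Longrightarrow>
       (\<Sum>u\<in>F. 2 powr - weight d r u) \<le> C * 2 powr - (r 1 * real n) * real (max 1 n) ^ (\<nu> - 1)"
proof -
  define B where "B = (1 / (1 - 2 powr - (r 1 * \<kappa>))) ^ (d - \<nu>)"
  have rk: "0 < r 1 * \<kappa>" using r1 kappa by simp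
  have B: "0 < B"
  proof -
    have "(2::real) powr - (r 1 * \<kappa>) < 1" using rk powr_less_mono[of "- (r 1 * \<kappa>)" 0 2] by simp
    then show ?thesis by (simp add: B_def)
  qed
  define c where "c = 2 powr - r 1"
  have c: "0 < c" "c < 1" using r1 powr_less_mono[of "- r 1" 0 2] by (auto simp: c_def)
  have cp: "2 powr - (r 1 * real l) = c ^ l" for l by (simp add: c_def powr_power mult.commute)
  define D where "D = (\<Sum>i. c ^ i * real (1 + i) ^ (\<nu> - 1))"
  note sm = summable_power_geometric[OF c, of "\<nu> - 1"]
  have D: "0 \<le> D" unfolding D_def using c sm by (intro suminf_nonneg) auto
  define E where "E = B * (D + 1) * real (1 + G) ^ (\<nu> - 1) * 2 powr (r 1 * real G)"
  have E: "0 < E" using B D by (simp add: E_def)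
  have "(\<Sum>u\<in>F. 2 powr - weight d r u) \<le> E * 2 powr - (r 1 * real n) * real (max 1 n) ^ (\<nu> - 1)"
    if nm: "n \<le> m + G" and F: "finite F" "F \<subseteq> {u\<in>indices d. real m \<le> weight d g u}" for n m F
  proof -
    define m' where "m' = n - G"
    have m': "m' \<le> m" "m' \<le> n" "n \<le> m' + G" using nm by (auto simp: m'_def)
    define L where "L = Max (insert 0 ((\<lambda>u. nat \<lfloor>weight d g u\<rfloor>) ` F))"
    have FU: "F = (\<Union>i\<in>{..L}. F \<inter> layer (m' + i))"
    proof -
      have "u \<in> (\<Union>i\<in>{..L}. F \<inter> layer (m' + i))" if u: "u \<in> F" for u
      proof -
        let ?l = "nat \<lfloor>weight d g u\<rfloor>"
        have "?l \<le> L" unfolding L_def using F u by (intro Max_ge) auto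
        moreover have "real m \<le> weight d g u" using F u by auto
        then have "m \<le> ?l" by linarith
        moreover have "u \<in> layer ?l" using F u layer_floor by auto
        ultimately show ?thesis using u m' by (auto intro!: bexI[of _ "?l - m'"])
      qed
      then show ?thesis by auto
    qed
    have "(\<Sum>u\<in>F. 2 powr - weight d r u) = (\<Sum>i\<le>L. \<Sum>u\<in>F \<inter> layer (m' + i). 2 powr - weight d r u)"
    proof -
      have dj: "layer (m' + i) \<inter> layer (m' + j) = {}" if "i \<noteq> j" for i j
        using that by (intro layer_disjoint) simp
      show ?thesis
        by (subst FU, subst sum.UNION_disjoint) (use F dj in auto)
    qed
    also have "\<dots> \<le> (\<Sum>i\<le>L. (B * c ^ m' * (real (1 + G) * real (max 1 n)) ^ (\<nu> - 1)) * (c ^ i * real (1 + i) ^ (\<nu> - 1)))"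
    proof (rule sum_mono)
      fix i
      have "(\<Sum>u\<in>F \<inter> layer (m' + i). 2 powr - weight d r u)
        \<le> (\<Sum>u\<in>F \<inter> layer (m' + i). c ^ (m' + i) * 2 powr - (r 1 * \<kappa> * real (\<Sum>j\<in>{\<nu>+1..d}. u j)))"
      proof (rule sum_mono)
        fix u assume u: "u \<in> F \<inter> layer (m' + i)"
        have "2 powr - weight d r u \<le> 2 powr - (r 1 * (weight d g u + \<kappa> * real (\<Sum>j\<in>{\<nu>+1..d}. u j)))"
          using weight_r_ge[of u] by (intro powr_mono) auto
        also have "\<dots> \<le> 2 powr - (r 1 * (real (m' + i) + \<kappa> * real (\<Sum>j\<in>{\<nu>+1..d}. u j)))"
        proof -
          have "r 1 * (real (m' + i) + \<kappa> * real (\<Sum>j\<in>{\<nu>+1..d}. u j)) \<le> r 1 * (weight d g u + \<kappa> * real (\<Sum>j\<in>{\<nu>+1..d}. u j))"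
            using u r1 by (intro mult_left_mono) (auto simp: layer_def)
          then show ?thesis by (intro powr_mono) auto
        qed
        also have "\<dots> = 2 powr (- (r 1 * real (m' + i)) + - (r 1 * \<kappa> * real (\<Sum>j\<in>{\<nu>+1..d}. u j)))"
          by (simp only: distrib_left mult.assoc minus_add_distrib)
        also have "\<dots> = c ^ (m' + i) * 2 powr - (r 1 * \<kappa> * real (\<Sum>j\<in>{\<nu>+1..d}. u j))"
          by (simp only: powr_add cp)
        finally show "2 powr - weight d r u \<le> c ^ (m' + i) * 2 powr - (r 1 * \<kappa> * real (\<Sum>j\<in>{\<nu>+1..d}. u j))" .
      qed
      also have "\<dots> = c ^ (m' + i) * (\<Sum>u\<in>F \<inter> layer (m' + i). 2 powr - (r 1 * \<kappa> * real (\<Sum>j\<in>{\<nu>+1..d}. u j)))"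
        by (simp only: sum_distrib_left)
      also have "\<dots> \<le> c ^ (m' + i) * (B * real (m' + i) ^ (\<nu> - 1))"
        unfolding B_def using c by (intro mult_left_mono layer_prod_sum_le rk) auto
      also have "\<dots> \<le> c ^ (m' + i) * (B * ((real (1 + G) * real (max 1 n)) * real (1 + i)) ^ (\<nu> - 1))"
      proof (intro mult_left_mono power_mono)
        \<comment> \<open>The layer number is bounded by a factor in \<open>n\<close> times
          \<open>1 + i\<close>, so that the sum over \<open>i\<close> is a convergent series
          independent of \<open>n\<close>.\<close>
        have "m' + i \<le> max 1 n + max 1 n * i" using m'(2) by (intro add_mono) (auto simp: le_max_iff_disj)
        also have "\<dots> = 1 * max 1 n * (1 + i)" by simp
        also have "\<dots> \<le> ((1 + G) * max 1 n) * (1 + i)" by (intro mult_right_mono) simp_all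
        finally have "real (m' + i) \<le> real (((1 + G) * max 1 n) * (1 + i))" by (rule of_nat_mono)
        then show "real (m' + i) \<le> (real (1 + G) * real (max 1 n)) * real (1 + i)" by (simp only: of_nat_mult)
      qed (use B c in auto)
      also have "\<dots> = (B * c ^ m' * (real (1 + G) * real (max 1 n)) ^ (\<nu> - 1)) * (c ^ i * real (1 + i) ^ (\<nu> - 1))"
        by (simp only: power_mult_distrib power_add mult_ac)
      finally show "(\<Sum>u\<in>F \<inter> layer (m' + i). 2 powr - weight d r u)
         \<le> (B * c ^ m' * (real (1 + G) * real (max 1 n)) ^ (\<nu> - 1)) * (c ^ i * real (1 + i) ^ (\<nu> - 1))" .
    qed
    also have "\<dots> = (B * c ^ m' * (real (1 + G) * real (max 1 n)) ^ (\<nu> - 1)) * (\<Sum>i\<le>L. c ^ i * real (1 + i) ^ (\<nu> - 1))"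
      by (simp only: sum_distrib_left)
    also have "\<dots> \<le> (B * c ^ m' * (real (1 + G) * real (max 1 n)) ^ (\<nu> - 1)) * (D + 1)"
    proof (intro mult_left_mono)
      have "(\<Sum>i\<le>L. c ^ i * real (1 + i) ^ (\<nu> - 1)) \<le> D"
        unfolding D_def using c by (intro sum_le_suminf sm) auto
      then show "(\<Sum>i\<le>L. c ^ i * real (1 + i) ^ (\<nu> - 1)) \<le> D + 1" by simp
    qed (use B c in auto)
    also have "\<dots> \<le> (B * (2 powr (r 1 * real G) * 2 powr - (r 1 * real n)) * (real (1 + G) * real (max 1 n)) ^ (\<nu> - 1)) * (D + 1)"
    proof (intro mult_left_mono mult_right_mono)
      have "r 1 * real n \<le> r 1 * (real m' + real G)" using m' r1 by (intro mult_left_mono) linarith+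
      then have "2 powr - (r 1 * real m') \<le> 2 powr (r 1 * real G + - (r 1 * real n))"
        by (intro powr_mono) (auto simp: distrib_left)
      then show "c ^ m' \<le> 2 powr (r 1 * real G) * 2 powr - (r 1 * real n)" by (simp only: cp powr_add)
    qed (use B D in auto)
    also have "\<dots> = E * 2 powr - (r 1 * real n) * real (max 1 n) ^ (\<nu> - 1)"
      by (simp only: E_def power_mult_distrib mult_ac)
    finally show ?thesis .
  qed
  then show ?thesis using that[OF E] by blast
qed

end

section \<open>Approximation of the class from hyperbolic crosses\<close>

lemma besov_class_subset_Lp: "besov_class d r p \<theta> \<subseteq> Lp d p"
  by (auto simp: besov_class_def Lp0_def)

context anisotropic
begin

definition size_factor :: "nat \<Rightarrow> real" where
  "size_factor n = real (max 1 n) ^ (\<nu> - 1)"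

lemma size_factor_ge_1: "1 \<le> size_factor n"
  unfolding size_factor_def by (intro one_le_power) simp

lemma remainder_bound:
  assumes q: "1 \<le> q" "q \<le> p" and \<theta>: "1 \<le> \<theta>"
  obtains C where "0 < C" "\<And>n f. f \<in> besov_class d r p \<theta> \<Longrightarrow>
    Bq1_norm d q (\<lambda>x. f x - A_sum d (cross n) f x) \<le> ennreal (C * 2 powr - (r 1 * real n) * size_factor n powr (1 - enn2real (1 / \<theta>)))"
proof -
  \<comment> \<open>Passing to a neighbour changes every entry by at most one, hence the weight by
    at most the sum of the \<open>g j\<close>.\<close>
  define G where "G = nat \<lceil>\<Sum>j=1..d. g j\<rceil>"
  obtain C1 where C1: "0 < C1"
    "\<And>n m F. n \<le> m + G \<Longrightarrow> finite F \<Longrightarrow> F \<subseteq> {u\<in>indices d. real m \<le> weight d g u} \<Longrightarrow>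
       (\<Sum>u\<in>F. 2 powr - weight d r u) \<le> C1 * 2 powr - (r 1 * real n) * real (max 1 n) ^ (\<nu> - 1)"
    using tail_sum[of G] by blast
  define K where "K = 2 * A_const d * A_const d * 9 ^ d"
  have K: "0 < K" using A_const_ge_1[of d] by (simp add: K_def)
  define C2 where "C2 = 2 powr (r 1 * real G)"
  have C2: "0 < C2" by (simp add: C2_def)
  let ?\<tau> = "enn2real (1 / \<theta>)"
  have "Bq1_norm d q (\<lambda>x. f x - A_sum d (cross n) f x) \<le> ennreal (K * (C1 + C2) * 2 powr - (r 1 * real n) * size_factor n powr (1 - ?\<tau>))"
    if f: "f \<in> besov_class d r p \<theta>" for n f
  proof -
    define U where "U = {u\<in>indices d. \<exists>t\<in>nbrs d u. t \<notin> cross n}"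
    have U: "u \<in> indices d" "real (n - G) \<le> weight d g u" if uU: "u \<in> U" for u
    proof -
      show u: "u \<in> indices d" using uU by (simp add: U_def)
      obtain t where t: "t \<in> nbrs d u" "t \<notin> cross n" using uU by (auto simp: U_def)
      have "t \<in> indices d" using t(1) nbrs_subset by auto
      then have "real n \<le> weight d g t" using t(2) by (auto simp: cross_def)
      also have "\<dots> \<le> (\<Sum>j=1..d. (real (u j) + 1) * g j)"
      proof (intro sum_mono mult_right_mono)
        fix j assume "j \<in> {1..d}"
        then have "t j \<le> u j + 1" using t(1) by (auto simp: nbrs_def PiE_iff)
        then show "real (t j) \<le> real (u j) + 1" by linarith
        show "0 \<le> g j" using g_ge_1[of j] by simp
      qed
      also have "\<dots> = weight d g u + (\<Sum>j=1..d. g j)" by (simp add: distrib_right sum.distrib)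
      also have "(\<Sum>j=1..d. g j) \<le> real G" unfolding G_def by linarith
      finally show "real (n - G) \<le> weight d g u" using weight_ge_1[OF u] by (cases "n \<le> G") auto
    qed
    \<comment> \<open>With the size factor as \<open>X\<close>, the bound \<open>?S\<close> has the
      order of \<open>X * ?m\<close>, and both terms of the truncated estimate have the same
      order.\<close>
    let ?S = "C1 * 2 powr - (r 1 * real n) * size_factor n" and ?m = "C2 * 2 powr - (r 1 * real n)"
    have "Bq1_norm d q (\<lambda>x. f x - A_sum d (cross n) f x) \<le> ennreal K * (\<Sum>\<^sub>\<infinity>u\<in>U. Lp_norm d p (beta_block d p u f))"
      unfolding K_def U_def using subsetD[OF besov_class_subset_Lp f]
      by (intro Bq1_norm_remainder_le q finite_cross cross_subset)
    also have "(\<Sum>\<^sub>\<infinity>u\<in>U. Lp_norm d p (beta_block d p u f)) \<le> ennreal (size_factor n powr - ?\<tau> * ?S + size_factor n powr (1 - ?\<tau>) * ?m)"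
    proof (rule besov_sum_le[OF \<theta>])
      show "besov_norm d r p \<theta> f \<le> 1" using f by (simp add: besov_class_def)
      show "U \<subseteq> indices d" using U by auto
      show "0 < size_factor n" using size_factor_ge_1[of n] by linarith
      show "(\<Sum>u\<in>F. 2 powr - weight d r u) \<le> ?S" if "finite F" "F \<subseteq> U" for F
        unfolding size_factor_def using that U by (intro C1(2)[of n "n - G"]) auto
      show "2 powr - weight d r u \<le> ?m" if u: "u \<in> U" for u
      proof -
        have "0 \<le> \<kappa> * real (\<Sum>j\<in>{\<nu>+1..d}. u j)"
          using kappa by (intro mult_nonneg_nonneg of_nat_0_le_iff) simp
        then have "real n - real G \<le> weight d g u + \<kappa> * real (\<Sum>j\<in>{\<nu>+1..d}. u j)"
          using U(2)[OF u] by linarith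
        then have "r 1 * (real n - real G) \<le> r 1 * (weight d g u + \<kappa> * real (\<Sum>j\<in>{\<nu>+1..d}. u j))"
          using r1 by (intro mult_left_mono) auto
        then have "r 1 * (real n - real G) \<le> weight d r u" using weight_r_ge[of u] by linarith
        then have "2 powr - weight d r u \<le> 2 powr (r 1 * real G + - (r 1 * real n))"
          by (intro powr_mono) (auto simp: right_diff_distrib)
        then show ?thesis by (simp only: C2_def powr_add)
      qed
    qed (use C2 in simp)
    also have "size_factor n powr - ?\<tau> * ?S + size_factor n powr (1 - ?\<tau>) * ?m
        = (C1 + C2) * 2 powr - (r 1 * real n) * size_factor n powr (1 - ?\<tau>)"
    proof -
      have "size_factor n powr - ?\<tau> * size_factor n = size_factor n powr (1 - ?\<tau>)"
        using size_factor_ge_1[of n] powr_add[of "size_factor n" "- ?\<tau>" 1] by simp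
      then have "size_factor n powr - ?\<tau> * ?S = C1 * 2 powr - (r 1 * real n) * size_factor n powr (1 - ?\<tau>)"
        by (metis mult.assoc mult.commute)
      then show ?thesis by (simp add: algebra_simps)
    qed
    also have "ennreal K * ennreal ((C1 + C2) * 2 powr - (r 1 * real n) * size_factor n powr (1 - ?\<tau>))
       = ennreal (K * (C1 + C2) * 2 powr - (r 1 * real n) * size_factor n powr (1 - ?\<tau>))"
      using K C1 C2 by (simp add: ennreal_mult[symmetric] mult.assoc)
    finally show ?thesis by (simp add: mult_left_mono)
  qed
  then show ?thesis using that[of "K * (C1 + C2)"] K C1 C2 by (auto simp: add_pos_pos)
qed

lemma linear_width_upper:
  assumes q: "1 \<le> q" "q \<le> p" and \<theta>: "1 \<le> \<theta>"
  obtains C where "0 < C" "\<And>n M. C * 2 ^ n * real n ^ (\<nu> - 1) \<le> real M \<Longrightarrow>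
     linear_width M (besov_class d r p \<theta>) (Bq1 d q) (Bq1_norm d q)
       \<le> ennreal (C * 2 powr - (r 1 * real n) * size_factor n powr (1 - enn2real (1 / \<theta>)))"
proof -
  obtain C1 where C1: "0 < C1" "\<And>n f. f \<in> besov_class d r p \<theta> \<Longrightarrow>
    Bq1_norm d q (\<lambda>x. f x - A_sum d (cross n) f x) \<le> ennreal (C1 * 2 powr - (r 1 * real n) * size_factor n powr (1 - enn2real (1 / \<theta>)))"
    using remainder_bound[OF assms] by blast
  obtain C2 where C2: "0 < C2" "\<And>n. real (rank_bound d (cross n)) \<le> C2 * 2 ^ n * real n ^ (\<nu> - 1)"
    using rank_cross by blast
  have "linear_width M (besov_class d r p \<theta>) (Bq1 d q) (Bq1_norm d q)
       \<le> ennreal (max C1 C2 * 2 powr - (r 1 * real n) * size_factor n powr (1 - enn2real (1 / \<theta>)))"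
    if M: "max C1 C2 * 2 ^ n * real n ^ (\<nu> - 1) \<le> real M" for n M
  proof -
    have "C2 * (2 ^ n * real n ^ (\<nu> - 1)) \<le> max C1 C2 * (2 ^ n * real n ^ (\<nu> - 1))"
      by (intro mult_right_mono) auto
    then have "real (rank_bound d (cross n)) \<le> real M"
      using C2(2)[of n] M unfolding mult.assoc by linarith
    then have "linear_width M (besov_class d r p \<theta>) (Bq1 d q) (Bq1_norm d q)
       \<le> (SUP w\<in>besov_class d r p \<theta>. Bq1_norm d q (\<lambda>x. w x - A_sum d (cross n) w x))"
      by (intro linear_width_le_A_sum q finite_cross cross_subset) simp
    also have "\<dots> \<le> ennreal (C1 * 2 powr - (r 1 * real n) * size_factor n powr (1 - enn2real (1 / \<theta>)))"
      by (rule SUP_least) (rule C1(2))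
    also have "\<dots> \<le> ennreal (max C1 C2 * 2 powr - (r 1 * real n) * size_factor n powr (1 - enn2real (1 / \<theta>)))"
      by (intro ennreal_leI mult_right_mono) auto
    finally show ?thesis .
  qed
  then show ?thesis using that[of "max C1 C2"] C1 by auto
qed

text \<open>All weights are at least 1, so the cross for \<open>n = 0\<close> is empty and the
  remainder is the function itself.\<close>

lemma besov_class_bounded:
  assumes q: "1 \<le> q" "q \<le> p" and \<theta>: "1 \<le> \<theta>"
  obtains C where "0 < C" "\<And>f. f \<in> besov_class d r p \<theta> \<Longrightarrow> Bq1_norm d q f \<le> ennreal C"
proof -
  obtain C1 where C1: "0 < C1" "\<And>n f. f \<in> besov_class d r p \<theta> \<Longrightarrow>
    Bq1_norm d q (\<lambda>x. f x - A_sum d (cross n) f x) \<le> ennreal (C1 * 2 powr - (r 1 * real n) * size_factor n powr (1 - enn2real (1 / \<theta>)))"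
    using remainder_bound[OF assms] by blast
  have "cross 0 = {}" using weight_ge_1 by (force simp: cross_def)
  then have "Bq1_norm d q f \<le> ennreal C1" if "f \<in> besov_class d r p \<theta>" for f
    using C1(2)[OF that, of 0] by (simp add: A_sum_def size_factor_def)
  then show ?thesis using that C1 by blast
qed

lemma besov_class_subset_Bq1:
  assumes q: "1 \<le> q" "q \<le> p" and \<theta>: "1 \<le> \<theta>"
  shows "besov_class d r p \<theta> \<subseteq> Bq1 d q"
proof
  fix f assume f: "f \<in> besov_class d r p \<theta>"
  obtain C where C: "\<And>f. f \<in> besov_class d r p \<theta> \<Longrightarrow> Bq1_norm d q f \<le> ennreal C"
    using besov_class_bounded[OF assms] by blast
  have L: "f \<in> Lp0 d p" using f by (simp add: besov_class_def)
  have "Lp_norm d q f \<le> 2 * Lp_norm d p f"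
    using L by (intro Lp_norm_mono_exponent q) (auto simp: Lp0_def Lp_def)
  also have "\<dots> < \<infinity>" using L by (auto simp: Lp0_def Lp_def ennreal_mult_less_top)
  finally have "f \<in> Lp0 d q" using L by (auto simp: Lp0_def Lp_def)
  moreover have "Bq1_norm d q f < \<infinity>" using C[OF f] by (rule le_less_trans) simp
  ultimately show "f \<in> Bq1 d q" by (simp add: Bq1_def)
qed

end

subsection \<open>Packings in finite-dimensional seminormed spaces\<close>

abbreviation lborel_pi :: "nat \<Rightarrow> (nat \<Rightarrow> real) measure" where
  "lborel_pi n \<equiv> \<Pi>\<^sub>M i\<in>{..<n}. lborel"

lemma product_sigma_finite_lborel: "product_sigma_finite (\<lambda>i::nat. lborel :: real measure)"
  by (simp add: product_sigma_finite_def lborel.sigma_finite_measure_axioms)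

lemma emeasure_lborel_affine_vimage:
  fixes A :: "real set"
  assumes "A \<in> sets borel" "0 < c"
  shows "emeasure lborel ((\<lambda>y. (y - a) / c) -` A) = ennreal c * emeasure lborel A"
proof -
  have m: "(\<lambda>y. (y - a) / c) -` A \<in> sets borel"
    using measurable_sets[of "\<lambda>y. (y - a) / c" borel borel A] assms by simp
  have "emeasure lborel ((\<lambda>y. (y - a) / c) -` A)
      = emeasure (density (distr lborel borel (\<lambda>x. a + c * x)) (\<lambda>_. ennreal \<bar>c\<bar>)) ((\<lambda>y. (y - a) / c) -` A)"
    using lborel_real_affine[of c a] assms by simp
  also have "\<dots> = ennreal \<bar>c\<bar> * emeasure (distr lborel borel (\<lambda>x. a + c * x)) ((\<lambda>y. (y - a) / c) -` A)"
    using m by (subst emeasure_density_const) auto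
  also have "emeasure (distr lborel borel (\<lambda>x. a + c * x)) ((\<lambda>y. (y - a) / c) -` A) = emeasure lborel A"
  proof (subst emeasure_distr)
    have "(\<lambda>x. a + c * x) -` (\<lambda>y. (y - a) / c) -` A = A" using assms by auto
    then show "emeasure lborel ((\<lambda>x. a + c * x) -` (\<lambda>y. (y - a) / c) -` A \<inter> space lborel) = emeasure lborel A"
      by simp
  qed (use m in auto)
  finally show ?thesis using assms by simp
qed

text \<open>The inverse of the map from \<open>x\<close> to \<open>a + c * x\<close>: the preimage
  of \<open>K\<close> is the copy \<open>a + c * K\<close>, whose measurability is that of a
  preimage.\<close>

definition unscale :: "nat \<Rightarrow> (nat \<Rightarrow> real) \<Rightarrow> real \<Rightarrow> (nat \<Rightarrow> real) \<Rightarrow> nat \<Rightarrow> real" where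
  "unscale n a c y = (\<lambda>i\<in>{..<n}. (y i - a i) / c)"

lemma measurable_unscale: "unscale n a c \<in> lborel_pi n \<rightarrow>\<^sub>M lborel_pi n"
  unfolding unscale_def[abs_def]
proof (rule measurable_restrict)
  fix i assume i: "i \<in> {..<n}"
  have "(\<lambda>y. y i) \<in> lborel_pi n \<rightarrow>\<^sub>M lborel" using i by (rule measurable_component_singleton)
  then have "(\<lambda>y. y i) \<in> lborel_pi n \<rightarrow>\<^sub>M borel" by simp
  then show "(\<lambda>y. (y i - a i) / c) \<in> lborel_pi n \<rightarrow>\<^sub>M lborel" by simp
qed

text \<open>The product measure is determined by its values on boxes, and on a box the claim is the
  one-dimensional affine rule in each coordinate.\<close>

lemma emeasure_unscale_vimage:
  assumes A: "A \<in> sets (lborel_pi n)" and c: "0 < c"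
  shows "emeasure (lborel_pi n) (unscale n a c -` A \<inter> space (lborel_pi n)) = ennreal (c ^ n) * emeasure (lborel_pi n) A"
proof -
  interpret product_sigma_finite "\<lambda>i::nat. lborel :: real measure" by (rule product_sigma_finite_lborel)
  let ?P = "scale_measure (ennreal (inverse (c ^ n))) (distr (lborel_pi n) (lborel_pi n) (unscale n a c))"
  have "?P = lborel_pi n"
  proof (rule PiM_eqI)
    fix A :: "nat \<Rightarrow> real set" assume A: "\<And>i. i \<in> {..<n} \<Longrightarrow> A i \<in> sets lborel"
    have "unscale n a c -` (Pi\<^sub>E {..<n} A) \<inter> space (lborel_pi n) = (\<Pi>\<^sub>E i\<in>{..<n}. (\<lambda>y. (y - a i) / c) -` A i)"
      by (auto simp: unscale_def space_PiM PiE_iff)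
    moreover have "(\<lambda>y. (y - a i) / c) -` A i \<in> sets lborel" if "i \<in> {..<n}" for i
      using measurable_sets[of "\<lambda>y. (y - a i) / c" borel borel "A i"] A[OF that] by simp
    moreover have "Pi\<^sub>E {..<n} A \<in> sets (lborel_pi n)"
      using A by (rule sets_PiM_I_finite[OF finite_lessThan])
    ultimately have "emeasure (distr (lborel_pi n) (lborel_pi n) (unscale n a c)) (Pi\<^sub>E {..<n} A)
        = (\<Prod>i\<in>{..<n}. emeasure lborel ((\<lambda>y. (y - a i) / c) -` A i))"
      by (simp only: emeasure_distr[OF measurable_unscale] emeasure_PiM[OF finite_lessThan])
    also have "\<dots> = (\<Prod>i\<in>{..<n}. ennreal c * emeasure lborel (A i))"
      using A c by (intro prod.cong refl emeasure_lborel_affine_vimage) auto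
    also have "\<dots> = ennreal (c ^ n) * (\<Prod>i\<in>{..<n}. emeasure lborel (A i))"
      using c by (simp add: prod.distrib ennreal_power)
    finally show "emeasure ?P (Pi\<^sub>E {..<n} A) = (\<Prod>i\<in>{..<n}. emeasure lborel (A i))"
      using c by (simp add: mult.assoc[symmetric] ennreal_mult[symmetric])
  qed simp_all
  then have "emeasure (lborel_pi n) A = ennreal (inverse (c ^ n)) * emeasure (distr (lborel_pi n) (lborel_pi n) (unscale n a c)) A"
    by (metis emeasure_scale_measure)
  also have "emeasure (distr (lborel_pi n) (lborel_pi n) (unscale n a c)) A = emeasure (lborel_pi n) (unscale n a c -` A \<inter> space (lborel_pi n))"
    using A by (intro emeasure_distr measurable_unscale)
  finally have "ennreal (c ^ n) * emeasure (lborel_pi n) A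
      = ennreal (c ^ n) * (ennreal (inverse (c ^ n)) * emeasure (lborel_pi n) (unscale n a c -` A \<inter> space (lborel_pi n)))"
    by simp
  then show ?thesis using c by (simp add: mult.assoc[symmetric] ennreal_mult[symmetric])
qed

text \<open>A seminorm on real \<open>n\<close>-space, carried by functions on all naturals that are
  seen only through their first \<open>n\<close> values. It may vanish on nonzero vectors, as
  happens when functions that agree almost everywhere are identified.\<close>

locale coordinate_seminorm =
  fixes n :: nat and g :: "(nat \<Rightarrow> real) \<Rightarrow> real"
  assumes subadd: "g (\<lambda>i. x i + y i) \<le> g x + g y"
    and homog: "g (\<lambda>i. c * x i) = \<bar>c\<bar> * g x"
    and dep: "(\<And>i. i < n \<Longrightarrow> x i = y i) \<Longrightarrow> g x = g y"
begin

lemma g_zero: "g (\<lambda>i. 0) = 0"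
  using homog[of 0 "\<lambda>i. 0"] by simp

lemma g_minus: "g (\<lambda>i. x i - y i) = g (\<lambda>i. y i - x i)"
  using homog[of "-1" "\<lambda>i. y i - x i"] by simp

lemma g_nonneg: "0 \<le> g x"
  using subadd[of x "\<lambda>i. - 1 * x i"] homog[of "-1" x] g_zero by simp

definition lip :: "nat \<Rightarrow> real" where
  "lip i = g (\<lambda>k. if k = i then 1 else 0)"

lemma g_le_sum: "g x \<le> (\<Sum>i<n. \<bar>x i\<bar> * lip i)"
proof -
  have "g (\<lambda>i. if i < m then x i else 0) \<le> (\<Sum>i<m. \<bar>x i\<bar> * lip i)" for m
  proof (induction m)
    case 0
    then show ?case using g_zero by simp
  next
    case (Suc m)
    have "(\<lambda>i. if i < Suc m then x i else 0) = (\<lambda>i. (if i < m then x i else 0) + x m * (if i = m then 1 else 0))"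
      by (auto simp: fun_eq_iff less_Suc_eq)
    then have "g (\<lambda>i. if i < Suc m then x i else 0) \<le> g (\<lambda>i. if i < m then x i else 0) + g (\<lambda>i. x m * (if i = m then 1 else 0))"
      using subadd[of "\<lambda>i. if i < m then x i else 0" "\<lambda>i. x m * (if i = m then 1 else 0)"] by simp
    then show ?case using Suc homog[of "x m" "\<lambda>i. if i = m then 1 else 0"] by (simp add: lip_def)
  qed
  from this[of n] show ?thesis using dep[of x "\<lambda>i. if i < n then x i else 0"] by simp
qed

lemma continuous_on_g: "continuous_on UNIV g"
proof (rule continuous_at_imp_continuous_on, rule ballI)
  fix x :: "nat \<Rightarrow> real"
  let ?h = "\<lambda>y. \<Sum>i<n. \<bar>y i - x i\<bar> * lip i"
  have "continuous_on UNIV ?h"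
  proof (rule continuous_on_sum)
    fix i
    have "continuous_on UNIV (\<lambda>y::nat \<Rightarrow> real. y i)" by (rule continuous_on_product_coordinates)
    then show "continuous_on UNIV (\<lambda>y. \<bar>y i - x i\<bar> * lip i)"
      by (intro continuous_on_mult continuous_on_rabs continuous_on_diff continuous_on_const)
  qed
  then have "isCont ?h x" by (simp add: continuous_on_eq_continuous_at)
  then have h: "?h \<midarrow>x\<rightarrow> 0" by (simp add: isCont_def)
  have "\<bar>g y - g x\<bar> \<le> ?h y" for y
  proof -
    have "g y \<le> g x + g (\<lambda>i. y i - x i)"
      using subadd[of x "\<lambda>i. y i - x i"] by (simp only: add_diff_cancel_left' add_diff_eq)
    moreover have "g x \<le> g y + g (\<lambda>i. x i - y i)"
      using subadd[of y "\<lambda>i. x i - y i"] by (simp only: add_diff_cancel_left' add_diff_eq)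
    moreover note g_le_sum[of "\<lambda>i. y i - x i"] g_minus[of x y]
    ultimately show ?thesis by linarith
  qed
  then have "(\<lambda>y. g y - g x) \<midarrow>x\<rightarrow> 0"
    by (intro Lim_null_comparison[OF _ h] always_eventually allI) (simp only: real_norm_def)
  then show "isCont g x" unfolding isCont_def by (rule LIM_zero_cancel)
qed

lemma measurable_g: "g \<in> borel_measurable (lborel_pi n)"
proof -
  have "(\<lambda>x i. if i < n then x i else 0) \<in> lborel_pi n \<rightarrow>\<^sub>M (\<Pi>\<^sub>M i\<in>UNIV. borel)"
  proof (rule measurable_PiM_single')
    fix i :: nat
    show "(\<lambda>x. if i < n then x i else 0) \<in> borel_measurable (lborel_pi n)"
    proof (cases "i < n")
      case True
      then have "(\<lambda>y. y i) \<in> lborel_pi n \<rightarrow>\<^sub>M lborel" by (intro measurable_component_singleton) auto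
      then show ?thesis using True by simp
    qed simp
  qed auto
  moreover have "g \<in> (\<Pi>\<^sub>M i\<in>(UNIV::nat set). (borel::real measure)) \<rightarrow>\<^sub>M borel"
    by (subst measurable_cong_sets[OF sets_PiM_equal_borel refl]) (rule borel_measurable_continuous_onI[OF continuous_on_g])
  ultimately have "(\<lambda>x. g (\<lambda>i. if i < n then x i else 0)) \<in> borel_measurable (lborel_pi n)"
    by (rule measurable_compose)
  moreover have "g (\<lambda>i. if i < n then x i else 0) = g x" for x by (rule dep) simp
  ultimately show ?thesis by simp
qed

text \<open>
  The unit ball is cut off by a cube, because it may be unbounded. The size \<open>T\<close> of the cube is
  chosen such that the volume comparison still involves the same cut-off ball on both sides.
\<close>

lemma packing_bound:
  assumes X: "finite X" "\<And>x. x \<in> X \<Longrightarrow> g x \<le> R"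
    and sep: "\<And>x y. x \<in> X \<Longrightarrow> y \<in> X \<Longrightarrow> x \<noteq> y \<Longrightarrow> e < g (\<lambda>i. x i - y i)"
    and R: "0 < R" and e: "0 < e"
  shows "real (card X) \<le> (1 + 2 * R / e) ^ n"
proof -
  interpret product_sigma_finite "\<lambda>i::nat. lborel :: real measure" by (rule product_sigma_finite_lborel)
  define T0 where "T0 = 1 + (\<Sum>x\<in>X. \<Sum>i<n. \<bar>x i\<bar>)"
  have T0: "\<bar>x i\<bar> \<le> T0" if "x \<in> X" "i < n" for x i
  proof -
    have "\<bar>x i\<bar> \<le> (\<Sum>i<n. \<bar>x i\<bar>)" using that by (intro member_le_sum[of i "{..<n}" "\<lambda>i. \<bar>x i\<bar>"]) auto
    also have "\<dots> \<le> (\<Sum>x\<in>X. \<Sum>i<n. \<bar>x i\<bar>)"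
      using that X(1) by (intro member_le_sum[of x X "\<lambda>x. \<Sum>i<n. \<bar>x i\<bar>"] sum_nonneg) auto
    finally show ?thesis by (simp add: T0_def)
  qed
  have T0pos: "0 < T0" unfolding T0_def by (intro add_pos_nonneg sum_nonneg) auto
  \<comment> \<open>The points of \<open>X\<close> have coordinates of size at most
    \<open>T0 = R * T\<close>, so the copy of \<open>K\<close> of size \<open>e / 2\<close> around
    such a point lies in the copy of size \<open>R + e / 2\<close> around the origin.\<close>
  define T where "T = T0 / R"
  have T: "0 < T" using T0pos R by (simp add: T_def)
  define K where "K = {x \<in> space (lborel_pi n). g x \<le> 1 \<and> (\<forall>i\<in>{..<n}. \<bar>x i\<bar> \<le> T)}"
  have K: "K \<in> sets (lborel_pi n)"
  proof -
    have "{x \<in> space (lborel_pi n). \<bar>x i\<bar> \<le> T} \<in> sets (lborel_pi n)" if "i \<in> {..<n}" for i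
    proof -
      have "(\<lambda>y. y i) \<in> lborel_pi n \<rightarrow>\<^sub>M lborel" using that by (rule measurable_component_singleton)
      then have [measurable]: "(\<lambda>y. y i) \<in> borel_measurable (lborel_pi n)" by simp
      show ?thesis by measurable
    qed
    then have "{x \<in> space (lborel_pi n). \<forall>i\<in>{..<n}. \<bar>x i\<bar> \<le> T} \<in> sets (lborel_pi n)"
      by (intro sets.sets_Collect_finite_All) auto
    moreover have "{x \<in> space (lborel_pi n). g x \<le> 1} \<in> sets (lborel_pi n)"
      using measurable_g by measurable
    moreover have "K = {x \<in> space (lborel_pi n). g x \<le> 1} \<inter> {x \<in> space (lborel_pi n). \<forall>i\<in>{..<n}. \<bar>x i\<bar> \<le> T}"
      by (auto simp: K_def)
    ultimately show ?thesis by auto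
  qed
  have Kfin: "emeasure (lborel_pi n) K < \<infinity>"
  proof -
    have "emeasure (lborel_pi n) K \<le> emeasure (lborel_pi n) (\<Pi>\<^sub>E i\<in>{..<n}. {-T..T})"
    proof (rule emeasure_mono)
      show "K \<subseteq> (\<Pi>\<^sub>E i\<in>{..<n}. {-T..T})"
      proof
        fix x assume x: "x \<in> K"
        then have "x i \<in> {-T..T}" if "i \<in> {..<n}" for i
          using that unfolding K_def by (metis (mono_tags, lifting) abs_le_D1 abs_le_D2 atLeastAtMost_iff mem_Collect_eq minus_le_iff)
        then show "x \<in> (\<Pi>\<^sub>E i\<in>{..<n}. {-T..T})" using x by (simp add: K_def space_PiM PiE_iff)
      qed
      show "(\<Pi>\<^sub>E i\<in>{..<n}. {-T..T}) \<in> sets (lborel_pi n)"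
        by (rule sets_PiM_I_finite[OF finite_lessThan]) simp
    qed
    also have "\<dots> = (\<Prod>i\<in>{..<n}. ennreal (2 * T))"
      using T by (subst emeasure_PiM) auto
    also have "\<dots> = ennreal ((2 * T) ^ n)" using T by (simp add: ennreal_power)
    also have "\<dots> < \<infinity>" by simp
    finally show ?thesis .
  qed
  \<comment> \<open>A cube of half-width \<eta> fits into \<open>K\<close>, which therefore has
    positive volume and can be cancelled at the end.\<close>
  define \<eta> where "\<eta> = min T (1 / (1 + (\<Sum>i<n. lip i)))"
  have lip0: "0 \<le> (\<Sum>i<n. lip i)" by (intro sum_nonneg) (auto simp: lip_def g_nonneg)
  have \<eta>: "0 < \<eta>" "\<eta> \<le> T" "\<eta> * (\<Sum>i<n. lip i) \<le> 1"
  proof -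
    show "0 < \<eta>" "\<eta> \<le> T" using T lip0 by (auto simp: \<eta>_def)
    have "\<eta> * (\<Sum>i<n. lip i) \<le> 1 / (1 + (\<Sum>i<n. lip i)) * (\<Sum>i<n. lip i)"
      using lip0 by (intro mult_right_mono) (auto simp: \<eta>_def)
    also have "\<dots> \<le> 1" using lip0 by (simp add: divide_le_eq)
    finally show "\<eta> * (\<Sum>i<n. lip i) \<le> 1" .
  qed
  have Kpos: "0 < emeasure (lborel_pi n) K"
  proof -
    have "0 < (\<Prod>i\<in>{..<n}. ennreal (2 * \<eta>))"
      using \<eta> by (simp add: ennreal_power ennreal_less_zero_iff)
    also have "\<dots> = emeasure (lborel_pi n) (\<Pi>\<^sub>E i\<in>{..<n}. {-\<eta>..\<eta>})"
      using \<eta> by (subst emeasure_PiM) auto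
    also have "\<dots> \<le> emeasure (lborel_pi n) K"
    proof (rule emeasure_mono[OF _ K], rule subsetI)
      fix x assume x: "x \<in> (\<Pi>\<^sub>E i\<in>{..<n}. {-\<eta>..\<eta>})"
      then have x\<eta>: "\<bar>x i\<bar> \<le> \<eta>" if "i < n" for i
        using PiE_mem[OF x, of i] that by (simp add: abs_le_iff)
      have "g x \<le> (\<Sum>i<n. \<bar>x i\<bar> * lip i)" by (rule g_le_sum)
      also have "\<dots> \<le> (\<Sum>i<n. \<eta> * lip i)"
        using x\<eta> by (intro sum_mono mult_right_mono) (auto simp: lip_def g_nonneg)
      also have "\<dots> \<le> 1" using \<eta>(3) by (simp add: sum_distrib_left)
      finally have "g x \<le> 1" .
      moreover have "\<bar>x i\<bar> \<le> T" if "i \<in> {..<n}" for i using x\<eta>[of i] \<eta>(2) that by simp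
      moreover have "x \<in> space (lborel_pi n)" using x by (simp add: space_PiM PiE_iff)
      ultimately show "x \<in> K" by (simp add: K_def)
    qed
    finally show ?thesis .
  qed
  let ?S = "\<lambda>a c. unscale n a c -` K \<inter> space (lborel_pi n)"
  have mS: "?S a c \<in> sets (lborel_pi n)" for a c using measurable_sets[OF measurable_unscale K] .
  have S: "g (\<lambda>i. y i - a i) \<le> c \<and> (\<forall>i<n. \<bar>y i - a i\<bar> \<le> c * T) \<longleftrightarrow> y \<in> ?S a c"
    if "0 < c" "y \<in> space (lborel_pi n)" for y a c
  proof -
    have "g (unscale n a c y) = g (\<lambda>i. inverse c * (y i - a i))"
      by (rule dep) (simp add: unscale_def divide_inverse mult.commute)
    then have "g (unscale n a c y) = g (\<lambda>i. y i - a i) / c" using that by (simp add: homog divide_inverse mult.commute)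
    then have "g (unscale n a c y) \<le> 1 \<longleftrightarrow> g (\<lambda>i. y i - a i) \<le> c"
      using that by (simp add: pos_divide_le_eq)
    moreover have "(\<forall>i\<in>{..<n}. \<bar>unscale n a c y i\<bar> \<le> T) \<longleftrightarrow> (\<forall>i<n. \<bar>y i - a i\<bar> \<le> c * T)"
      using that by (auto simp: unscale_def abs_divide pos_divide_le_eq mult.commute)
    moreover have "unscale n a c y \<in> space (lborel_pi n)" by (simp add: unscale_def space_PiM)
    ultimately show ?thesis using that by (simp add: K_def)
  qed
  have disj: "disjoint_family_on (\<lambda>x. ?S x (e / 2)) X"
    unfolding disjoint_family_on_def
  proof (intro ballI impI)
    fix x y assume xy: "x \<in> X" "y \<in> X" "x \<noteq> y"
    show "?S x (e / 2) \<inter> ?S y (e / 2) = {}"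
    proof (rule ccontr)
      assume "?S x (e / 2) \<inter> ?S y (e / 2) \<noteq> {}"
      then obtain z where z: "z \<in> ?S x (e / 2)" "z \<in> ?S y (e / 2)" by blast
      have zs: "z \<in> space (lborel_pi n)" using z by simp
      have "g (\<lambda>i. z i - x i) \<le> e / 2" "g (\<lambda>i. z i - y i) \<le> e / 2"
        using z S[of "e / 2" z x] S[of "e / 2" z y] e zs by simp_all
      moreover have "g (\<lambda>i. x i - y i) \<le> g (\<lambda>i. x i - z i) + g (\<lambda>i. z i - y i)"
        using subadd[of "\<lambda>i. x i - z i" "\<lambda>i. z i - y i"] by simp
      ultimately show False using sep[OF xy] g_minus[of x z] by simp
    qed
  qed
  have sub: "?S x (e / 2) \<subseteq> ?S (\<lambda>i. 0) (R + e / 2)" if x: "x \<in> X" for x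
  proof
    fix y assume y: "y \<in> ?S x (e / 2)"
    then have ys: "y \<in> space (lborel_pi n)" by simp
    have y': "g (\<lambda>i. y i - x i) \<le> e / 2" "\<And>i. i < n \<Longrightarrow> \<bar>y i - x i\<bar> \<le> e / 2 * T"
      using y S[of "e / 2" y x] e ys by simp_all
    have "g y \<le> R + e / 2"
      using subadd[of x "\<lambda>i. y i - x i"] X(2)[OF x] y'(1) by simp
    moreover have "\<bar>y i\<bar> \<le> (R + e / 2) * T" if "i < n" for i
    proof -
      have "T0 = R * T" using R by (simp add: T_def)
      then show ?thesis using T0[OF x that] y'(2)[OF that] unfolding distrib_right by linarith
    qed
    ultimately show "y \<in> ?S (\<lambda>i. 0) (R + e / 2)"
      using S[of "R + e / 2" y "\<lambda>i. 0"] R e ys by simp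
  qed
  have "of_nat (card X) * (ennreal ((e / 2) ^ n) * emeasure (lborel_pi n) K) = (\<Sum>x\<in>X. emeasure (lborel_pi n) (?S x (e / 2)))"
    using e K by (simp add: emeasure_unscale_vimage)
  also have "\<dots> = emeasure (lborel_pi n) (\<Union>x\<in>X. ?S x (e / 2))"
    by (rule sum_emeasure) (use mS disj X in auto)
  also have "\<dots> \<le> emeasure (lborel_pi n) (?S (\<lambda>i. 0) (R + e / 2))"
    using sub by (intro emeasure_mono mS) blast
  also have "\<dots> = ennreal ((R + e / 2) ^ n) * emeasure (lborel_pi n) K"
    using R e K by (intro emeasure_unscale_vimage) auto
  finally have le: "of_nat (card X) * (ennreal ((e / 2) ^ n) * emeasure (lborel_pi n) K) \<le> ennreal ((R + e / 2) ^ n) * emeasure (lborel_pi n) K" .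
  obtain k where k: "emeasure (lborel_pi n) K = ennreal k" "0 < k"
    using Kfin Kpos by (cases "emeasure (lborel_pi n) K") auto
  have "ennreal (real (card X) * (e / 2) ^ n * k) \<le> ennreal ((R + e / 2) ^ n * k)"
    using le e R k by (simp add: ennreal_mult ennreal_of_nat_eq_real_of_nat mult.assoc)
  then have "real (card X) * (e / 2) ^ n * k \<le> (R + e / 2) ^ n * k"
    using e R k by (subst (asm) ennreal_le_iff) auto
  then have "real (card X) * (e / 2) ^ n \<le> (R + e / 2) ^ n" using k by simp
  then have "real (card X) \<le> (R + e / 2) ^ n / (e / 2) ^ n" using e by (simp add: pos_le_divide_eq)
  also have "\<dots> = ((R + e / 2) / (e / 2)) ^ n" by (rule power_divide[symmetric])
  also have "(R + e / 2) / (e / 2) = 1 + 2 * R / e" using e by (simp add: field_simps)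
  finally show ?thesis .
qed

text \<open>A separated set of maximal cardinality is a net, because a point far from it could be
  added. The packing bound guarantees that the maximum exists.\<close>

lemma net_exists:
  assumes R: "0 < R" and e: "0 < e"
  obtains X where "finite X" "real (card X) \<le> (1 + 2 * R / e) ^ n"
    "\<And>x. g x \<le> R \<Longrightarrow> \<exists>y\<in>X. g (\<lambda>i. x i - y i) \<le> e"
proof -
  define P where "P X \<longleftrightarrow> finite X \<and> (\<forall>x\<in>X. g x \<le> R) \<and> (\<forall>x\<in>X. \<forall>y\<in>X. x \<noteq> y \<longrightarrow> e < g (\<lambda>i. x i - y i))" for X
  have bd: "real (card X) \<le> (1 + 2 * R / e) ^ n" if "P X" for X
    using that R e by (intro packing_bound) (auto simp: P_def)
  define b where "b = nat \<lfloor>(1 + 2 * R / e) ^ n\<rfloor> + 1"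
  have "\<forall>X. P X \<longrightarrow> card X < b"
  proof (intro allI impI)
    fix X assume "P X"
    then have "card X \<le> nat \<lfloor>(1 + 2 * R / e) ^ n\<rfloor>" by (intro le_nat_floor bd)
    then show "card X < b" by (simp add: b_def)
  qed
  moreover have "P {}" by (simp add: P_def)
  ultimately obtain X where X: "P X" "\<And>Y. P Y \<Longrightarrow> card Y \<le> card X"
    using ex_has_greatest_nat[of P "{}" card b] by blast
  have "\<exists>y\<in>X. g (\<lambda>i. x i - y i) \<le> e" if x: "g x \<le> R" for x
  proof (rule ccontr)
    assume "\<not> (\<exists>y\<in>X. g (\<lambda>i. x i - y i) \<le> e)"
    then have far: "\<And>y. y \<in> X \<Longrightarrow> e < g (\<lambda>i. x i - y i)" by force
    have notin: "x \<notin> X" using far[of x] g_zero e by auto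
    have "e < g (\<lambda>i. y i - x i)" if "y \<in> X" for y using far[OF that] g_minus[of x y] by simp
    then have "P (insert x X)"
      using X(1) x far unfolding P_def by blast
    then have "card (insert x X) \<le> card X" by (rule X(2))
    then show False using X(1) notin by (simp add: P_def)
  qed
  then show ?thesis using that X(1) bd by (auto simp: P_def)
qed

end

subsection \<open>Entropy numbers are controlled by Kolmogorov widths\<close>

text \<open>\<open>V\<close> is a vector space on which \<open>N\<close> is subadditive and
  homogeneous; it may exceed the target space, and \<open>N\<close> may be infinite on it. In the
  application \<open>V\<close> consists of the integrable functions, on which blocks are
  linear.\<close>

locale function_seminorm =
  fixes V :: "('a \<Rightarrow> complex) set" and N :: "('a \<Rightarrow> complex) \<Rightarrow> ennreal"
  assumes V_add: "f \<in> V \<Longrightarrow> h \<in> V \<Longrightarrow> f + h \<in> V"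
    and V_scale: "f \<in> V \<Longrightarrow> cscale c f \<in> V"
    and V_0: "0 \<in> V"
    and N_add: "f \<in> V \<Longrightarrow> h \<in> V \<Longrightarrow> N (f + h) \<le> N f + N h"
    and N_scale: "f \<in> V \<Longrightarrow> N (cscale c f) = ennreal (cmod c) * N f"
begin

lemma N_0: "N 0 = 0"
proof -
  have "cscale 0 0 = (0 :: 'a \<Rightarrow> complex)" by (simp add: cscale_def fun_eq_iff)
  then show ?thesis using N_scale[OF V_0, of 0] by simp
qed

lemma uminus_eq_cscale: "- f = cscale (-1) f"
  by (simp add: cscale_def fun_eq_iff)

lemma V_minus: "f \<in> V \<Longrightarrow> - f \<in> V"
  unfolding uminus_eq_cscale by (rule V_scale)

lemma V_diff: "f \<in> V \<Longrightarrow> h \<in> V \<Longrightarrow> f - h \<in> V"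
  using V_add[of f "- h"] V_minus[of h] by simp

lemma N_minus: "f \<in> V \<Longrightarrow> N (- f) = N f"
  unfolding uminus_eq_cscale using N_scale[of f "-1"] by simp

lemma N_minus_commute: "f \<in> V \<Longrightarrow> h \<in> V \<Longrightarrow> N (f - h) = N (h - f)"
  using N_minus[OF V_diff[of f h]] by simp

lemma N_triangle: "f \<in> V \<Longrightarrow> h \<in> V \<Longrightarrow> k \<in> V \<Longrightarrow> N (f - k) \<le> N (f - h) + N (h - k)"
  using N_add[of "f - h" "h - k"] V_diff by simp

lemma V_sum: "(\<And>i. i \<in> A \<Longrightarrow> f i \<in> V) \<Longrightarrow> sum f A \<in> V"
  by (induction A rule: infinite_finite_induct) (auto intro: V_add V_0)

lemma N_sum: "(\<And>i. i \<in> A \<Longrightarrow> f i \<in> V) \<Longrightarrow> N (sum f A) \<le> (\<Sum>i\<in>A. N (f i))"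
proof (induction A rule: infinite_finite_induct)
  case (insert x A)
  have "N (f x + sum f A) \<le> N (f x) + N (sum f A)"
    using insert(4) by (intro N_add V_sum) blast+
  also have "\<dots> \<le> N (f x) + (\<Sum>i\<in>A. N (f i))" using insert by (intro add_mono) auto
  finally show ?case unfolding sum.insert[OF insert(1,2)] .
qed (simp_all add: N_0)

lemma V_span: "B \<subseteq> V \<Longrightarrow> cfun.span B \<subseteq> V"
proof
  fix f assume B: "B \<subseteq> V" and f: "f \<in> cfun.span B"
  from f show "f \<in> V"
  proof (induction rule: cfun.span_induct_alt)
    case base
    show ?case by (rule V_0)
  next
    case (step c x y)
    then show ?case using B by (intro V_add V_scale) blast+
  qed
qed

text \<open>Real and imaginary parts of the coefficients parametrise the complex span by
  \<open>2 * card B\<close> real coordinates. \<open>N\<close> pulls back to a seminorm in these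
  coordinates, to which the volume argument applies.\<close>

lemma span_net:
  assumes B: "finite B" "B \<subseteq> V" "\<And>b. b \<in> B \<Longrightarrow> N b < \<infinity>" and R: "0 < R" and e: "0 < e"
  obtains A where "finite A" "A \<subseteq> cfun.span B" "real (card A) \<le> (1 + 2 * R / e) ^ (2 * card B)"
    "\<And>v. v \<in> cfun.span B \<Longrightarrow> N v \<le> ennreal R \<Longrightarrow> \<exists>a\<in>A. N (v - a) \<le> ennreal e"
proof -
  define D where "D = card B"
  obtain h where h: "bij_betw h {..<D} B"
    using ex_bij_betw_nat_finite[OF B(1)] by (auto simp: D_def atLeast0LessThan)
  have hB: "i < D \<Longrightarrow> h i \<in> B" for i using h by (auto simp: bij_betw_def)
  define z where "z x i = Complex (x i) (x (D + i))" for x :: "nat \<Rightarrow> real" and i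
  define val where "val x = (\<Sum>i<D. cscale (z x i) (h i))" for x :: "nat \<Rightarrow> real"
  have val_span: "val x \<in> cfun.span B" for x
    unfolding val_def using hB by (intro cfun.span_sum cfun.span_scale cfun.span_base) auto
  then have val_V: "val x \<in> V" for x using V_span[OF B(2)] by auto
  have val_add: "val (\<lambda>i. x i + y i) = val x + val y" for x y
  proof -
    have "z (\<lambda>i. x i + y i) i = z x i + z y i" for i by (simp add: z_def complex_eq_iff)
    then show ?thesis by (simp add: val_def cfun.scale_left_distrib sum.distrib)
  qed
  have val_scale: "val (\<lambda>i. c * x i) = cscale (of_real c) (val x)" for c x
  proof -
    have "z (\<lambda>i. c * x i) i = of_real c * z x i" for i by (simp add: z_def complex_eq_iff)
    then show ?thesis by (simp add: val_def cfun.scale_sum_right)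
  qed
  have val_diff: "val (\<lambda>i. x i - y i) = val x - val y" for x y
    using val_add[of "\<lambda>i. x i - y i" y] by (simp add: algebra_simps)
  have surj: "\<exists>x. v = val x" if v: "v \<in> cfun.span B" for v
  proof -
    obtain u where u: "v = (\<Sum>b\<in>B. cscale (u b) b)"
      using v unfolding cfun.span_finite[OF B(1)] by blast
    have "v = (\<Sum>i<D. cscale (u (h i)) (h i))"
      unfolding u by (rule sum.reindex_bij_betw[OF h, symmetric])
    also have "\<dots> = val (\<lambda>i. if i < D then Re (u (h i)) else Im (u (h (i - D))))"
      unfolding val_def by (intro sum.cong refl) (simp add: z_def)
    finally show ?thesis by blast
  qed
  have Nfin: "N (val x) < \<infinity>" for x
  proof -
    have "N (val x) \<le> (\<Sum>i<D. N (cscale (z x i) (h i)))"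
      unfolding val_def using hB B(2) by (intro N_sum V_scale) auto
    also have "\<dots> = (\<Sum>i<D. ennreal (cmod (z x i)) * N (h i))"
      using hB B(2) by (intro sum.cong refl N_scale) auto
    also have "\<dots> < \<infinity>"
      using hB B(3) by (auto simp: ennreal_sum_less_top ennreal_mult_less_top)
    finally show ?thesis .
  qed
  define g where "g x = enn2real (N (val x))" for x
  have gN: "N (val x) = ennreal (g x)" for x using Nfin[of x] by (simp add: g_def less_top)
  interpret coordinate_seminorm "2 * D" g
  proof
    fix x y :: "nat \<Rightarrow> real" and c :: real
    have "ennreal (g (\<lambda>i. x i + y i)) \<le> ennreal (g x) + ennreal (g y)"
      unfolding gN[symmetric] val_add by (rule N_add[OF val_V val_V])
    also have "\<dots> = ennreal (g x + g y)" by (simp add: g_def)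
    finally show "g (\<lambda>i. x i + y i) \<le> g x + g y"
      by (subst (asm) ennreal_le_iff) (simp_all add: g_def)
    have "N (val (\<lambda>i. c * x i)) = ennreal \<bar>c\<bar> * N (val x)"
      unfolding val_scale N_scale[OF val_V] by simp
    then show "g (\<lambda>i. c * x i) = \<bar>c\<bar> * g x" by (simp add: g_def enn2real_mult)
    assume eq: "\<And>i. i < 2 * D \<Longrightarrow> x i = y i"
    then have "z x i = z y i" if "i < D" for i using that by (simp add: z_def)
    then have "val x = val y" unfolding val_def by (intro sum.cong) auto
    then show "g x = g y" by (simp add: g_def)
  qed
  obtain X where X: "finite X" "real (card X) \<le> (1 + 2 * R / e) ^ (2 * D)"
    "\<And>x. g x \<le> R \<Longrightarrow> \<exists>y\<in>X. g (\<lambda>i. x i - y i) \<le> e"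
    using net_exists[OF R e] by blast
  show ?thesis
  proof (rule that[of "val ` X"])
    show "finite (val ` X)" using X(1) by simp
    show "val ` X \<subseteq> cfun.span B" using val_span by auto
    have "real (card (val ` X)) \<le> real (card X)" using card_image_le[OF X(1), of val] by simp
    then show "real (card (val ` X)) \<le> (1 + 2 * R / e) ^ (2 * card B)" using X(2) by (simp add: D_def)
    fix v assume v: "v \<in> cfun.span B" "N v \<le> ennreal R"
    obtain x where x: "v = val x" using surj[OF v(1)] by blast
    then have "ennreal (g x) \<le> ennreal R" using v(2) gN by simp
    then have "g x \<le> R" using R by (subst (asm) ennreal_le_iff) auto
    then obtain y where y: "y \<in> X" "g (\<lambda>i. x i - y i) \<le> e" using X(3) by blast
    have "N (v - val y) = ennreal (g (\<lambda>i. x i - y i))" unfolding x gN[symmetric] val_diff ..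
    then have "N (v - val y) \<le> ennreal e" using y(2) by (simp only: ennreal_leI)
    then show "\<exists>a\<in>val ` X. N (v - a) \<le> ennreal e" using y(1) by blast
  qed
qed

lemma power_le_two_power:
  fixes x :: real
  assumes "0 \<le> x" "x \<le> 2 ^ K" "c \<le> 2 ^ (j + 1)"
  shows "x ^ (2 * c) \<le> real (2 ^ (2 ^ (j + 2) * K))"
proof -
  have "2 * c \<le> 2 * 2 ^ (j + 1)" using assms(3) by (rule mult_left_mono) simp
  then have "K * (2 * c) \<le> K * 2 ^ (j + 2)" by (intro mult_left_mono) simp_all
  then have le: "K * (2 * c) \<le> 2 ^ (j + 2) * K" by (simp only: mult.commute)
  have "x ^ (2 * c) \<le> (2 ^ K) ^ (2 * c)" using assms by (intro power_mono)
  also have "\<dots> = 2 ^ (K * (2 * c))" by (rule power_mult[symmetric])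
  also have "\<dots> \<le> 2 ^ (2 ^ (j + 2) * K)" using le by (rule power_increasing) simp
  finally show ?thesis by (simp only: of_nat_power of_nat_numeral)
qed

text \<open>The bits spent on all levels: the net at level \<open>j\<close> lives in at most
  \<open>2 ^ (j + 2)\<close> real dimensions, and each costs
  \<open>3 + a + (a + 1) * (m - j)\<close> bits. The growth of the dimensions absorbs the factor
  linear in \<open>m - j\<close>. In the induction step every earlier level gains
  \<open>(a + 1) * 2 ^ (j + 2)\<close>, and the bound exactly doubles.\<close>

lemma sum_bits_le:
  "(\<Sum>j=1..m. 2 ^ (j + 2) * (3 + a + (a + 1) * (m - j))) \<le> 2 ^ (m + 4) * (2 + a)" for m a :: nat
proof (induction m)
  case (Suc m)
  have "(\<Sum>j=1..k. (2::nat) ^ (j + 2)) \<le> 8 * 2 ^ k" for k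
    by (induction k) simp_all
  moreover have p3: "2 ^ (m + 3) = 8 * (2::nat) ^ m" by (simp add: power_add)
  ultimately have geo: "(\<Sum>j=1..m. (2::nat) ^ (j + 2)) \<le> 2 ^ (m + 3)" by (simp only:)
  have "(\<Sum>j=1..Suc m. 2 ^ (j + 2) * (3 + a + (a + 1) * (Suc m - j)))
      = (\<Sum>j=1..m. 2 ^ (j + 2) * (3 + a + (a + 1) * (Suc m - j))) + 2 ^ (m + 3) * (3 + a)"
    unfolding p3 by simp
  also have "(\<Sum>j=1..m. 2 ^ (j + 2) * (3 + a + (a + 1) * (Suc m - j)))
      = (\<Sum>j=1..m. 2 ^ (j + 2) * (3 + a + (a + 1) * (m - j)) + (a + 1) * 2 ^ (j + 2))"
    by (intro sum.cong refl) (auto simp: Suc_diff_le algebra_simps)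
  also have "\<dots> = (\<Sum>j=1..m. 2 ^ (j + 2) * (3 + a + (a + 1) * (m - j))) + (a + 1) * (\<Sum>j=1..m. 2 ^ (j + 2))"
    by (simp only: sum.distrib sum_distrib_left)
  also have "\<dots> + 2 ^ (m + 3) * (3 + a) \<le> 2 ^ (m + 4) * (2 + a) + (a + 1) * 2 ^ (m + 3) + 2 ^ (m + 3) * (3 + a)"
    by (intro add_mono mult_left_mono order_refl Suc.IH geo) auto
  also have "\<dots> = 2 ^ (Suc m + 4) * (2 + a)"
    by (simp add: power_add algebra_simps)
  finally show ?case .
qed simp

text \<open>
  Carl's argument: near-best approximants from subspaces of dimension \<open>2 ^ j\<close> are telescoped, and
  the \<open>j\<close>-th difference is replaced by a point of a net whose mesh shrinks geometrically in \<open>m - j\<close>.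
\<close>

lemma entropy_number_le:
  assumes Y: "Y \<subseteq> V" "\<And>f. f \<in> Y \<Longrightarrow> N f < \<infinity>" "0 \<in> Y" and W: "W \<subseteq> Y"
    and \<delta>0: "\<And>w. w \<in> W \<Longrightarrow> N w \<le> ennreal (\<delta> 0)"
    and \<delta>: "\<And>j. 1 \<le> j \<Longrightarrow> j \<le> m \<Longrightarrow> kolmogorov_width (2 ^ j) W Y N < ennreal (\<delta> j)"
    and pos: "0 < \<delta> m" and growth: "\<And>j. j \<le> m \<Longrightarrow> \<delta> j \<le> 2 ^ (a * (m - j)) * \<delta> m"
    and M: "2 ^ (m + 4) * (2 + a) \<le> M"
  shows "entropy_number M W Y N \<le> ennreal (6 * \<delta> m)"
proof -
  \<comment> \<open>At level 0 the subspace is trivial, so the telescoping starts from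
    \<open>u 0 = 0\<close>; this is where the bound of \<open>N\<close> on \<open>W\<close> by
    \<open>\<delta> 0\<close> enters.\<close>
  define good where "good j B \<longleftrightarrow> finite B \<and> card B \<le> 2 ^ j \<and> B \<subseteq> Y \<and>
    (\<forall>w\<in>W. \<exists>u\<in>cfun.span B. N (w - u) \<le> ennreal (\<delta> j)) \<and> (j = 0 \<longrightarrow> B = {})" for j B
  have "\<exists>B. good j B" if j: "j \<le> m" for j
  proof (cases "j = 0")
    case True
    have "\<exists>u\<in>cfun.span {}. N (w - u) \<le> ennreal (\<delta> j)" if "w \<in> W" for w
      using \<delta>0[OF that] unfolding True by (intro bexI[OF _ cfun.span_zero]) (simp only: diff_zero)
    then have "good j {}" unfolding good_def by simp
    then show ?thesis by blast
  next
    case False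
    then have "kolmogorov_width (2 ^ j) W Y N < ennreal (\<delta> j)" using \<delta> j by simp
    then obtain L where L: "L \<in> subspaces_upto Y (2 ^ j)" "(SUP w\<in>W. INF u\<in>L. N (w - u)) < ennreal (\<delta> j)"
      unfolding kolmogorov_width_def INF_less_iff[of _ "subspaces_upto Y (2 ^ j)"] by (rule bexE)
    obtain B where B: "finite B" "card B \<le> 2 ^ j" "cfun.span B = L" "L \<subseteq> Y"
      using L(1) unfolding subspaces_upto_def by blast
    have "\<exists>u\<in>cfun.span B. N (w - u) \<le> ennreal (\<delta> j)" if w: "w \<in> W" for w
    proof -
      have "(INF u\<in>L. N (w - u)) \<le> (SUP w\<in>W. INF u\<in>L. N (w - u))" by (rule SUP_upper[OF w])
      also note L(2)
      finally obtain u where "u \<in> L" "N (w - u) < ennreal (\<delta> j)" unfolding INF_less_iff by (rule bexE)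
      then show ?thesis unfolding B(3) by (intro bexI[of _ u] less_imp_le)
    qed
    moreover have "B \<subseteq> Y" using cfun.span_superset[of B] unfolding B(3) using B(4) by (rule subset_trans)
    ultimately have "good j B" unfolding good_def using B(1,2) False by blast
    then show ?thesis by blast
  qed
  then have "\<forall>j. \<exists>B. j \<le> m \<longrightarrow> good j B" by blast
  then obtain B where "\<forall>j. j \<le> m \<longrightarrow> good j (B j)" by (rule choice[THEN exE])
  then have B: "\<And>j. j \<le> m \<Longrightarrow> finite (B j)" "\<And>j. j \<le> m \<Longrightarrow> card (B j) \<le> 2 ^ j" "\<And>j. j \<le> m \<Longrightarrow> B j \<subseteq> Y"
    "\<And>j w. j \<le> m \<Longrightarrow> w \<in> W \<Longrightarrow> \<exists>u\<in>cfun.span (B j). N (w - u) \<le> ennreal (\<delta> j)" "B 0 = {}"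
    unfolding good_def by blast+
  \<comment> \<open>\<open>R j\<close> dominates \<open>\<delta> j + \<delta> (j - 1)\<close> by the
    growth condition, hence the difference of consecutive approximants. The meshes
    \<open>e j\<close> sum to at most \<open>2 * \<delta> m\<close>.\<close>
  define R where "R j = 2 * 2 ^ (a * (m - j + 1)) * \<delta> m" for j
  define e where "e j = \<delta> m / 2 ^ (m - j)" for j
  define C where "C j = B j \<union> B (j - 1)" for j
  have Rpos: "0 < R j" "0 < e j" for j using pos by (auto simp: R_def e_def)
  have C: "finite (C j)" "C j \<subseteq> Y" "card (C j) \<le> 2 ^ (j + 1)" if "j \<in> {1..m}" for j
  proof -
    have j: "j \<le> m" "j - 1 \<le> m" using that by auto
    show "finite (C j)" "C j \<subseteq> Y" using B(1,3)[OF j(1)] B(1,3)[OF j(2)] by (auto simp: C_def)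
    have "card (C j) \<le> card (B j) + card (B (j - 1))" unfolding C_def by (rule card_Un_le)
    also have "\<dots> \<le> 2 ^ j + 2 ^ (j - 1)" by (rule add_mono[OF B(2)[OF j(1)] B(2)[OF j(2)]])
    also have "\<dots> \<le> 2 ^ j + 2 ^ j" by (rule add_left_mono, rule power_increasing) simp_all
    also have "\<dots> = 2 ^ (j + 1)" by simp
    finally show "card (C j) \<le> 2 ^ (j + 1)" .
  qed
  define net where "net j A \<longleftrightarrow> finite A \<and> A \<subseteq> cfun.span (C j) \<and> real (card A) \<le> (1 + 2 * R j / e j) ^ (2 * card (C j)) \<and>
    (\<forall>v\<in>cfun.span (C j). N v \<le> ennreal (R j) \<longrightarrow> (\<exists>a\<in>A. N (v - a) \<le> ennreal (e j)))" for j A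
  have "\<exists>A. net j A" if j: "j \<in> {1..m}" for j
  proof -
    have CV: "C j \<subseteq> V" "\<And>b. b \<in> C j \<Longrightarrow> N b < \<infinity>" using C[OF j] Y by blast+
    show ?thesis
    proof (rule span_net[OF C(1)[OF j] CV Rpos(1)[of j] Rpos(2)[of j]])
      fix A assume "finite A" "A \<subseteq> cfun.span (C j)" "real (card A) \<le> (1 + 2 * R j / e j) ^ (2 * card (C j))"
        "\<And>v. v \<in> cfun.span (C j) \<Longrightarrow> N v \<le> ennreal (R j) \<Longrightarrow> \<exists>a\<in>A. N (v - a) \<le> ennreal (e j)"
      then have "net j A" unfolding net_def by blast
      then show "\<exists>A. net j A" by blast
    qed
  qed
  then have "\<forall>j. \<exists>A. j \<in> {1..m} \<longrightarrow> net j A" by blast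
  then obtain A where "\<forall>j. j \<in> {1..m} \<longrightarrow> net j (A j)" by (rule choice[THEN exE])
  then have A: "\<And>j. j \<in> {1..m} \<Longrightarrow> finite (A j)" "\<And>j. j \<in> {1..m} \<Longrightarrow> A j \<subseteq> cfun.span (C j)"
    "\<And>j. j \<in> {1..m} \<Longrightarrow> real (card (A j)) \<le> (1 + 2 * R j / e j) ^ (2 * card (C j))"
    "\<And>j v. j \<in> {1..m} \<Longrightarrow> v \<in> cfun.span (C j) \<Longrightarrow> N v \<le> ennreal (R j) \<Longrightarrow> \<exists>a\<in>A j. N (v - a) \<le> ennreal (e j)"
    unfolding net_def by blast+
  have spanV: "cfun.span (B j) \<subseteq> V" if "j \<le> m" for j using B(3)[OF that] Y(1) by (intro V_span) auto
  have AV: "A j \<subseteq> V" if "j \<in> {1..m}" for j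
    using A(2)[OF that] V_span[of "C j"] C(2)[OF that] Y(1) by blast
  define T where "T = (\<Pi>\<^sub>E j\<in>{1..m}. A j)"
  have T: "finite T" unfolding T_def using A(1) by (intro finite_PiE) auto
  have cardA: "card (A j) \<le> 2 ^ (2 ^ (j + 2) * (3 + a + (a + 1) * (m - j)))" if j: "j \<in> {1..m}" for j
  proof -
    define k where "k = m - j"
    have ex: "2 + a + (a + 1) * k = 2 + a * (k + 1) + k" by (simp add: algebra_simps)
    have "2 * R j / e j = 4 * 2 ^ (a * (k + 1)) * 2 ^ k"
    proof -
      have "2 * (2 * x * y) / (y / z) = 4 * x * z" if "y > 0" for x y z :: real
        using that by simp
      from this[OF pos] show ?thesis by (simp only: R_def e_def k_def)
    qed
    also have "\<dots> = 2 ^ (2 + a + (a + 1) * k)"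
      unfolding ex power_add by simp
    finally have "1 + 2 * R j / e j \<le> 2 * 2 ^ (2 + a + (a + 1) * k)"
      using one_le_power[of "2::real" "2 + a + (a + 1) * k"] by linarith
    moreover have "(2::real) * 2 ^ (2 + a + (a + 1) * k) = 2 ^ Suc (2 + a + (a + 1) * k)" by (rule power_Suc[symmetric])
    moreover have "Suc (2 + a + (a + 1) * k) = 3 + a + (a + 1) * (m - j)" by (simp add: k_def)
    ultimately have b: "1 + 2 * R j / e j \<le> 2 ^ (3 + a + (a + 1) * (m - j))" by (simp only:)
    have "0 \<le> R j / e j" using Rpos[of j] by (intro divide_nonneg_pos less_imp_le)
    then have nn: "0 \<le> 1 + 2 * R j / e j" by simp
    have "real (card (A j)) \<le> (1 + 2 * R j / e j) ^ (2 * card (C j))" by (rule A(3)[OF j])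
    also have "\<dots> \<le> real (2 ^ (2 ^ (j + 2) * (3 + a + (a + 1) * (m - j))))"
      by (rule power_le_two_power[OF nn b C(3)[OF j]])
    finally have "real (card (A j)) \<le> real (2 ^ (2 ^ (j + 2) * (3 + a + (a + 1) * (m - j))))" .
    then show ?thesis by (simp only: of_nat_le_iff)
  qed
  have "card T = (\<Prod>j\<in>{1..m}. card (A j))" unfolding T_def by (rule card_PiE) simp
  also have "\<dots> \<le> (\<Prod>j\<in>{1..m}. 2 ^ (2 ^ (j + 2) * (3 + a + (a + 1) * (m - j))))"
    by (intro prod_mono conjI cardA) auto
  also have "\<dots> = 2 ^ (\<Sum>j=1..m. 2 ^ (j + 2) * (3 + a + (a + 1) * (m - j)))" by (rule power_sum[symmetric])
  also have "\<dots> \<le> 2 ^ M"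
    by (rule power_increasing[OF order_trans[OF sum_bits_le M]]) simp
  finally have cT: "card T \<le> 2 ^ M" .
  have cover: "\<exists>t\<in>T. N (w - (\<Sum>j=1..m. t j)) \<le> ennreal (3 * \<delta> m)" if w: "w \<in> W" for w
  proof -
    have wV: "w \<in> V" using w W Y by auto
    have "\<forall>j. \<exists>u. j \<le> m \<longrightarrow> u \<in> cfun.span (B j) \<and> N (w - u) \<le> ennreal (\<delta> j)"
      using B(4)[OF _ w] by blast
    then obtain u where "\<forall>j. j \<le> m \<longrightarrow> u j \<in> cfun.span (B j) \<and> N (w - u j) \<le> ennreal (\<delta> j)"
      by (rule choice[THEN exE])
    then have u: "\<And>j. j \<le> m \<Longrightarrow> u j \<in> cfun.span (B j)" "\<And>j. j \<le> m \<Longrightarrow> N (w - u j) \<le> ennreal (\<delta> j)"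
      by simp_all
    have uV: "u j \<in> V" if "j \<le> m" for j using u(1) spanV that by blast
    have "\<exists>a\<in>A j. N (u j - u (j - 1) - a) \<le> ennreal (e j)" if j: "j \<in> {1..m}" for j
    proof (rule A(4)[OF j])
      have jm: "j \<le> m" "j - 1 \<le> m" using j by auto
      show "u j - u (j - 1) \<in> cfun.span (C j)"
        using u(1)[OF jm(1)] u(1)[OF jm(2)] cfun.span_mono[of "B j" "C j"] cfun.span_mono[of "B (j - 1)" "C j"]
        unfolding C_def by (intro cfun.span_diff) blast+
      have "N (u j - u (j - 1)) \<le> N (u j - w) + N (w - u (j - 1))"
        by (intro N_triangle uV wV jm)
      also have "\<dots> \<le> ennreal (\<delta> j) + ennreal (\<delta> (j - 1))"
        using u(2)[OF jm(1)] u(2)[OF jm(2)] N_minus_commute[OF wV uV[OF jm(1)]] by (intro add_mono) auto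
      also have "\<dots> \<le> ennreal (2 ^ (a * (m - j + 1)) * \<delta> m) + ennreal (2 ^ (a * (m - j + 1)) * \<delta> m)"
      proof (intro add_mono ennreal_leI)
        have "\<delta> j \<le> 2 ^ (a * (m - j)) * \<delta> m" by (rule growth[OF jm(1)])
        also have "\<dots> \<le> 2 ^ (a * (m - j + 1)) * \<delta> m"
          using pos by (intro mult_right_mono power_increasing) auto
        finally show "\<delta> j \<le> 2 ^ (a * (m - j + 1)) * \<delta> m" .
        have "m - (j - 1) = m - j + 1" using j by auto
        then show "\<delta> (j - 1) \<le> 2 ^ (a * (m - j + 1)) * \<delta> m" using growth[OF jm(2)] by simp
      qed
      also have "\<dots> = ennreal (R j)" using pos by (simp add: R_def flip: ennreal_plus)
      finally show "N (u j - u (j - 1)) \<le> ennreal (R j)" .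
    qed
    then have "\<forall>j. \<exists>a. j \<in> {1..m} \<longrightarrow> a \<in> A j \<and> N (u j - u (j - 1) - a) \<le> ennreal (e j)" by blast
    then obtain t where "\<forall>j. j \<in> {1..m} \<longrightarrow> t j \<in> A j \<and> N (u j - u (j - 1) - t j) \<le> ennreal (e j)"
      by (rule choice[THEN exE])
    then have t: "\<And>j. j \<in> {1..m} \<Longrightarrow> t j \<in> A j" "\<And>j. j \<in> {1..m} \<Longrightarrow> N (u j - u (j - 1) - t j) \<le> ennreal (e j)"
      by blast+
    define t' where "t' = restrict t {1..m}"
    have "u 0 = 0" using u(1)[of 0] B(5) by simp
    then have tele: "u m = (\<Sum>j=1..m. u j - u (j - 1))"
      using sum_telescope''[of 0 m u] by (simp add: atLeastSucAtMost_greaterThanAtMost)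
    have tV: "t j \<in> V" if "j \<in> {1..m}" for j using t(1) AV that by blast
    have vV: "u j - u (j - 1) - t j \<in> V" if "j \<in> {1..m}" for j
      using that by (intro V_diff uV tV) auto
    have eq: "w - (\<Sum>j=1..m. t j) = (w - u m) + (\<Sum>j=1..m. u j - u (j - 1) - t j)"
      unfolding sum_subtractf[of _ t] tele[symmetric] by simp
    have "N (w - (\<Sum>j=1..m. t j)) \<le> N (w - u m) + N (\<Sum>j=1..m. u j - u (j - 1) - t j)"
      unfolding eq by (intro N_add V_diff wV uV V_sum vV order_refl)
    also have "\<dots> \<le> ennreal (\<delta> m) + (\<Sum>j=1..m. ennreal (e j))"
      using u(2)[of m] t(2) vV by (intro add_mono order_trans[OF N_sum] sum_mono) auto
    also have "\<dots> = ennreal (\<delta> m + (\<Sum>j=1..m. e j))"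
    proof -
      have "0 \<le> (\<Sum>j=1..m. e j)" using Rpos(2) by (intro sum_nonneg less_imp_le)
      then show ?thesis using pos Rpos(2) by (simp add: sum_ennreal less_imp_le)
    qed
    also have "\<dots> \<le> ennreal (3 * \<delta> m)"
    proof (rule ennreal_leI)
      have "(\<Sum>j=1..k. 1 / 2 ^ (k - j)) \<le> (2::real)" for k :: nat
      proof -
        have "(\<Sum>j=1..k. 1 / 2 ^ (k - j)) = (\<Sum>i<k. 1 / (2::real) ^ i)"
          by (intro sum.reindex_bij_witness[of _ "\<lambda>i. k - i" "\<lambda>j. k - j"]) auto
        also have "\<dots> = (\<Sum>i<k. (1 / 2) ^ i)" by (simp add: power_divide)
        also have "\<dots> \<le> 2" by (simp add: geometric_sum)
        finally show ?thesis .
      qed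
      then have "\<delta> m * (\<Sum>j=1..m. 1 / 2 ^ (m - j)) \<le> \<delta> m * 2" using pos by (intro mult_left_mono) auto
      then show "\<delta> m + (\<Sum>j=1..m. e j) \<le> 3 * \<delta> m" by (simp add: e_def sum_distrib_left)
    qed
    also have "(\<Sum>j=1..m. t j) = (\<Sum>j=1..m. t' j)" by (rule sum.cong) (auto simp: t'_def)
    finally have "N (w - (\<Sum>j=1..m. t' j)) \<le> ennreal (3 * \<delta> m)" .
    moreover have "t' \<in> T" using t(1) by (auto simp: t'_def T_def)
    ultimately show ?thesis by blast
  qed
  define P where "P t w \<longleftrightarrow> w \<in> W \<and> N (w - (\<Sum>j=1..m. t j)) \<le> ennreal (3 * \<delta> m)" for t w
  \<comment> \<open>The sums of net points lie in \<open>V\<close>, whereas centres must lie in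
    \<open>Y\<close>. Each sum is replaced by a point of \<open>W\<close> near it, if there is one,
    which doubles the radius from \<open>3 * \<delta> m\<close> to
    \<open>6 * \<delta> m\<close>.\<close>
  define Z where "Z = (\<lambda>t. if \<exists>w. P t w then SOME w. P t w else 0) ` T"
  have Z: "finite Z" "card Z \<le> 2 ^ M" "Z \<subseteq> Y"
  proof -
    show "finite Z" using T by (simp add: Z_def)
    show "card Z \<le> 2 ^ M" unfolding Z_def using card_image_le[OF T] cT order_trans by blast
    have "(if \<exists>w. P t w then SOME w. P t w else 0) \<in> Y" for t
      using someI_ex[of "P t"] W Y(3) by (auto simp: P_def)
    then show "Z \<subseteq> Y" unfolding Z_def by blast
  qed
  have ZW: "\<exists>y\<in>Z. N (w - y) \<le> ennreal (6 * \<delta> m)" if w: "w \<in> W" for w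
  proof -
    obtain t where t: "t \<in> T" "P t w" using cover[OF w] w by (auto simp: P_def)
    let ?y = "SOME w. P t w"
    have y: "P t ?y" by (rule someI[of "P t", OF t(2)])
    have wV: "w \<in> V" "?y \<in> V" using w y W Y by (auto simp: P_def)
    have sV: "(\<Sum>j=1..m. t j) \<in> V" using t(1) by (intro V_sum subsetD[OF AV]) (auto simp: T_def PiE_iff)
    have "N (w - ?y) \<le> N (w - (\<Sum>j=1..m. t j)) + N ((\<Sum>j=1..m. t j) - ?y)"
      by (intro N_triangle wV sV)
    also have "\<dots> \<le> ennreal (3 * \<delta> m) + ennreal (3 * \<delta> m)"
      using t(2) y N_minus_commute[OF wV(2) sV] by (intro add_mono) (auto simp: P_def)
    also have "\<dots> = ennreal (6 * \<delta> m)" using pos by (simp flip: ennreal_plus)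
    finally have "N (w - ?y) \<le> ennreal (6 * \<delta> m)" .
    moreover have "?y \<in> Z" unfolding Z_def using t by (auto intro!: image_eqI[of _ _ t])
    ultimately show ?thesis by blast
  qed
  have "\<exists>y::nat \<Rightarrow> 'a \<Rightarrow> complex. (\<forall>j\<in>{1..2 ^ M}. y j \<in> Y) \<and> Z \<subseteq> y ` {1..2 ^ M}"
  proof -
    obtain h where h: "bij_betw h {..<card Z} Z" using ex_bij_betw_nat_finite[OF Z(1)] by (auto simp: atLeast0LessThan)
    define y where "y j = (if j - 1 < card Z then h (j - 1) else 0)" for j
    have "y j \<in> Y" for j using h Z(3) Y(3) by (auto simp: y_def bij_betw_def)
    moreover have "Z \<subseteq> y ` {1..2 ^ M}"
    proof
      fix v assume "v \<in> Z"
      then obtain i where i: "i < card Z" "v = h i" using h by (auto simp: bij_betw_def)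
      then have "v = y (i + 1)" "i + 1 \<in> {1..2 ^ M}" using Z(2) by (auto simp: y_def)
      then show "v \<in> y ` {1..2 ^ M}" by blast
    qed
    ultimately show ?thesis by blast
  qed
  then obtain y :: "nat \<Rightarrow> 'a \<Rightarrow> complex" where y: "\<forall>j\<in>{1..2 ^ M}. y j \<in> Y" "Z \<subseteq> y ` {1..2 ^ M}" by blast
  have "W \<subseteq> (\<Union>j\<in>{1..2 ^ M}. {f \<in> Y. N (f - y j) \<le> ennreal (6 * \<delta> m)})"
  proof
    fix w assume w: "w \<in> W"
    obtain v where v: "v \<in> Z" "N (w - v) \<le> ennreal (6 * \<delta> m)" using ZW[OF w] by blast
    then obtain j where "j \<in> {1..2 ^ M}" "v = y j" using y(2) by blast
    then show "w \<in> (\<Union>j\<in>{1..2 ^ M}. {f \<in> Y. N (f - y j) \<le> ennreal (6 * \<delta> m)})" using v w W by blast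
  qed
  then show ?thesis unfolding entropy_number_def using y(1) by (intro Inf_lower) blast
qed

end

subsection \<open>Sections of the cube and Hamming balls\<close>

text \<open>Gaussian elimination: an equation with nonzero coefficient at \<open>j\<close> is solved
  for the unknown at \<open>j\<close> and substituted into the others, which removes one equation
  and one unknown.\<close>

lemma homogeneous_system:
  fixes a :: "'b \<Rightarrow> 'i \<Rightarrow> complex"
  assumes "finite B" "finite I" "card B < card I"
  shows "\<exists>z. (\<exists>i\<in>I. z i \<noteq> 0) \<and> (\<forall>b\<in>B. (\<Sum>i\<in>I. z i * a b i) = 0)"
  using assms
proof (induction B arbitrary: I a rule: finite_induct)
  case empty
  then obtain i where "i \<in> I" by fastforce
  then show ?case by (intro exI[of _ "\<lambda>_. 1"]) auto
next
  case (insert b B)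
  show ?case
  proof (cases "\<forall>i\<in>I. a b i = 0")
    case True
    obtain z where "\<exists>i\<in>I. z i \<noteq> 0" "\<forall>b\<in>B. (\<Sum>i\<in>I. z i * a b i) = 0"
      using insert.IH[of I a] insert.prems insert.hyps by auto
    moreover have "(\<Sum>i\<in>I. z i * a b i) = 0" using True by (intro sum.neutral) simp
    ultimately show ?thesis by blast
  next
    case False
    then obtain j where j: "j \<in> I" "a b j \<noteq> 0" by blast
    define a' where "a' c i = a c i - a c j * a b i / a b j" for c i
    have "card B < card (I - {j})" using insert.prems insert.hyps j by simp
    then obtain z where z: "\<exists>i\<in>I - {j}. z i \<noteq> 0" "\<forall>c\<in>B. (\<Sum>i\<in>I - {j}. z i * a' c i) = 0"
      using insert.IH[of "I - {j}" a'] insert.prems by auto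
    define w where "w i = (if i = j then - (\<Sum>i\<in>I - {j}. z i * a b i) / a b j else z i)" for i
    have split: "(\<Sum>i\<in>I. w i * a c i) = - (\<Sum>i\<in>I - {j}. z i * a b i) / a b j * a c j + (\<Sum>i\<in>I - {j}. z i * a c i)" for c
    proof -
      have "(\<Sum>i\<in>I. w i * a c i) = w j * a c j + (\<Sum>i\<in>I - {j}. w i * a c i)"
        using insert.prems j by (intro sum.remove)
      moreover have "(\<Sum>i\<in>I - {j}. w i * a c i) = (\<Sum>i\<in>I - {j}. z i * a c i)"
        by (intro sum.cong) (auto simp: w_def)
      ultimately show ?thesis by (simp add: w_def)
    qed
    have "(\<Sum>i\<in>I. w i * a b i) = 0" unfolding split using j by simp
    moreover have "(\<Sum>i\<in>I. w i * a c i) = 0" if "c \<in> B" for c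
    proof -
      have "z i * a' c i = z i * a c i - z i * a b i * (a c j / a b j)" for i
        by (simp add: a'_def right_diff_distrib)
      then have "(\<Sum>i\<in>I - {j}. z i * a' c i) = (\<Sum>i\<in>I - {j}. z i * a c i) - (\<Sum>i\<in>I - {j}. z i * a b i) * (a c j / a b j)"
        by (simp only: sum_subtractf sum_distrib_right)
      then have "0 = (\<Sum>i\<in>I - {j}. z i * a c i) - (\<Sum>i\<in>I - {j}. z i * a b i) * (a c j / a b j)"
        using z(2) that by simp
      then show ?thesis unfolding split by simp
    qed
    moreover have "\<exists>i\<in>I. w i \<noteq> 0" using z(1) by (auto simp: w_def)
    ultimately show ?thesis by blast
  qed
qed

text \<open>Intermediate values: the modulus is below 1 at \<open>t = 0\<close> and at least
  \<open>2 - |y|\<close>, hence above 1, at \<open>t = 2 / |z|\<close>.\<close>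

lemma exists_unit_modulus:
  fixes y z :: complex
  assumes "cmod y < 1" "z \<noteq> 0"
  obtains t where "0 < t" "cmod (y + of_real t * z) = 1"
proof -
  let ?h = "\<lambda>t::real. cmod (y + of_real t * z)"
  have "\<exists>t\<ge>0. t \<le> 2 / cmod z \<and> ?h t = 1"
  proof (rule IVT')
    show "?h 0 \<le> 1" using assms by simp
    have "cmod (of_real (2 / cmod z) * z) = 2" using assms by (simp add: norm_mult norm_divide)
    moreover have "cmod (of_real (2 / cmod z) * z) \<le> cmod (y + of_real (2 / cmod z) * z) + cmod y"
      using norm_triangle_ineq4[of "y + of_real (2 / cmod z) * z" y] by simp
    ultimately show "1 \<le> ?h (2 / cmod z)" using assms by linarith
    show "continuous_on {0..2 / cmod z} ?h" by (intro continuous_intros)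
  qed (use assms in simp)
  then obtain t where t: "0 \<le> t" "?h t = 1" by blast
  moreover have "t \<noteq> 0" using t assms by auto
  ultimately show ?thesis using that[of t] by simp
qed

text \<open>The witness is an extreme point of the section of the cube.\<close>

lemma cube_section_extreme:
  fixes a :: "'b \<Rightarrow> 'i \<Rightarrow> complex"
  assumes B: "finite B" and I: "finite I"
  shows "\<exists>y. (\<forall>i\<in>I. cmod (y i) \<le> 1) \<and> (\<forall>b\<in>B. (\<Sum>i\<in>I. y i * a b i) = 0)
    \<and> card I \<le> card {i\<in>I. cmod (y i) = 1} + card B"
proof -
  define P where "P y \<longleftrightarrow> (\<forall>i\<in>I. cmod (y i) \<le> 1) \<and> (\<forall>b\<in>B. (\<Sum>i\<in>I. y i * a b i) = 0)" for y :: "'i \<Rightarrow> complex"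
  define u where "u y = card {i\<in>I. cmod (y i) = 1}" for y :: "'i \<Rightarrow> complex"
  have "u y < card I + 1" for y unfolding u_def using card_mono[OF I, of "{i\<in>I. cmod (y i) = 1}"] by (simp add: less_Suc_eq_le)
  moreover have "P (\<lambda>_. 0)" by (simp add: P_def)
  \<comment> \<open>Extremality is expressed by a maximal number of unimodular coordinates.\<close>
  ultimately obtain y where y: "P y" "\<And>w. P w \<Longrightarrow> u w \<le> u y"
    using ex_has_greatest_nat[of P "\<lambda>_. 0" u "card I + 1"] by blast
  have "card I \<le> u y + card B"
  proof (rule ccontr)
    assume "\<not> card I \<le> u y + card B"
    define J where "J = {i\<in>I. cmod (y i) = 1}"
    have J: "J \<subseteq> I" "finite J" using I by (auto simp: J_def)
    have "card B < card (I - J)"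
      using \<open>\<not> card I \<le> u y + card B\<close> card_Diff_subset[OF J(2,1)] by (simp add: u_def J_def)
    then obtain z where z: "\<exists>i\<in>I - J. z i \<noteq> 0" "\<forall>b\<in>B. (\<Sum>i\<in>I - J. z i * a b i) = 0"
      using homogeneous_system[OF B, of "I - J" a] I by auto
    define S where "S = {i\<in>I - J. z i \<noteq> 0}"
    have S: "finite S" "S \<noteq> {}" using I z(1) by (auto simp: S_def)
    have lt: "cmod (y i) < 1" if "i \<in> I - J" for i
      using y(1) that by (auto simp: P_def J_def less_le)
    have "\<exists>t>0. cmod (y i + of_real t * z i) = 1" if "i \<in> S" for i
      using exists_unit_modulus[of "y i" "z i"] lt[of i] that by (auto simp: S_def)
    then have "\<forall>i. \<exists>t. i \<in> S \<longrightarrow> 0 < t \<and> cmod (y i + of_real t * z i) = 1" by blast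
    then obtain t where "\<forall>i. i \<in> S \<longrightarrow> 0 < t i \<and> cmod (y i + of_real (t i) * z i) = 1"
      by (rule choice[THEN exE])
    then have t: "\<And>i. i \<in> S \<Longrightarrow> 0 < t i" "\<And>i. i \<in> S \<Longrightarrow> cmod (y i + of_real (t i) * z i) = 1" by blast+
    \<comment> \<open>\<open>m\<close> is the first time at which a coordinate reaches modulus 1 on
      the way from \<open>y\<close> along \<open>z\<close>. Until then every moving coordinate is a
      convex combination of \<open>y i\<close> and its own unimodular point.\<close>
    define m where "m = Min (t ` S)"
    have "m \<in> t ` S" unfolding m_def using S by (intro Min_in) auto
    then obtain i0 where i0: "i0 \<in> S" "m = t i0" by auto
    have m0: "0 < m" using t(1)[OF i0(1)] i0(2) by simp
    have mle: "m \<le> t i" if "i \<in> S" for i unfolding m_def using S that by (intro Min_le) auto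
    define w where "w i = (if i \<in> I - J then y i + of_real m * z i else y i)" for i
    have wle: "cmod (w i) \<le> 1" if "i \<in> I" for i
    proof (cases "i \<in> S")
      case True
      define l where "l = m / t i"
      have l: "0 \<le> l" "l \<le> 1" using m0 mle[OF True] t(1)[OF True] by (auto simp: l_def)
      have "y i + of_real m * z i = of_real (1 - l) * y i + of_real l * (y i + of_real (t i) * z i)"
        using t(1)[OF True] by (simp add: l_def algebra_simps)
      also have "cmod \<dots> \<le> cmod (of_real (1 - l) * y i) + cmod (of_real l * (y i + of_real (t i) * z i))"
        by (rule norm_triangle_ineq)
      also have "\<dots> = (1 - l) * cmod (y i) + l * 1"
        using l t(2)[OF True] by (simp only: norm_mult norm_of_real abs_of_nonneg diff_ge_0_iff_ge)
      also have "\<dots> \<le> (1 - l) * 1 + l * 1"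
        using l lt[of i] True by (intro add_mono mult_left_mono) (auto simp: S_def)
      finally show ?thesis using True by (simp add: w_def S_def)
    next
      case False
      then have "w i = y i" using that by (auto simp: w_def S_def)
      then show ?thesis using y(1) that by (simp add: P_def)
    qed
    have "P w" unfolding P_def
    proof (intro conjI ballI)
      fix b assume b: "b \<in> B"
      have "w i * a b i = y i * a b i + of_real m * (if i \<in> I - J then z i * a b i else 0)" for i
        by (simp add: w_def algebra_simps)
      then have "(\<Sum>i\<in>I. w i * a b i) = (\<Sum>i\<in>I. y i * a b i) + of_real m * (\<Sum>i\<in>I. if i \<in> I - J then z i * a b i else 0)"
        by (simp only: sum.distrib sum_distrib_left)
      also have "(\<Sum>i\<in>I. if i \<in> I - J then z i * a b i else 0) = (\<Sum>i\<in>I - J. z i * a b i)"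
        by (rule sum.mono_neutral_cong_right) (use I in auto)
      finally show "(\<Sum>i\<in>I. w i * a b i) = 0" using z(2) y(1) b by (simp add: P_def)
    qed (rule wle)
    moreover have "u y < u w"
    proof -
      have "insert i0 J \<subseteq> {i\<in>I. cmod (w i) = 1}"
        using i0 t(2)[OF i0(1)] J by (auto simp: w_def S_def J_def)
      then have "card (insert i0 J) \<le> u w" unfolding u_def using I by (intro card_mono) auto
      moreover have "i0 \<notin> J" using i0 by (simp add: S_def)
      ultimately show ?thesis using J by (simp add: u_def J_def)
    qed
    ultimately show False using y(2)[of w] by simp
  qed
  then show ?thesis using y(1) by (auto simp: P_def u_def)
qed

text \<open>A Chernoff-type count: a subset \<open>C\<close> of \<open>I\<close> gets the weight
  \<open>(1/8) ^ card C\<close>. All weights sum to \<open>(9/8) ^ N\<close>, and each member of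
  \<open>F\<close>, shifted by \<open>A0\<close>, has weight at least \<open>(1/8) ^ h\<close>. For
  \<open>16 * h \<le> N\<close> fewer than 2 to the power \<open>N / 2\<close> members remain,
  because \<open>8 * (9/8) ^ 16 < 2 ^ 8\<close>; sixteenth powers keep the claim in the
  naturals.\<close>

lemma hamming_ball_card:
  assumes I: "finite I" "I \<noteq> {}" and h: "16 * h \<le> card I"
    and F: "F \<subseteq> Pow I" "\<And>A. A \<in> F \<Longrightarrow> card (sym_diff A A0) \<le> h" and A0: "A0 \<subseteq> I"
  shows "card F ^ 16 < 2 ^ (8 * card I)"
proof -
  define N where "N = card I"
  have N: "0 < N" using I by (simp add: N_def card_gt_0_iff)
  have inj: "inj_on (\<lambda>A. sym_diff A A0) F" by (rule inj_onI) blast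
  have finF: "finite F" using F(1) I(1) by (meson finite_Pow_iff finite_subset)
  have wsum: "(\<Sum>C\<in>Pow I. (1 / 8 :: real) ^ card C) = (9 / 8) ^ N"
  proof -
    have "(\<Prod>i\<in>I. (1 / 8 :: real) + 1) = (\<Sum>C\<in>Pow I. (\<Prod>i\<in>C. 1 / 8) * (\<Prod>i\<in>I - C. 1))"
      by (rule prod_add[OF I(1)])
    then show ?thesis by (simp add: N_def)
  qed
  have "real (card F) * (1 / 8) ^ h = (\<Sum>A\<in>F. (1 / 8) ^ h)" by simp
  also have "\<dots> \<le> (\<Sum>A\<in>F. (1 / 8) ^ card (sym_diff A A0))"
    using F(2) by (intro sum_mono power_decreasing) auto
  also have "\<dots> = (\<Sum>C\<in>(\<lambda>A. sym_diff A A0) ` F. (1 / 8) ^ card C)"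
    by (simp add: sum.reindex[OF inj] o_def)
  also have "\<dots> \<le> (\<Sum>C\<in>Pow I. (1 / 8) ^ card C)"
    using F(1) A0 I by (intro sum_mono2) auto
  finally have "real (card F) * (1 / 8) ^ h \<le> (9 / 8) ^ N" unfolding wsum .
  then have "real (card F) \<le> 8 ^ h * (9 / 8) ^ N" by (simp add: power_divide field_simps)
  then have "real (card F) ^ 16 \<le> (8 ^ h * (9 / 8) ^ N) ^ 16" by (intro power_mono) auto
  also have "\<dots> = 8 ^ (16 * h) * ((9 / 8) ^ 16) ^ N"
    by (simp only: power_mult_distrib power_mult[symmetric] mult.commute)
  also have "\<dots> \<le> 8 ^ N * ((9 / 8) ^ 16) ^ N"
    using h by (intro mult_right_mono power_increasing) (auto simp: N_def)
  also have "\<dots> = (8 * (9 / 8) ^ 16) ^ N" by (simp only: power_mult_distrib)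
  also have "\<dots> < 256 ^ N"
  proof (rule power_strict_mono)
    show "8 * (9 / 8) ^ 16 < (256::real)" by (simp add: power_divide)
  qed (use N in auto)
  also have "\<dots> = (2 ^ 8) ^ N" by simp
  also have "\<dots> = 2 ^ (8 * N)" by (rule power_mult[symmetric])
  finally have "real (card F ^ 16) < real (2 ^ (8 * N))" by simp
  then show ?thesis by (simp only: of_nat_less_iff N_def)
qed

subsection \<open>Interpolation kernels\<close>

definition node :: "nat \<Rightarrow> nat \<Rightarrow> real" where
  "node m i = 2 * pi * real i / real m"

lemma sum_harmonic_nodes:
  assumes "1 \<le> m" "\<bar>k\<bar> < int m"
  shows "(\<Sum>i<m. harmonic k (- node m i)) = (if k = 0 then of_nat m else 0)"
proof (cases "k = 0")
  case False
  define w where "w = harmonic k (- (2 * pi / real m))"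
  have wi: "w ^ i = cis (real i * (real_of_int k * - (2 * pi / real m)))" for i
    unfolding w_def harmonic_def by (rule Complex.DeMoivre)
  have pw: "harmonic k (- node m i) = w ^ i" for i
  proof -
    have "real i * (real_of_int k * - (2 * pi / real m)) = real_of_int k * - node m i" by (simp add: node_def)
    then show ?thesis unfolding wi by (simp only: harmonic_def)
  qed
  have "w ^ m = 1"
  proof -
    have "real m * (real_of_int k * - (2 * pi / real m)) = 2 * pi * of_int (- k)" using assms by simp
    then have "w ^ m = cis (2 * pi * of_int (- k))" unfolding wi by (simp only:)
    also have "\<dots> = 1" by (rule cis_multiple_2pi) simp
    finally show ?thesis .
  qed
  moreover have "w \<noteq> 1"
  proof
    assume "w = 1"
    then have "cos (real_of_int k * (2 * pi / real m)) = 1"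
      by (auto simp: w_def harmonic_def complex_eq_iff)
    then obtain n :: int where n: "real_of_int k * (2 * pi / real m) = of_int n * 2 * pi"
      unfolding cos_one_2pi_int by blast
    moreover have "real_of_int k * (2 * pi / real m) = (2 * pi) * (real_of_int k / real m)" by simp
    moreover have "of_int n * 2 * pi = (2 * pi) * real_of_int n" by simp
    ultimately have "(2 * pi) * (real_of_int k / real m) = (2 * pi) * of_int n" by (simp only:)
    then have "real_of_int k / real m = of_int n" by (simp only: mult_cancel_left) simp
    then have "real_of_int k = of_int n * real m" using assms by (simp add: divide_eq_eq)
    then have "real_of_int k = real_of_int (n * int m)" by simp
    then have "k = n * int m" by (simp only: of_int_eq_iff)
    then have "int m dvd k" by simp
    then have "int m \<le> \<bar>k\<bar>" using False dvd_imp_le_int[of k "int m"] by simp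
    then show False using assms by simp
  qed
  ultimately have "(\<Sum>i<m. w ^ i) = 0" by (simp add: geometric_sum)
  then show ?thesis using False by (simp add: pw)
qed simp

text \<open>Summation over \<open>m\<close> equidistant nodes keeps only the frequencies divisible
  by \<open>m\<close>. The coefficients at \<open>m\<close> and \<open>- m\<close> vanish, so only
  the mean survives.\<close>

lemma sum_fejer_nodes:
  assumes "1 \<le> m"
  shows "(\<Sum>i<m. fejer m (t - node m i)) = real m"
proof -
  have "complex_of_real (\<Sum>i<m. fejer m (t - node m i))
     = (\<Sum>i<m. \<Sum>k\<in>{- int m..int m}. complex_of_real (fejer_hat m k) * harmonic k (t - node m i))"
    using assms by (simp add: fejer_eq_harmonic[OF _ order_refl])
  also have "\<dots> = (\<Sum>k\<in>{- int m..int m}. complex_of_real (fejer_hat m k) * harmonic k t * (\<Sum>i<m. harmonic k (- node m i)))"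
  proof (subst sum.swap, rule sum.cong)
    fix k
    have "harmonic k (t - node m i) = harmonic k t * harmonic k (- node m i)" for i
      by (simp add: harmonic_def cis_mult algebra_simps)
    then show "(\<Sum>i<m. complex_of_real (fejer_hat m k) * harmonic k (t - node m i))
       = complex_of_real (fejer_hat m k) * harmonic k t * (\<Sum>i<m. harmonic k (- node m i))"
      by (simp add: sum_distrib_left mult.assoc)
  qed simp
  also have "\<dots> = (\<Sum>k\<in>{- int m..int m}. if k = 0 then of_nat m else 0)"
  proof (rule sum.cong)
    fix k assume k: "k \<in> {- int m..int m}"
    show "complex_of_real (fejer_hat m k) * harmonic k t * (\<Sum>i<m. harmonic k (- node m i)) = (if k = 0 then of_nat m else 0)"
    proof (cases "\<bar>k\<bar> < int m")
      case True
      then show ?thesis using assms by (simp add: sum_harmonic_nodes fejer_hat_def)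
    next
      case False
      then have "\<bar>k\<bar> = int m" using k by auto
      then have "\<bar>real_of_int k\<bar> = real m" by (metis of_int_abs of_int_of_nat_eq)
      then have "fejer_hat m k = 0" "k \<noteq> 0" using assms by (auto simp: fejer_hat_def)
      then show ?thesis by simp
    qed
  qed simp
  also have "\<dots> = complex_of_real (real m)" by simp
  finally show ?thesis by (simp only: of_real_eq_iff)
qed

text \<open>The kernel is twice the Fejer kernel of order \<open>2 * m\<close> minus that of order
  \<open>m\<close>. The \<open>m\<close> nodes are the even-numbered ones among \<open>2 * m\<close>
  nodes, so by nonnegativity the first kernel sums to at most \<open>2 * m\<close>; altogether
  \<open>2 * (2 * m) + m\<close>.\<close>

lemma sum_abs_vallee_poussin_nodes:
  assumes "1 \<le> m"
  shows "(\<Sum>i<m. \<bar>vallee_poussin m (t - node m i)\<bar>) \<le> 5 * real m"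
proof -
  have "(\<Sum>i<m. fejer (2 * m) (t - node m i)) = (\<Sum>i\<in>(\<lambda>i. 2 * i) ` {..<m}. fejer (2 * m) (t - node (2 * m) i))"
  proof (subst sum.reindex)
    have "node (2 * m) (2 * i) = node m i" for i by (simp add: node_def)
    then show "(\<Sum>i<m. fejer (2 * m) (t - node m i)) = sum ((\<lambda>i. fejer (2 * m) (t - node (2 * m) i)) \<circ> (\<lambda>i. 2 * i)) {..<m}"
      by (simp only: o_def)
  qed (auto simp: inj_on_def)
  also have "\<dots> \<le> (\<Sum>i<2 * m. fejer (2 * m) (t - node (2 * m) i))"
    by (intro sum_mono2) (auto simp: fejer_nonneg)
  also have "\<dots> = 2 * real m" using assms sum_fejer_nodes[of "2 * m" t] by simp
  finally have f2: "(\<Sum>i<m. fejer (2 * m) (t - node m i)) \<le> 2 * real m" .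
  have "(\<Sum>i<m. \<bar>vallee_poussin m (t - node m i)\<bar>) \<le> (\<Sum>i<m. 2 * fejer (2 * m) (t - node m i) + fejer m (t - node m i))"
  proof (rule sum_mono)
    fix i
    show "\<bar>vallee_poussin m (t - node m i)\<bar> \<le> 2 * fejer (2 * m) (t - node m i) + fejer m (t - node m i)"
      using fejer_nonneg[of "2 * m" "t - node m i"] fejer_nonneg[of m "t - node m i"] assms
      by (simp add: vallee_poussin_eq_fejer)
  qed
  also have "\<dots> = 2 * (\<Sum>i<m. fejer (2 * m) (t - node m i)) + (\<Sum>i<m. fejer m (t - node m i))"
    by (simp add: sum.distrib sum_distrib_left)
  also have "\<dots> \<le> 5 * real m" using f2 sum_fejer_nodes[OF assms, of t] by simp
  finally show ?thesis .
qed

section \<open>Kernels modulated into a dyadic range\<close>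

definition dyadic :: "nat \<Rightarrow> int set" where
  "dyadic n = {k. 2 ^ (n - 1) \<le> \<bar>k\<bar> \<and> \<bar>k\<bar> < 2 ^ n}"

lemma finite_dyadic: "finite (dyadic n)"
  by (rule finite_subset[of _ "{- (2 ^ n)..2 ^ n}"]) (auto simp: dyadic_def)

lemma rho_eq: "rho d s = (\<Pi>\<^sub>E j\<in>{1..d}. dyadic (s j))"
  by (simp add: rho_def dyadic_def)

lemma finite_rho: "finite (rho d s)"
  unfolding rho_eq by (intro finite_PiE finite_dyadic) simp

lemma rho_subset_freqs: "rho d s \<subseteq> freqs d"
  unfolding rho_def by (intro PiE_mono) auto

text \<open>Number of nodes per coordinate. For \<open>n \<ge> 3\<close> the quantity
  \<open>2 * mesh n = 2 ^ (n - 2)\<close> is half the width of the positive dyadic range and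
  \<open>centre n\<close> is its midpoint, so that kernels of degree below \<open>2 * mesh n\<close>
  fit into the range after modulation.\<close>

definition mesh :: "nat \<Rightarrow> nat" where
  "mesh n = 2 ^ (n - 3)"

definition centre :: "nat \<Rightarrow> int" where
  "centre n = 3 * 2 ^ (n - 2)"

lemma mesh_ge_1: "1 \<le> mesh n" "Suc 0 \<le> mesh n" by (simp_all add: mesh_def)

lemma mesh_double: "3 \<le> n \<Longrightarrow> 2 * int (mesh n) = 2 ^ (n - 2)"
proof -
  assume n: "3 \<le> n"
  then have "n - 2 = Suc (n - 3)" by simp
  then show ?thesis by (simp add: mesh_def)
qed

text \<open>The frequencies of a modulated kernel of degree below \<open>2 * mesh n\<close> fill the positive half of one dyadic block.\<close>

lemma modulated_sum:
  fixes q :: "int \<Rightarrow> complex"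
  assumes n: "3 \<le> n" and q: "\<And>l. 2 * int (mesh n) \<le> \<bar>l\<bar> \<Longrightarrow> q l = 0"
  shows "(\<Sum>l\<in>{- int (2 * mesh n)..int (2 * mesh n)}. q l * h (l + centre n)) = (\<Sum>k\<in>dyadic n. q (k - centre n) * h k)"
proof -
  let ?p = "(2::int) ^ (n - 2)"
  have p: "2 * int (mesh n) = ?p" by (rule mesh_double[OF n])
  have e: "(2::int) ^ (n - 1) = 2 * ?p" "(2::int) ^ n = 4 * ?p"
  proof -
    have "n - 1 = Suc (n - 2)" "n = Suc (Suc (n - 2))" using n by simp_all
    then show "(2::int) ^ (n - 1) = 2 * ?p" "(2::int) ^ n = 4 * ?p" by (metis power_Suc, metis power_Suc mult.assoc numeral_Bit0 mult_2)
  qed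
  have ppos: "0 < ?p" by simp
  have "(\<Sum>l\<in>{- int (2 * mesh n)..int (2 * mesh n)}. q l * h (l + centre n)) = (\<Sum>k\<in>{2 * ?p..4 * ?p}. q (k - centre n) * h k)"
    by (rule sum.reindex_bij_witness[of _ "\<lambda>k. k - centre n" "\<lambda>l. l + centre n"]) (use p in \<open>auto simp: centre_def\<close>)
  also have "\<dots> = (\<Sum>k\<in>dyadic n. q (k - centre n) * h k)"
  proof (rule sum.mono_neutral_cong)
    fix k assume k: "k \<in> dyadic n - {2 * ?p..4 * ?p}"
    then have "k \<le> - (2 * ?p)" unfolding dyadic_def e by auto
    then have "2 * int (mesh n) \<le> \<bar>k - centre n\<bar>" unfolding p centre_def using ppos by linarith
    then show "q (k - centre n) * h k = 0" using q by simp
  next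
    fix k assume k: "k \<in> {2 * ?p..4 * ?p} - dyadic n"
    then have "k = 4 * ?p" unfolding dyadic_def e using ppos by auto
    then have "2 * int (mesh n) \<le> \<bar>k - centre n\<bar>" unfolding p centre_def using ppos by linarith
    then show "q (k - centre n) * h k = 0" using q by simp
  qed (auto simp: finite_dyadic)
  finally show ?thesis .
qed

lemma fejer_hat_eq_0: "1 \<le> m \<Longrightarrow> int m \<le> \<bar>k\<bar> \<Longrightarrow> fejer_hat m k = 0"
proof -
  assume "1 \<le> m" "int m \<le> \<bar>k\<bar>"
  then have "real m \<le> \<bar>real_of_int k\<bar>" by linarith
  then show ?thesis using \<open>1 \<le> m\<close> by (simp add: fejer_hat_def)
qed

lemma hat_mesh_eq_0:
  assumes "2 * int (mesh n) \<le> \<bar>l\<bar>"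
  shows "fejer_hat (mesh n) l = 0" "vp_hat (mesh n) l = 0"
  using assms by (simp_all add: fejer_hat_eq_0 vp_hat_eq_0 mesh_ge_1)

text \<open>Coefficients of the Fejer kernel translated to a node, modulated by
  \<open>centre n\<close> and divided by the number of nodes. Positivity of the kernel will bound
  the interpolating polynomials.\<close>

definition kc :: "nat \<Rightarrow> nat \<Rightarrow> int \<Rightarrow> complex" where
  "kc n i k = of_real (fejer_hat (mesh n) (k - centre n)) * harmonic (k - centre n) (- node (mesh n) i) / of_nat (mesh n)"

text \<open>The dual system. The de la Vallee-Poussin coefficients are 1 wherever the Fejer
  coefficients do not vanish, which makes the two systems biorthogonal.\<close>

definition dc :: "nat \<Rightarrow> nat \<Rightarrow> int \<Rightarrow> complex" where
  "dc n i k = of_real (vp_hat (mesh n) (k - centre n)) * harmonic (k - centre n) (- node (mesh n) i) / of_nat (mesh n)"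

lemma harmonic_shift: "harmonic l (t - x) * harmonic c t = harmonic l (- x) * harmonic (l + c) t"
  by (simp add: harmonic_def cis_mult algebra_simps)

lemma sum_kc:
  assumes n: "3 \<le> n"
  shows "(\<Sum>k\<in>dyadic n. kc n i k * harmonic k t)
    = harmonic (centre n) t * of_real (fejer (mesh n) (t - node (mesh n) i) / real (mesh n))"
proof -
  let ?m = "mesh n" let ?x = "node ?m i"
  have "of_real (fejer ?m (t - ?x)) = (\<Sum>l\<in>{- int (2 * ?m)..int (2 * ?m)}. complex_of_real (fejer_hat ?m l) * harmonic l (t - ?x))"
    by (rule fejer_eq_harmonic) (auto simp: mesh_ge_1)
  then have "harmonic (centre n) t * of_real (fejer ?m (t - ?x) / real ?m)
     = (\<Sum>l\<in>{- int (2 * ?m)..int (2 * ?m)}. complex_of_real (fejer_hat ?m l) * (harmonic l (t - ?x) * harmonic (centre n) t) / of_nat ?m)"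
    by (simp add: sum_divide_distrib sum_distrib_left mult_ac)
  also have "\<dots> = (\<Sum>l\<in>{- int (2 * ?m)..int (2 * ?m)}. (complex_of_real (fejer_hat ?m l) * harmonic l (- ?x) / of_nat ?m) * harmonic (l + centre n) t)"
    unfolding harmonic_shift by (simp add: mult_ac)
  also have "\<dots> = (\<Sum>k\<in>dyadic n. (complex_of_real (fejer_hat ?m (k - centre n)) * harmonic (k - centre n) (- ?x) / of_nat ?m) * harmonic k t)"
    by (rule modulated_sum[OF n]) (simp only: hat_mesh_eq_0 of_real_0 mult_zero_left div_0)
  finally show ?thesis by (simp add: kc_def)
qed

lemma sum_dc:
  assumes n: "3 \<le> n"
  shows "(\<Sum>k\<in>dyadic n. dc n i k * harmonic k t)
    = harmonic (centre n) t * of_real (vallee_poussin (mesh n) (t - node (mesh n) i) / real (mesh n))"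
proof -
  let ?m = "mesh n" let ?x = "node ?m i"
  have "of_real (vallee_poussin ?m (t - ?x)) = (\<Sum>l\<in>{- int (2 * ?m)..int (2 * ?m)}. complex_of_real (vp_hat ?m l) * harmonic l (t - ?x))"
    by (rule vallee_poussin_eq_harmonic) (auto simp: mesh_ge_1)
  then have "harmonic (centre n) t * of_real (vallee_poussin ?m (t - ?x) / real ?m)
     = (\<Sum>l\<in>{- int (2 * ?m)..int (2 * ?m)}. complex_of_real (vp_hat ?m l) * (harmonic l (t - ?x) * harmonic (centre n) t) / of_nat ?m)"
    by (simp add: sum_divide_distrib sum_distrib_left mult_ac)
  also have "\<dots> = (\<Sum>l\<in>{- int (2 * ?m)..int (2 * ?m)}. (complex_of_real (vp_hat ?m l) * harmonic l (- ?x) / of_nat ?m) * harmonic (l + centre n) t)"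
    unfolding harmonic_shift by (simp add: mult_ac)
  also have "\<dots> = (\<Sum>k\<in>dyadic n. (complex_of_real (vp_hat ?m (k - centre n)) * harmonic (k - centre n) (- ?x) / of_nat ?m) * harmonic k t)"
    by (rule modulated_sum[OF n]) (simp only: hat_mesh_eq_0 of_real_0 mult_zero_left div_0)
  finally show ?thesis by (simp add: dc_def)
qed

text \<open>Frequency \<open>k\<close> at a difference of nodes has the same phase as frequency
  \<open>i - i'\<close> at \<open>- node m k\<close>. After this exchange of roles the sum is the
  orthogonality relation for equidistant nodes.\<close>

lemma fejer_at_nodes:
  assumes "i < m" "i' < m"
  shows "fejer m (node m i' - node m i) = (if i = i' then real m else 0)"
proof -
  have "harmonic (int k) (node m i' - node m i) = harmonic (int i - int i') (- node m k)" for k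
  proof -
    have "real_of_int (int k) * (node m i' - node m i) = real_of_int (int i - int i') * - node m k"
      by (simp add: node_def algebra_simps diff_divide_distrib)
    then show ?thesis unfolding harmonic_def by (simp only:)
  qed
  then have "(\<Sum>k<m. harmonic (int k) (node m i' - node m i)) = (if i = i' then of_nat m else 0)"
    using sum_harmonic_nodes[of m "int i - int i'"] assms by simp
  then show ?thesis using assms by (simp add: fejer_def power2_eq_square)
qed

text \<open>Multiplication by the trapezoid leaves the Fejer coefficients unchanged, so the inner
  product is the Fejer kernel at a difference of nodes, divided by the square of
  \<open>mesh n\<close>.\<close>

lemma kc_dc_orthogonal:
  assumes n: "3 \<le> n" and i: "i < mesh n" "i' < mesh n"
  shows "(\<Sum>k\<in>dyadic n. kc n i k * cnj (dc n i' k)) = (if i = i' then 1 / of_nat (mesh n) else 0)"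
proof -
  let ?m = "mesh n"
  have "kc n i k * cnj (dc n i' k) = (of_real (fejer_hat ?m (k - centre n)) * harmonic (k - centre n) (node ?m i' - node ?m i) / (of_nat ?m)\<^sup>2) * 1" for k
  proof -
    let ?l = "k - centre n"
    have "fejer_hat ?m ?l * vp_hat ?m ?l = fejer_hat ?m ?l"
    proof (cases "\<bar>?l\<bar> \<le> int ?m")
      case True
      then show ?thesis using vp_hat_eq_1[OF mesh_ge_1(1), of ?l n] by simp
    next
      case False
      then show ?thesis using fejer_hat_eq_0[OF mesh_ge_1(1), of n ?l] by simp
    qed
    then have fv: "complex_of_real (fejer_hat ?m ?l) * of_real (vp_hat ?m ?l) = of_real (fejer_hat ?m ?l)"
      by (simp only: of_real_mult[symmetric])
    have hh: "harmonic ?l (- node ?m i) * cnj (harmonic ?l (- node ?m i')) = harmonic ?l (node ?m i' - node ?m i)"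
      by (simp add: harmonic_def cis_cnj cis_mult algebra_simps)
    have "kc n i k * cnj (dc n i' k) = (complex_of_real (fejer_hat ?m ?l) * of_real (vp_hat ?m ?l)) * (harmonic ?l (- node ?m i) * cnj (harmonic ?l (- node ?m i'))) / (of_nat ?m)\<^sup>2"
      by (simp add: kc_def dc_def power2_eq_square)
    then show ?thesis unfolding fv hh by simp
  qed
  then have "(\<Sum>k\<in>dyadic n. kc n i k * cnj (dc n i' k))
     = (\<Sum>k\<in>dyadic n. (of_real (fejer_hat ?m (k - centre n)) * harmonic (k - centre n) (node ?m i' - node ?m i) / (of_nat ?m)\<^sup>2) * 1)"
    by (simp only:)
  also have "\<dots> = (\<Sum>l\<in>{- int (2 * ?m)..int (2 * ?m)}. (of_real (fejer_hat ?m l) * harmonic l (node ?m i' - node ?m i) / (of_nat ?m)\<^sup>2) * 1)"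
    by (rule modulated_sum[OF n, symmetric]) (simp only: hat_mesh_eq_0 of_real_0 mult_zero_left div_0)
  also have "\<dots> = (\<Sum>l\<in>{- int (2 * ?m)..int (2 * ?m)}. of_real (fejer_hat ?m l) * harmonic l (node ?m i' - node ?m i)) / (of_nat ?m)\<^sup>2"
    by (simp add: sum_divide_distrib)
  also have "\<dots> = of_real (fejer ?m (node ?m i' - node ?m i)) / (of_nat ?m)\<^sup>2"
    by (subst fejer_eq_harmonic[of ?m "2 * ?m"]) (auto simp: mesh_ge_1)
  also have "\<dots> = (if i = i' then 1 / of_nat ?m else 0)"
    using mesh_ge_1[of n] unfolding fejer_at_nodes[OF i] by (simp add: power2_eq_square)
  finally show ?thesis .
qed

subsection \<open>Biorthogonal systems in the dyadic blocks\<close>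

definition grid :: "nat \<Rightarrow> (nat \<Rightarrow> nat) \<Rightarrow> (nat \<Rightarrow> nat) set" where
  "grid d s = (\<Pi>\<^sub>E j\<in>{1..d}. {..<mesh (s j)})"

definition KC :: "nat \<Rightarrow> (nat \<Rightarrow> nat) \<Rightarrow> (nat \<Rightarrow> nat) \<Rightarrow> (nat \<Rightarrow> int) \<Rightarrow> complex" where
  "KC d s i k = (\<Prod>j\<in>{1..d}. kc (s j) (i j) (k j))"

definition DC :: "nat \<Rightarrow> (nat \<Rightarrow> nat) \<Rightarrow> (nat \<Rightarrow> nat) \<Rightarrow> (nat \<Rightarrow> int) \<Rightarrow> complex" where
  "DC d s i k = (\<Prod>j\<in>{1..d}. dc (s j) (i j) (k j))"

lemma finite_grid: "finite (grid d s)"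
  unfolding grid_def by (intro finite_PiE) auto

lemma card_grid: "card (grid d s) = 2 ^ (\<Sum>j\<in>{1..d}. s j - 3)"
  unfolding grid_def by (subst card_PiE) (auto simp: mesh_def power_sum)

lemma KC_DC_orthogonal:
  assumes s: "\<And>j. j \<in> {1..d} \<Longrightarrow> 3 \<le> s j" and i: "i \<in> grid d s" "i' \<in> grid d s"
  shows "(\<Sum>k\<in>rho d s. KC d s i k * cnj (DC d s i' k)) = (if i = i' then 1 / of_nat (card (grid d s)) else 0)"
proof -
  have "(\<Sum>k\<in>rho d s. KC d s i k * cnj (DC d s i' k)) = (\<Sum>k\<in>rho d s. \<Prod>j\<in>{1..d}. kc (s j) (i j) (k j) * cnj (dc (s j) (i' j) (k j)))"
    by (simp add: KC_def DC_def prod.distrib)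
  also have "\<dots> = (\<Prod>j\<in>{1..d}. \<Sum>k\<in>dyadic (s j). kc (s j) (i j) k * cnj (dc (s j) (i' j) k))"
    unfolding rho_eq by (rule prod_sum_PiE[symmetric]) (auto simp: finite_dyadic)
  also have "\<dots> = (\<Prod>j\<in>{1..d}. if i j = i' j then 1 / of_nat (mesh (s j)) else 0)"
    using i by (intro prod.cong refl kc_dc_orthogonal s) (auto simp: grid_def PiE_iff)
  also have "\<dots> = (if i = i' then 1 / of_nat (card (grid d s)) else 0)"
  proof (cases "i = i'")
    case True
    have "card (grid d s) = (\<Prod>j\<in>{1..d}. mesh (s j))"
      unfolding grid_def by (subst card_PiE) auto
    then show ?thesis using True by (simp add: prod_dividef)
  next
    case False
    have "\<exists>j\<in>{1..d}. i j \<noteq> i' j"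
    proof (rule ccontr)
      assume "\<not> (\<exists>j\<in>{1..d}. i j \<noteq> i' j)"
      then have "i = i'" using i unfolding grid_def by (intro PiE_ext[of i "{1..d}" "\<lambda>j. {..<mesh (s j)}" i']) auto
      then show False using False by simp
    qed
    then show ?thesis using False by (intro trans[OF prod_zero]) auto
  qed
  finally show ?thesis .
qed

lemma trig_poly_tensor:
  fixes c :: "nat \<Rightarrow> int \<Rightarrow> complex"
  shows "trig_poly d (rho d s) (\<lambda>k. \<Prod>j\<in>{1..d}. c j (k j)) x = (\<Prod>j\<in>{1..d}. \<Sum>k\<in>dyadic (s j). c j k * harmonic k (x j))"
proof -
  have "trig_poly d (rho d s) (\<lambda>k. \<Prod>j\<in>{1..d}. c j (k j)) x = (\<Sum>k\<in>rho d s. \<Prod>j\<in>{1..d}. c j (k j) * harmonic (k j) (x j))"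
    by (simp add: trig_poly_def character_eq_prod prod.distrib)
  also have "\<dots> = (\<Prod>j\<in>{1..d}. \<Sum>k\<in>dyadic (s j). c j k * harmonic k (x j))"
    unfolding rho_eq by (rule prod_sum_PiE[symmetric]) (auto simp: finite_dyadic)
  finally show ?thesis .
qed

lemma norm_trig_poly_combination_le:
  assumes y: "\<And>i. i \<in> I \<Longrightarrow> cmod (y i) \<le> 1"
  shows "cmod (trig_poly d K (\<lambda>k. \<Sum>i\<in>I. y i * c i k) x) \<le> (\<Sum>i\<in>I. cmod (trig_poly d K (c i) x))"
proof -
  have "trig_poly d K (\<lambda>k. \<Sum>i\<in>I. y i * c i k) x = (\<Sum>i\<in>I. y i * trig_poly d K (c i) x)"
    unfolding trig_poly_sum[symmetric] by (simp add: trig_poly_def sum_distrib_left mult.assoc)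
  also have "cmod \<dots> \<le> (\<Sum>i\<in>I. cmod (y i * trig_poly d K (c i) x))" by (rule norm_sum)
  also have "\<dots> \<le> (\<Sum>i\<in>I. 1 * cmod (trig_poly d K (c i) x))"
    unfolding norm_mult using y by (intro sum_mono mult_right_mono) auto
  finally show ?thesis by simp
qed

text \<open>The moduli of the basis functions are products of Fejer values, which are nonnegative
  and sum to 1 over the grid. Hence the bound is uniform in the block.\<close>

lemma norm_primal_le:
  assumes s: "\<And>j. j \<in> {1..d} \<Longrightarrow> 3 \<le> s j" and y: "\<And>i. i \<in> grid d s \<Longrightarrow> cmod (y i) \<le> 1"
  shows "cmod (trig_poly d (rho d s) (\<lambda>k. \<Sum>i\<in>grid d s. y i * KC d s i k) x) \<le> 1"
proof -
  have "cmod (trig_poly d (rho d s) (\<lambda>k. \<Sum>i\<in>grid d s. y i * KC d s i k) x) \<le> (\<Sum>i\<in>grid d s. cmod (trig_poly d (rho d s) (KC d s i) x))"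
    by (rule norm_trig_poly_combination_le[OF y])
  also have "\<dots> = (\<Sum>i\<in>grid d s. \<Prod>j\<in>{1..d}. fejer (mesh (s j)) (x j - node (mesh (s j)) (i j)) / real (mesh (s j)))"
  proof (rule sum.cong)
    fix i
    have "trig_poly d (rho d s) (KC d s i) x = (\<Prod>j\<in>{1..d}. harmonic (centre (s j)) (x j) * of_real (fejer (mesh (s j)) (x j - node (mesh (s j)) (i j)) / real (mesh (s j))))"
      unfolding KC_def[abs_def] trig_poly_tensor[of d s "\<lambda>j. kc (s j) (i j)" x] by (intro prod.cong refl sum_kc s)
    also have "cmod \<dots> = (\<Prod>j\<in>{1..d}. fejer (mesh (s j)) (x j - node (mesh (s j)) (i j)) / real (mesh (s j)))"
      unfolding prod_norm[symmetric] norm_mult norm_of_real norm_harmonic by (simp add: fejer_nonneg)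
    finally show "cmod (trig_poly d (rho d s) (KC d s i) x) = (\<Prod>j\<in>{1..d}. fejer (mesh (s j)) (x j - node (mesh (s j)) (i j)) / real (mesh (s j)))" .
  qed simp
  also have "\<dots> = (\<Prod>j\<in>{1..d}. \<Sum>i<mesh (s j). fejer (mesh (s j)) (x j - node (mesh (s j)) i) / real (mesh (s j)))"
    unfolding grid_def by (rule prod_sum_PiE[symmetric]) auto
  also have "\<dots> = (\<Prod>j\<in>{1..d}. 1)"
  proof (rule prod.cong)
    fix j
    show "(\<Sum>i<mesh (s j). fejer (mesh (s j)) (x j - node (mesh (s j)) i) / real (mesh (s j))) = 1"
      using mesh_ge_1[of "s j"] sum_fejer_nodes[OF mesh_ge_1(1)[of "s j"], of "x j"]
      unfolding sum_divide_distrib[symmetric] by simp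
  qed simp
  finally show ?thesis by simp
qed

lemma norm_dual_le:
  assumes s: "\<And>j. j \<in> {1..d} \<Longrightarrow> 3 \<le> s j" and y: "\<And>i. i \<in> grid d s \<Longrightarrow> cmod (y i) \<le> 1"
  shows "cmod (trig_poly d (rho d s) (\<lambda>k. \<Sum>i\<in>grid d s. y i * DC d s i k) x) \<le> 5 ^ d"
proof -
  have "cmod (trig_poly d (rho d s) (\<lambda>k. \<Sum>i\<in>grid d s. y i * DC d s i k) x) \<le> (\<Sum>i\<in>grid d s. cmod (trig_poly d (rho d s) (DC d s i) x))"
    by (rule norm_trig_poly_combination_le[OF y])
  also have "\<dots> = (\<Sum>i\<in>grid d s. \<Prod>j\<in>{1..d}. \<bar>vallee_poussin (mesh (s j)) (x j - node (mesh (s j)) (i j)) / real (mesh (s j))\<bar>)"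
  proof (rule sum.cong)
    fix i
    have "trig_poly d (rho d s) (DC d s i) x = (\<Prod>j\<in>{1..d}. harmonic (centre (s j)) (x j) * of_real (vallee_poussin (mesh (s j)) (x j - node (mesh (s j)) (i j)) / real (mesh (s j))))"
      unfolding DC_def[abs_def] trig_poly_tensor[of d s "\<lambda>j. dc (s j) (i j)" x] by (intro prod.cong refl sum_dc s)
    also have "cmod \<dots> = (\<Prod>j\<in>{1..d}. \<bar>vallee_poussin (mesh (s j)) (x j - node (mesh (s j)) (i j)) / real (mesh (s j))\<bar>)"
      unfolding prod_norm[symmetric] norm_mult norm_of_real norm_harmonic by simp
    finally show "cmod (trig_poly d (rho d s) (DC d s i) x) = (\<Prod>j\<in>{1..d}. \<bar>vallee_poussin (mesh (s j)) (x j - node (mesh (s j)) (i j)) / real (mesh (s j))\<bar>)" .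
  qed simp
  also have "\<dots> = (\<Prod>j\<in>{1..d}. \<Sum>i<mesh (s j). \<bar>vallee_poussin (mesh (s j)) (x j - node (mesh (s j)) i) / real (mesh (s j))\<bar>)"
    unfolding grid_def by (rule prod_sum_PiE[symmetric]) auto
  also have "\<dots> \<le> (\<Prod>j\<in>{1..d}. 5)"
  proof (intro prod_mono conjI sum_nonneg)
    fix j
    show "(\<Sum>i<mesh (s j). \<bar>vallee_poussin (mesh (s j)) (x j - node (mesh (s j)) i) / real (mesh (s j))\<bar>) \<le> 5"
      using mesh_ge_1[of "s j"] sum_abs_vallee_poussin_nodes[OF mesh_ge_1(1)[of "s j"], of "x j"]
      unfolding abs_divide sum_divide_distrib[symmetric] by (simp add: divide_le_eq)
  qed simp
  finally show ?thesis by simp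
qed

subsection \<open>Pairing with functions of the target space\<close>

text \<open>The indices of the smooth blocks that can meet the sharp cell \<open>rho d s\<close>.
  They extend only downwards from \<open>s\<close>, which is what evenness exploits.\<close>

definition active :: "nat \<Rightarrow> (nat \<Rightarrow> nat) \<Rightarrow> (nat \<Rightarrow> nat) set" where
  "active d s = (\<Pi>\<^sub>E j\<in>{1..d}. {s j - 1..s j})"

lemma finite_active: "finite (active d s)"
  unfolding active_def by (intro finite_PiE) auto

lemma card_active_le: "card (active d s) \<le> 2 ^ d"
proof -
  have "card (active d s) = (\<Prod>j\<in>{1..d}. card {s j - 1..s j})"
    unfolding active_def by (rule card_PiE) simp
  also have "\<dots> \<le> (\<Prod>j\<in>{1..d}. 2)" by (intro prod_mono) auto
  finally show ?thesis by simp
qed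

lemma active_subset_indices:
  assumes "\<And>j. j \<in> {1..d} \<Longrightarrow> 2 \<le> s j"
  shows "active d s \<subseteq> indices d"
  unfolding active_def indices_def using assms by (intro PiE_mono) force

lemma block_hat_nz_active:
  assumes t: "t \<in> indices d" "block_hat d t k \<noteq> 0" and k: "k \<in> rho d s"
  shows "t \<in> active d s"
proof -
  have "s j - 1 \<le> t j \<and> t j \<le> s j" if j: "j \<in> {1..d}" for j
  proof -
    have kj: "2 ^ (s j - 1) \<le> \<bar>k j\<bar>" "\<bar>k j\<bar> < 2 ^ s j" using k j by (auto simp: rho_def PiE_iff)
    have pw: "(2::int) ^ (s j - 1) < 2 ^ (t j + 1)" "(2::int) ^ (t j - 1) < 2 ^ s j"
      using block_hat_support[OF t j] kj by linarith+
    have "s j - 1 < t j + 1" "t j - 1 < s j"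
      using power_less_imp_less_exp[OF _ pw(1)] power_less_imp_less_exp[OF _ pw(2)] by simp_all
    then show ?thesis using indices_ge_1[OF t(1) j] by auto
  qed
  then show ?thesis using t by (auto simp: active_def indices_def PiE_iff)
qed

text \<open>In each direction the two blocks telescope to the trapezoid at \<open>2 ^ s j\<close>,
  which is 1 on the dyadic range, minus the one at \<open>2 ^ (s j - 2)\<close> or, for
  \<open>s j = 2\<close>, the constant term; the subtracted part vanishes there.\<close>

lemma sum_block_hat_active:
  assumes s: "\<And>j. j \<in> {1..d} \<Longrightarrow> 2 \<le> s j" and k: "k \<in> rho d s"
  shows "(\<Sum>t\<in>active d s. block_hat d t k) = 1"
proof -
  have "(\<Sum>t\<in>active d s. block_hat d t k) = (\<Prod>j\<in>{1..d}. \<Sum>t\<in>{s j - 1..s j}. a_hat t (k j))"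
    unfolding active_def block_hat_def by (rule prod_sum_PiE[symmetric]) auto
  also have "\<dots> = (\<Prod>j\<in>{1..d}. 1)"
  proof (rule prod.cong)
    fix j assume j: "j \<in> {1..d}"
    have kj: "2 ^ (s j - 1) \<le> \<bar>k j\<bar>" "\<bar>k j\<bar> < 2 ^ s j" using k j by (auto simp: rho_def PiE_iff)
    have sj: "2 \<le> s j" by (rule s[OF j])
    have tel: "(\<Sum>t\<in>{s j - 1..s j}. a_hat t (k j)) = vp_hat (2 ^ s j) (k j)
        - (if s j - 1 = 1 then if k j = 0 then 1 else 0 else vp_hat (2 ^ (s j - 1 - 1)) (k j))"
      using sj by (intro sum_a_hat_telescope) auto
    have "vp_hat (2 ^ s j) (k j) = 1" using kj by (intro vp_hat_eq_1) auto
    moreover have "vp_hat (2 ^ (s j - 1 - 1)) (k j) = 0" if "s j - 1 \<noteq> 1"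
    proof -
      have "s j - 1 = Suc (s j - 1 - 1)" using sj by simp
      then have "(2::int) ^ (s j - 1) = 2 * 2 ^ (s j - 1 - 1)" by (metis power_Suc)
      then show ?thesis using kj by (intro vp_hat_eq_0) auto
    qed
    moreover have "k j \<noteq> 0"
    proof
      assume "k j = 0"
      then have "(2::int) ^ (s j - 1) \<le> 0" using kj by simp
      then show False by (simp add: not_le[symmetric])
    qed
    ultimately show "(\<Sum>t\<in>{s j - 1..s j}. a_hat t (k j)) = 1" unfolding tel by simp
  qed simp
  finally show ?thesis by simp
qed

lemma integral_mult_cnj_trig_poly:
  assumes "integrable (torus d) h"
  shows "(\<integral>x. h x * cnj (trig_poly d K c x) \<partial>torus d) = (\<Sum>k\<in>K. fourier_coeff d h k * cnj (c k))"
proof -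
  have "(\<integral>x. h x * cnj (trig_poly d K c x) \<partial>torus d) = (\<integral>x. (\<Sum>k\<in>K. cnj (c k) * (h x * character d (\<lambda>j. - k j) x)) \<partial>torus d)"
    by (simp add: trig_poly_def cnj_character sum_distrib_left mult_ac)
  also have "\<dots> = (\<Sum>k\<in>K. cnj (c k) * fourier_coeff d h k)"
    unfolding fourier_coeff_def using assms
    by (subst Bochner_Integration.integral_sum) (auto intro!: integrable_mult_right integrable_mult_character)
  finally show ?thesis by (simp add: mult.commute)
qed

text \<open>\<open>h\<close> is split into its active smooth blocks, and each coefficient sum
  becomes an integral against the test polynomial. Only L_1 norms of the blocks appear on the right,
  which makes the bound usable for every \<open>q\<close>.\<close>

lemma pairing_bound:
  assumes s: "\<And>j. j \<in> {1..d} \<Longrightarrow> 2 \<le> s j" and h: "integrable (torus d) h"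
    and B: "\<And>x. cmod (trig_poly d (rho d s) c x) \<le> B" "0 \<le> B"
  shows "ennreal (cmod (\<Sum>k\<in>rho d s. fourier_coeff d h k * cnj (c k))) \<le> ennreal B * (\<Sum>t\<in>active d s. Lp_norm d 1 (A_block d t h))"
proof -
  have si: "active d s \<subseteq> indices d" by (rule active_subset_indices) (rule s)
  have "(\<Sum>k\<in>rho d s. fourier_coeff d h k * cnj (c k)) = (\<Sum>k\<in>rho d s. \<Sum>t\<in>active d s. fourier_coeff d (A_block d t h) k * cnj (c k))"
  proof (rule sum.cong)
    fix k assume k: "k \<in> rho d s"
    then have kf: "k \<in> freqs d" using rho_subset_freqs by auto
    have "(\<Sum>t\<in>active d s. fourier_coeff d (A_block d t h) k * cnj (c k)) = (\<Sum>t\<in>active d s. of_real (block_hat d t k) * (fourier_coeff d h k * cnj (c k)))"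
      using si by (intro sum.cong refl) (subst fourier_coeff_A_block[OF _ h kf], auto simp: mult.assoc)
    also have "\<dots> = of_real (\<Sum>t\<in>active d s. block_hat d t k) * (fourier_coeff d h k * cnj (c k))"
      by (simp only: sum_distrib_right of_real_sum)
    finally show "fourier_coeff d h k * cnj (c k) = (\<Sum>t\<in>active d s. fourier_coeff d (A_block d t h) k * cnj (c k))"
      using sum_block_hat_active[OF _ k] s by (simp only: of_real_1 mult_1_left)
  qed simp
  also have "\<dots> = (\<Sum>t\<in>active d s. \<Sum>k\<in>rho d s. fourier_coeff d (A_block d t h) k * cnj (c k))"
    by (rule sum.swap)
  also have "\<dots> = (\<Sum>t\<in>active d s. \<integral>x. A_block d t h x * cnj (trig_poly d (rho d s) c x) \<partial>torus d)"
    using si h by (intro sum.cong refl integral_mult_cnj_trig_poly[symmetric] integrable_A_block) auto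
  finally have eq: "(\<Sum>k\<in>rho d s. fourier_coeff d h k * cnj (c k)) = (\<Sum>t\<in>active d s. \<integral>x. A_block d t h x * cnj (trig_poly d (rho d s) c x) \<partial>torus d)" .
  have "ennreal (cmod (\<Sum>k\<in>rho d s. fourier_coeff d h k * cnj (c k))) \<le> ennreal (\<Sum>t\<in>active d s. cmod (\<integral>x. A_block d t h x * cnj (trig_poly d (rho d s) c x) \<partial>torus d))"
    unfolding eq by (intro ennreal_leI norm_sum)
  also have "\<dots> = (\<Sum>t\<in>active d s. ennreal (cmod (\<integral>x. A_block d t h x * cnj (trig_poly d (rho d s) c x) \<partial>torus d)))"
    by (rule sum_ennreal[symmetric]) simp
  also have "\<dots> \<le> (\<Sum>t\<in>active d s. ennreal B * Lp_norm d 1 (A_block d t h))"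
  proof (rule sum_mono)
    fix t assume "t \<in> active d s"
    then have t: "t \<in> indices d" using si by auto
    note [measurable] = measurable_A_block[OF t h]
    show "ennreal (cmod (\<integral>x. A_block d t h x * cnj (trig_poly d (rho d s) c x) \<partial>torus d)) \<le> ennreal B * Lp_norm d 1 (A_block d t h)"
    proof (cases "integrable (torus d) (\<lambda>x. A_block d t h x * cnj (trig_poly d (rho d s) c x))")
      case True
      have "ennreal (cmod (\<integral>x. A_block d t h x * cnj (trig_poly d (rho d s) c x) \<partial>torus d))
          \<le> (\<integral>\<^sup>+ x. ennreal (cmod (A_block d t h x * cnj (trig_poly d (rho d s) c x))) \<partial>torus d)"
        using True by (rule integral_norm_bound_ennreal)
      also have "\<dots> \<le> (\<integral>\<^sup>+ x. ennreal B * ennreal (cmod (A_block d t h x)) \<partial>torus d)"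
      proof (rule nn_integral_mono)
        fix x
        have "cmod (A_block d t h x * cnj (trig_poly d (rho d s) c x)) \<le> B * cmod (A_block d t h x)"
          unfolding norm_mult complex_mod_cnj by (subst mult.commute) (intro mult_right_mono B(1) norm_ge_zero)
        then show "ennreal (cmod (A_block d t h x * cnj (trig_poly d (rho d s) c x))) \<le> ennreal B * ennreal (cmod (A_block d t h x))"
          using B(2) by (simp add: ennreal_leI flip: ennreal_mult)
      qed
      also have "\<dots> = ennreal B * Lp_norm d 1 (A_block d t h)"
        unfolding Lp_norm_1 by (rule nn_integral_cmult) measurable
      finally show ?thesis .
    qed (simp add: not_integrable_integral_eq)
  qed
  finally show ?thesis by (simp add: sum_distrib_left)
qed

subsection \<open>Lower bounds from families of even blocks\<close>

lemma enn2real_inverse_exponent: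
  assumes "1 \<le> (\<theta>::ennreal)"
  shows "0 \<le> enn2real (1 / \<theta>)" "enn2real (1 / \<theta>) \<le> 1"
proof -
  show "0 \<le> enn2real (1 / \<theta>)" by simp
  from assms show "enn2real (1 / \<theta>) \<le> 1"
  proof (cases rule: ennreal_exponent_cases)
    case 1
    then show ?thesis by simp
  next
    case (2 T)
    have "1 / \<theta> = ennreal 1 / ennreal T" unfolding 2 by simp
    also have "\<dots> = ennreal (1 / T)" using 2 by (intro divide_ennreal) simp_all
    finally have "1 / \<theta> = ennreal (1 / T)" .
    then show ?thesis using 2 by simp
  qed
qed

lemma besov_norm_leI:
  assumes \<theta>: "1 \<le> \<theta>" and P: "finite P" "P \<noteq> {}" "P \<subseteq> indices d" and y: "0 \<le> y"
    and zero: "\<And>t. t \<in> indices d - P \<Longrightarrow> Lp_norm d p (beta_block d p t f) = 0"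
    and le: "\<And>t. t \<in> P \<Longrightarrow> ennreal (2 powr weight d r t) * Lp_norm d p (beta_block d p t f) \<le> ennreal y"
  shows "besov_norm d r p \<theta> f \<le> ennreal (real (card P) powr enn2real (1 / \<theta>) * y)"
  using \<theta>
proof (cases rule: ennreal_exponent_cases)
  case 1
  have "ennreal (2 powr weight d r t) * Lp_norm d p (beta_block d p t f) \<le> ennreal y" if "t \<in> indices d" for t
    using zero[of t] le[of t] that by (cases "t \<in> P") auto
  then have "besov_norm d r p \<theta> f \<le> ennreal y"
    unfolding besov_norm_def 1 by (auto intro: SUP_least)
  moreover have "real (card P) powr enn2real (1 / \<theta>) = 1" using P 1 by (simp add: card_gt_0_iff)
  ultimately show ?thesis by simp
next
  case (2 T)
  have eT: "enn2real \<theta> = T" "\<theta> \<noteq> \<infinity>" using 2 by auto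
  have \<tau>: "enn2real (1 / \<theta>) = 1 / T"
  proof -
    have "1 / \<theta> = ennreal 1 / ennreal T" unfolding 2 by simp
    also have "\<dots> = ennreal (1 / T)" using 2 by (intro divide_ennreal) simp_all
    finally have "1 / \<theta> = ennreal (1 / T)" .
    then show ?thesis using 2 by simp
  qed
  let ?a = "\<lambda>t. ennreal (2 powr (weight d r t * T)) * enn_powr (Lp_norm d p (beta_block d p t f)) T"
  have at: "?a t \<le> ennreal (y powr T)" if t: "t \<in> P" for t
  proof (cases "Lp_norm d p (beta_block d p t f)")
    case (real z)
    have "ennreal (2 powr weight d r t * z) \<le> ennreal y" using le[OF t] real by (simp add: ennreal_mult)
    then have "2 powr weight d r t * z \<le> y" using y by (subst (asm) ennreal_le_iff) auto
    then have "(2 powr weight d r t * z) powr T \<le> y powr T" using 2 real by (intro powr_mono2) auto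
    then have "2 powr (weight d r t * T) * z powr T \<le> y powr T" using real by (simp add: powr_mult powr_powr)
    then show ?thesis using real by (simp add: enn_powr_ennreal ennreal_leI flip: ennreal_mult)
  next
    case top
    then show ?thesis using le[OF t] by (simp add: ennreal_mult_top top_unique)
  qed
  have "(\<Sum>\<^sub>\<infinity>t\<in>indices d. ?a t) \<le> ennreal (real (card P) * y powr T)"
  proof (rule ennreal_infsum_leI)
    fix F assume F: "finite F" "F \<subseteq> indices d"
    have "sum ?a F = sum ?a (F \<inter> P)"
      using F zero 2 by (intro sum.mono_neutral_right) (auto simp: enn_powr_def)
    also have "\<dots> \<le> (\<Sum>t\<in>F \<inter> P. ennreal (y powr T))" using at by (intro sum_mono) auto
    also have "\<dots> \<le> (\<Sum>t\<in>P. ennreal (y powr T))" using P by (intro sum_mono2) auto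
    also have "\<dots> = ennreal (real (card P) * y powr T)"
      by (simp add: ennreal_mult ennreal_of_nat_eq_real_of_nat)
    finally show "sum ?a F \<le> ennreal (real (card P) * y powr T)" .
  qed
  also have "\<dots> = ennreal ((real (card P) powr (1 / T) * y) powr T)"
    using 2 y by (simp add: powr_mult powr_powr)
  finally show ?thesis unfolding \<tau> besov_norm_def eT(1) using eT(2) 2 y
    by (simp add: enn_powr_le_iff)
qed

text \<open>All blocks have the same number \<open>2 ^ e\<close> of nodes and weight at most
  \<omega>, so they enter on equal terms. The value 4 is the smallest even entry for which the
  modulated kernels are available.\<close>

locale lower_blocks =
  fixes d :: nat and r :: "nat \<Rightarrow> real" and D :: "(nat \<Rightarrow> nat) set" and e :: nat and \<omega> :: real
  assumes finite_D: "finite D" and D_ne: "D \<noteq> {}" and D_indices: "D \<subseteq> indices d"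
    and D_ge: "\<And>s j. s \<in> D \<Longrightarrow> j \<in> {1..d} \<Longrightarrow> 4 \<le> s j"
    and D_even: "\<And>s j. s \<in> D \<Longrightarrow> j \<in> {1..d} \<Longrightarrow> even (s j)"
    and D_dim: "\<And>s. s \<in> D \<Longrightarrow> (\<Sum>j\<in>{1..d}. s j - 3) = e"
    and D_weight: "\<And>s. s \<in> D \<Longrightarrow> weight d r s \<le> \<omega>"
    and r_nonneg: "\<And>j. j \<in> {1..d} \<Longrightarrow> 0 \<le> r j"
begin

definition I :: "((nat \<Rightarrow> nat) \<times> (nat \<Rightarrow> nat)) set" where
  "I = Sigma D (grid d)"

definition coef :: "real \<Rightarrow> ((nat \<Rightarrow> nat) \<times> (nat \<Rightarrow> nat) \<Rightarrow> complex) \<Rightarrow> (nat \<Rightarrow> nat) \<Rightarrow> (nat \<Rightarrow> int) \<Rightarrow> complex" where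
  "coef \<eta> x s k = of_real \<eta> * (\<Sum>i\<in>grid d s. x (s, i) * KC d s i k)"

definition test :: "real \<Rightarrow> ((nat \<Rightarrow> nat) \<times> (nat \<Rightarrow> nat) \<Rightarrow> complex) \<Rightarrow> (nat \<Rightarrow> real) \<Rightarrow> complex" where
  "test \<eta> x = (\<lambda>z. \<Sum>s\<in>D. trig_poly d (rho d s) (coef \<eta> x s) z)"

definition pair :: "((nat \<Rightarrow> real) \<Rightarrow> complex) \<Rightarrow> ((nat \<Rightarrow> nat) \<times> (nat \<Rightarrow> nat) \<Rightarrow> complex) \<Rightarrow> complex" where
  "pair h y = (\<Sum>s\<in>D. \<Sum>k\<in>rho d s. fourier_coeff d h k * cnj (\<Sum>i\<in>grid d s. y (s, i) * DC d s i k))"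

lemma finite_I: "finite I" unfolding I_def using finite_D finite_grid by auto

lemma card_I: "card I = card D * 2 ^ e"
proof -
  have "card I = (\<Sum>s\<in>D. card (grid d s))"
    unfolding I_def by (rule card_SigmaI) (use finite_D finite_grid in auto)
  also have "\<dots> = (\<Sum>s\<in>D. 2 ^ e)" using D_dim by (intro sum.cong refl) (simp add: card_grid)
  finally show ?thesis by simp
qed

lemma D_ge': "s \<in> D \<Longrightarrow> j \<in> {1..d} \<Longrightarrow> 3 \<le> s j" "s \<in> D \<Longrightarrow> j \<in> {1..d} \<Longrightarrow> 2 \<le> s j"
  using D_ge[of s j] by simp_all

lemma active_indices: "s \<in> D \<Longrightarrow> active d s \<subseteq> indices d"
  by (rule active_subset_indices) (rule D_ge'(2))

text \<open>\<open>s j\<close> is the even one among \<open>t j\<close> and \<open>t j + 1\<close>,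
  so \<open>t\<close> determines \<open>s\<close>.\<close>

lemma active_disjoint:
  assumes "s \<in> D" "s' \<in> D" "t \<in> active d s" "t \<in> active d s'"
  shows "s = s'"
proof -
  have "s j = s' j" if j: "j \<in> {1..d}" for j
  proof -
    have "s j - 1 \<le> t j" "t j \<le> s j" "s' j - 1 \<le> t j" "t j \<le> s' j"
      using assms(3,4) j by (auto simp: active_def PiE_iff)
    moreover have "4 \<le> s j" "4 \<le> s' j" using D_ge assms j by auto
    moreover obtain a b where "s j = 2 * a" "s' j = 2 * b" using D_even[OF assms(1) j] D_even[OF assms(2) j] by (auto elim!: evenE)
    ultimately show ?thesis by presburger
  qed
  then show ?thesis using assms(1,2) D_indices unfolding indices_def by (intro PiE_ext[of s "{1..d}" "\<lambda>_. {1..}" s']) auto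
qed

lemma rho_disjoint:
  assumes "s \<in> D" "s' \<in> D" "k \<in> rho d s" "k \<in> rho d s'"
  shows "s = s'"
proof -
  have "(\<Sum>t\<in>active d s. block_hat d t k) = 1"
    by (rule sum_block_hat_active[OF _ assms(3)]) (rule D_ge'(2)[OF assms(1)])
  then have "(\<Sum>t\<in>active d s. block_hat d t k) \<noteq> 0" by simp
  then obtain t where t: "t \<in> active d s" "block_hat d t k \<noteq> 0" by (rule sum.not_neutral_contains_not_neutral)
  then have "t \<in> active d s'" using active_indices[OF assms(1)] assms(4) by (intro block_hat_nz_active) auto
  then show ?thesis using active_disjoint assms t by blast
qed

lemma integrable_test: "integrable (torus d) (test \<eta> x)"
  unfolding test_def by (intro Bochner_Integration.integrable_sum integrable_trig_poly)

lemma fourier_coeff_test: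
  assumes k: "k \<in> freqs d"
  shows "fourier_coeff d (test \<eta> x) k = (\<Sum>s\<in>D. if k \<in> rho d s then coef \<eta> x s k else 0)"
proof -
  have "fourier_coeff d (test \<eta> x) k = (\<Sum>s\<in>D. fourier_coeff d (trig_poly d (rho d s) (coef \<eta> x s)) k)"
    unfolding test_def by (intro fourier_coeff_sum integrable_trig_poly)
  also have "\<dots> = (\<Sum>s\<in>D. if k \<in> rho d s then coef \<eta> x s k else 0)"
    by (rule sum.cong[OF refl], rule fourier_coeff_trig_poly[OF finite_rho rho_subset_freqs k])
  finally show ?thesis .
qed

lemma fourier_coeff_test_rho:
  assumes s: "s \<in> D" and k: "k \<in> rho d s"
  shows "fourier_coeff d (test \<eta> x) k = coef \<eta> x s k"
proof -
  have "k \<in> freqs d" using k rho_subset_freqs by auto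
  then have "fourier_coeff d (test \<eta> x) k = (\<Sum>s'\<in>D. if k \<in> rho d s' then coef \<eta> x s' k else 0)"
    by (rule fourier_coeff_test)
  also have "\<dots> = (\<Sum>s'\<in>D. if s' = s then coef \<eta> x s k else 0)"
  proof (rule sum.cong[OF refl])
    fix s' assume s': "s' \<in> D"
    show "(if k \<in> rho d s' then coef \<eta> x s' k else 0) = (if s' = s then coef \<eta> x s k else 0)"
    proof (cases "s' = s")
      case True
      then show ?thesis using k by simp
    next
      case False
      then have "k \<notin> rho d s'" using rho_disjoint[OF s s' k] by blast
      then show ?thesis using False by simp
    qed
  qed
  finally show ?thesis using s finite_D by simp
qed

text \<open>Biorthogonality makes the pairing diagonal in the coordinates \<open>I\<close>, each
  with the factor \<open>\<eta> / 2 ^ e\<close>. This transfers the problem to the unit cube over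
  \<open>I\<close>.\<close>

lemma pair_test: "pair (test \<eta> x) y = of_real (\<eta> / 2 ^ e) * (\<Sum>v\<in>I. x v * cnj (y v))"
proof -
  have "(\<Sum>k\<in>rho d s. fourier_coeff d (test \<eta> x) k * cnj (\<Sum>i\<in>grid d s. y (s, i) * DC d s i k))
    = of_real (\<eta> / 2 ^ e) * (\<Sum>i\<in>grid d s. x (s, i) * cnj (y (s, i)))" if s: "s \<in> D" for s
  proof -
    let ?G = "grid d s"
    have "(\<Sum>k\<in>rho d s. fourier_coeff d (test \<eta> x) k * cnj (\<Sum>i\<in>?G. y (s, i) * DC d s i k))
       = (\<Sum>k\<in>rho d s. \<Sum>i\<in>?G. \<Sum>i'\<in>?G. of_real \<eta> * (x (s, i) * cnj (y (s, i'))) * (KC d s i k * cnj (DC d s i' k)))"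
    proof (rule sum.cong)
      fix k assume k: "k \<in> rho d s"
      have "fourier_coeff d (test \<eta> x) k * cnj (\<Sum>i\<in>?G. y (s, i) * DC d s i k)
        = of_real \<eta> * ((\<Sum>i\<in>?G. x (s, i) * KC d s i k) * (\<Sum>i'\<in>?G. cnj (y (s, i')) * cnj (DC d s i' k)))"
        unfolding fourier_coeff_test_rho[OF s k] coef_def by (simp add: mult.assoc)
      then show "fourier_coeff d (test \<eta> x) k * cnj (\<Sum>i\<in>?G. y (s, i) * DC d s i k)
        = (\<Sum>i\<in>?G. \<Sum>i'\<in>?G. of_real \<eta> * (x (s, i) * cnj (y (s, i'))) * (KC d s i k * cnj (DC d s i' k)))"
        unfolding sum_product by (simp add: sum_distrib_left mult_ac)
    qed simp
    also have "\<dots> = (\<Sum>i\<in>?G. \<Sum>i'\<in>?G. \<Sum>k\<in>rho d s. of_real \<eta> * (x (s, i) * cnj (y (s, i'))) * (KC d s i k * cnj (DC d s i' k)))"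
      by (subst sum.swap) (intro sum.cong refl sum.swap)
    also have "\<dots> = (\<Sum>i\<in>?G. \<Sum>i'\<in>?G. of_real \<eta> * (x (s, i) * cnj (y (s, i'))) * (if i = i' then 1 / of_nat (card ?G) else 0))"
      unfolding sum_distrib_left[symmetric] using D_ge'(1)[OF s] by (intro sum.cong refl) (subst KC_DC_orthogonal, auto)
    also have "\<dots> = (\<Sum>i\<in>?G. of_real \<eta> * (x (s, i) * cnj (y (s, i))) * (1 / 2 ^ e))"
    proof (rule sum.cong)
      fix i assume i: "i \<in> ?G"
      have "(\<Sum>i'\<in>?G. of_real \<eta> * (x (s, i) * cnj (y (s, i'))) * (if i = i' then 1 / of_nat (card ?G) else 0))
        = (\<Sum>i'\<in>?G. if i' = i then of_real \<eta> * (x (s, i) * cnj (y (s, i))) * (1 / of_nat (card ?G)) else 0)"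
        by (intro sum.cong) auto
      also have "\<dots> = of_real \<eta> * (x (s, i) * cnj (y (s, i))) * (1 / of_nat (card ?G))"
        using i finite_grid by simp
      finally show "(\<Sum>i'\<in>?G. of_real \<eta> * (x (s, i) * cnj (y (s, i'))) * (if i = i' then 1 / of_nat (card ?G) else 0))
        = of_real \<eta> * (x (s, i) * cnj (y (s, i))) * (1 / 2 ^ e)"
        using D_dim[OF s] by (simp add: card_grid)
    qed simp
    also have "\<dots> = of_real (\<eta> / 2 ^ e) * (\<Sum>i\<in>?G. x (s, i) * cnj (y (s, i)))"
      by (simp add: sum_distrib_left)
    finally show ?thesis .
  qed
  then have "pair (test \<eta> x) y = (\<Sum>s\<in>D. of_real (\<eta> / 2 ^ e) * (\<Sum>i\<in>grid d s. x (s, i) * cnj (y (s, i))))"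
    unfolding pair_def by (rule sum.cong[OF refl])
  also have "\<dots> = of_real (\<eta> / 2 ^ e) * (\<Sum>s\<in>D. \<Sum>i\<in>grid d s. x (s, i) * cnj (y (s, i)))"
    by (simp only: sum_distrib_left)
  also have "(\<Sum>s\<in>D. \<Sum>i\<in>grid d s. x (s, i) * cnj (y (s, i))) = (\<Sum>v\<in>I. x v * cnj (y v))"
    unfolding I_def using finite_D finite_grid by (subst sum.Sigma) (auto intro!: sum.cong)
  finally show ?thesis .
qed

text \<open>One vector of the unit cube tests all blocks at once. Since the active sets are
  disjoint, the L_1 contributions form part of the target norm; the factor 2 is the passage from L_1
  to L_q.\<close>

lemma pair_bound:
  assumes q: "1 \<le> q" and h: "integrable (torus d) h" and y: "\<And>v. v \<in> I \<Longrightarrow> cmod (y v) \<le> 1"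
  shows "ennreal (cmod (pair h y)) \<le> ennreal (2 * 5 ^ d) * Bq1_norm d q h"
proof -
  have "ennreal (cmod (pair h y)) \<le> ennreal (\<Sum>s\<in>D. cmod (\<Sum>k\<in>rho d s. fourier_coeff d h k * cnj (\<Sum>i\<in>grid d s. y (s, i) * DC d s i k)))"
    unfolding pair_def by (intro ennreal_leI norm_sum)
  also have "\<dots> = (\<Sum>s\<in>D. ennreal (cmod (\<Sum>k\<in>rho d s. fourier_coeff d h k * cnj (\<Sum>i\<in>grid d s. y (s, i) * DC d s i k))))"
    by (rule sum_ennreal[symmetric]) simp
  also have "\<dots> \<le> (\<Sum>s\<in>D. ennreal (5 ^ d) * (\<Sum>t\<in>active d s. Lp_norm d 1 (A_block d t h)))"
  proof (rule sum_mono)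
    fix s assume s: "s \<in> D"
    have dual: "cmod (trig_poly d (rho d s) (\<lambda>k. \<Sum>i\<in>grid d s. y (s, i) * DC d s i k) z) \<le> 5 ^ d" for z
      using D_ge'(1)[OF s] y s by (intro norm_dual_le) (auto simp: I_def)
    show "ennreal (cmod (\<Sum>k\<in>rho d s. fourier_coeff d h k * cnj (\<Sum>i\<in>grid d s. y (s, i) * DC d s i k)))
       \<le> ennreal (5 ^ d) * (\<Sum>t\<in>active d s. Lp_norm d 1 (A_block d t h))"
      by (rule pairing_bound[OF D_ge'(2)[OF s] h dual]) simp_all
  qed
  also have "\<dots> = ennreal (5 ^ d) * (\<Sum>s\<in>D. \<Sum>t\<in>active d s. Lp_norm d 1 (A_block d t h))"
    by (simp only: sum_distrib_left)
  also have "(\<Sum>s\<in>D. \<Sum>t\<in>active d s. Lp_norm d 1 (A_block d t h)) = (\<Sum>t\<in>(\<Union>s\<in>D. active d s). Lp_norm d 1 (A_block d t h))"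
  proof (rule sum.UNION_disjoint[symmetric])
    show "\<forall>s\<in>D. \<forall>s'\<in>D. s \<noteq> s' \<longrightarrow> active d s \<inter> active d s' = {}" using active_disjoint by blast
  qed (use finite_D finite_active in auto)
  also have "\<dots> \<le> (\<Sum>t\<in>(\<Union>s\<in>D. active d s). 2 * Lp_norm d q (A_block d t h))"
    using active_indices by (intro sum_mono Lp_norm_mono_exponent q order_refl measurable_A_block h) auto
  also have "\<dots> = 2 * (\<Sum>t\<in>(\<Union>s\<in>D. active d s). Lp_norm d q (A_block d t h))"
    by (simp only: sum_distrib_left)
  also have "(\<Sum>t\<in>(\<Union>s\<in>D. active d s). Lp_norm d q (A_block d t h)) \<le> Bq1_norm d q h"
    unfolding Bq1_norm_def using active_indices finite_D finite_active by (intro ennreal_sum_le_infsum) auto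
  also have "ennreal (5 ^ d) * (2 * Bq1_norm d q h) = ennreal (2 * 5 ^ d) * Bq1_norm d q h"
    by (simp add: ennreal_mult mult_ac)
  finally show ?thesis by (simp add: mult_left_mono)
qed

lemma pair_diff:
  assumes "integrable (torus d) f" "integrable (torus d) h"
  shows "pair (f - h) y = pair f y - pair h y"
proof -
  have "fourier_coeff d (f - h) k = fourier_coeff d f k - fourier_coeff d h k" for k
    using fourier_coeff_diff[OF assms] by (simp add: fun_diff_def)
  then show ?thesis by (simp add: pair_def left_diff_distrib sum_subtractf)
qed

text \<open>Chosen to bring the class norm of test functions with data in the unit cube below 1: the
  weights are at most \<open>2 powr \<omega>\<close>, smooth blocks cost \<open>A_const d\<close>,
  and at most \<open>2 ^ d * card D\<close> blocks do not vanish.\<close>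

definition amplitude :: "ennreal \<Rightarrow> real" where
  "amplitude \<theta> = 2 powr - \<omega> / (A_const d * 2 ^ d * real (card D) powr enn2real (1 / \<theta>))"

lemma card_D_pos: "0 < card D" using finite_D D_ne by (simp add: card_gt_0_iff)

lemma amplitude_pos: "0 < amplitude \<theta>"
  using card_D_pos A_const_ge_1[of d] by (simp add: amplitude_def)

text \<open>A sharp block of the test function is one of its pieces or zero. A smooth block sees at
  most one piece, since no index is active for two members of \<open>D\<close>. Each piece is
  bounded by the amplitude in the supremum norm, hence in every L_p.\<close>

lemma test_in_besov_class:
  assumes p: "1 \<le> p" and \<theta>: "1 \<le> \<theta>" and x: "\<And>v. v \<in> I \<Longrightarrow> cmod (x v) \<le> 1"
  shows "test (amplitude \<theta>) x \<in> besov_class d r p \<theta>"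
proof -
  let ?\<eta> = "amplitude \<theta>" let ?f = "test ?\<eta> x"
  let ?F = "\<lambda>s. trig_poly d (rho d s) (coef ?\<eta> x s)"
  have F: "cmod (?F s z) \<le> ?\<eta>" if s: "s \<in> D" for s z
  proof -
    have "?F s z = of_real ?\<eta> * trig_poly d (rho d s) (\<lambda>k. \<Sum>i\<in>grid d s. x (s, i) * KC d s i k) z"
      unfolding trig_poly_def coef_def by (simp only: mult.assoc sum_distrib_left[symmetric])
    moreover have "cmod (trig_poly d (rho d s) (\<lambda>k. \<Sum>i\<in>grid d s. x (s, i) * KC d s i k) z) \<le> 1"
      using D_ge'(1)[OF s] x s by (intro norm_primal_le) (auto simp: I_def)
    ultimately show ?thesis using amplitude_pos[of \<theta>] by (simp add: norm_mult mult_left_le)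
  qed
  have F_norm: "Lp_norm d p (?F s) \<le> ennreal ?\<eta>" if "s \<in> D" for s
    using F[OF that] by (intro Lp_norm_le_bound p) auto
  define K where "K = (\<Union>s\<in>D. rho d s)"
  have K: "finite K" "K \<subseteq> freqs d"
  proof -
    show "finite K" using finite_D finite_rho by (simp add: K_def)
    show "K \<subseteq> freqs d" unfolding K_def by (rule UN_least) (rule rho_subset_freqs)
  qed
  have Lp0: "?f \<in> Lp0 d p"
  proof -
    define c where "c k = (\<Sum>s\<in>D. if k \<in> rho d s then coef ?\<eta> x s k else 0)" for k
    have "?F s z = trig_poly d K (\<lambda>k. if k \<in> rho d s then coef ?\<eta> x s k else 0) z" if "s \<in> D" for s z
      unfolding trig_poly_def using that K
      by (intro sum.mono_neutral_cong_left) (auto simp: K_def)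
    then have "?f z = trig_poly d K c z" for z
      unfolding test_def c_def[abs_def] trig_poly_sum[symmetric] by (intro sum.cong) auto
    then have "?f = trig_poly d K c" by auto
    also have "\<dots> \<in> Bq1 d p"
    proof (rule trig_poly_in_Bq1[OF p K])
      fix k j assume "k \<in> K" "j \<in> {1..d}"
      then obtain s where "s \<in> D" "2 ^ (s j - 1) \<le> \<bar>k j\<bar>" by (auto simp: K_def rho_def PiE_iff)
      moreover have "(0::int) < 2 ^ (s j - 1)" by simp
      ultimately show "k j \<noteq> 0" by linarith
    qed
    finally show ?thesis by (simp add: Bq1_def)
  qed
  define P where "P = (\<Union>s\<in>D. active d s)"
  have P: "finite P" "P \<subseteq> indices d" using finite_D finite_active active_indices by (auto simp: P_def)
  have s_act: "s \<in> active d s" if "s \<in> D" for s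
    using that D_indices by (auto simp: active_def indices_def PiE_iff)
  have P_ne: "P \<noteq> {}" using D_ne s_act by (auto simp: P_def)
  have card_P: "card P \<le> 2 ^ d * card D"
  proof -
    have "card P \<le> (\<Sum>s\<in>D. card (active d s))" unfolding P_def by (rule card_UN_le[OF finite_D])
    also have "\<dots> \<le> (\<Sum>s\<in>D. 2 ^ d)" by (intro sum_mono card_active_le)
    finally show ?thesis by (simp add: mult.commute)
  qed
  have eta_le: "ennreal ?\<eta> \<le> ennreal (A_const d * ?\<eta>)"
    using amplitude_pos[of \<theta>] A_const_ge_1[of d] by (intro ennreal_leI) simp
  have A_eq: "A_block d t ?f = A_block d t (?F s)" if t: "t \<in> indices d" and s: "s \<in> D"
    and only: "\<And>s'. s' \<in> D \<Longrightarrow> t \<in> active d s' \<Longrightarrow> s' = s" for t s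
  proof (rule A_block_cong_fourier[OF t integrable_test integrable_trig_poly])
    fix k assume k: "k \<in> freqs d" "block_hat d t k \<noteq> 0"
    have "fourier_coeff d ?f k = (\<Sum>s'\<in>D. if k \<in> rho d s' then coef ?\<eta> x s' k else 0)"
      by (rule fourier_coeff_test[OF k(1)])
    also have "\<dots> = (\<Sum>s'\<in>D. if s' = s then (if k \<in> rho d s then coef ?\<eta> x s k else 0) else 0)"
    proof (intro sum.cong refl)
      fix s' assume s': "s' \<in> D"
      have "k \<notin> rho d s'" if "s' \<noteq> s" using block_hat_nz_active[OF t k(2), of s'] only[OF s'] that by metis
      then show "(if k \<in> rho d s' then coef ?\<eta> x s' k else 0) = (if s' = s then (if k \<in> rho d s then coef ?\<eta> x s k else 0) else 0)"
        by auto
    qed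
    also have "\<dots> = (if k \<in> rho d s then coef ?\<eta> x s k else 0)" using s finite_D by simp
    also have "\<dots> = fourier_coeff d (?F s) k"
      by (rule fourier_coeff_trig_poly[OF finite_rho rho_subset_freqs k(1), symmetric])
    finally show "fourier_coeff d ?f k = fourier_coeff d (?F s) k" .
  qed
  have delta_in: "delta_block d t ?f = ?F t" if "t \<in> D" for t
    using fourier_coeff_test_rho[OF that]
    by (auto simp: delta_block_def trig_poly_def fun_eq_iff intro!: sum.cong)
  have rho_indices_unique: "s' = t" if ti: "t \<in> indices d" and s'D: "s' \<in> D" and kt: "k \<in> rho d t" and ks: "k \<in> rho d s'" for t s' k
  proof -
    have "s' j = t j" if j: "j \<in> {1..d}" for j
    proof -
      have "2 ^ (t j - 1) \<le> \<bar>k j\<bar>" "\<bar>k j\<bar> < 2 ^ t j" "2 ^ (s' j - 1) \<le> \<bar>k j\<bar>" "\<bar>k j\<bar> < 2 ^ s' j"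
        using kt ks j by (auto simp: rho_def PiE_iff)
      then have pw: "(2::int) ^ (t j - 1) < 2 ^ s' j" "(2::int) ^ (s' j - 1) < 2 ^ t j" by linarith+
      have "t j - 1 < s' j" "s' j - 1 < t j"
        using power_less_imp_less_exp[OF _ pw(1)] power_less_imp_less_exp[OF _ pw(2)] by simp_all
      moreover have "1 \<le> t j" "1 \<le> s' j" using indices_ge_1[OF ti j] indices_ge_1[OF subsetD[OF D_indices s'D] j] by simp_all
      ultimately show ?thesis by linarith
    qed
    then show ?thesis using ti s'D D_indices unfolding indices_def by (intro PiE_ext[of s' "{1..d}" "\<lambda>_. {1..}" t]) auto
  qed
  have delta_out: "delta_block d t ?f = (\<lambda>_. 0)" if t: "t \<in> indices d" "t \<notin> D" for t
  proof -
    have "fourier_coeff d ?f k = 0" if k: "k \<in> rho d t" for k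
    proof -
      have "k \<in> freqs d" using k rho_subset_freqs by auto
      then show ?thesis using rho_indices_unique[OF t(1) _ k] t(2)
        by (subst fourier_coeff_test) (auto intro!: sum.neutral)
    qed
    then show ?thesis by (simp add: delta_block_def fun_eq_iff)
  qed
  have zero: "Lp_norm d p (beta_block d p t ?f) = 0" if t: "t \<in> indices d - P" for t
  proof (cases "1 < p \<and> p < \<infinity>")
    case True
    have "t \<notin> D" using t s_act by (auto simp: P_def)
    then show ?thesis using True t delta_out Lp_norm_zero[OF p] by (simp add: beta_block_def)
  next
    case False
    obtain s where s: "s \<in> D" using D_ne by auto
    have "A_block d t ?f = A_block d t (?F s)" using t s by (intro A_eq) (auto simp: P_def)
    also have "\<dots> = (\<lambda>_. 0)"
      using t s block_hat_nz_active[of t d _ s] by (intro A_block_trig_poly_eq_0 finite_rho rho_subset_freqs) (auto simp: P_def)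
    finally show ?thesis unfolding beta_block_def if_not_P[OF False] using Lp_norm_zero[OF p] by simp
  qed
  have bound: "Lp_norm d p (beta_block d p t ?f) \<le> ennreal (A_const d * ?\<eta>)" if t: "t \<in> P" for t
  proof (cases "1 < p \<and> p < \<infinity>")
    case True
    show ?thesis
    proof (cases "t \<in> D")
      case inD: True
      have "Lp_norm d p (beta_block d p t ?f) = Lp_norm d p (?F t)" using True inD delta_in by (simp add: beta_block_def)
      also have "\<dots> \<le> ennreal ?\<eta>" by (rule F_norm[OF inD])
      finally show ?thesis using eta_le by (rule order_trans)
    next
      case notin: False
      then show ?thesis using True t P delta_out[of t] Lp_norm_zero[OF p] by (auto simp: beta_block_def)
    qed
  next
    case False
    obtain s where s: "s \<in> D" "t \<in> active d s" using t by (auto simp: P_def)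
    have ti: "t \<in> indices d" using t P by auto
    have "A_block d t ?f = A_block d t (?F s)" using s active_disjoint by (intro A_eq ti) auto
    then have "Lp_norm d p (beta_block d p t ?f) = Lp_norm d p (A_block d t (?F s))"
      unfolding beta_block_def if_not_P[OF False] by simp
    also have "\<dots> \<le> ennreal (A_const d) * Lp_norm d p (?F s)"
      unfolding A_const_def by (rule Lp_norm_A_block_le[OF p ti integrable_trig_poly])
    also have "\<dots> \<le> ennreal (A_const d) * ennreal ?\<eta>" by (intro mult_left_mono F_norm s) simp
    also have "\<dots> = ennreal (A_const d * ?\<eta>)" using amplitude_pos[of \<theta>] A_const_ge_1[of d] by (simp add: ennreal_mult)
    finally show ?thesis .
  qed
  have "besov_norm d r p \<theta> ?f \<le> ennreal (real (card P) powr enn2real (1 / \<theta>) * (2 powr \<omega> * (A_const d * ?\<eta>)))"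
  proof (rule besov_norm_leI[OF \<theta> P(1) P_ne P(2)])
    show "0 \<le> 2 powr \<omega> * (A_const d * ?\<eta>)" using amplitude_pos[of \<theta>] A_const_ge_1[of d] by simp
    fix t assume t: "t \<in> P"
    then obtain s where s: "s \<in> D" "t \<in> active d s" by (auto simp: P_def)
    have "weight d r t \<le> weight d r s"
      using s(2) r_nonneg by (intro sum_mono mult_right_mono) (auto simp: active_def PiE_iff)
    then have "weight d r t \<le> \<omega>" using D_weight[OF s(1)] by linarith
    then have "ennreal (2 powr weight d r t) * Lp_norm d p (beta_block d p t ?f) \<le> ennreal (2 powr \<omega>) * ennreal (A_const d * ?\<eta>)"
      by (intro mult_mono bound t ennreal_leI powr_mono) auto
    also have "\<dots> = ennreal (2 powr \<omega> * (A_const d * ?\<eta>))"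
      using amplitude_pos[of \<theta>] A_const_ge_1[of d] by (intro ennreal_mult[symmetric]) auto
    finally show "ennreal (2 powr weight d r t) * Lp_norm d p (beta_block d p t ?f) \<le> ennreal (2 powr \<omega> * (A_const d * ?\<eta>))" .
  qed (rule zero)
  also have "\<dots> \<le> ennreal 1"
  proof (rule ennreal_leI)
    let ?\<tau> = "enn2real (1 / \<theta>)"
    have "real (card P) \<le> real (2 ^ d * card D)" using card_P by (rule of_nat_mono)
    then have "real (card P) powr ?\<tau> \<le> (2 ^ d * real (card D)) powr ?\<tau>"
      using enn2real_inverse_exponent[OF \<theta>] by (intro powr_mono2) auto
    also have "\<dots> = (2 ^ d) powr ?\<tau> * real (card D) powr ?\<tau>" by (simp add: powr_mult)
    also have "\<dots> \<le> (2 ^ d) powr 1 * real (card D) powr ?\<tau>"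
      using enn2real_inverse_exponent[OF \<theta>] by (intro mult_right_mono powr_mono) auto
    finally have "real (card P) powr ?\<tau> \<le> 2 ^ d * real (card D) powr ?\<tau>" by simp
    then have "real (card P) powr ?\<tau> * (2 powr \<omega> * (A_const d * ?\<eta>)) \<le> 2 ^ d * real (card D) powr ?\<tau> * (2 powr \<omega> * (A_const d * ?\<eta>))"
      using amplitude_pos[of \<theta>] A_const_ge_1[of d] by (intro mult_right_mono) auto
    also have "\<dots> = 1"
      using card_D_pos A_const_ge_1[of d] by (simp add: amplitude_def powr_minus)
    finally show "real (card P) powr ?\<tau> * (2 powr \<omega> * (A_const d * ?\<eta>)) \<le> 1" .
  qed
  finally show ?thesis using Lp0 by (simp add: besov_class_def)
qed

end

section \<open>Lower bounds for Kolmogorov widths and entropy numbers\<close>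

lemma function_seminorm_Bq1:
  assumes q: "1 \<le> q"
  shows "function_seminorm {f. integrable (torus d) f} (Bq1_norm d q)"
proof
  fix f h :: "(nat \<Rightarrow> real) \<Rightarrow> complex" and c :: complex
  show "0 \<in> {f. integrable (torus d) f}" by (simp add: zero_fun_def)
  assume f: "f \<in> {f. integrable (torus d) f}"
  show "cscale c f \<in> {f. integrable (torus d) f}" using f by (simp add: cscale_def)
  show "Bq1_norm d q (cscale c f) = ennreal (cmod c) * Bq1_norm d q f"
    using Bq1_norm_cscale[OF q] f by simp
  assume h: "h \<in> {f. integrable (torus d) f}"
  show "f + h \<in> {f. integrable (torus d) f}" using f h by (simp add: plus_fun_def)
  show "Bq1_norm d q (f + h) \<le> Bq1_norm d q f + Bq1_norm d q h"
    using Bq1_norm_add[OF q] f h by simp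
qed

lemma Bq1_integrable: "1 \<le> q \<Longrightarrow> f \<in> Bq1 d q \<Longrightarrow> integrable (torus d) f"
  using Lp_integrable[of q f d] by (auto simp: Bq1_def Lp0_def)

context lower_blocks
begin

lemma pair_linear:
  assumes "integrable (torus d) f" "integrable (torus d) h"
  shows "pair (cscale c f + h) y = c * pair f y + pair h y"
proof -
  have "fourier_coeff d (cscale c f + h) k = c * fourier_coeff d f k + fourier_coeff d h k" for k
  proof -
    have "fourier_coeff d (cscale c f + h) k = fourier_coeff d (\<lambda>x. c * f x + h x) k"
      by (simp add: cscale_def plus_fun_def)
    also have "\<dots> = fourier_coeff d (\<lambda>x. c * f x) k + fourier_coeff d h k"
      using assms by (intro fourier_coeff_add) auto
    finally show ?thesis by (simp only: fourier_coeff_cmult)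
  qed
  then show ?thesis by (simp add: pair_def distrib_right sum.distrib sum_distrib_left mult.assoc)
qed

lemma pair_eq_sum_I:
  "pair h y = (\<Sum>v\<in>I. cnj (y v) * (\<Sum>k\<in>rho d (fst v). fourier_coeff d h k * cnj (DC d (fst v) (snd v) k)))"
proof -
  have "(\<Sum>k\<in>rho d s. fourier_coeff d h k * cnj (\<Sum>i\<in>grid d s. y (s, i) * DC d s i k))
     = (\<Sum>i\<in>grid d s. cnj (y (s, i)) * (\<Sum>k\<in>rho d s. fourier_coeff d h k * cnj (DC d s i k)))" for s
    by (simp add: sum_distrib_left mult_ac) (rule sum.swap)
  then have "pair h y = (\<Sum>s\<in>D. \<Sum>i\<in>grid d s. cnj (y (s, i)) * (\<Sum>k\<in>rho d s. fourier_coeff d h k * cnj (DC d s i k)))"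
    unfolding pair_def by (simp only:)
  also have "\<dots> = (\<Sum>v\<in>I. cnj (y v) * (\<Sum>k\<in>rho d (fst v). fourier_coeff d h k * cnj (DC d (fst v) (snd v) k)))"
    unfolding I_def using finite_D finite_grid by (subst sum.Sigma) (auto intro!: sum.cong)
  finally show ?thesis .
qed

text \<open>The vector \<open>y\<close> from the cube section serves both as data of the test
  function and as dual vector. Elements of the subspace pair with it to 0, while the test function
  pairs to at least half of \<open>amplitude \<theta> * card D\<close>, because half of the
  coordinates are unimodular. Division by the constant \<open>2 * 5 ^ d\<close> of
  \<open>pair_bound\<close> gives the claim.\<close>

lemma kolmogorov_width_ge:
  assumes q: "1 \<le> q" and p: "1 \<le> p" and \<theta>: "1 \<le> \<theta>" and M: "2 * M \<le> card I"
  shows "ennreal (amplitude \<theta> * real (card D) / (4 * 5 ^ d)) \<le> kolmogorov_width M (besov_class d r p \<theta>) (Bq1 d q) (Bq1_norm d q)"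
  unfolding kolmogorov_width_def
proof (rule INF_greatest)
  fix L assume "L \<in> subspaces_upto (Bq1 d q) M"
  then obtain B where B: "finite B" "card B \<le> M" "cfun.span B = L" "L \<subseteq> Bq1 d q"
    unfolding subspaces_upto_def by blast
  define a where "a b v = (\<Sum>k\<in>rho d (fst v). fourier_coeff d b k * cnj (DC d (fst v) (snd v) k))" for b v
  obtain z where z: "\<forall>v\<in>I. cmod (z v) \<le> 1" "\<forall>b\<in>B. (\<Sum>v\<in>I. z v * a b v) = 0"
    "card I \<le> card {v\<in>I. cmod (z v) = 1} + card B"
    using cube_section_extreme[OF B(1) finite_I, of a] by blast
  \<comment> \<open>The pairing is conjugate linear in its second argument, whereas the conditions
    on \<open>z\<close> are linear.\<close>
  define y where "y v = cnj (z v)" for v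
  have y1: "cmod (y v) \<le> 1" if "v \<in> I" for v using z(1) that by (simp add: y_def)
  have int: "integrable (torus d) u" if "u \<in> L" for u using Bq1_integrable[OF q] B(4) that by blast
  have orth: "pair u y = 0" if "u \<in> L" for u
  proof -
    have "u \<in> L \<and> pair u y = 0"
      using that unfolding B(3)[symmetric]
    proof (induction rule: cfun.span_induct_alt)
      case base
      have "pair 0 y = 0" by (simp add: pair_def fourier_coeff_def)
      then show ?case using cfun.span_zero[of B] by blast
    next
      case (step c b u)
      have bL: "b \<in> L" "u \<in> L" using step B(3) cfun.span_base by blast+
      have "pair b y = 0"
        using z(2) step(1) unfolding pair_eq_sum_I y_def complex_cnj_cnj by (simp add: a_def)
      then have "pair (cscale c b + u) y = 0"
        using pair_linear[OF int[OF bL(1)] int[OF bL(2)], of c y] step by simp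
      moreover have "cscale c b + u \<in> cfun.span B"
        by (rule cfun.span_add[OF cfun.span_scale[OF cfun.span_base]]) (use step in auto)
      ultimately show ?case by blast
    qed
    then show ?thesis ..
  qed
  let ?f = "test (amplitude \<theta>) y"
  have fW: "?f \<in> besov_class d r p \<theta>" by (rule test_in_besov_class[OF p \<theta> y1])
  have pf: "amplitude \<theta> * real (card D) / 2 \<le> cmod (pair ?f y)"
  proof -
    have "(\<Sum>v\<in>I. y v * cnj (y v)) = of_real (\<Sum>v\<in>I. (cmod (y v))\<^sup>2)"
      unfolding of_real_sum by (intro sum.cong refl complex_norm_square[symmetric])
    then have "pair ?f y = of_real (amplitude \<theta> / 2 ^ e * (\<Sum>v\<in>I. (cmod (y v))\<^sup>2))"
      unfolding pair_test by (simp only: of_real_mult)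
    then have eq: "cmod (pair ?f y) = amplitude \<theta> / 2 ^ e * (\<Sum>v\<in>I. (cmod (y v))\<^sup>2)"
      using amplitude_pos[of \<theta>] by (simp add: sum_nonneg del: of_real_mult of_real_divide of_real_sum)
    have "real (card I) / 2 \<le> real (card {v\<in>I. cmod (z v) = 1})"
      using z(3) B(2) M by linarith
    also have "\<dots> = (\<Sum>v\<in>{v\<in>I. cmod (z v) = 1}. (cmod (y v))\<^sup>2)" by (simp add: y_def)
    also have "\<dots> \<le> (\<Sum>v\<in>I. (cmod (y v))\<^sup>2)" using finite_I by (intro sum_mono2) auto
    finally have "amplitude \<theta> / 2 ^ e * (real (card I) / 2) \<le> cmod (pair ?f y)"
      unfolding eq using amplitude_pos[of \<theta>] by (intro mult_left_mono) auto
    moreover have "amplitude \<theta> / 2 ^ e * (real (card I) / 2) = amplitude \<theta> * real (card D) / 2"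
      by (simp add: card_I)
    ultimately show ?thesis by simp
  qed
  have "ennreal (amplitude \<theta> * real (card D) / (4 * 5 ^ d)) \<le> Bq1_norm d q (?f - u)" if u: "u \<in> L" for u
  proof -
    have int': "integrable (torus d) (?f - u)"
      using integrable_test int[OF u] by (simp add: fun_diff_def)
    have "ennreal (amplitude \<theta> * real (card D) / 2) \<le> ennreal (cmod (pair (?f - u) y))"
      using pf orth[OF u] pair_diff[OF integrable_test int[OF u]] by (intro ennreal_leI) simp
    also have "\<dots> \<le> ennreal (2 * 5 ^ d) * Bq1_norm d q (?f - u)"
      by (rule pair_bound[OF q int' y1])
    finally have "ennreal (1 / (2 * 5 ^ d)) * ennreal (amplitude \<theta> * real (card D) / 2) \<le> ennreal (1 / (2 * 5 ^ d)) * (ennreal (2 * 5 ^ d) * Bq1_norm d q (?f - u))"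
      by (rule mult_left_mono) simp
    moreover have "ennreal (1 / (2 * 5 ^ d)) * (ennreal (2 * 5 ^ d) * Bq1_norm d q (?f - u)) = Bq1_norm d q (?f - u)"
      unfolding mult.assoc[symmetric] by (subst ennreal_mult[symmetric]) simp_all
    moreover have "ennreal (1 / (2 * 5 ^ d)) * ennreal (amplitude \<theta> * real (card D) / 2) = ennreal (amplitude \<theta> * real (card D) / (4 * 5 ^ d))"
      using amplitude_pos[of \<theta>] by (subst ennreal_mult[symmetric]) simp_all
    ultimately show ?thesis by simp
  qed
  then have "ennreal (amplitude \<theta> * real (card D) / (4 * 5 ^ d)) \<le> (INF u\<in>L. Bq1_norm d q (?f - u))"
    by (rule INF_greatest)
  also have "\<dots> \<le> (SUP w\<in>besov_class d r p \<theta>. INF u\<in>L. Bq1_norm d q (w - u))"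
    by (rule SUP_upper[OF fW])
  finally show "ennreal (amplitude \<theta> * real (card D) / (4 * 5 ^ d)) \<le> (SUP w\<in>besov_class d r p \<theta>. INF u\<in>L. Bq1_norm d q (w - u))" .
qed

text \<open>Subsets of \<open>I\<close> index the test functions. For two of them in one ball,
  pairing their difference with the difference of the indicators counts the symmetric difference,
  which is therefore small. By the Hamming count a ball holds fewer than 2 to the power
  \<open>card I / 2\<close> subsets, too few for \<open>2 ^ M\<close> balls to cover all when
  \<open>2 * M \<le> card I\<close>.\<close>

lemma entropy_number_ge:
  assumes q: "1 \<le> q" and p: "1 \<le> p" and \<theta>: "1 \<le> \<theta>" and M: "2 * M \<le> card I"
  shows "ennreal (amplitude \<theta> * real (card D) / (64 * 5 ^ d)) \<le> entropy_number M (besov_class d r p \<theta>) (Bq1 d q) (Bq1_norm d q)"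
  unfolding entropy_number_def
proof (rule Inf_greatest, rule ccontr)
  fix \<epsilon> :: ennreal
  assume "\<epsilon> \<in> {e. \<exists>y :: nat \<Rightarrow> (nat \<Rightarrow> real) \<Rightarrow> complex. (\<forall>j\<in>{1..2 ^ M}. y j \<in> Bq1 d q) \<and>
     besov_class d r p \<theta> \<subseteq> (\<Union>j\<in>{1..2 ^ M}. {f \<in> Bq1 d q. Bq1_norm d q (f - y j) \<le> e})}"
  then obtain y :: "nat \<Rightarrow> (nat \<Rightarrow> real) \<Rightarrow> complex" where y: "\<And>j. j \<in> {1..2 ^ M} \<Longrightarrow> y j \<in> Bq1 d q"
    "besov_class d r p \<theta> \<subseteq> (\<Union>j\<in>{1..2 ^ M}. {f \<in> Bq1 d q. Bq1_norm d q (f - y j) \<le> \<epsilon>})"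
    by blast
  assume "\<not> ennreal (amplitude \<theta> * real (card D) / (64 * 5 ^ d)) \<le> \<epsilon>"
  then have "\<epsilon> < ennreal (amplitude \<theta> * real (card D) / (64 * 5 ^ d))" by simp
  then obtain E where E: "\<epsilon> = ennreal E" "0 \<le> E" "E < amplitude \<theta> * real (card D) / (64 * 5 ^ d)"
    by (cases \<epsilon>) (auto simp: ennreal_less_iff)
  interpret N: function_seminorm "{f. integrable (torus d) f}" "Bq1_norm d q"
    by (rule function_seminorm_Bq1[OF q])
  define ind :: "((nat \<Rightarrow> nat) \<times> (nat \<Rightarrow> nat)) set \<Rightarrow> (nat \<Rightarrow> nat) \<times> (nat \<Rightarrow> nat) \<Rightarrow> complex"
    where "ind A v = (if v \<in> A then 1 else 0)" for A v
  let ?f = "\<lambda>A. test (amplitude \<theta>) (ind A)"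
  define ball where "ball j = {A\<in>Pow I. Bq1_norm d q (?f A - y j) \<le> \<epsilon>}" for j
  have cover: "Pow I \<subseteq> (\<Union>j\<in>{1..2 ^ M}. ball j)"
  proof
    fix A assume A: "A \<in> Pow I"
    have "?f A \<in> besov_class d r p \<theta>" by (rule test_in_besov_class[OF p \<theta>]) (simp add: ind_def)
    then obtain j where "j \<in> {1..2 ^ M}" "Bq1_norm d q (?f A - y j) \<le> \<epsilon>" using y(2) by blast
    then show "A \<in> (\<Union>j\<in>{1..2 ^ M}. ball j)" using A by (auto simp: ball_def)
  qed
  have I_ne: "I \<noteq> {}"
  proof
    assume "I = {}"
    then have "card D * 2 ^ e = 0" using card_I by simp
    then show False using card_D_pos by simp
  qed
  have small: "card (ball j) ^ 16 < 2 ^ (8 * card I)" if j: "j \<in> {1..2 ^ M}" for j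
  proof (cases "ball j = {}")
    case True
    then show ?thesis by simp
  next
    case False
    then obtain A0 where A0: "A0 \<in> ball j" by blast
    have yj: "integrable (torus d) (y j)" using Bq1_integrable[OF q y(1)[OF j]] .
    have "card (sym_diff A A0) \<le> card I div 16" if A: "A \<in> ball j" for A
    proof -
      have sub: "A \<subseteq> I" "A0 \<subseteq> I" using A A0 by (auto simp: ball_def)
      define v where "v w = ind A w - ind A0 w" for w
      have v1: "cmod (v w) \<le> 1" for w by (simp add: v_def ind_def)
      have "Bq1_norm d q (?f A - ?f A0) \<le> Bq1_norm d q (?f A - y j) + Bq1_norm d q (y j - ?f A0)"
        by (rule N.N_triangle) (simp_all add: integrable_test yj)
      also have "Bq1_norm d q (y j - ?f A0) = Bq1_norm d q (?f A0 - y j)"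
        by (rule N.N_minus_commute) (simp_all add: integrable_test yj)
      also have "Bq1_norm d q (?f A - y j) + Bq1_norm d q (?f A0 - y j) \<le> ennreal E + ennreal E"
        using A A0 unfolding ball_def E(1) by (intro add_mono) blast+
      also have "\<dots> = ennreal (2 * E)" using E(2) by (simp flip: ennreal_plus)
      finally have Nle: "Bq1_norm d q (?f A - ?f A0) \<le> ennreal (2 * E)" .
      have "pair (?f A - ?f A0) v = of_real (amplitude \<theta> / 2 ^ e) * (\<Sum>w\<in>I. v w * cnj (v w))"
        unfolding pair_diff[OF integrable_test integrable_test] pair_test
        by (simp add: v_def right_diff_distrib left_diff_distrib sum_subtractf)
      also have "(\<Sum>w\<in>I. v w * cnj (v w)) = (\<Sum>w\<in>I. if w \<in> sym_diff A A0 then 1 else 0)"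
        by (intro sum.cong) (auto simp: v_def ind_def)
      also have "\<dots> = of_nat (card (sym_diff A A0))"
      proof -
        have "(\<Sum>w\<in>I. if w \<in> sym_diff A A0 then 1 else 0) = (\<Sum>w\<in>sym_diff A A0. (1::complex))"
          by (rule sum.mono_neutral_cong_right) (use finite_I sub in auto)
        then show ?thesis by simp
      qed
      finally have eq: "pair (?f A - ?f A0) v = of_real (amplitude \<theta> / 2 ^ e) * of_nat (card (sym_diff A A0))" .
      have "cmod (pair (?f A - ?f A0) v) = amplitude \<theta> / 2 ^ e * real (card (sym_diff A A0))"
        unfolding eq using amplitude_pos[of \<theta>] by (simp add: norm_mult norm_divide norm_power)
      moreover have "ennreal (cmod (pair (?f A - ?f A0) v)) \<le> ennreal (2 * 5 ^ d) * Bq1_norm d q (?f A - ?f A0)"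
        by (rule pair_bound[OF q _ v1]) (use integrable_test in \<open>simp add: fun_diff_def\<close>)
      moreover have "\<dots> \<le> ennreal (2 * 5 ^ d) * ennreal (2 * E)" by (intro mult_left_mono Nle) simp
      moreover have "\<dots> = ennreal (4 * 5 ^ d * E)" using E(2) by (subst ennreal_mult[symmetric]) simp_all
      ultimately have "ennreal (amplitude \<theta> / 2 ^ e * real (card (sym_diff A A0))) \<le> ennreal (4 * 5 ^ d * E)" by simp
      then have "amplitude \<theta> / 2 ^ e * real (card (sym_diff A A0)) \<le> 4 * 5 ^ d * E"
        using E(2) by (subst (asm) ennreal_le_iff) auto
      also have "\<dots> < 4 * 5 ^ d * (amplitude \<theta> * real (card D) / (64 * 5 ^ d))"
        using E(3) by (intro mult_strict_left_mono) auto
      also have "\<dots> = amplitude \<theta> * (real (card D) / 16)" by simp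
      finally have "amplitude \<theta> * (real (card (sym_diff A A0)) / 2 ^ e) < amplitude \<theta> * (real (card D) / 16)" by simp
      then have "real (card (sym_diff A A0)) / 2 ^ e < real (card D) / 16"
        using amplitude_pos[of \<theta>] by (simp only: mult_less_cancel_left_pos)
      then have "real (card (sym_diff A A0)) < real (card D) / 16 * 2 ^ e" by (simp add: pos_divide_less_eq)
      then have "16 * real (card (sym_diff A A0)) < real (card D * 2 ^ e)" by simp
      then have "16 * card (sym_diff A A0) < card I" unfolding card_I by linarith
      then show ?thesis by simp
    qed
    then show ?thesis
      using A0 finite_I I_ne by (intro hamming_ball_card[of I "card I div 16" _ A0]) (auto simp: ball_def)
  qed
  define b where "b = Max ((\<lambda>j. card (ball j)) ` {1..2 ^ M})"
  have "b \<in> (\<lambda>j. card (ball j)) ` {1..2 ^ M}" unfolding b_def by (intro Max_in) auto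
  then have b16: "b ^ 16 < 2 ^ (8 * card I)" using small by auto
  have "2 ^ card I = card (Pow I)" using finite_I by (simp add: card_Pow)
  also have "\<dots> \<le> card (\<Union>j\<in>{1..2 ^ M}. ball j)"
    using finite_I by (intro card_mono cover finite_UN_I) (auto simp: ball_def)
  also have "\<dots> \<le> (\<Sum>j\<in>{1..2 ^ M}. card (ball j))" by (rule card_UN_le) simp
  also have "\<dots> \<le> (\<Sum>j\<in>{1..(2::nat) ^ M}. b)" unfolding b_def by (intro sum_mono Max_ge) auto
  also have "\<dots> = 2 ^ M * b" by simp
  finally have "(2 ^ card I) ^ 16 \<le> (2 ^ M * b) ^ 16" by (rule power_mono) simp
  also have "\<dots> = 2 ^ (M * 16) * b ^ 16" by (simp only: power_mult_distrib power_mult)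
  also have "\<dots> < 2 ^ (M * 16) * 2 ^ (8 * card I)" using b16 by (intro mult_strict_left_mono) simp_all
  also have "\<dots> \<le> 2 ^ (8 * card I) * 2 ^ (8 * card I)"
    using M by (intro mult_right_mono power_increasing) auto
  also have "\<dots> = 2 ^ (8 * card I + 8 * card I)" by (rule power_add[symmetric])
  also have "8 * card I + 8 * card I = card I * 16" by simp
  also have "(2::nat) ^ (card I * 16) = (2 ^ card I) ^ 16" by (rule power_mult)
  finally show False by simp
qed

end

subsection \<open>Asymptotic comparison\<close>

lemma kolmogorov_width_le_linear_width:
  assumes "W \<subseteq> Y"
  shows "kolmogorov_width M W Y N \<le> linear_width M W Y N"
  unfolding linear_width_def
proof (intro INF_greatest)
  fix L T assume L: "L \<in> subspaces_upto Y M" and T: "T \<in> {T. cont_linear_into Y N L T}"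
  have "(SUP w\<in>W. INF u\<in>L. N (w - u)) \<le> (SUP w\<in>W. N (w - T w))"
  proof (rule SUP_least)
    fix w assume w: "w \<in> W"
    then have "T w \<in> L" using T assms by (auto simp: cont_linear_into_def)
    then have "(INF u\<in>L. N (w - u)) \<le> N (w - T w)" by (rule INF_lower)
    also have "\<dots> \<le> (SUP w\<in>W. N (w - T w))" by (rule SUP_upper[OF w])
    finally show "(INF u\<in>L. N (w - u)) \<le> (SUP w\<in>W. N (w - T w))" .
  qed
  then show "kolmogorov_width M W Y N \<le> (SUP w\<in>W. N (w - T w))"
    unfolding kolmogorov_width_def by (rule INF_lower2[OF L])
qed

lemma weakly_equivI:
  assumes c: "0 < c" "0 < c'" "0 < C" "0 < C'"
    and a: "\<And>M. 2 \<le> M \<Longrightarrow> ennreal c * \<phi> M \<le> a M" "\<And>M. 2 \<le> M \<Longrightarrow> a M \<le> ennreal C * \<phi> M"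
    and b: "\<And>M. 2 \<le> M \<Longrightarrow> ennreal c' * \<phi> M \<le> b M" "\<And>M. 2 \<le> M \<Longrightarrow> b M \<le> ennreal C' * \<phi> M"
  shows "a \<asymp> b"
proof -
  have "ennreal (c' / C) * a M \<le> b M \<and> b M \<le> ennreal (C' / c) * a M" if M: "2 \<le> M" for M
  proof
    have "ennreal (c' / C) * a M \<le> ennreal (c' / C) * (ennreal C * \<phi> M)" by (intro mult_left_mono a(2)[OF M]) simp
    also have "\<dots> = ennreal c' * \<phi> M" using c by (simp add: mult.assoc[symmetric] ennreal_mult[symmetric])
    finally show "ennreal (c' / C) * a M \<le> b M" using b(1)[OF M] by (rule order_trans)
    have "ennreal C' * \<phi> M = ennreal (C' / c) * (ennreal c * \<phi> M)" using c by (simp add: mult.assoc[symmetric] ennreal_mult[symmetric])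
    also have "\<dots> \<le> ennreal (C' / c) * a M" by (intro mult_left_mono a(1)[OF M]) simp
    finally show "b M \<le> ennreal (C' / c) * a M" by (rule order_trans[OF b(2)[OF M]])
  qed
  then show ?thesis unfolding weakly_equiv_def using c by (intro exI[of _ "c' / C"] exI[of _ "C' / c"] conjI) auto
qed

text \<open>Ensures that \<open>M\<close> divided by the logarithmic power is still at least of the
  order of the square root of \<open>M\<close>, so that its logarithm controls that of
  \<open>M\<close>.\<close>

lemma log_power_le_sqrt:
  obtains c where "1 \<le> c" "\<And>x. 2 \<le> x \<Longrightarrow> log 2 x ^ k \<le> c * x powr (1 / 2)"
proof (cases "k = 0")
  case True
  have "log 2 x ^ k \<le> 1 * x powr (1 / 2)" if "2 \<le> x" for x
    using that True by (simp add: ge_one_powr_ge_zero)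
  then show ?thesis using that[of 1] by blast
next
  case False
  define a where "a = 1 / (2 * real k)"
  have a: "0 < a" using False by (simp add: a_def)
  define c where "c = max 1 ((1 / (a * ln 2)) ^ k)"
  have "log 2 x ^ k \<le> c * x powr (1 / 2)" if x: "2 \<le> x" for x
  proof -
    have "log 2 x = ln x / ln 2" by (simp add: log_def)
    also have "\<dots> \<le> (x powr a / a) / ln 2"
      using x a by (intro divide_right_mono ln_powr_bound) auto
    also have "\<dots> = 1 / (a * ln 2) * x powr a" by simp
    finally have "log 2 x ^ k \<le> (1 / (a * ln 2) * x powr a) ^ k"
      using x by (intro power_mono) auto
    also have "\<dots> = (1 / (a * ln 2)) ^ k * (x powr a) ^ k" by (rule power_mult_distrib)
    also have "(x powr a) ^ k = x powr (1 / 2)"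
    proof -
      have "(x powr a) ^ k = (x powr a) powr real k" using x by (subst powr_realpow) auto
      also have "\<dots> = x powr (a * real k)" by (rule powr_powr)
      also have "a * real k = 1 / 2" using False by (simp add: a_def)
      finally show ?thesis .
    qed
    also have "(1 / (a * ln 2)) ^ k * x powr (1 / 2) \<le> c * x powr (1 / 2)"
      unfolding c_def by (intro mult_right_mono) auto
    finally show ?thesis .
  qed
  then show ?thesis using that[of c] by (auto simp: c_def)
qed

section \<open>Upper rates in M\<close>

context anisotropic
begin

text \<open>Expressed through the quotient of \<open>M\<close> and the logarithmic power, which is
  the scale \<open>2 ^ n\<close> at which a cross has rank of order \<open>M\<close>.\<close>

definition rate :: "real \<Rightarrow> nat \<Rightarrow> real" where
  "rate \<tau> M = (real M / log 2 (real M) ^ (\<nu> - 1)) powr - r 1 * (log 2 (real M) ^ (\<nu> - 1)) powr (1 - \<tau>)"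

lemma log_ge_1: "2 \<le> M \<Longrightarrow> 1 \<le> log 2 (real M)"
  using log_le_cancel_iff[of 2 2 "real M"] by simp

lemma log_power_ge_1: "2 \<le> M \<Longrightarrow> 1 \<le> log 2 (real M) ^ (\<nu> - 1)"
  using log_ge_1 by (intro one_le_power)

lemma rate_eq:
  assumes "2 \<le> M"
  shows "rate \<tau> M = real M powr - r 1 * (log 2 (real M) ^ (\<nu> - 1)) powr (r 1 + 1 - \<tau>)"
proof -
  let ?l = "log 2 (real M) ^ (\<nu> - 1)"
  have l: "0 < ?l" using log_power_ge_1[OF assms] by linarith
  have "rate \<tau> M = real M powr - r 1 / ?l powr - r 1 * ?l powr (1 - \<tau>)"
    using l by (simp add: rate_def powr_divide)
  also have "\<dots> = real M powr - r 1 * (?l powr r 1 * ?l powr (1 - \<tau>))"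
    by (simp add: powr_minus field_simps)
  also have "?l powr r 1 * ?l powr (1 - \<tau>) = ?l powr (r 1 + 1 - \<tau>)"
    by (simp add: powr_add[symmetric] add_diff_eq)
  finally show ?thesis .
qed

text \<open>With \<open>x\<close> the quotient of \<open>M\<close> by \<open>A\<close> times the
  logarithmic power, \<open>n\<close> is the largest natural number with
  \<open>2 ^ n \<le> x\<close>. Then \<open>n\<close> is at most the logarithm of \<open>M\<close>,
  so the rank condition holds, and \<open>x / 2 \<le> 2 ^ n\<close> turns the error at
  \<open>n\<close> into the rate.\<close>

lemma linear_width_le_rate:
  assumes q: "1 \<le> q" "q \<le> p" and \<theta>: "1 \<le> \<theta>"
  obtains C where "0 < C" "\<And>M. 2 \<le> M \<Longrightarrow>
     linear_width M (besov_class d r p \<theta>) (Bq1 d q) (Bq1_norm d q) \<le> ennreal (C * rate (enn2real (1 / \<theta>)) M)"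
proof -
  let ?\<tau> = "enn2real (1 / \<theta>)" let ?W = "besov_class d r p \<theta>"
  have \<tau>: "?\<tau> \<le> 1" using enn2real_inverse_exponent[OF \<theta>] by simp
  obtain C1 where C1: "0 < C1" "\<And>n M. C1 * 2 ^ n * real n ^ (\<nu> - 1) \<le> real M \<Longrightarrow>
     linear_width M ?W (Bq1 d q) (Bq1_norm d q) \<le> ennreal (C1 * 2 powr - (r 1 * real n) * size_factor n powr (1 - ?\<tau>))"
    using linear_width_upper[OF assms] by blast
  obtain C2 where C2: "0 < C2" "\<And>f. f \<in> ?W \<Longrightarrow> Bq1_norm d q f \<le> ennreal C2"
    using besov_class_bounded[OF assms] by blast
  define A where "A = max 1 C1"
  have A: "1 \<le> A" "C1 \<le> A" by (auto simp: A_def)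
  define C where "C = (C1 + C2) * (2 * A) powr r 1"
  have C: "0 < C" using C1 C2 A by (simp add: C_def)
  have "linear_width M ?W (Bq1 d q) (Bq1_norm d q) \<le> ennreal (C * rate ?\<tau> M)" if M: "2 \<le> M" for M
  proof -
    let ?l = "log 2 (real M) ^ (\<nu> - 1)"
    have l: "1 \<le> ?l" by (rule log_power_ge_1[OF M])
    have lp: "1 \<le> ?l powr (1 - ?\<tau>)" using l \<tau> by (intro ge_one_powr_ge_zero) auto
    define x where "x = real M / (A * ?l)"
    have x: "0 < x" using M A l by (simp add: x_def)
    have xr: "(x / 2) powr - r 1 = (2 * A) powr r 1 * (real M / ?l) powr - r 1"
    proof -
      have "x / 2 = (real M / ?l) / (2 * A)" using A l by (simp add: x_def)
      also have "\<dots> powr - r 1 = (real M / ?l) powr - r 1 / (2 * A) powr - r 1"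
        by (rule powr_divide)
      also have "\<dots> = (2 * A) powr r 1 * (real M / ?l) powr - r 1" by (simp add: powr_minus field_simps)
      finally show ?thesis .
    qed
    show ?thesis
    \<comment> \<open>For \<open>x < 1\<close> no such \<open>n\<close> exists. The zero operator is
      used, and the rate is bounded below by a constant.\<close>
    proof (cases "x < 1")
      case True
      have "linear_width M ?W (Bq1 d q) (Bq1_norm d q) \<le> (SUP w\<in>?W. Bq1_norm d q (\<lambda>x. w x - A_sum d {} w x))"
        by (rule linear_width_le_A_sum[OF q(1)]) (simp_all add: rank_bound_def)
      also have "\<dots> \<le> ennreal C2" using C2(2) by (intro SUP_least) (simp add: A_sum_def)
      also have "\<dots> \<le> ennreal (C * rate ?\<tau> M)"
      proof (rule ennreal_leI)
        have "1 powr - r 1 \<le> (x / 2) powr - r 1" using True x r1 by (intro powr_mono2') auto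
        then have "1 * 1 \<le> ((2 * A) powr r 1 * (real M / ?l) powr - r 1) * ?l powr (1 - ?\<tau>)"
          unfolding xr[symmetric] by (intro mult_mono lp) auto
        then have "(C1 + C2) * 1 \<le> (C1 + C2) * (((2 * A) powr r 1 * (real M / ?l) powr - r 1) * ?l powr (1 - ?\<tau>))"
          using C1 C2 by (intro mult_left_mono) auto
        then show "C2 \<le> C * rate ?\<tau> M" using C1 by (simp add: C_def rate_def mult.assoc)
      qed
      finally show ?thesis .
    next
      case False
      define n where "n = nat \<lfloor>log 2 x\<rfloor>"
      have l0: "0 \<le> log 2 x" using False by simp
      then have n: "real n \<le> log 2 x" "log 2 x < real n + 1" unfolding n_def by linarith+
      have two_n: "2 ^ n \<le> x" "x / 2 \<le> 2 ^ n"
      proof -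
        have "2 powr real n \<le> 2 powr log 2 x" "2 powr log 2 x \<le> 2 powr (real n + 1)" using n by (intro powr_mono; simp)+
        moreover have "2 powr log 2 x = x" using x by simp
        moreover have "2 powr real n = 2 ^ n" "2 powr (real n + 1) = 2 * 2 ^ n"
          by (simp_all add: powr_realpow powr_add)
        ultimately show "2 ^ n \<le> x" "x / 2 \<le> 2 ^ n" by simp_all
      qed
      have "x \<le> real M"
      proof -
        have "1 * 1 \<le> A * ?l" using A l by (intro mult_mono) auto
        then show ?thesis unfolding x_def using M by (simp add: divide_le_eq mult_left_le_one_le mult_le_cancel_left1)
      qed
      then have "log 2 x \<le> log 2 (real M)" using x by simp
      then have nl: "real n \<le> log 2 (real M)" "real (max 1 n) \<le> log 2 (real M)"
        using n log_ge_1[OF M] by linarith+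
      have nl': "real n ^ (\<nu> - 1) \<le> ?l" "size_factor n \<le> ?l"
        unfolding size_factor_def using nl by (intro power_mono; simp)+
      have "C1 * 2 ^ n * real n ^ (\<nu> - 1) \<le> A * x * ?l"
        using A C1 two_n x nl' l by (intro mult_mono mult_nonneg_nonneg) auto
      also have "\<dots> = real M"
      proof -
        have "A * (real M / (A * y)) * y = real M" if "0 < y" for y
          using that A by simp
        from this[of ?l] show ?thesis unfolding x_def using l by linarith
      qed
      finally have "linear_width M ?W (Bq1 d q) (Bq1_norm d q) \<le> ennreal (C1 * 2 powr - (r 1 * real n) * size_factor n powr (1 - ?\<tau>))"
        by (rule C1(2))
      also have "\<dots> \<le> ennreal (C * rate ?\<tau> M)"
      proof (rule ennreal_leI)
        have "2 powr - (r 1 * real n) = (2 ^ n) powr - r 1"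
          by (simp add: powr_realpow[symmetric] powr_powr mult.commute)
        also have "\<dots> \<le> (x / 2) powr - r 1" using two_n x r1 by (intro powr_mono2') auto
        finally have "2 powr - (r 1 * real n) \<le> (2 * A) powr r 1 * (real M / ?l) powr - r 1" unfolding xr .
        then have "C1 * 2 powr - (r 1 * real n) * size_factor n powr (1 - ?\<tau>)
           \<le> (C1 + C2) * ((2 * A) powr r 1 * (real M / ?l) powr - r 1) * ?l powr (1 - ?\<tau>)"
          using C1 C2 nl' \<tau> size_factor_ge_1[of n] by (intro mult_mono powr_mono2 mult_nonneg_nonneg) auto
        then show "C1 * 2 powr - (r 1 * real n) * size_factor n powr (1 - ?\<tau>) \<le> C * rate ?\<tau> M"
          by (simp add: C_def rate_def mult.assoc)
      qed
      finally show ?thesis .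
    qed
  qed
  then show ?thesis using that C by blast
qed

lemma zero_in_Bq1: "1 \<le> q \<Longrightarrow> 0 \<in> Bq1 d q"
  using trig_poly_in_Bq1[of q "{}" d undefined] by (simp add: trig_poly_def[abs_def] zero_fun_def)

text \<open>Carl's inequality is applied with a multiple of the rate at ranks \<open>2 ^ j\<close>
  as strict majorant of the widths. The level \<open>m\<close> is the dyadic logarithm of
  \<open>M\<close> lowered by a constant that pays for the overhead in bits.\<close>

lemma entropy_number_le_rate:
  assumes q: "1 \<le> q" "q \<le> p" and \<theta>: "1 \<le> \<theta>"
  obtains C where "0 < C" "\<And>M. 2 \<le> M \<Longrightarrow>
     entropy_number M (besov_class d r p \<theta>) (Bq1 d q) (Bq1_norm d q) \<le> ennreal (C * rate (enn2real (1 / \<theta>)) M)"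
proof -
  let ?\<tau> = "enn2real (1 / \<theta>)" let ?W = "besov_class d r p \<theta>" let ?b = "r 1 + 1 - ?\<tau>"
  interpret N: function_seminorm "{f. integrable (torus d) f}" "Bq1_norm d q"
    by (rule function_seminorm_Bq1[OF q(1)])
  have b: "0 \<le> ?b" using enn2real_inverse_exponent[OF \<theta>] r1 by simp
  obtain C1 where C1: "0 < C1" "\<And>M. 2 \<le> M \<Longrightarrow> linear_width M ?W (Bq1 d q) (Bq1_norm d q) \<le> ennreal (C1 * rate ?\<tau> M)"
    using linear_width_le_rate[OF assms] by blast
  obtain C2 where C2: "0 < C2" "\<And>f. f \<in> ?W \<Longrightarrow> Bq1_norm d q f \<le> ennreal C2"
    using besov_class_bounded[OF assms] by blast
  note WY = besov_class_subset_Bq1[OF assms]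
  \<comment> \<open>\<open>2 * C1\<close> makes the comparison with the widths strict, and
    \<open>C2\<close> covers level 0.\<close>
  define K where "K = 2 * C1 + C2"
  have K: "0 < K" using C1 C2 by (simp add: K_def)
  define \<delta> where "\<delta> j = K * 2 powr - (r 1 * real j) * size_factor j powr ?b" for j
  have \<delta>_pos: "0 < \<delta> j" for j using K size_factor_ge_1[of j] by (simp add: \<delta>_def)
  have rate_pow: "rate ?\<tau> (2 ^ j) = 2 powr - (r 1 * real j) * size_factor j powr ?b" if j: "1 \<le> j" for j
  proof -
    have "2 ^ 1 \<le> (2::nat) ^ j" using j by (intro power_increasing) auto
    then have "rate ?\<tau> (2 ^ j) = real (2 ^ j) powr - r 1 * (log 2 (real (2 ^ j)) ^ (\<nu> - 1)) powr ?b"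
      by (intro rate_eq) simp
    moreover have "log 2 (real (2 ^ j)) = real j" by (simp add: log_nat_power)
    moreover have "real (2 ^ j) powr - r 1 = 2 powr - (r 1 * real j)"
      by (simp add: powr_realpow[symmetric] powr_powr mult.commute)
    moreover have "max 1 j = j" using j by simp
    ultimately show ?thesis by (simp add: size_factor_def)
  qed
  \<comment> \<open>Rounding up gives an integral growth exponent. The size factors are increasing
    in the level and so respect the growth condition.\<close>
  define a where "a = nat \<lceil>r 1\<rceil>"
  have a: "r 1 \<le> real a" unfolding a_def by linarith
  have main: "entropy_number M ?W (Bq1 d q) (Bq1_norm d q) \<le> ennreal (6 * \<delta> m)" if M: "2 ^ (m + 4) * (2 + a) \<le> M" for m M
  proof (rule N.entropy_number_le[where a = a and m = m])
    show "Bq1 d q \<subseteq> {f. integrable (torus d) f}" using Bq1_integrable[OF q(1)] by auto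
    show "Bq1_norm d q f < \<infinity>" if "f \<in> Bq1 d q" for f using that by (simp add: Bq1_def)
    show "0 \<in> Bq1 d q" by (rule zero_in_Bq1[OF q(1)])
    show "?W \<subseteq> Bq1 d q" by (rule WY)
    show "Bq1_norm d q w \<le> ennreal (\<delta> 0)" if "w \<in> ?W" for w
    proof -
      have "C2 \<le> \<delta> 0" using C1 by (simp add: \<delta>_def size_factor_def K_def)
      then show ?thesis using C2(2)[OF that] by (meson ennreal_leI order_trans)
    qed
    show "kolmogorov_width (2 ^ j) ?W (Bq1 d q) (Bq1_norm d q) < ennreal (\<delta> j)" if j: "1 \<le> j" "j \<le> m" for j
    proof -
      have "2 ^ 1 \<le> (2::nat) ^ j" using j by (intro power_increasing) auto
      then have "kolmogorov_width (2 ^ j) ?W (Bq1 d q) (Bq1_norm d q) \<le> ennreal (C1 * rate ?\<tau> (2 ^ j))"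
        using C1(2)[of "2 ^ j"] kolmogorov_width_le_linear_width[OF WY, of "2 ^ j" "Bq1_norm d q"] by simp
      also have "\<dots> < ennreal (\<delta> j)"
      proof (rule ennreal_lessI[OF \<delta>_pos])
        have "0 < 2 powr - (r 1 * real j) * size_factor j powr ?b" using \<delta>_pos[of j] K by (simp add: \<delta>_def zero_less_mult_iff)
        then have "C1 * (2 powr - (r 1 * real j) * size_factor j powr ?b) < K * (2 powr - (r 1 * real j) * size_factor j powr ?b)"
          using C1 C2 by (intro mult_strict_right_mono) (auto simp: K_def)
        then show "C1 * rate ?\<tau> (2 ^ j) < \<delta> j" unfolding rate_pow[OF j(1)] by (simp add: \<delta>_def mult.assoc)
      qed
      finally show ?thesis .
    qed
    show "0 < \<delta> m" by (rule \<delta>_pos)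
    show "\<delta> j \<le> 2 ^ (a * (m - j)) * \<delta> m" if j: "j \<le> m" for j
    proof -
      have "size_factor j \<le> size_factor m" unfolding size_factor_def using j by (intro power_mono) auto
      then have s: "size_factor j powr ?b \<le> size_factor m powr ?b" using b size_factor_ge_1[of j] by (intro powr_mono2) auto
      have "r 1 * real (m - j) \<le> real a * real (m - j)" using a by (intro mult_right_mono) auto
      then have "- (r 1 * real j) \<le> real (a * (m - j)) + - (r 1 * real m)"
        using j by (simp add: of_nat_diff right_diff_distrib)
      then have "2 powr - (r 1 * real j) \<le> 2 powr (real (a * (m - j)) + - (r 1 * real m))" by (rule powr_mono) simp
      also have "\<dots> = 2 ^ (a * (m - j)) * 2 powr - (r 1 * real m)"
        by (subst powr_add, subst powr_realpow) simp_all
      finally have "K * 2 powr - (r 1 * real j) * size_factor j powr ?b \<le> K * (2 ^ (a * (m - j)) * 2 powr - (r 1 * real m)) * size_factor m powr ?b"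
        using K s by (intro mult_mono mult_nonneg_nonneg) auto
      then show ?thesis by (simp add: \<delta>_def mult_ac)
    qed
    show "2 ^ (m + 4) * (2 + a) \<le> M" by (rule M)
  qed
  \<comment> \<open>By \<open>2 + a \<le> 2 ^ (2 + a)\<close> the overhead
    \<open>2 ^ (m + 4) * (2 + a)\<close> is at most \<open>2 ^ (m + c)\<close>.\<close>
  define c where "c = 4 + (2 + a)"
  define C where "C = 6 * K * 2 powr (r 1 * (real c + 1)) + C2 * 2 powr (r 1 * (real c + 1))"
  have C: "0 < C" using K C2 by (simp add: C_def add_pos_pos)
  have "entropy_number M ?W (Bq1 d q) (Bq1_norm d q) \<le> ennreal (C * rate ?\<tau> M)" if M: "2 \<le> M" for M
  proof -
    let ?l = "log 2 (real M) ^ (\<nu> - 1)"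
    have l: "1 \<le> ?l" by (rule log_power_ge_1[OF M])
    have lb: "1 \<le> ?l powr ?b" using l b by (intro ge_one_powr_ge_zero) auto
    define L where "L = nat \<lfloor>log 2 (real M)\<rfloor>"
    have L: "real L \<le> log 2 (real M)" "log 2 (real M) < real L + 1" using log_ge_1[OF M] unfolding L_def by linarith+
    have pwL: "2 ^ L \<le> real M" "real M \<le> 2 powr (real L + 1)"
    proof -
      have "2 powr real L \<le> 2 powr log 2 (real M)" "2 powr log 2 (real M) \<le> 2 powr (real L + 1)" using L by (intro powr_mono; simp)+
      moreover have "2 powr log 2 (real M) = real M" using M by simp
      ultimately show "2 ^ L \<le> real M" "real M \<le> 2 powr (real L + 1)" by (simp_all add: powr_realpow)
    qed
    have Mr: "2 powr - (r 1 * (real L + 1)) \<le> real M powr - r 1"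
    proof -
      have "(2 powr (real L + 1)) powr - r 1 \<le> real M powr - r 1" using pwL(2) M r1 by (intro powr_mono2') auto
      then show ?thesis by (simp add: powr_powr mult.commute)
    qed
    show ?thesis
    proof (cases "c \<le> L")
      case True
      define m where "m = L - c"
      have "real (2 ^ L) \<le> real M" using pwL(1) by simp
      then have "2 ^ L \<le> M" by (rule of_nat_le_iff[THEN iffD1])
      moreover have Lm: "L = (m + 4) + (2 + a)" using True by (simp add: m_def c_def)
      have "(2::nat) ^ L = 2 ^ (m + 4) * 2 ^ (2 + a)" unfolding Lm by (rule power_add)
      moreover have "2 ^ (m + 4) * (2 + a) \<le> 2 ^ (m + 4) * 2 ^ (2 + a)"
        by (intro mult_left_mono less_imp_le[OF less_exp]) simp
      ultimately have "2 ^ (m + 4) * (2 + a) \<le> M" by linarith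
      then have "entropy_number M ?W (Bq1 d q) (Bq1_norm d q) \<le> ennreal (6 * \<delta> m)" by (rule main)
      also have "\<dots> \<le> ennreal (C * rate ?\<tau> M)"
      proof (rule ennreal_leI)
        have "real (max 1 m) \<le> log 2 (real M)" using L log_ge_1[OF M] by (simp add: m_def)
        then have "size_factor m \<le> ?l" unfolding size_factor_def by (intro power_mono) auto
        then have s: "size_factor m powr ?b \<le> ?l powr ?b" using b size_factor_ge_1[of m] by (intro powr_mono2) auto
        have "- (r 1 * real m) = r 1 * (real c + 1) + - (r 1 * (real L + 1))"
          using True by (simp add: m_def of_nat_diff algebra_simps)
        then have "2 powr - (r 1 * real m) = 2 powr (r 1 * (real c + 1)) * 2 powr - (r 1 * (real L + 1))"
          by (simp only: powr_add)
        also have "\<dots> \<le> 2 powr (r 1 * (real c + 1)) * real M powr - r 1" by (intro mult_left_mono Mr) simp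
        finally have "6 * (K * 2 powr - (r 1 * real m) * size_factor m powr ?b) \<le> 6 * (K * (2 powr (r 1 * (real c + 1)) * real M powr - r 1) * ?l powr ?b)"
          using K s by (intro mult_mono mult_nonneg_nonneg) auto
        also have "\<dots> = 6 * K * 2 powr (r 1 * (real c + 1)) * rate ?\<tau> M" by (simp add: rate_eq[OF M] mult_ac)
        also have "\<dots> \<le> C * rate ?\<tau> M" using C2 by (intro mult_right_mono) (simp_all add: C_def rate_def)
        finally show "6 * \<delta> m \<le> C * rate ?\<tau> M" by (simp add: \<delta>_def)
      qed
      finally show ?thesis .
    next
      case False
      \<comment> \<open>For the remaining bounded range of \<open>M\<close> one ball around 0 is
        enough, since the rate is bounded below there.\<close>
      have "entropy_number M ?W (Bq1 d q) (Bq1_norm d q) \<le> ennreal C2"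
        unfolding entropy_number_def
      proof (rule Inf_lower, rule CollectI, rule exI[of _ "\<lambda>_. 0"], rule conjI)
        show "\<forall>j\<in>{1..2 ^ M}. 0 \<in> Bq1 d q" using zero_in_Bq1[OF q(1)] by blast
        show "?W \<subseteq> (\<Union>j\<in>{1..2 ^ M :: nat}. {f \<in> Bq1 d q. Bq1_norm d q (f - 0) \<le> ennreal C2})"
        proof
          fix f assume f: "f \<in> ?W"
          have "f \<in> {f \<in> Bq1 d q. Bq1_norm d q (f - 0) \<le> ennreal C2}"
            unfolding diff_zero using subsetD[OF WY f] C2(2)[OF f] by (intro CollectI conjI)
          then show "f \<in> (\<Union>j\<in>{1..2 ^ M :: nat}. {f \<in> Bq1 d q. Bq1_norm d q (f - 0) \<le> ennreal C2})"
            by (rule UN_I[of 1, rotated]) simp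
        qed
      qed
      also have "\<dots> \<le> ennreal (C * rate ?\<tau> M)"
      proof (rule ennreal_leI)
        have "r 1 * (real L + 1) \<le> r 1 * (real c + 1)" using False r1 by (intro mult_left_mono) auto
        then have "(2::real) powr 0 \<le> 2 powr (r 1 * (real c + 1) + - (r 1 * (real L + 1)))" by (intro powr_mono) auto
        also have "\<dots> = 2 powr (r 1 * (real c + 1)) * 2 powr - (r 1 * (real L + 1))" by (rule powr_add)
        also have "\<dots> \<le> 2 powr (r 1 * (real c + 1)) * real M powr - r 1" by (intro mult_left_mono Mr) simp
        finally have "C2 * (1 * 1) \<le> C2 * ((2 powr (r 1 * (real c + 1)) * real M powr - r 1) * ?l powr ?b)"
          using C2 lb by (intro mult_left_mono mult_mono) auto
        also have "\<dots> = C2 * 2 powr (r 1 * (real c + 1)) * rate ?\<tau> M" by (simp add: rate_eq[OF M] mult_ac)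
        also have "\<dots> \<le> C * rate ?\<tau> M" using K by (intro mult_right_mono) (simp_all add: C_def rate_def)
        finally show "C2 \<le> C * rate ?\<tau> M" by simp
      qed
      finally show ?thesis .
    qed
  qed
  then show ?thesis using that C by blast
qed

end

section \<open>Families of even blocks and lower rates in M\<close>

context anisotropic
begin

lemma r_nonneg: "j \<in> {1..d} \<Longrightarrow> 0 \<le> r j"
proof (cases "j \<le> \<nu>")
  case True
  assume "j \<in> {1..d}"
  then show ?thesis using True r_eq[of j] r1 by simp
next
  case False
  assume "j \<in> {1..d}"
  then have "r 1 * (1 + 2 * \<kappa>) \<le> r j" using False by (intro r_ge) simp
  moreover have "0 \<le> r 1 * (1 + 2 * \<kappa>)" using r1 kappa by simp
  ultimately show ?thesis by linarith
qed

text \<open>The numbers \<open>b j\<close> for \<open>j < \<nu>\<close> are free, and the entry at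
  \<nu> balances them, so that the first \<nu> entries sum to \<open>2 * t + 2 * \<nu>\<close>. With
  \<open>b j\<close> at most \<open>t div \<nu>\<close> and \<open>\<nu> \<le> t\<close> the
  balancing entry is at least 4; beyond \<nu> the smallest admissible entry is taken.\<close>

definition split_index :: "nat \<Rightarrow> (nat \<Rightarrow> nat) \<Rightarrow> nat \<Rightarrow> nat" where
  "split_index t b = (\<lambda>j\<in>{1..d}. if j < \<nu> then 2 * b j + 2 else if j = \<nu> then 2 * (t - (\<Sum>i\<in>{1..<\<nu>}. b i)) + 2 else 4)"

definition even_family :: "nat \<Rightarrow> (nat \<Rightarrow> nat) set" where
  "even_family t = split_index t ` (\<Pi>\<^sub>E i\<in>{1..<\<nu>}. {1..t div \<nu>})"

text \<open>For \<open>\<nu> \<le> t\<close> this is the weight shared by all members of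
  \<open>even_family t\<close>, because \<open>r\<close> is constant on the first \<nu>
  directions.\<close>

definition top_weight :: "nat \<Rightarrow> real" where
  "top_weight t = 2 * r 1 * real t + (2 * r 1 * real \<nu> + (\<Sum>j\<in>{\<nu>+1..d}. 4 * r j))"

lemma split_sum_le:
  assumes b: "b \<in> (\<Pi>\<^sub>E i\<in>{1..<\<nu>}. {1..t div \<nu>})"
  shows "(\<Sum>i\<in>{1..<\<nu>}. b i) + t div \<nu> \<le> t"
proof -
  have "(\<Sum>i\<in>{1..<\<nu>}. b i) \<le> (\<Sum>i\<in>{1..<\<nu>}. t div \<nu>)"
    using b by (intro sum_mono) (auto simp: PiE_iff)
  then have "(\<Sum>i\<in>{1..<\<nu>}. b i) + t div \<nu> \<le> (\<nu> - 1) * (t div \<nu>) + t div \<nu>" by simp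
  also have "\<dots> = \<nu> * (t div \<nu>)" using nu by (cases \<nu>) auto
  also have "\<dots> \<le> t" by (rule times_div_less_eq_dividend)
  finally show ?thesis .
qed

lemma sum_split:
  fixes f :: "nat \<Rightarrow> real"
  shows "(\<Sum>j=1..d. f j) = (\<Sum>j\<in>{1..<\<nu>}. f j) + f \<nu> + (\<Sum>j\<in>{\<nu>+1..d}. f j)"
proof -
  have "{1..d} = {1..<\<nu>} \<union> ({\<nu>} \<union> {\<nu>+1..d})" using nu by auto
  then have "(\<Sum>j=1..d. f j) = (\<Sum>j\<in>{1..<\<nu>}. f j) + (\<Sum>j\<in>{\<nu>} \<union> {\<nu>+1..d}. f j)"
    by (simp only:) (rule sum.union_disjoint, auto)
  also have "(\<Sum>j\<in>{\<nu>} \<union> {\<nu>+1..d}. f j) = f \<nu> + (\<Sum>j\<in>{\<nu>+1..d}. f j)"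
    by (subst sum.union_disjoint) auto
  finally show ?thesis by simp
qed

lemma lower_blocks_even_family:
  assumes t: "\<nu> \<le> t"
  shows "lower_blocks d r (even_family t) (2 * t + d - 2 * \<nu>) (top_weight t)"
    and "card (even_family t) = (t div \<nu>) ^ (\<nu> - 1)"
proof -
  let ?B = "\<Pi>\<^sub>E i\<in>{1..<\<nu>}. {1..t div \<nu>}"
  have td: "1 \<le> t div \<nu>" using t nu by (simp add: div_greater_zero_iff Suc_le_eq)
  have finB: "finite ?B" by (intro finite_PiE) auto
  have val: "split_index t b j = (if j < \<nu> then 2 * b j + 2 else if j = \<nu> then 2 * (t - (\<Sum>i\<in>{1..<\<nu>}. b i)) + 2 else 4)"
    if "j \<in> {1..d}" for b j using that by (simp add: split_index_def)
  have inj: "inj_on (split_index t) ?B"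
  proof (rule inj_onI)
    fix b b' assume b: "b \<in> ?B" "b' \<in> ?B" and eq: "split_index t b = split_index t b'"
    have "b j = b' j" if j: "j \<in> {1..<\<nu>}" for j
    proof -
      have "j \<in> {1..d}" "j < \<nu>" using j nu by auto
      then show ?thesis using fun_cong[OF eq, of j] val[of j b] val[of j b'] by simp
    qed
    then show "b = b'" using b by (intro PiE_ext[of b "{1..<\<nu>}" "\<lambda>_. {1..t div \<nu>}" b']) auto
  qed
  show "card (even_family t) = (t div \<nu>) ^ (\<nu> - 1)"
    unfolding even_family_def card_image[OF inj] by (subst card_PiE) auto
  have ge: "4 \<le> split_index t b j" "even (split_index t b j)" if b: "b \<in> ?B" and j: "j \<in> {1..d}" for b j
  proof -
    define u where "u = t - (\<Sum>i\<in>{1..<\<nu>}. b i)"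
    have "t div \<nu> + (\<Sum>i\<in>{1..<\<nu>}. b i) \<le> t" using split_sum_le[OF b] by (simp only: add.commute)
    then have "t div \<nu> \<le> u" unfolding u_def by (rule add_le_imp_le_diff)
    then have u: "1 \<le> u" by (rule order_trans[OF td])
    have bj: "1 \<le> b j" if "j < \<nu>" using PiE_mem[OF b, of j] j that by simp
    have v: "split_index t b j = (if j < \<nu> then 2 * b j + 2 else if j = \<nu> then 2 * u + 2 else 4)"
      unfolding u_def by (rule val[OF j])
    show "4 \<le> split_index t b j" unfolding v using u bj by (cases "j < \<nu>"; cases "j = \<nu>"; simp)
    show "even (split_index t b j)" unfolding v by simp
  qed
  have wsum: "weight d c (split_index t b) = (\<Sum>j\<in>{1..<\<nu>}. (2 * real (b j) + 2) * c j)
      + (2 * (real t - (\<Sum>i\<in>{1..<\<nu>}. real (b i))) + 2) * c \<nu> + (\<Sum>j\<in>{\<nu>+1..d}. 4 * c j)" if b: "b \<in> ?B" for b c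
  proof -
    have "(\<Sum>j\<in>{1..<\<nu>}. real (split_index t b j) * c j) = (\<Sum>j\<in>{1..<\<nu>}. (2 * real (b j) + 2) * c j)"
    proof (intro sum.cong refl)
      fix j assume "j \<in> {1..<\<nu>}"
      then have "j \<in> {1..d}" "j < \<nu>" using nu by auto
      then show "real (split_index t b j) * c j = (2 * real (b j) + 2) * c j" by (subst val) simp_all
    qed
    moreover have "real (split_index t b \<nu>) = 2 * (real t - (\<Sum>i\<in>{1..<\<nu>}. real (b i))) + 2"
    proof -
      have le: "(\<Sum>i\<in>{1..<\<nu>}. b i) \<le> t" using split_sum_le[OF b] by (rule add_leD1)
      have "split_index t b \<nu> = 2 * (t - (\<Sum>i\<in>{1..<\<nu>}. b i)) + 2" by (subst val) (use nu in auto)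
      then have "real (split_index t b \<nu>) = 2 * real (t - (\<Sum>i\<in>{1..<\<nu>}. b i)) + 2" by simp
      then show ?thesis unfolding of_nat_diff[OF le] of_nat_sum .
    qed
    moreover have "(\<Sum>j\<in>{\<nu>+1..d}. real (split_index t b j) * c j) = (\<Sum>j\<in>{\<nu>+1..d}. 4 * c j)"
    proof (intro sum.cong refl)
      fix j assume "j \<in> {\<nu>+1..d}"
      then have "j \<in> {1..d}" "\<not> j < \<nu>" "j \<noteq> \<nu>" by auto
      then show "real (split_index t b j) * c j = 4 * c j" by (subst val) simp_all
    qed
    ultimately show ?thesis unfolding sum_split by (simp only:)
  qed
  have affine: "(\<Sum>j\<in>{1..<\<nu>}. (2 * real (b j) + 2) * c) = 2 * c * (\<Sum>j\<in>{1..<\<nu>}. real (b j)) + 2 * c * (real \<nu> - 1)" for b :: "nat \<Rightarrow> nat" and c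
  proof -
    have "(\<Sum>j\<in>{1..<\<nu>}. (2 * real (b j) + 2) * c) = (\<Sum>j\<in>{1..<\<nu>}. 2 * c * real (b j)) + (\<Sum>j\<in>{1..<\<nu>}. 2 * c)"
      unfolding sum.distrib[symmetric] by (intro sum.cong refl) (simp add: algebra_simps)
    also have "(\<Sum>j\<in>{1..<\<nu>}. 2 * c * real (b j)) = 2 * c * (\<Sum>j\<in>{1..<\<nu>}. real (b j))" by (rule sum_distrib_left[symmetric])
    also have "(\<Sum>j\<in>{1..<\<nu>}. 2 * c) = 2 * c * (real \<nu> - 1)" using nu by (simp add: of_nat_diff)
    finally show ?thesis .
  qed
  show "lower_blocks d r (even_family t) (2 * t + d - 2 * \<nu>) (top_weight t)"
  proof
    show "finite (even_family t)" using finB by (simp add: even_family_def)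
    show "even_family t \<noteq> {}"
    proof -
      have "(\<lambda>i\<in>{1..<\<nu>}. 1) \<in> ?B" using td by auto
      then show ?thesis unfolding even_family_def by blast
    qed
    show "even_family t \<subseteq> indices d"
    proof
      fix s assume "s \<in> even_family t"
      then obtain b where b: "b \<in> ?B" "s = split_index t b" by (auto simp: even_family_def)
      have "1 \<le> s j" if "j \<in> {1..d}" for j using ge(1)[OF b(1) that] b(2) by simp
      then show "s \<in> indices d" unfolding indices_def b(2) by (auto simp: split_index_def)
    qed
    show "0 \<le> r j" if "j \<in> {1..d}" for j using that by (rule r_nonneg)
    fix s j assume s: "s \<in> even_family t"
    then obtain b where b: "b \<in> ?B" "s = split_index t b" by (auto simp: even_family_def)
    show "4 \<le> s j" "even (s j)" if "j \<in> {1..d}" unfolding b(2) by (rule ge[OF b(1) that])+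
    have "real (\<Sum>j\<in>{1..d}. s j - 3) = (\<Sum>j=1..d. real (s j) * 1) - (\<Sum>j=1..d. 3)"
    proof -
      have "real (s j - 3) = real (s j) * 1 - 3" if "j \<in> {1..d}" for j
      proof -
        have "3 \<le> s j" unfolding b(2) using ge(1)[OF b(1) that] by linarith
        then show ?thesis by (simp only: of_nat_diff mult_1_right of_nat_numeral)
      qed
      then show ?thesis unfolding of_nat_sum sum_subtractf[symmetric] by (intro sum.cong refl)
    qed
    also have "(\<Sum>j=1..d. real (s j) * 1) = 2 * (real t + real \<nu>) + 4 * (real d - real \<nu>)"
    proof -
      have "(\<Sum>j\<in>{\<nu>+1..d}. 4 * 1) = 4 * (real d - real \<nu>)" using nu by (simp add: of_nat_diff)
      then show ?thesis unfolding b(2) wsum[OF b(1), of "\<lambda>_. 1"] affine by (simp add: algebra_simps)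
    qed
    also have "2 * (real t + real \<nu>) + 4 * (real d - real \<nu>) - (\<Sum>j=1..d. 3) = real (2 * t + d - 2 * \<nu>)"
      using t by (simp add: of_nat_diff)
    finally show "(\<Sum>j\<in>{1..d}. s j - 3) = 2 * t + d - 2 * \<nu>" by (simp only: of_nat_eq_iff)
    show "weight d r s \<le> top_weight t"
    proof -
      have low: "(\<Sum>j\<in>{1..<\<nu>}. (2 * real (b j) + 2) * r j) = (\<Sum>j\<in>{1..<\<nu>}. (2 * real (b j) + 2) * r 1)"
      proof (intro sum.cong refl)
        fix j assume "j \<in> {1..<\<nu>}"
        then have "r j = r 1" by (intro r_eq) simp
        then show "(2 * real (b j) + 2) * r j = (2 * real (b j) + 2) * r 1" by (simp only:)
      qed
      have r\<nu>: "r \<nu> = r 1" using nu by (intro r_eq) simp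
      have collect: "2 * c * S + 2 * c * (n - 1) + (2 * (x - S) + 2) * c + R = 2 * c * x + (2 * c * n + R)"
        for c S n x R :: real by (simp add: algebra_simps)
      have "weight d r s = top_weight t"
        unfolding b(2) wsum[OF b(1)] low r\<nu> affine top_weight_def by (rule collect)
      then show ?thesis by simp
    qed
  qed
qed

lemma widths_ge_even_family:
  assumes q: "1 \<le> q" and p: "1 \<le> p" and \<theta>: "1 \<le> \<theta>"
  obtains c where "0 < c" "\<And>t M. \<nu> \<le> t \<Longrightarrow> 2 * real M \<le> real ((t div \<nu>) ^ (\<nu> - 1)) * 2 ^ (2 * t) / 2 ^ d \<Longrightarrow>
     ennreal (c * 2 powr - (2 * r 1 * real t) * real ((t div \<nu>) ^ (\<nu> - 1)) powr (1 - enn2real (1 / \<theta>)))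
       \<le> kolmogorov_width M (besov_class d r p \<theta>) (Bq1 d q) (Bq1_norm d q) \<and>
     ennreal (c * 2 powr - (2 * r 1 * real t) * real ((t div \<nu>) ^ (\<nu> - 1)) powr (1 - enn2real (1 / \<theta>)))
       \<le> entropy_number M (besov_class d r p \<theta>) (Bq1 d q) (Bq1_norm d q)"
proof -
  let ?\<tau> = "enn2real (1 / \<theta>)" let ?W = "besov_class d r p \<theta>"
  define w0 where "w0 = 2 * r 1 * real \<nu> + (\<Sum>j\<in>{\<nu>+1..d}. 4 * r j)"
  \<comment> \<open>Collects the factors independent of \<open>t\<close>; 64 is the larger of the
    two denominators in the lower bounds.\<close>
  define c where "c = 2 powr - w0 / (A_const d * 2 ^ d) / (64 * 5 ^ d)"
  have c: "0 < c" using A_const_ge_1[of d] by (simp add: c_def)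
  have "ennreal (c * 2 powr - (2 * r 1 * real t) * real ((t div \<nu>) ^ (\<nu> - 1)) powr (1 - ?\<tau>)) \<le> kolmogorov_width M ?W (Bq1 d q) (Bq1_norm d q) \<and>
     ennreal (c * 2 powr - (2 * r 1 * real t) * real ((t div \<nu>) ^ (\<nu> - 1)) powr (1 - ?\<tau>)) \<le> entropy_number M ?W (Bq1 d q) (Bq1_norm d q)"
    if t: "\<nu> \<le> t" and M: "2 * real M \<le> real ((t div \<nu>) ^ (\<nu> - 1)) * 2 ^ (2 * t) / 2 ^ d" for t M
  proof -
    interpret lower_blocks d r "even_family t" "2 * t + d - 2 * \<nu>" "top_weight t"
      by (rule lower_blocks_even_family(1)[OF t])
    define N where "N = real (card (even_family t))"
    have N: "N = real ((t div \<nu>) ^ (\<nu> - 1))" unfolding N_def lower_blocks_even_family(2)[OF t] ..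
    have Npos: "0 < N" using card_D_pos by (simp add: N_def)
    have "2 * M \<le> card I"
    proof -
      have "2 * real M \<le> N * (2 ^ (2 * t) / 2 ^ d)" using M by (simp add: N)
      also have "(2::real) ^ (2 * t) / 2 ^ d \<le> 2 ^ (2 * t + d - 2 * \<nu>)"
      proof -
        have "(2::real) ^ (2 * t) \<le> 2 ^ (2 * t + d - 2 * \<nu> + d)" using nu t by (intro power_increasing) auto
        then show ?thesis by (simp add: power_add divide_le_eq)
      qed
      finally have "real (2 * M) \<le> real (card I)" using Npos by (simp add: card_I N_def mult_left_mono)
      then show ?thesis by (simp only: of_nat_le_iff)
    qed
    note low = kolmogorov_width_ge[OF q p \<theta> this] entropy_number_ge[OF q p \<theta> this]
    have eq: "c * 2 powr - (2 * r 1 * real t) * N powr (1 - ?\<tau>) = amplitude \<theta> * N / (64 * 5 ^ d)"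
    proof -
      have "2 powr - top_weight t = 2 powr - w0 * 2 powr - (2 * r 1 * real t)"
        by (simp add: top_weight_def w0_def powr_add[symmetric])
      moreover have "N powr (1 - ?\<tau>) = N / N powr ?\<tau>" using Npos by (simp add: powr_diff)
      ultimately show ?thesis by (simp add: c_def amplitude_def N_def)
    qed
    have "amplitude \<theta> * N / (64 * 5 ^ d) \<le> amplitude \<theta> * N / (4 * 5 ^ d)"
      using amplitude_pos[of \<theta>] Npos by (intro divide_left_mono) auto
    then have le: "ennreal (amplitude \<theta> * N / (64 * 5 ^ d)) \<le> ennreal (amplitude \<theta> * N / (4 * 5 ^ d))" by (rule ennreal_leI)
    show ?thesis unfolding N[symmetric] eq
      using order_trans[OF le low(1)[folded N_def]] low(2)[folded N_def] by (rule conjI)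
  qed
  then show ?thesis using that[OF c] by blast
qed

text \<open>\<open>t\<close> is chosen with \<open>2 ^ (2 * t)\<close> of the order of
  \<open>M\<close> divided by the logarithmic power. The family then has enough members to dominate
  a multiple of that power and offers at least \<open>2 * M\<close> coordinates, while
  \<open>2 powr - (2 * r 1 * t)\<close> has the order of the first factor of the rate.\<close>

lemma widths_ge_rate:
  assumes q: "1 \<le> q" and p: "1 \<le> p" and \<theta>: "1 \<le> \<theta>"
  obtains c where "0 < c" "\<And>M. 2 \<le> M \<Longrightarrow>
     ennreal (c * rate (enn2real (1 / \<theta>)) M) \<le> kolmogorov_width M (besov_class d r p \<theta>) (Bq1 d q) (Bq1_norm d q) \<and>
     ennreal (c * rate (enn2real (1 / \<theta>)) M) \<le> entropy_number M (besov_class d r p \<theta>) (Bq1 d q) (Bq1_norm d q)"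
proof -
  let ?\<tau> = "enn2real (1 / \<theta>)" let ?W = "besov_class d r p \<theta>"
  have \<tau>: "0 \<le> ?\<tau>" "?\<tau> \<le> 1" using enn2real_inverse_exponent[OF \<theta>] by auto
  obtain c0 where c0: "0 < c0" "\<And>t M. \<nu> \<le> t \<Longrightarrow> 2 * real M \<le> real ((t div \<nu>) ^ (\<nu> - 1)) * 2 ^ (2 * t) / 2 ^ d \<Longrightarrow>
     ennreal (c0 * 2 powr - (2 * r 1 * real t) * real ((t div \<nu>) ^ (\<nu> - 1)) powr (1 - ?\<tau>)) \<le> kolmogorov_width M ?W (Bq1 d q) (Bq1_norm d q) \<and>
     ennreal (c0 * 2 powr - (2 * r 1 * real t) * real ((t div \<nu>) ^ (\<nu> - 1)) powr (1 - ?\<tau>)) \<le> entropy_number M ?W (Bq1 d q) (Bq1_norm d q)"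
    using widths_ge_even_family[OF assms] by blast
  obtain c1 where c1: "1 \<le> c1" "\<And>x. 2 \<le> x \<Longrightarrow> log 2 x ^ (\<nu> - 1) \<le> c1 * x powr (1 / 2)"
    using log_power_le_sqrt[of "\<nu> - 1"] by blast
  \<comment> \<open>Compares the logarithmic power with the number of blocks: the logarithm of
    \<open>M\<close> is at most \<open>4 * t\<close>, and
    \<open>t \<le> 2 * \<nu> * (t div \<nu>)\<close>.\<close>
  define B where "B = (8 * real \<nu>) ^ (\<nu> - 1)"
  have B: "1 \<le> B" unfolding B_def using nu by (intro one_le_power) simp
  \<comment> \<open>The first summand forces \<open>\<nu> \<le> t\<close>, the second provides
    \<open>2 * M\<close> coordinates.\<close>
  define A where "A = c1 * 4 ^ \<nu> + 2 * 2 ^ d * B"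
  have A: "c1 * 4 ^ \<nu> \<le> A" "2 * 2 ^ d * B \<le> A" "c1 \<le> A" "0 < A"
  proof -
    show 1: "c1 * 4 ^ \<nu> \<le> A" "2 * 2 ^ d * B \<le> A" using B c1 by (auto simp: A_def)
    have "c1 * 1 \<le> c1 * 4 ^ \<nu>" using c1 by (intro mult_left_mono) auto
    then show "c1 \<le> A" "0 < A" using 1 c1 by linarith+
  qed
  define c where "c = c0 * (4 * A) powr - r 1 / B"
  have c: "0 < c" using c0 A B by (simp add: c_def)
  have "ennreal (c * rate ?\<tau> M) \<le> kolmogorov_width M ?W (Bq1 d q) (Bq1_norm d q) \<and>
     ennreal (c * rate ?\<tau> M) \<le> entropy_number M ?W (Bq1 d q) (Bq1_norm d q)" if M: "2 \<le> M" for M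
  proof -
    let ?l = "log 2 (real M) ^ (\<nu> - 1)"
    have l: "1 \<le> ?l" by (rule log_power_ge_1[OF M])
    define x where "x = A * real M / ?l"
    have x_ge: "A / c1 * real M powr (1 / 2) \<le> x"
    proof -
      have "A / c1 * real M powr (1 / 2) * ?l \<le> A / c1 * real M powr (1 / 2) * (c1 * real M powr (1 / 2))"
        using c1 A M by (intro mult_left_mono c1(2)) auto
      also have "\<dots> = A * (real M powr (1 / 2) * real M powr (1 / 2))" using c1 by simp
      also have "\<dots> = A * real M" using M by (simp add: powr_add[symmetric])
      finally show ?thesis unfolding x_def using l by (simp add: pos_le_divide_eq)
    qed
    have sq1: "1 \<le> real M powr (1 / 2)" using M by (intro ge_one_powr_ge_zero) auto
    have "4 ^ \<nu> * 1 \<le> A / c1 * real M powr (1 / 2)"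
      using A c1 sq1 by (intro mult_mono) (auto simp: le_divide_eq mult.commute)
    then have x4: "4 ^ \<nu> \<le> x" using x_ge by simp
    have x0: "0 < x" using x4 zero_less_power[of "4::real" \<nu>] by linarith
    have xs: "real M powr (1 / 2) \<le> x"
    proof -
      have "1 * real M powr (1 / 2) \<le> A / c1 * real M powr (1 / 2)" using A c1 by (intro mult_right_mono) (auto simp: le_divide_eq)
      then show ?thesis using x_ge by simp
    qed
    define t where "t = nat \<lceil>log 2 x / 2\<rceil>"
    have lx: "2 * real \<nu> \<le> log 2 x"
    proof -
      have "log 2 (4 ^ \<nu>) \<le> log 2 x" using x4 x0 by simp
      moreover have "log 2 (4 ^ \<nu>) = real \<nu> * log 2 4" by (rule log_nat_power) simp
      moreover have "log 2 4 = (2::real)" using log_powr_cancel[of 2 2] by simp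
      ultimately show ?thesis by simp
    qed
    have tx: "log 2 x / 2 \<le> real t" "real t \<le> log 2 x / 2 + 1" using lx unfolding t_def by linarith+
    have t\<nu>: "\<nu> \<le> t" using tx lx by linarith
    have lt: "log 2 (real M) \<le> 4 * real t"
    proof -
      have "log 2 (real M powr (1 / 2)) \<le> log 2 x" using xs x0 M by simp
      then have "log 2 (real M) / 2 \<le> log 2 x" using M by (simp add: log_powr)
      then show ?thesis using tx by linarith
    qed
    have two_t: "x \<le> 2 ^ (2 * t)" "2 ^ (2 * t) \<le> 4 * x"
    proof -
      have "2 powr log 2 x \<le> 2 powr real (2 * t)" "2 powr real (2 * t) \<le> 2 powr (log 2 x + 2)"
        using tx by (intro powr_mono; simp)+
      moreover have "2 powr log 2 x = x" using x0 by simp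
      moreover have "2 powr real (2 * t) = 2 ^ (2 * t)" by (rule powr_realpow) simp
      moreover have "2 powr (log 2 x + 2) = 4 * x" using x0 by (simp add: powr_add)
      ultimately show "x \<le> 2 ^ (2 * t)" "2 ^ (2 * t) \<le> 4 * x" by simp_all
    qed
    have div_ge: "log 2 (real M) \<le> 8 * real \<nu> * real (t div \<nu>)"
    proof -
      have "1 \<le> t div \<nu>" using t\<nu> nu by (simp add: div_greater_zero_iff Suc_le_eq)
      then have "\<nu> * 1 \<le> \<nu> * (t div \<nu>)" by (intro mult_left_mono) auto
      moreover have "t = \<nu> * (t div \<nu>) + t mod \<nu>" by simp
      moreover have "t mod \<nu> < \<nu>" using nu by simp
      ultimately have "t \<le> 2 * (\<nu> * (t div \<nu>))" by linarith
      then have "real t \<le> real (2 * (\<nu> * (t div \<nu>)))" by (rule of_nat_mono)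
      then show ?thesis using lt by simp
    qed
    define N where "N = real ((t div \<nu>) ^ (\<nu> - 1))"
    have lN: "?l \<le> B * N"
    proof -
      have "?l \<le> (8 * real \<nu> * real (t div \<nu>)) ^ (\<nu> - 1)" using log_ge_1[OF M] by (intro power_mono div_ge) simp
      then show ?thesis by (simp add: B_def N_def power_mult_distrib)
    qed
    have N0: "0 \<le> N" by (simp add: N_def)
    have "2 * real M \<le> N * 2 ^ (2 * t) / 2 ^ d"
    proof -
      have "2 * 2 ^ d * B * real M \<le> A * real M" using A by (intro mult_right_mono) auto
      also have "\<dots> = ?l * x"
      proof -
        have "A * real M = y * (A * real M / y)" if "0 < y" for y using that by simp
        from this[of ?l] show ?thesis unfolding x_def using l by linarith
      qed
      also have "\<dots> \<le> (B * N) * 2 ^ (2 * t)" using lN two_t x0 l by (intro mult_mono) auto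
      finally have "B * (2 * 2 ^ d * real M) \<le> B * (N * 2 ^ (2 * t))" by (simp add: mult_ac)
      then have "2 * 2 ^ d * real M \<le> N * 2 ^ (2 * t)" using B by (subst (asm) mult_le_cancel_left_pos) linarith+
      then show ?thesis by (simp add: pos_le_divide_eq mult_ac)
    qed
    note low = c0(2)[OF t\<nu> this[unfolded N_def]]
    have "c * rate ?\<tau> M \<le> c0 * 2 powr - (2 * r 1 * real t) * N powr (1 - ?\<tau>)"
    proof -
      have "4 * A * (real M / ?l) = 4 * x" unfolding x_def by simp
      then have "(4 * A) powr - r 1 * (real M / ?l) powr - r 1 = (4 * x) powr - r 1"
        using powr_mult[of "4 * A" "real M / ?l" "- r 1"] by (simp only:)
      also have "\<dots> \<le> (2 ^ (2 * t)) powr - r 1" using two_t r1 by (intro powr_mono2') auto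
      also have "\<dots> = 2 powr - (2 * r 1 * real t)" by (simp add: powr_realpow[symmetric] powr_powr mult_ac)
      finally have 1: "(4 * A) powr - r 1 * (real M / ?l) powr - r 1 \<le> 2 powr - (2 * r 1 * real t)" .
      have "?l powr (1 - ?\<tau>) \<le> (B * N) powr (1 - ?\<tau>)" using lN l \<tau> by (intro powr_mono2) auto
      also have "\<dots> = B powr (1 - ?\<tau>) * N powr (1 - ?\<tau>)" by (rule powr_mult)
      also have "\<dots> \<le> B powr 1 * N powr (1 - ?\<tau>)" using B \<tau> by (intro mult_right_mono powr_mono) auto
      finally have 2: "?l powr (1 - ?\<tau>) / B \<le> N powr (1 - ?\<tau>)" using B by (simp add: divide_le_eq mult.commute)
      have "c * rate ?\<tau> M = c0 * ((4 * A) powr - r 1 * (real M / ?l) powr - r 1) * (?l powr (1 - ?\<tau>) / B)"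
        by (simp add: c_def rate_def)
      also have "\<dots> \<le> c0 * 2 powr - (2 * r 1 * real t) * N powr (1 - ?\<tau>)"
        using c0(1) B by (intro mult_mono 1 2 mult_left_mono mult_nonneg_nonneg) auto
      finally show ?thesis .
    qed
    then have le: "ennreal (c * rate ?\<tau> M) \<le> ennreal (c0 * 2 powr - (2 * r 1 * real t) * N powr (1 - ?\<tau>))" by (rule ennreal_leI)
    show ?thesis
      using order_trans[OF le conjunct1[OF low[folded N_def]]] order_trans[OF le conjunct2[OF low[folded N_def]]] by (rule conjI)
  qed
  then show ?thesis using that[OF c] by blast
qed

end

section \<open>Comparison of the three quantities with the common rate\<close>

theorem theorem4p2:
  fixes d \<nu> :: nat and p q \<theta> :: ennreal and r :: "nat \<Rightarrow> real"
  assumes "2 \<le> d"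
    and "1 \<le> q" and "q \<le> p"
    and "1 \<le> \<theta>"
    and "1 \<le> \<nu>" and "\<nu> \<le> d"
    and "0 < r 1"
    and "\<forall>j\<in>{1..\<nu>}. r j = r 1"
    and "\<nu> < d \<Longrightarrow> r \<nu> < r (\<nu> + 1)"
    and "\<forall>j. \<nu> + 1 \<le> j \<and> j < d \<longrightarrow> r j \<le> r (j + 1)"
  shows "((\<lambda>M. entropy_number M (besov_class d r p \<theta>) (Bq1 d q) (Bq1_norm d q))
           \<asymp> (\<lambda>M. kolmogorov_width M (besov_class d r p \<theta>) (Bq1 d q) (Bq1_norm d q)))
    \<and> ((\<lambda>M. kolmogorov_width M (besov_class d r p \<theta>) (Bq1 d q) (Bq1_norm d q))
           \<asymp> (\<lambda>M. linear_width M (besov_class d r p \<theta>) (Bq1 d q) (Bq1_norm d q)))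
    \<and> ((\<lambda>M. linear_width M (besov_class d r p \<theta>) (Bq1 d q) (Bq1_norm d q))
           \<asymp> (\<lambda>M. ennreal (real M powr (- r 1)
                 * (log 2 (real M) ^ (\<nu> - 1)) powr (r 1 + 1 - enn2real (1 / \<theta>)))))"
proof -
  \<comment> \<open>Half of the relative gap between \<open>r 1\<close> and
    \<open>r (\<nu> + 1)\<close>. If there is no direction beyond \<nu>, any positive value
    serves.\<close>
  define \<kappa> where "\<kappa> = (if \<nu> < d then (r (\<nu> + 1) / r 1 - 1) / 2 else 1)"
  have r\<nu>: "r \<nu> = r 1" using assms(5) by (intro bspec[OF assms(8)]) simp
  have \<kappa>: "0 < \<kappa>"
  proof (cases "\<nu> < d")
    case True
    then have "1 < r (\<nu> + 1) / r 1" using assms(9)[OF True] assms(7) unfolding r\<nu> by (simp only: less_divide_eq_1_pos)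
    then show ?thesis unfolding \<kappa>_def using True by simp
  qed (simp add: \<kappa>_def)
  have mono: "r 1 * (1 + 2 * \<kappa>) \<le> r j" if j: "j \<in> {\<nu>+1..d}" for j
  proof -
    have "\<nu> < d" using j by simp
    then have "\<kappa> = (r (\<nu> + 1) / r 1 - 1) / 2" unfolding \<kappa>_def by (rule if_P)
    then have "1 + 2 * \<kappa> = r (\<nu> + 1) / r 1" by (simp only: mult_2 field_sum_of_halves add.commute[of 1] diff_add_cancel)
    then have eq: "r 1 * (1 + 2 * \<kappa>) = r (\<nu> + 1)" using assms(7) by simp
    have "r (\<nu> + 1) \<le> r n" if "\<nu> + 1 \<le> n" "n \<le> d" for n
      using that
    proof (induction n rule: dec_induct)
      case (step n)
      then have "r n \<le> r (n + 1)" by (intro assms(10)[rule_format] conjI) linarith+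
      moreover have "r (\<nu> + 1) \<le> r n" using step by linarith
      ultimately show ?case by simp
    qed (rule order_refl)
    then show ?thesis unfolding eq using j by simp
  qed
  interpret anisotropic d \<nu> r \<kappa>
  proof (rule anisotropic.intro)
    show "r j = r 1" if "j \<in> {1..\<nu>}" for j using that by (rule bspec[OF assms(8)])
    show "r 1 * (1 + 2 * \<kappa>) \<le> r j" if "j \<in> {\<nu>+1..d}" for j using that by (rule mono)
  qed (fact assms(5-7) \<kappa>)+
  have p: "1 \<le> p" using assms(2,3) by order
  let ?W = "besov_class d r p \<theta>" and ?Y = "Bq1 d q" and ?N = "Bq1_norm d q"
  let ?\<phi> = "\<lambda>M. ennreal (rate (enn2real (1 / \<theta>)) M)"
  obtain Cl where Cl: "0 < Cl" "\<And>M. 2 \<le> M \<Longrightarrow> linear_width M ?W ?Y ?N \<le> ennreal (Cl * rate (enn2real (1 / \<theta>)) M)"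
    using linear_width_le_rate[OF assms(2-4)] by blast
  obtain Ce where Ce: "0 < Ce" "\<And>M. 2 \<le> M \<Longrightarrow> entropy_number M ?W ?Y ?N \<le> ennreal (Ce * rate (enn2real (1 / \<theta>)) M)"
    using entropy_number_le_rate[OF assms(2-4)] by blast
  obtain c where c: "0 < c" "\<And>M. 2 \<le> M \<Longrightarrow> ennreal (c * rate (enn2real (1 / \<theta>)) M) \<le> kolmogorov_width M ?W ?Y ?N \<and>
     ennreal (c * rate (enn2real (1 / \<theta>)) M) \<le> entropy_number M ?W ?Y ?N"
    using widths_ge_rate[OF assms(2) p assms(4)] by blast
  have kl: "kolmogorov_width M ?W ?Y ?N \<le> linear_width M ?W ?Y ?N" for M
    by (rule kolmogorov_width_le_linear_width[OF besov_class_subset_Bq1[OF assms(2-4)]])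
  have ent: "ennreal c * ?\<phi> M \<le> entropy_number M ?W ?Y ?N" "entropy_number M ?W ?Y ?N \<le> ennreal Ce * ?\<phi> M" if "2 \<le> M" for M
    using c(1) c(2)[OF that] Ce(1) Ce(2)[OF that] by (auto simp: ennreal_mult')
  have kol: "ennreal c * ?\<phi> M \<le> kolmogorov_width M ?W ?Y ?N" "kolmogorov_width M ?W ?Y ?N \<le> ennreal Cl * ?\<phi> M" if "2 \<le> M" for M
    using c(1) c(2)[OF that] Cl(1) order_trans[OF kl Cl(2)[OF that]] by (auto simp: ennreal_mult')
  have lin: "ennreal c * ?\<phi> M \<le> linear_width M ?W ?Y ?N" "linear_width M ?W ?Y ?N \<le> ennreal Cl * ?\<phi> M" if "2 \<le> M" for M
    using order_trans[OF kol(1)[OF that] kl] Cl(1) Cl(2)[OF that] by (auto simp: ennreal_mult')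
  let ?R = "\<lambda>M. ennreal (real M powr (- r 1) * (log 2 (real M) ^ (\<nu> - 1)) powr (r 1 + 1 - enn2real (1 / \<theta>)))"
  have R: "?\<phi> M = ?R M" if "2 \<le> M" for M by (simp only: rate_eq[OF that])
  have R1: "ennreal 1 * ?\<phi> M \<le> ?R M" if "2 \<le> M" for M
    unfolding ennreal_1 mult_1_left by (rule eq_refl[OF R[OF that]])
  have R2: "?R M \<le> ennreal 1 * ?\<phi> M" if "2 \<le> M" for M
    unfolding ennreal_1 mult_1_left by (rule eq_refl[OF R[OF that, symmetric]])
  define E K L \<rho> \<phi> where defs: "E = (\<lambda>M. entropy_number M ?W ?Y ?N)" "K = (\<lambda>M. kolmogorov_width M ?W ?Y ?N)"
    "L = (\<lambda>M. linear_width M ?W ?Y ?N)" "\<rho> = ?R" "\<phi> = ?\<phi>"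
  have E: "ennreal c * \<phi> M \<le> E M" "E M \<le> ennreal Ce * \<phi> M" if "2 \<le> M" for M unfolding defs by (fact ent[OF that])+
  have K: "ennreal c * \<phi> M \<le> K M" "K M \<le> ennreal Cl * \<phi> M" if "2 \<le> M" for M unfolding defs by (fact kol[OF that])+
  have L: "ennreal c * \<phi> M \<le> L M" "L M \<le> ennreal Cl * \<phi> M" if "2 \<le> M" for M unfolding defs by (fact lin[OF that])+
  have \<rho>: "ennreal 1 * \<phi> M \<le> \<rho> M" "\<rho> M \<le> ennreal 1 * \<phi> M" if "2 \<le> M" for M
    unfolding defs by (fact R1[OF that], fact R2[OF that])
  have "E \<asymp> K" by (rule weakly_equivI[OF c(1) c(1) Ce(1) Cl(1)]) (fact E K)+
  moreover have "K \<asymp> L" by (rule weakly_equivI[OF c(1) c(1) Cl(1) Cl(1)]) (fact K L)+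
  moreover have "L \<asymp> \<rho>" by (rule weakly_equivI[OF c(1) zero_less_one Cl(1) zero_less_one]) (fact L \<rho>)+
  ultimately show ?thesis unfolding defs by (intro conjI)
qed

end
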